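(* Let $d,T\ge 1$ be integers and $1\le p<\infty$. There exists a constant $C>0$ depending only on $d,T,p$ such that the following holds: for every $\mathcal{AW}_p$-relatively compact set $K\subseteq\mathcal P_p((\mathbb R^d)^T)$, all $0<\sigma<R$ and all $\mu,\nu\in K$, $$\mathcal{AW}_p(\mu,\nu)^p\le C\left(R^p\,\frac{\mathcal W_1(\mu,\nu)}{\sigma}+\sup_{\gamma\in K}\left(\sum_{t=0}^{T-1}h^{t,p}_\gamma(\sigma)\right)^p+\sup_{\gamma\in K}\int_{\{|x|\ge R\}}|x|^p\,\gamma(dx)\right).$$
   Context: $|\cdot|$ is the Euclidean norm. $\mathcal P_p(\mathbb R^N)$ is the set of Borel probability measures on $\mathbb R^N$ with finite $p$-th moment. $\mathcal W_p(\mu,\nu)=(\inf_{\pi\in\mathrm{Cpl}(\mu,\nu)}\int|x-y|^p\,d\pi)^{1/p}$, with $\mathrm{Cpl}(\mu,\nu)$ the set of couplings. For $x\in(\mathbb R^d)^T$, $x_{1:t}=(x_1,\dots,x_t)$. A coupling $\pi$ of $\mu,\nu\in\mathcal P((\mathbb R^d)^T)$ is bicausal if for $(X,Y)\sim\pi$ and every $t\in\{1,\dots,T-1\}$: $Y_{1:t}$ and $(X_{t+1},\dots,X_T)$ are conditionally independent given $X_{1:t}$, and $X_{1:t}$ and $(Y_{t+1},\dots,Y_T)$ are conditionally independent given $Y_{1:t}$; $\mathrm{Cpl}_{bc}(\mu,\nu)$ is the set of bicausal couplings. The metric $\mathcal{AW}_p$ on $\mathcal P_p((\mathbb R^d)^T)$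 is $\mathcal{AW}_p(\mu,\nu)=\left(\inf_{\pi\in\mathrm{Cpl}_{bc}(\mu,\nu)}\int\sum_{t=1}^T|x_t-y_t|^p\,\pi(dx,dy)\right)^{1/p}$. For $X\sim\mu$, $\mu_{x_{1:t}}\in\mathcal P(\mathbb R^d)$ denotes the regular conditional law $\mathbb P(X_{t+1}\in\cdot\mid X_{1:t}=x_{1:t})$. The $p$-modulus of continuity of $\mu$, for $t\in\{1,\dots,T-1\}$ and $\delta>0$, is $\omega^{t,p}_\mu(\delta)=\sup\left\{(\mathbb E[\mathcal W_p(\mu_{X_{1:t}},\mu_{Y_{1:t}})^p])^{1/p}: X,Y\sim\mu,\ (\mathbb E[|X_{1:t}-Y_{1:t}|^p])^{1/p}<\delta\right\}$ (supremum over all jointly defined pairs with both marginal laws $\mu$). Iterated moduli: $h^{0,p}_\mu(\sigma)=\sigma$ and $h^{t,p}_\mu(\sigma)=\omega^{t,p}_\mu\left(\sum_{s=0}^{t-1}h^{s,p}_\mu(\sigma)\right)$ for $t\in\{1,\dots,T-1\}$. *)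

theory Defs
  imports "HOL-Probability.Probability"
begin

text \<open>
  A point of \<open>(\<real>\<^sup>d)\<^sup>t\<close> is an extensional function on \<open>{1..t}\<close>, so that \<open>x\<^bsub>1:t\<^esub>\<close> is
  \<open>restrict x {1..t}\<close>. As the product is finite and \<open>\<real>\<^sup>d\<close> is second countable, the product
  sigma-algebra is the Borel sigma-algebra.
\<close>

definition path_space :: "nat \<Rightarrow> (nat \<Rightarrow> real^'d) measure" where
  "path_space t = PiM {1..t} (\<lambda>_. borel)"

definition path_norm :: "nat \<Rightarrow> (nat \<Rightarrow> real^'d) \<Rightarrow> real" where
  "path_norm t x = L2_set (\<lambda>s. norm (x s)) {1..t}"

definition path_dist :: "nat \<Rightarrow> (nat \<Rightarrow> real^'d) \<Rightarrow> (nat \<Rightarrow> real^'d) \<Rightarrow> real" where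
  "path_dist t x y = L2_set (\<lambda>s. dist (x s) (y s)) {1..t}"

text \<open>Only used with exponents \<open>a > 0\<close>, whence the value at infinity.\<close>

definition epowr :: "ennreal \<Rightarrow> real \<Rightarrow> ennreal" where
  "epowr x a = (if x = \<infinity> then \<infinity> else ennreal (enn2real x powr a))"

definition moment_measures :: "real \<Rightarrow> nat \<Rightarrow> (nat \<Rightarrow> real^'d) measure set" where
  "moment_measures p T =
     {\<mu>. prob_space \<mu> \<and> sets \<mu> = sets (path_space T) \<and>
         (\<integral>\<^sup>+x. ennreal (path_norm T x powr p) \<partial>\<mu>) < \<infinity>}"

definition couplings :: "'a measure \<Rightarrow> 'b measure \<Rightarrow> ('a \<times> 'b) measure set" where
  "couplings M N =
     {\<pi>. prob_space \<pi> \<and> sets \<pi> = sets (M \<Otimes>\<^sub>M N) \<and> distr \<pi> M fst = M \<and> distr \<pi> N snd = N}"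

definition wasserstein ::
  "('a \<Rightarrow> 'a \<Rightarrow> real) \<Rightarrow> real \<Rightarrow> 'a measure \<Rightarrow> 'a measure \<Rightarrow> ennreal" where
  "wasserstein \<rho> p M N =
     epowr (INF \<pi>\<in>couplings M N. \<integral>\<^sup>+\<omega>. ennreal (\<rho> (fst \<omega>) (snd \<omega>) powr p) \<partial>\<pi>) (1 / p)"

definition cond_prob_given ::
  "'w measure \<Rightarrow> 'c measure \<Rightarrow> ('w \<Rightarrow> 'c) \<Rightarrow> 'w set \<Rightarrow> 'w \<Rightarrow> real" where
  "cond_prob_given M MZ Z E =
     real_cond_exp M (vimage_algebra (space M) Z MZ) (indicator E)"

definition cond_indep ::
  "'w measure \<Rightarrow> 'a measure \<Rightarrow> ('w \<Rightarrow> 'a) \<Rightarrow> 'b measure \<Rightarrow> ('w \<Rightarrow> 'b) \<Rightarrow> 'c measure \<Rightarrow> ('w \<Rightarrow> 'c) \<Rightarrow> bool"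
  where
  "cond_indep M MU U MV V MZ Z \<longleftrightarrow>
     (\<forall>A\<in>sets MU. \<forall>B\<in>sets MV. AE \<omega> in M.
        cond_prob_given M MZ Z {\<omega>'\<in>space M. U \<omega>' \<in> A \<and> V \<omega>' \<in> B} \<omega> =
        cond_prob_given M MZ Z {\<omega>'\<in>space M. U \<omega>' \<in> A} \<omega> *
        cond_prob_given M MZ Z {\<omega>'\<in>space M. V \<omega>' \<in> B} \<omega>)"

definition bicausal_couplings ::
  "nat \<Rightarrow> (nat \<Rightarrow> real^'d) measure \<Rightarrow> (nat \<Rightarrow> real^'d) measure \<Rightarrow>
   ((nat \<Rightarrow> real^'d) \<times> (nat \<Rightarrow> real^'d)) measure set" where
  "bicausal_couplings T \<mu> \<nu> =
     {\<pi>\<in>couplings \<mu> \<nu>. \<forall>t\<in>{1..<T}.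
        cond_indep \<pi>
          (path_space t) (\<lambda>\<omega>. restrict (snd \<omega>) {1..t})
          (PiM {Suc t..T} (\<lambda>_. borel)) (\<lambda>\<omega>. restrict (fst \<omega>) {Suc t..T})
          (path_space t) (\<lambda>\<omega>. restrict (fst \<omega>) {1..t}) \<and>
        cond_indep \<pi>
          (path_space t) (\<lambda>\<omega>. restrict (fst \<omega>) {1..t})
          (PiM {Suc t..T} (\<lambda>_. borel)) (\<lambda>\<omega>. restrict (snd \<omega>) {Suc t..T})
          (path_space t) (\<lambda>\<omega>. restrict (snd \<omega>) {1..t})}"

definition adapted_wasserstein ::
  "real \<Rightarrow> nat \<Rightarrow> (nat \<Rightarrow> real^'d) measure \<Rightarrow> (nat \<Rightarrow> real^'d) measure \<Rightarrow> ennreal" where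
  "adapted_wasserstein p T \<mu> \<nu> =
     epowr (INF \<pi>\<in>bicausal_couplings T \<mu> \<nu>.
              \<integral>\<^sup>+\<omega>. ennreal (\<Sum>t=1..T. dist (fst \<omega> t) (snd \<omega> t) powr p) \<partial>\<pi>) (1 / p)"

text \<open>
  The distance is finite on \<^const>\<open>moment_measures\<close> because the independent coupling is bicausal,
  so passing to real values loses nothing there.
\<close>

definition adapted_topology :: "real \<Rightarrow> nat \<Rightarrow> (nat \<Rightarrow> real^'d) measure topology" where
  "adapted_topology p T =
     Metric_space.mtopology (moment_measures p T)
       (\<lambda>\<mu> \<nu>. enn2real (adapted_wasserstein p T \<mu> \<nu>))"

definition adapted_relatively_compact ::
  "real \<Rightarrow> nat \<Rightarrow> (nat \<Rightarrow> real^'d) measure set \<Rightarrow> bool" where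
  "adapted_relatively_compact p T K \<longleftrightarrow>
     K \<subseteq> moment_measures p T \<and>
     compactin (adapted_topology p T) (adapted_topology p T closure_of K)"

definition is_cond_law ::
  "(nat \<Rightarrow> real^'d) measure \<Rightarrow> nat \<Rightarrow> ((nat \<Rightarrow> real^'d) \<Rightarrow> (real^'d) measure) \<Rightarrow> bool" where
  "is_cond_law \<mu> t \<kappa> \<longleftrightarrow>
     \<kappa> \<in> measurable (path_space t) (prob_algebra borel) \<and>
     (\<forall>A\<in>sets (path_space t). \<forall>B\<in>sets borel.
        emeasure \<mu> {x\<in>space \<mu>. restrict x {1..t} \<in> A \<and> x (Suc t) \<in> B} =
        (\<integral>\<^sup>+x. indicator A (restrict x {1..t}) * emeasure (\<kappa> (restrict x {1..t})) B \<partial>\<mu>))"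

text \<open>
  Regular conditional laws exist, and are unique up to null sets of the law of \<open>X\<^bsub>1:t\<^esub>\<close>; the modulus
  below does not depend on the version that is chosen.
\<close>

definition cond_law ::
  "(nat \<Rightarrow> real^'d) measure \<Rightarrow> nat \<Rightarrow> (nat \<Rightarrow> real^'d) \<Rightarrow> (real^'d) measure" where
  "cond_law \<mu> t = (SOME \<kappa>. is_cond_law \<mu> t \<kappa>)"

text \<open>Jointly defined pairs \<open>X, Y \<sim> \<mu>\<close> are represented by their joint law.\<close>

definition modulus ::
  "real \<Rightarrow> (nat \<Rightarrow> real^'d) measure \<Rightarrow> nat \<Rightarrow> ennreal \<Rightarrow> ennreal" where
  "modulus p \<mu> t \<delta> =
     (SUP \<pi>\<in>{\<pi>\<in>couplings \<mu> \<mu>.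
               epowr (\<integral>\<^sup>+\<omega>. ennreal (path_dist t (fst \<omega>) (snd \<omega>) powr p) \<partial>\<pi>) (1 / p) < \<delta>}.
        epowr (\<integral>\<^sup>+\<omega>. epowr (wasserstein dist p (cond_law \<mu> t (restrict (fst \<omega>) {1..t}))
                                             (cond_law \<mu> t (restrict (snd \<omega>) {1..t}))) p \<partial>\<pi>)
              (1 / p))"

fun iter_modulus ::
  "real \<Rightarrow> (nat \<Rightarrow> real^'d) measure \<Rightarrow> nat \<Rightarrow> ennreal \<Rightarrow> ennreal" where
  "iter_modulus p \<mu> 0 \<sigma> = \<sigma>"
| "iter_modulus p \<mu> (Suc t) \<sigma> = modulus p \<mu> (Suc t) (\<Sum>s=0..t. iter_modulus p \<mu> s \<sigma>)"

end

theory Submission imports Defs begin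

text \<open>The coordinates are quantised by a grid of mesh proportional to \<open>\<sigma>\<close>. Averaging over shifts of the
  grid gives one for which a nearly optimal \<open>W\<^sub>1\<close>-coupling separates the two cell sequences with
  probability at most \<open>C W\<^sub>1(\<mu>, \<nu>) / \<sigma>\<close>.

  Each path \<open>X\<close> is then coupled causally with a cell sequence \<open>Q\<close> that has the law of the cells of
  \<open>X\<close>, but is Markov relative to \<open>X\<close>: given \<open>Q\<^bsub>1:t\<^esub>\<close>, a second path \<open>X'\<close> is resampled from the law
  conditioned on these cells, and \<open>X\<^bsub>t+1\<^esub>\<close> and \<open>X'\<^bsub>t+1\<^esub>\<close> are coupled almost optimally. As \<open>X\<close> and
  \<open>X'\<close> both have law \<open>\<mu>\<close> and follow the same cells, the modulus of continuity bounds the distance of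
  \<open>X\<^bsub>t+1\<^esub>\<close> from the cell \<open>Q\<^bsub>t+1\<^esub>\<close>, and induction on \<open>t\<close> produces the iterated moduli.

  The next cell of this chain depends on \<open>Q\<^bsub>1:t\<^esub>\<close> only. The chains of \<open>\<mu>\<close> and \<open>\<nu>\<close> can therefore be
  driven together by maximal couplings of their next cells, which makes the coupling of the paths
  bicausal, and the cell sequences differ with at most \<open>2 T\<close> times the probability under any coupling
  of \<open>\<mu>\<close> and \<open>\<nu>\<close>. Where they agree, the triangle inequality through the common cell bounds the cost by
  the errors of the two chains; elsewhere the cost is split at the level \<open>R\<close>.\<close>

section \<open>Regular conditional laws\<close>

text \<open>Closeness of the path laws in \<open>W1\<close> does not control their conditional laws,
  so a good coupling of \<mu> and \<nu> cannot simply be made bicausal. Total variation behaves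
  better: for sequences of countably many cells, agreement can be propagated step by step at a
  bounded loss, and this is the only place where the two laws are compared. A fixed grid may have
  its walls where both laws carry mass, hence the choice of the shift. The comparison of a path with
  cells takes place within one law, and there the modulus enters. The cells of the path itself would
  not do, as the law of the next one depends on the whole past; resampling removes this dependence
  at the price of an error that feeds into the next step. The modulus demands a strict inequality:
  the zeroth term \<sigma> supplies the slack, and the mesh \<open>\<sigma> / (4 * T * d)\<close>
  keeps the rounding errors of all steps below it. Conditional laws and couplings have to be
  kernels, which is why nearly optimal couplings are described by countably many explicit
  densities.\<close>

definition disintegrates ::
  "'w measure \<Rightarrow> ('w \<Rightarrow> 'x) \<Rightarrow> 'x measure \<Rightarrow> ('w \<Rightarrow> 'z) \<Rightarrow> 'z measure \<Rightarrow> ('x \<Rightarrow> 'z measure) \<Rightarrow> bool"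
  where "disintegrates M X MX Z MZ \<kappa> \<longleftrightarrow>
    \<kappa> \<in> MX \<rightarrow>\<^sub>M prob_algebra MZ \<and>
    (\<forall>F\<in> borel_measurable (MX \<Otimes>\<^sub>M MZ).
       (\<integral>\<^sup>+\<omega>. F (X \<omega>, Z \<omega>) \<partial>M) = (\<integral>\<^sup>+\<omega>. (\<integral>\<^sup>+z. F (X \<omega>, z) \<partial>\<kappa> (X \<omega>)) \<partial>M))"

lemma nn_integral_kernel_measurable [measurable (raw)]:
  assumes "\<kappa> \<in> M \<rightarrow>\<^sub>M prob_algebra N" "(\<lambda>(x, y). f x y) \<in> borel_measurable (M \<Otimes>\<^sub>M N)"
  shows "(\<lambda>x. \<integral>\<^sup>+y. f x y \<partial>\<kappa> x) \<in> borel_measurable M"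
  using nn_integral_measurable_subprob_algebra2[OF assms(2) measurable_prob_algebraD[OF assms(1)]] .

lemma kernel_prob: "\<kappa> \<in> M \<rightarrow>\<^sub>M prob_algebra N \<Longrightarrow> x \<in> space M \<Longrightarrow> prob_space (\<kappa> x)"
  and kernel_sets: "\<kappa> \<in> M \<rightarrow>\<^sub>M prob_algebra N \<Longrightarrow> x \<in> space M \<Longrightarrow> sets (\<kappa> x) = sets N"
  and kernel_space: "\<kappa> \<in> M \<rightarrow>\<^sub>M prob_algebra N \<Longrightarrow> x \<in> space M \<Longrightarrow> space (\<kappa> x) = space N"
  by (auto dest!: measurable_space simp: space_prob_algebra dest!: sets_eq_imp_space_eq)

text \<open>The law of \<open>(X, Z)\<close> and the mixture of the kernels, carried to the product
  by \<open>Pair (X \<omega>)\<close>, agree on rectangles. These form an intersection-stable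
  generator of the product sigma-algebra, so the two laws coincide and rectangles may be replaced by
  arbitrary integrands \<open>F\<close>, the form in which conditioning is used from here
  on.\<close>

lemma disintegratesI:
  assumes "prob_space M" and [measurable]: "X \<in> M \<rightarrow>\<^sub>M MX" "Z \<in> M \<rightarrow>\<^sub>M MZ"
    and \<kappa>[measurable]: "\<kappa> \<in> MX \<rightarrow>\<^sub>M prob_algebra MZ"
    and rect: "\<And>A B. A \<in> sets MX \<Longrightarrow> B \<in> sets MZ \<Longrightarrow>
      emeasure M {\<omega>\<in>space M. X \<omega> \<in> A \<and> Z \<omega> \<in> B} = (\<integral>\<^sup>+\<omega>. indicator A (X \<omega>) * emeasure (\<kappa> (X \<omega>)) B \<partial>M)"
  shows "disintegrates M X MX Z MZ \<kappa>"
proof -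
  interpret prob_space M by fact
  let ?P = "distr M (MX \<Otimes>\<^sub>M MZ) (\<lambda>\<omega>. (X \<omega>, Z \<omega>))"
  let ?Q = "M \<bind> (\<lambda>\<omega>. distr (\<kappa> (X \<omega>)) (MX \<Otimes>\<^sub>M MZ) (Pair (X \<omega>)))"
  have K[measurable]: "(\<lambda>\<omega>. distr (\<kappa> (X \<omega>)) (MX \<Otimes>\<^sub>M MZ) (Pair (X \<omega>))) \<in> M \<rightarrow>\<^sub>M prob_algebra (MX \<Otimes>\<^sub>M MZ)"
    by measurable
  have sets_Q: "sets ?Q = sets (MX \<Otimes>\<^sub>M MZ)"
    by (rule sets_bind_measurable[OF measurable_prob_algebraD[OF K]]) (simp add: not_empty)
  have "?P = ?Q"
  proof (rule measure_eqI_generator_eq[OF Int_stable_pair_measure_generator pair_measure_closed _ _ _ _ _,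
        where A = "\<lambda>_. space MX \<times> space MZ"])
    fix S assume "S \<in> {a \<times> b |a b. a \<in> sets MX \<and> b \<in> sets MZ}"
    then obtain A B where S: "S = A \<times> B" and [measurable]: "A \<in> sets MX" "B \<in> sets MZ" by auto
    have "emeasure ?P S = emeasure M {\<omega>\<in>space M. X \<omega> \<in> A \<and> Z \<omega> \<in> B}"
      unfolding S by (subst emeasure_distr) (auto intro!: arg_cong[where f = "emeasure M"])
    also have "\<dots> = (\<integral>\<^sup>+\<omega>. emeasure (distr (\<kappa> (X \<omega>)) (MX \<Otimes>\<^sub>M MZ) (Pair (X \<omega>))) S \<partial>M)"
      unfolding rect[OF \<open>A \<in> sets MX\<close> \<open>B \<in> sets MZ\<close>]
    proof (rule nn_integral_cong)
      fix \<omega> assume "\<omega> \<in> space M"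
      then have x: "X \<omega> \<in> space MX" by (rule measurable_space[rotated]) simp
      note [measurable_cong] = kernel_sets[OF \<kappa> x]
      have "Pair (X \<omega>) -` (A \<times> B) \<inter> space (\<kappa> (X \<omega>)) = (if X \<omega> \<in> A then B else {})"
        using sets.sets_into_space[OF \<open>B \<in> sets MZ\<close>] kernel_space[OF \<kappa> x] by auto
      then show "indicator A (X \<omega>) * emeasure (\<kappa> (X \<omega>)) B
          = emeasure (distr (\<kappa> (X \<omega>)) (MX \<Otimes>\<^sub>M MZ) (Pair (X \<omega>))) S"
        unfolding S using x by (subst emeasure_distr) auto
    qed
    also have "\<dots> = emeasure ?Q S"
      unfolding S by (rule emeasure_bind[symmetric, OF not_empty measurable_prob_algebraD[OF K]]) simp
    finally show "emeasure ?P S = emeasure ?Q S" .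
  next
    show "sets ?P = sigma_sets (space MX \<times> space MZ) {a \<times> b |a b. a \<in> sets MX \<and> b \<in> sets MZ}"
      by (simp add: sets_pair_measure)
    show "sets ?Q = sigma_sets (space MX \<times> space MZ) {a \<times> b |a b. a \<in> sets MX \<and> b \<in> sets MZ}"
      using sets_Q by (simp add: sets_pair_measure)
    have "prob_space ?P" by (rule prob_space_distr) simp
    then interpret P: prob_space ?P .
    show "emeasure ?P (space MX \<times> space MZ) \<noteq> \<infinity>" by simp
  qed auto
  show ?thesis
    unfolding disintegrates_def
  proof (intro conjI ballI \<kappa>)
    fix F :: "_ \<Rightarrow> ennreal" assume [measurable]: "F \<in> borel_measurable (MX \<Otimes>\<^sub>M MZ)"
    have "(\<integral>\<^sup>+\<omega>. F (X \<omega>, Z \<omega>) \<partial>M) = (\<integral>\<^sup>+y. F y \<partial>?P)" by (simp add: nn_integral_distr)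
    also have "\<dots> = (\<integral>\<^sup>+\<omega>. (\<integral>\<^sup>+y. F y \<partial>distr (\<kappa> (X \<omega>)) (MX \<Otimes>\<^sub>M MZ) (Pair (X \<omega>))) \<partial>M)"
      unfolding \<open>?P = ?Q\<close> by (rule nn_integral_bind[OF _ measurable_prob_algebraD[OF K]]) simp
    also have "\<dots> = (\<integral>\<^sup>+\<omega>. (\<integral>\<^sup>+z. F (X \<omega>, z) \<partial>\<kappa> (X \<omega>)) \<partial>M)"
    proof (rule nn_integral_cong)
      fix \<omega> assume "\<omega> \<in> space M"
      then have x: "X \<omega> \<in> space MX" by (rule measurable_space[rotated]) simp
      note [measurable_cong] = kernel_sets[OF \<kappa> x]
      show "(\<integral>\<^sup>+y. F y \<partial>distr (\<kappa> (X \<omega>)) (MX \<Otimes>\<^sub>M MZ) (Pair (X \<omega>))) = (\<integral>\<^sup>+z. F (X \<omega>, z) \<partial>\<kappa> (X \<omega>))"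
        using x by (subst nn_integral_distr) auto
    qed
    finally show "(\<integral>\<^sup>+\<omega>. F (X \<omega>, Z \<omega>) \<partial>M) = (\<integral>\<^sup>+\<omega>. (\<integral>\<^sup>+z. F (X \<omega>, z) \<partial>\<kappa> (X \<omega>)) \<partial>M)" .
  qed
qed

lemma disintegrates_kernel: "disintegrates M X MX Z MZ \<kappa> \<Longrightarrow> \<kappa> \<in> MX \<rightarrow>\<^sub>M prob_algebra MZ"
  by (simp add: disintegrates_def)

lemma disintegrates_nn_integral:
  "disintegrates M X MX Z MZ \<kappa> \<Longrightarrow> F \<in> borel_measurable (MX \<Otimes>\<^sub>M MZ) \<Longrightarrow>
    (\<integral>\<^sup>+\<omega>. F (X \<omega>, Z \<omega>) \<partial>M) = (\<integral>\<^sup>+\<omega>. (\<integral>\<^sup>+z. F (X \<omega>, z) \<partial>\<kappa> (X \<omega>)) \<partial>M)"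
  by (simp add: disintegrates_def)

text \<open>On the set where \<open>g < f\<close>, the truncated difference \<open>f - g\<close> has
  integral zero by the hypothesis, hence vanishes almost everywhere. Finiteness of the integral of
  \<open>g\<close> is what allows the two integrals to be subtracted in
  \<open>ennreal\<close>.\<close>

lemma (in finite_measure) AE_mono_densityI:
  assumes [measurable]: "f \<in> borel_measurable M" "g \<in> borel_measurable M"
    and le: "\<And>A. A \<in> sets M \<Longrightarrow> (\<integral>\<^sup>+x\<in>A. f x \<partial>M) \<le> (\<integral>\<^sup>+x\<in>A. g x \<partial>M)"
    and fin: "(\<integral>\<^sup>+x. g x \<partial>M) < \<infinity>"
  shows "AE x in M. f x \<le> g x"
proof -
  define A where "A = {x\<in>space M. g x < f x}"
  have A[measurable]: "A \<in> sets M" unfolding A_def by measurable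
  have gfin: "(\<integral>\<^sup>+x\<in>A. g x \<partial>M) \<noteq> \<infinity>"
  proof -
    have "(\<integral>\<^sup>+x\<in>A. g x \<partial>M) \<le> (\<integral>\<^sup>+x. g x \<partial>M)"
      by (intro nn_integral_mono) (auto simp: indicator_def)
    then show ?thesis using fin by (auto simp: less_top[symmetric] top_unique)
  qed
  have "(\<integral>\<^sup>+x. (f x - g x) * indicator A x \<partial>M) = (\<integral>\<^sup>+x. f x * indicator A x - g x * indicator A x \<partial>M)"
    by (intro nn_integral_cong) (auto simp: indicator_def)
  also have "\<dots> = (\<integral>\<^sup>+x\<in>A. f x \<partial>M) - (\<integral>\<^sup>+x\<in>A. g x \<partial>M)"
    by (intro nn_integral_diff) (use gfin in \<open>auto simp: A_def indicator_def less_imp_le\<close>)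
  also have "\<dots> = 0" using le[OF A] by (metis gfin diff_eq_0_ennreal infinity_ennreal_def le_less_trans top.not_eq_extremum)
  finally have "AE x in M. (f x - g x) * indicator A x = 0"
    by (subst (asm) nn_integral_0_iff_AE) auto
  then show ?thesis
    by (rule AE_mp) (auto simp: A_def indicator_def ennreal_minus_eq_0 not_less intro!: AE_I2 split: if_splits)
qed

text \<open>Conditional distribution functions: Radon-Nikodym derivatives are regularised to a
  distribution function for every \<open>x\<close>, which \<open>interval_measure\<close> turns into
  a measure. The null sets have to be controlled for uncountably many levels at once, hence the
  detour through the rationals.\<close>

lemma ex_disintegrates_real:
  fixes Z :: "'w \<Rightarrow> real"
  assumes "prob_space M" and X[measurable]: "X \<in> M \<rightarrow>\<^sub>M MX" and Z[measurable]: "Z \<in> borel_measurable M"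
  shows "\<exists>\<kappa>. disintegrates M X MX Z borel \<kappa>"
proof -
  interpret prob_space M by fact
  define L where "L = distr M MX X"
  have sets_L[measurable_cong]: "sets L = sets MX" and space_L: "space L = space MX"
    by (simp_all add: L_def)
  interpret L: prob_space L unfolding L_def by (rule prob_space_distr) simp
  define P where "P A y = emeasure M {\<omega>\<in>space M. X \<omega> \<in> A \<and> Z \<omega> \<le> y}" for A y
  have P_mono: "P A y \<le> P A y'" if "A \<in> sets MX" "y \<le> y'" for A y y'
    unfolding P_def using that by (intro emeasure_mono) auto
  have P_le: "P A y \<le> emeasure L A" if "A \<in> sets MX" for A y
    unfolding P_def L_def using that by (subst emeasure_distr) (auto intro!: emeasure_mono)
  have P_top: "(\<lambda>n. P A (real n)) \<longlonglongrightarrow> emeasure L A" if [measurable]: "A \<in> sets MX" for A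
  proof -
    have "(\<Union>n. {\<omega>\<in>space M. X \<omega> \<in> A \<and> Z \<omega> \<le> real n}) = X -` A \<inter> space M"
      by (auto intro: real_arch_simple)
    then show ?thesis
      using Lim_emeasure_incseq[of "\<lambda>n. {\<omega>\<in>space M. X \<omega> \<in> A \<and> Z \<omega> \<le> real n}" M]
      unfolding P_def L_def by (subst emeasure_distr) (force simp: incseq_def image_subset_iff)+
  qed
  have P_bot: "(\<lambda>n. P A (- real n)) \<longlonglongrightarrow> 0" if [measurable]: "A \<in> sets MX" for A
  proof -
    have "(\<Inter>n. {\<omega>\<in>space M. X \<omega> \<in> A \<and> Z \<omega> \<le> - real n}) = {}"
    proof safe
      fix \<omega> assume *: "\<omega> \<in> (\<Inter>n. {\<omega>\<in>space M. X \<omega> \<in> A \<and> Z \<omega> \<le> - real n})"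
      obtain n where "- Z \<omega> < real n" using reals_Archimedean2 by blast
      moreover have "Z \<omega> \<le> - real n" using * by auto
      ultimately show "\<omega> \<in> {}" by simp
    qed
    then show ?thesis
      using Lim_emeasure_decseq[of "\<lambda>n. {\<omega>\<in>space M. X \<omega> \<in> A \<and> Z \<omega> \<le> - real n}" M]
      unfolding P_def by (force simp: decseq_def image_subset_iff)
  qed
  have P_right: "(\<lambda>n. P A (y + 1 / real (Suc n))) \<longlonglongrightarrow> P A y" if [measurable]: "A \<in> sets MX" for A y
  proof -
    have "(\<Inter>n. {\<omega>\<in>space M. X \<omega> \<in> A \<and> Z \<omega> \<le> y + 1 / real (Suc n)}) = {\<omega>\<in>space M. X \<omega> \<in> A \<and> Z \<omega> \<le> y}"
    proof safe
      fix \<omega> assume *: "\<omega> \<in> (\<Inter>n. {\<omega>\<in>space M. X \<omega> \<in> A \<and> Z \<omega> \<le> y + 1 / real (Suc n)})"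
      show "Z \<omega> \<le> y"
      proof (rule ccontr)
        assume "\<not> Z \<omega> \<le> y"
        then obtain n where "1 / real (Suc n) < Z \<omega> - y"
          using reals_Archimedean[of "Z \<omega> - y"] by (auto simp: inverse_eq_divide)
        moreover have "Z \<omega> \<le> y + 1 / real (Suc n)" using * by blast
        ultimately show False by simp
      qed
    qed (auto intro: order_trans)
    moreover have "decseq (\<lambda>n. {\<omega>\<in>space M. X \<omega> \<in> A \<and> Z \<omega> \<le> y + 1 / real (Suc n)})"
      by (auto simp: decseq_def intro: order_trans[OF _ add_left_mono[OF divide_left_mono]])
    ultimately show ?thesis
      using Lim_emeasure_decseq[of "\<lambda>n. {\<omega>\<in>space M. X \<omega> \<in> A \<and> Z \<omega> \<le> y + 1 / real (Suc n)}" M]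
      unfolding P_def by (auto simp: image_subset_iff)
  qed
  define N where "N y = distr (density M (indicator {\<omega>\<in>space M. Z \<omega> \<le> y})) MX X" for y
  have N: "emeasure (N y) A = P A y" if [measurable]: "A \<in> sets MX" for A y
  proof -
    have "X -` A \<inter> space M \<in> sets M" by measurable
    then show ?thesis
      unfolding N_def P_def by (subst emeasure_distr)
        (auto simp: emeasure_restricted intro!: arg_cong[where f = "emeasure M"])
  qed
  \<comment> \<open>For each level \<open>y\<close> a version of the conditional probability of
    \<open>Z \<le> y\<close> given \<open>X\<close>, determined up to a null set that depends on
    \<open>y\<close>.\<close>
  define F where "F y = RN_deriv L (N y)" for y
  have F_meas[measurable]: "F y \<in> borel_measurable MX" for y
    using borel_measurable_RN_deriv[of L "N y"] unfolding F_def
    by (simp add: measurable_cong_sets[OF sets_L])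
  have int_F: "(\<integral>\<^sup>+x\<in>A. F y x \<partial>L) = P A y" if [measurable]: "A \<in> sets MX" for A y
  proof -
    have "absolutely_continuous L (N y)"
      unfolding absolutely_continuous_def
    proof
      fix A assume "A \<in> null_sets L"
      then have "A \<in> sets MX" "emeasure L A = 0" by (auto simp: sets_L null_sets_def)
      then show "A \<in> null_sets (N y)"
        using P_le[of A y] by (auto simp: null_sets_def N) (simp add: N_def)
    qed
    then have "density L (F y) = N y"
      unfolding F_def by (rule L.density_RN_deriv) (simp add: N_def sets_L)
    then have "emeasure (density L (F y)) A = P A y" by (simp add: N)
    then show ?thesis by (subst (asm) emeasure_density) auto
  qed
  have L_fin: "(\<integral>\<^sup>+x. F y x \<partial>L) < \<infinity>" for y
  proof -
    have "(\<integral>\<^sup>+x. F y x \<partial>L) = (\<integral>\<^sup>+x\<in>space MX. F y x \<partial>L)"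
      by (intro nn_integral_cong) (auto simp: space_L)
    also have "\<dots> < \<infinity>" using int_F[of "space MX" y] by (simp add: P_def emeasure_eq_measure)
    finally show ?thesis .
  qed
  have F_mono: "AE x in L. F y x \<le> F y' x" if "y \<le> y'" for y y'
    by (rule L.AE_mono_densityI) (use L_fin[of y'] in \<open>auto simp: int_F sets_L P_mono that\<close>)
  have F_le1: "AE x in L. F y x \<le> 1" for y
    by (rule L.AE_mono_densityI) (auto simp: int_F sets_L P_le L.emeasure_space_1)
  \<comment> \<open>For every \<open>x\<close> this is monotone and right-continuous in
    \<open>y\<close>, while \<open>F\<close> is monotone only off a null set depending on the two
    levels. Rational levels keep the infimum countable and so measurable.\<close>
  define G where "G x y = (INF q\<in>{q::rat. y < of_rat q}. F (of_rat q) x)" for x and y :: real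
  have G_meas[measurable]: "(\<lambda>x. G x y) \<in> borel_measurable MX" for y
    unfolding G_def by (intro borel_measurable_INF) auto
  have G_mono: "G x y \<le> G x y'" if "y \<le> y'" for x y y'
    unfolding G_def using that by (intro INF_superset_mono) auto
  have G_le: "G x y \<le> F (of_rat q) x" if "y < of_rat q" for x y q
    unfolding G_def using that by (intro INF_lower) auto
  \<comment> \<open>Replacing \<open>F\<close> by \<open>G\<close> does not change the integrals: a
    rational between \<open>y\<close> and \<open>y + 1 / (n + 1)\<close> and right-continuity of
    \<open>P\<close> give one inequality, almost sure monotonicity over countably many rationals the
    other.\<close>
  have int_G: "(\<integral>\<^sup>+x\<in>A. G x y \<partial>L) = P A y" if A[measurable]: "A \<in> sets MX" for A y
  proof (rule antisym)
    have *: "(\<integral>\<^sup>+x\<in>A. G x y \<partial>L) \<le> P A (y + 1 / real (Suc n))" for n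
    proof -
      obtain q :: rat where q: "y < of_rat q" "of_rat q < y + 1 / real (Suc n)"
        using of_rat_dense[of y "y + 1 / real (Suc n)"] by auto
      have "(\<integral>\<^sup>+x\<in>A. G x y \<partial>L) \<le> (\<integral>\<^sup>+x\<in>A. F (of_rat q) x \<partial>L)"
        by (intro nn_integral_mono mult_right_mono G_le q) auto
      also have "\<dots> \<le> P A (y + 1 / real (Suc n))" using q by (simp add: int_F P_mono)
      finally show ?thesis .
    qed
    show "(\<integral>\<^sup>+x\<in>A. G x y \<partial>L) \<le> P A y"
      by (rule LIMSEQ_le_const[OF P_right[OF A]]) (use * in blast)
    have "AE x in L. \<forall>q::rat. y < of_rat q \<longrightarrow> F y x \<le> F (of_rat q) x"
      by (subst AE_all_countable) (auto intro!: F_mono AE_impI)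
    then have "AE x in L. F y x \<le> G x y"
      unfolding G_def by eventually_elim (auto intro!: INF_greatest)
    then have "(\<integral>\<^sup>+x\<in>A. F y x \<partial>L) \<le> (\<integral>\<^sup>+x\<in>A. G x y \<partial>L)"
      by (intro nn_integral_mono_AE) (auto elim!: eventually_mono intro!: mult_right_mono)
    then show "P A y \<le> (\<integral>\<^sup>+x\<in>A. G x y \<partial>L)" by (simp add: int_F)
  qed
  \<comment> \<open>The points where the regularised function has the limits 0 and 1 at the two
    ends; by monotonicity it is then also bounded by 1.\<close>
  define good where "good x \<longleftrightarrow> (INF n. G x (- real n)) = 0 \<and> (SUP n. G x (real n)) = 1" for x
  have good_meas[measurable]: "Measurable.pred MX good" unfolding good_def by measurable
  have AE_good: "AE x in L. good x"
  proof -
    have "AE x in L. (INF n. G x (- real n)) \<le> 0"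
    proof (rule L.AE_mono_densityI)
      fix A assume "A \<in> sets L"
      then have A[measurable]: "A \<in> sets MX" by (simp add: sets_L)
      have "(\<integral>\<^sup>+x\<in>A. (INF n. G x (- real n)) \<partial>L) \<le> P A (- real n)" for n
        unfolding int_G[OF A, symmetric] by (intro nn_integral_mono mult_right_mono INF_lower) auto
      then have "(\<integral>\<^sup>+x\<in>A. (INF n. G x (- real n)) \<partial>L) \<le> 0"
        by (intro LIMSEQ_le_const[OF P_bot[OF A]]) blast
      then show "(\<integral>\<^sup>+x\<in>A. (INF n. G x (- real n)) \<partial>L) \<le> (\<integral>\<^sup>+x\<in>A. 0 \<partial>L)" by simp
    qed auto
    moreover have "AE x in L. 1 \<le> (SUP n. G x (real n))" "AE x in L. (SUP n. G x (real n)) \<le> 1"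
    proof -
      have le: "AE x in L. G x y \<le> 1" for y
        by (rule L.AE_mono_densityI) (auto simp: int_G sets_L P_le L.emeasure_space_1)
      have "AE x in L. \<forall>n. G x (real n) \<le> 1" by (subst AE_all_countable) (auto intro: le)
      then show S: "AE x in L. (SUP n. G x (real n)) \<le> 1"
        by eventually_elim (auto intro: SUP_least)
      show "AE x in L. 1 \<le> (SUP n. G x (real n))"
      proof (rule L.AE_mono_densityI)
        fix A assume "A \<in> sets L"
        then have A[measurable]: "A \<in> sets MX" by (simp add: sets_L)
        have "P A (real n) \<le> (\<integral>\<^sup>+x\<in>A. (SUP n. G x (real n)) \<partial>L)" for n
          unfolding int_G[OF A, symmetric] by (intro nn_integral_mono mult_right_mono SUP_upper) auto
        then have "emeasure L A \<le> (\<integral>\<^sup>+x\<in>A. (SUP n. G x (real n)) \<partial>L)"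
          by (intro LIMSEQ_le_const2[OF P_top[OF A]]) blast
        then show "(\<integral>\<^sup>+x\<in>A. 1 \<partial>L) \<le> (\<integral>\<^sup>+x\<in>A. (SUP n. G x (real n)) \<partial>L)"
          using \<open>A \<in> sets L\<close> by simp
      next
        have "(\<integral>\<^sup>+x. (SUP n. G x (real n)) \<partial>L) \<le> (\<integral>\<^sup>+x. 1 \<partial>L)"
          by (rule nn_integral_mono_AE[OF S])
        then show "(\<integral>\<^sup>+x. (SUP n. G x (real n)) \<partial>L) < \<infinity>"
          by (auto simp: L.emeasure_space_1 intro: le_less_trans)
      qed auto
    qed
    ultimately show ?thesis
      unfolding good_def by eventually_elim (auto intro: antisym)
  qed
  \<comment> \<open>Off the good set the distribution function of the point mass at 0 is
    substituted, so that every \<open>D x\<close> is a distribution function and the kernel is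
    defined everywhere.\<close>
  define D where "D x y = (if good x then enn2real (G x y) else indicator {0..} y)" for x and y :: real
  have G1: "G x y \<le> 1" if "good x" for x y
  proof -
    obtain n where "y \<le> real n" using real_arch_simple by blast
    then have "G x y \<le> G x (real n)" by (rule G_mono)
    also have "\<dots> \<le> (SUP n. G x (real n))" by (rule SUP_upper) simp
    finally show ?thesis using that by (simp add: good_def)
  qed
  have GD: "ennreal (D x y) = G x y" if "good x" for x y
    using G1[OF that, of y] that by (simp add: D_def) (metis ennreal_enn2real ennreal_one_less_top le_less_trans)
  have D_nonneg: "0 \<le> D x y" for x y by (auto simp: D_def)
  have D_less: "D x y < e \<longleftrightarrow> G x y < ennreal e" if "good x" "0 < e" for x y e
    unfolding GD[OF that(1), symmetric] using that D_nonneg by (simp add: ennreal_less_iff)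
  have D_mono: "D x y \<le> D x y'" if "y \<le> y'" for x y y'
  proof (cases "good x")
    case True
    then show ?thesis using G_mono[OF that, of x] D_nonneg
      by (simp add: GD[OF True, symmetric])
  next
    case False then show ?thesis using that by (auto simp: D_def indicator_def)
  qed
  have D_right: "continuous (at_right a) (D x)" for x a
    unfolding continuous_within
  proof (rule order_tendstoI)
    fix e assume "e < D x a"
    then show "\<forall>\<^sub>F y in at_right a. e < D x y"
      unfolding eventually_at_right_field
      by (intro exI[of _ "a + 1"]) (auto intro: less_le_trans[OF _ D_mono])
  next
    fix e assume e: "D x a < e"
    have "\<exists>b>a. D x b < e"
    proof (cases "good x")
      case True
      have "0 < e" using D_nonneg[of x a] e by simp
      then have "G x a < ennreal e" using D_less[OF True] e by simp
      then obtain q where "a < of_rat q" "F (of_rat q) x < ennreal e"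
        unfolding G_def INF_less_iff by auto
      moreover obtain b where "a < b" "b < of_rat q" using dense[OF \<open>a < of_rat q\<close>] by blast
      ultimately show ?thesis using G_le[of b q x] D_less[OF True \<open>0 < e\<close>]
        by (auto intro!: exI[of _ b] intro: le_less_trans)
    next
      case False
      then show ?thesis using e
        by (intro exI[of _ "if a < 0 then a / 2 else a + 1"]) (auto simp: D_def indicator_def)
    qed
    then show "\<forall>\<^sub>F y in at_right a. D x y < e"
      unfolding eventually_at_right_field by (meson D_mono le_less_trans less_imp_le)
  qed
  have D_bot: "(D x \<longlongrightarrow> 0) at_bot" for x
  proof (rule order_tendstoI)
    fix e :: real assume "e < 0"
    then show "\<forall>\<^sub>F y in at_bot. e < D x y"
      by (intro always_eventually allI less_le_trans[OF _ D_nonneg])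
  next
    fix e :: real assume "0 < e"
    have "\<exists>b. D x b < e"
    proof (cases "good x")
      case True
      then have "(INF n. G x (- real n)) < ennreal e" using \<open>0 < e\<close> by (simp add: good_def)
      then show ?thesis unfolding INF_less_iff using D_less[OF True \<open>0 < e\<close>] by auto
    next
      case False then show ?thesis using \<open>0 < e\<close> by (auto simp: D_def intro!: exI[of _ "-1"])
    qed
    then show "\<forall>\<^sub>F y in at_bot. D x y < e"
      unfolding eventually_at_bot_linorder by (auto intro: le_less_trans D_mono)
  qed
  have D_top: "(D x \<longlongrightarrow> 1) at_top" for x
  proof (rule order_tendstoI)
    fix e :: real assume "1 < e"
    have "D x y \<le> 1" for y
    proof (cases "good x")
      case True then show ?thesis using G1[OF True, of y] by (simp flip: GD[OF True])
    qed (auto simp: D_def indicator_def)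
    then show "\<forall>\<^sub>F y in at_top. D x y < e"
      using \<open>1 < e\<close> by (intro always_eventually allI) (auto intro: le_less_trans)
  next
    fix e :: real assume "e < 1"
    have "\<exists>b. e < D x b"
    proof (cases "good x")
      case True
      then have "ennreal e < (SUP n. G x (real n))" using \<open>e < 1\<close>
        by (simp add: good_def)
      then obtain n where "ennreal e < G x (real n)" unfolding less_SUP_iff by auto
      then have "ennreal e < ennreal (D x (real n))" by (simp add: GD[OF True])
      then have "e < D x (real n)" using D_nonneg[of x "real n"]
        by (metis ennreal_leI linorder_not_less)
      then show ?thesis by blast
    next
      case False then show ?thesis using \<open>e < 1\<close> by (auto simp: D_def intro!: exI[of _ 1])
    qed
    then show "\<forall>\<^sub>F y in at_top. e < D x y"
      unfolding eventually_at_top_linorder by (auto intro: less_le_trans D_mono)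
  qed
  have D_meas[measurable]: "(\<lambda>x. D x y) \<in> borel_measurable MX" for y
    unfolding D_def by measurable
  define \<kappa> where "\<kappa> x = interval_measure (D x)" for x
  have \<kappa>_Iic: "emeasure (\<kappa> x) {..y} = ennreal (D x y)" for x y
    unfolding \<kappa>_def by (rule emeasure_interval_measure_Iic[OF D_mono D_right D_bot])
  have \<kappa>_prob: "real_distribution (\<kappa> x)" for x
    unfolding \<kappa>_def by (rule real_distribution_interval_measure[OF D_mono D_right D_bot D_top])
  have \<kappa>[measurable]: "\<kappa> \<in> MX \<rightarrow>\<^sub>M prob_algebra borel"
  proof (rule measurable_prob_algebra_generated)
    show "sets (borel :: real measure) = sigma_sets UNIV (range atMost)"
      by (simp add: borel_eq_atMost)
    show "Int_stable (range (atMost :: real \<Rightarrow> _))"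
      by (auto simp: Int_stable_def)
    show "prob_space (\<kappa> x)" for x using \<kappa>_prob[of x] by (simp add: real_distribution_def)
    show "sets (\<kappa> x) = sets borel" for x
      using \<kappa>_prob[of x] by (rule real_distribution.events_eq_borel)
    fix A :: "real set" assume "A \<in> range atMost"
    then show "(\<lambda>x. emeasure (\<kappa> x) A) \<in> borel_measurable MX"
      by (auto simp: \<kappa>_Iic)
  qed simp
  show ?thesis
  proof (intro exI disintegratesI)
    fix A and B :: "real set" assume A[measurable]: "A \<in> sets MX" and B[measurable]: "B \<in> sets borel"
    \<comment> \<open>For a fixed \<open>A\<close>, \<open>?M1\<close> is the law of
      \<open>Z\<close> on the event \<open>X \<in> A\<close> and \<open>?M2\<close> the mixture of
      the kernels over \<open>A\<close>. Both are finite measures on the line and are compared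
      through their distribution functions; the complement of \<open>good\<close> is null and does
      not contribute.\<close>
    let ?M1 = "distr (density M (indicator {\<omega>\<in>space M. X \<omega> \<in> A})) borel Z"
    let ?M2 = "density L (indicator A) \<bind> \<kappa>"
    have \<kappa>': "\<kappa> \<in> density L (indicator A) \<rightarrow>\<^sub>M subprob_algebra borel"
      using measurable_prob_algebraD[OF \<kappa>] by (simp add: measurable_cong_sets[OF sets_L])
    have [measurable]: "(\<lambda>x. emeasure (\<kappa> x) B) \<in> borel_measurable MX" if "B \<in> sets borel" for B
      by (rule measurable_emeasure_kernel[OF measurable_prob_algebraD[OF \<kappa>] that])
    have ne: "space (density L (indicator A)) \<noteq> {}" using L.not_empty by simp
    have M1: "emeasure ?M1 B = emeasure M {\<omega>\<in>space M. X \<omega> \<in> A \<and> Z \<omega> \<in> B}" if [measurable]: "B \<in> sets borel" for B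
    proof -
      have "Z -` B \<inter> space M \<in> sets M" by measurable
      then show ?thesis
        by (subst emeasure_distr)
        (auto simp: emeasure_restricted intro!: arg_cong[where f = "emeasure M"])
    qed
    have M2: "emeasure ?M2 B = (\<integral>\<^sup>+x. indicator A x * emeasure (\<kappa> x) B \<partial>L)" if [measurable]: "B \<in> sets borel" for B
      using that by (subst emeasure_bind[OF ne \<kappa>'])
        (auto intro!: nn_integral_density)
    have sets2: "sets ?M2 = sets borel"
      by (rule sets_bind[OF sets_kernel[OF \<kappa>'] ne])
    have "?M1 = ?M2"
    proof (rule cdf_unique')
      have "emeasure ?M1 (space ?M1) \<le> 1" using M1[of UNIV] by (simp add: emeasure_le_1)
      then show f1: "finite_borel_measure ?M1"
        by (intro finite_borel_measure.intro finite_borel_measure_axioms.intro finite_measureI)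
          (auto simp: top_unique)
      have "emeasure ?M2 UNIV = (\<integral>\<^sup>+x. indicator A x \<partial>L)"
        unfolding M2[of UNIV, simplified]
        using kernel_prob[OF \<kappa>] kernel_space[OF \<kappa>]
        by (intro nn_integral_cong) (metis mult.right_neutral prob_space.emeasure_space_1 space_L space_borel)
      then have "emeasure ?M2 UNIV \<le> 1" by (simp add: sets_L L.emeasure_le_1)
      then show f2: "finite_borel_measure ?M2"
        using sets2 sets_eq_imp_space_eq[OF sets2]
        by (intro finite_borel_measure.intro finite_borel_measure_axioms.intro finite_measureI)
          (auto simp: top_unique)
      show "cdf ?M1 = cdf ?M2"
      proof
        fix y
        have "emeasure ?M2 {..y} = (\<integral>\<^sup>+x\<in>A. G x y \<partial>L)"
          unfolding M2[OF atMost_borel] using AE_good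
          by (intro nn_integral_cong_AE) (auto simp: \<kappa>_Iic GD mult.commute elim!: eventually_mono)
        also have "\<dots> = emeasure ?M1 {..y}" by (simp add: int_G M1 P_def)
        finally show "cdf ?M1 y = cdf ?M2 y" by (simp add: cdf_def measure_def)
      qed
    qed
    then have "emeasure M {\<omega>\<in>space M. X \<omega> \<in> A \<and> Z \<omega> \<in> B} = (\<integral>\<^sup>+x. indicator A x * emeasure (\<kappa> x) B \<partial>L)"
      using M1[OF B] M2[OF B] by simp
    also have "\<dots> = (\<integral>\<^sup>+\<omega>. indicator A (X \<omega>) * emeasure (\<kappa> (X \<omega>)) B \<partial>M)"
      unfolding L_def
      by (subst nn_integral_distr) auto
    finally show "emeasure M {\<omega>\<in>space M. X \<omega> \<in> A \<and> Z \<omega> \<in> B}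
        = (\<integral>\<^sup>+\<omega>. indicator A (X \<omega>) * emeasure (\<kappa> (X \<omega>)) B \<partial>M)" .
  qed (fact | simp)+
qed

text \<open>Carries a kernel for the family of coordinates over to the vector that they
  form.\<close>

lemma disintegrates_cong_MZ:
  assumes d: "disintegrates M X MX Z MZ \<kappa>" and g[measurable]: "g \<in> MZ \<rightarrow>\<^sub>M N"
    and X: "X \<in> M \<rightarrow>\<^sub>M MX"
  shows "disintegrates M X MX (\<lambda>\<omega>. g (Z \<omega>)) N (\<lambda>x. distr (\<kappa> x) N g)"
  unfolding disintegrates_def
proof (intro conjI ballI)
  note \<kappa>[measurable] = disintegrates_kernel[OF d]
  show "(\<lambda>x. distr (\<kappa> x) N g) \<in> MX \<rightarrow>\<^sub>M prob_algebra N" by measurable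
  fix F :: "_ \<Rightarrow> ennreal" assume [measurable]: "F \<in> borel_measurable (MX \<Otimes>\<^sub>M N)"
  have "(\<integral>\<^sup>+\<omega>. F (X \<omega>, g (Z \<omega>)) \<partial>M) = (\<integral>\<^sup>+\<omega>. (\<integral>\<^sup>+z. F (X \<omega>, g z) \<partial>\<kappa> (X \<omega>)) \<partial>M)"
    using disintegrates_nn_integral[OF d, of "\<lambda>(x, z). F (x, g z)"] by simp
  also have "\<dots> = (\<integral>\<^sup>+\<omega>. (\<integral>\<^sup>+z. F (X \<omega>, z) \<partial>distr (\<kappa> (X \<omega>)) N g) \<partial>M)"
  proof (rule nn_integral_cong)
    fix \<omega> assume "\<omega> \<in> space M"
    then have x[measurable]: "X \<omega> \<in> space MX" using X by (rule measurable_space[rotated])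
    note [measurable_cong] = kernel_sets[OF \<kappa> x]
    show "(\<integral>\<^sup>+z. F (X \<omega>, g z) \<partial>\<kappa> (X \<omega>)) = (\<integral>\<^sup>+z. F (X \<omega>, z) \<partial>distr (\<kappa> (X \<omega>)) N g)"
      by (subst nn_integral_distr) auto
  qed
  finally show "(\<integral>\<^sup>+\<omega>. F (X \<omega>, g (Z \<omega>)) \<partial>M) = (\<integral>\<^sup>+\<omega>. (\<integral>\<^sup>+z. F (X \<omega>, z) \<partial>distr (\<kappa> (X \<omega>)) N g) \<partial>M)" .
qed

lemma nn_integral_bind_prob:
  assumes "M \<in> space (prob_algebra N)" and "K \<in> N \<rightarrow>\<^sub>M prob_algebra L" and "f \<in> borel_measurable L"
  shows "(\<integral>\<^sup>+x. f x \<partial>(M \<bind> K)) = (\<integral>\<^sup>+x. (\<integral>\<^sup>+y. f y \<partial>K x) \<partial>M)"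
proof -
  have "K \<in> M \<rightarrow>\<^sub>M subprob_algebra L"
    using measurable_prob_algebraD[OF assms(2)] assms(1)
    by (simp add: measurable_cong_sets[of M N] space_prob_algebra)
  then show ?thesis by (rule nn_integral_bind[OF assms(3)])
qed

lemma nn_integral_distr_kernel:
  assumes "M \<in> space (prob_algebra N)" and "g \<in> N \<rightarrow>\<^sub>M L" and "f \<in> borel_measurable L"
  shows "(\<integral>\<^sup>+x. f x \<partial>distr M L g) = (\<integral>\<^sup>+x. f (g x) \<partial>M)"
  using assms by (subst nn_integral_distr) (auto simp: space_prob_algebra measurable_cong_sets[of M N])

text \<open>Chain rule, one coordinate at a time: the new coordinate is disintegrated given
  \<open>X\<close> and the coordinates already treated, and the two kernels are composed. This
  reduces vectors to the real line.\<close>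

lemma ex_disintegrates_PiM:
  fixes Z :: "'i \<Rightarrow> 'w \<Rightarrow> real"
  assumes "prob_space M" and X[measurable]: "X \<in> M \<rightarrow>\<^sub>M MX" and "finite I"
    and Z[measurable]: "\<And>i. Z i \<in> borel_measurable M"
  shows "\<exists>\<kappa>. disintegrates M X MX (\<lambda>\<omega>. \<lambda>i\<in>I. Z i \<omega>) (PiM I (\<lambda>_. borel)) \<kappa>"
  using \<open>finite I\<close>
proof induction
  case empty
  let ?u = "\<lambda>_. undefined :: real"
  have u: "?u \<in> space (PiM {} (\<lambda>_::'i. borel :: real measure))" by (simp add: space_PiM)
  have "disintegrates M X MX (\<lambda>\<omega>. \<lambda>i\<in>{}. Z i \<omega>) (PiM {} (\<lambda>_. borel)) (\<lambda>_. return (PiM {} (\<lambda>_. borel)) ?u)"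
    unfolding disintegrates_def
  proof (intro conjI ballI)
    show "(\<lambda>_. return (PiM {} (\<lambda>_. borel)) ?u) \<in> MX \<rightarrow>\<^sub>M prob_algebra (PiM {} (\<lambda>_::'i. borel :: real measure))"
      using measurable_space[OF measurable_return_prob_space u] by (rule measurable_const)
    fix F :: "_ \<Rightarrow> ennreal"
    assume [measurable]: "F \<in> borel_measurable (MX \<Otimes>\<^sub>M PiM {} (\<lambda>_::'i. borel :: real measure))"
    show "(\<integral>\<^sup>+\<omega>. F (X \<omega>, \<lambda>i\<in>{}. Z i \<omega>) \<partial>M) =
       (\<integral>\<^sup>+\<omega>. (\<integral>\<^sup>+z. F (X \<omega>, z) \<partial>return (PiM {} (\<lambda>_. borel)) ?u) \<partial>M)"
      using measurable_space[OF X] u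
      by (intro nn_integral_cong) (auto simp: nn_integral_return restrict_def)
  qed
  then show ?case by blast
next
  case (insert i I)
  let ?I = "PiM I (\<lambda>_. borel :: real measure)" and ?J = "PiM (insert i I) (\<lambda>_. borel :: real measure)"
  from insert obtain \<kappa> where d: "disintegrates M X MX (\<lambda>\<omega>. \<lambda>i\<in>I. Z i \<omega>) ?I \<kappa>" by blast
  note \<kappa>[measurable] = disintegrates_kernel[OF d]
  obtain \<kappa>' where d': "disintegrates M (\<lambda>\<omega>. (X \<omega>, \<lambda>i\<in>I. Z i \<omega>)) (MX \<Otimes>\<^sub>M ?I) (Z i) borel \<kappa>'"
    using ex_disintegrates_real[OF \<open>prob_space M\<close>, of "\<lambda>\<omega>. (X \<omega>, \<lambda>i\<in>I. Z i \<omega>)" "MX \<Otimes>\<^sub>M ?I" "Z i"] by auto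
  note \<kappa>'[measurable] = disintegrates_kernel[OF d']
  have upd[measurable]: "(\<lambda>(v, r). v(i := r)) \<in> ?I \<Otimes>\<^sub>M borel \<rightarrow>\<^sub>M ?J"
    by (rule measurable_add_dim)
  have upd'[measurable (raw)]: "(\<lambda>x. (f x)(i := g x)) \<in> N \<rightarrow>\<^sub>M ?J"
    if "f \<in> N \<rightarrow>\<^sub>M ?I" "g \<in> borel_measurable N" for f g and N :: "'n measure"
    using measurable_compose[OF measurable_Pair[OF that] upd] by simp
  have F'[measurable]: "(\<lambda>((x, v), r). F (x, v(i := r))) \<in> borel_measurable ((MX \<Otimes>\<^sub>M ?I) \<Otimes>\<^sub>M borel)"
    if "F \<in> borel_measurable (MX \<Otimes>\<^sub>M ?J)" for F :: "_ \<Rightarrow> ennreal"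
  proof -
    have "(\<lambda>z. (fst (fst z), (snd (fst z))(i := snd z))) \<in> (MX \<Otimes>\<^sub>M ?I) \<Otimes>\<^sub>M borel \<rightarrow>\<^sub>M MX \<Otimes>\<^sub>M ?J"
      by (intro measurable_Pair measurable_compose[OF _ upd, of "\<lambda>z. (snd (fst z), snd z)", simplified]) measurable
    from measurable_compose[OF this that] show ?thesis by (simp add: split_beta')
  qed
  define \<rho> where "\<rho> x v = distr (\<kappa>' (x, v)) ?J (\<lambda>r. v(i := r))" for x v
  have \<rho>[measurable]: "(\<lambda>(x, v). \<rho> x v) \<in> MX \<Otimes>\<^sub>M ?I \<rightarrow>\<^sub>M prob_algebra ?J"
    unfolding \<rho>_def by measurable
  have "disintegrates M X MX (\<lambda>\<omega>. \<lambda>i\<in>insert i I. Z i \<omega>) ?J (\<lambda>x. \<kappa> x \<bind> \<rho> x)"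
    unfolding disintegrates_def
  proof (intro conjI ballI)
    show "(\<lambda>x. \<kappa> x \<bind> \<rho> x) \<in> MX \<rightarrow>\<^sub>M prob_algebra ?J" by measurable
    fix F :: "_ \<Rightarrow> ennreal" assume F[measurable]: "F \<in> borel_measurable (MX \<Otimes>\<^sub>M ?J)"
    have [measurable]: "(\<lambda>(x, v). \<integral>\<^sup>+r. F (x, v(i := r)) \<partial>\<kappa>' (x, v)) \<in> borel_measurable (MX \<Otimes>\<^sub>M ?I)"
      by measurable
    have eq: "(\<lambda>i\<in>insert i I. Z i \<omega>) = (\<lambda>i\<in>I. Z i \<omega>)(i := Z i \<omega>)" for \<omega>
      by (auto simp: restrict_def)
    have "(\<integral>\<^sup>+\<omega>. F (X \<omega>, \<lambda>i\<in>insert i I. Z i \<omega>) \<partial>M)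
        = (\<integral>\<^sup>+\<omega>. (\<integral>\<^sup>+r. F (X \<omega>, (\<lambda>i\<in>I. Z i \<omega>)(i := r)) \<partial>\<kappa>' (X \<omega>, \<lambda>i\<in>I. Z i \<omega>)) \<partial>M)"
      using disintegrates_nn_integral[OF d', of "\<lambda>((x, v), r). F (x, v(i := r))"] by (simp add: eq F')
    also have "\<dots> = (\<integral>\<^sup>+\<omega>. (\<integral>\<^sup>+v. (\<integral>\<^sup>+r. F (X \<omega>, v(i := r)) \<partial>\<kappa>' (X \<omega>, v)) \<partial>\<kappa> (X \<omega>)) \<partial>M)"
      using disintegrates_nn_integral[OF d, of "\<lambda>(x, v). \<integral>\<^sup>+r. F (x, v(i := r)) \<partial>\<kappa>' (x, v)"] by simp
    also have "\<dots> = (\<integral>\<^sup>+\<omega>. (\<integral>\<^sup>+w. F (X \<omega>, w) \<partial>(\<kappa> (X \<omega>) \<bind> \<rho> (X \<omega>))) \<partial>M)"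
    proof (rule nn_integral_cong)
      fix \<omega> assume "\<omega> \<in> space M"
      then have x[measurable]: "X \<omega> \<in> space MX" using X by (rule measurable_space[rotated])
      have "(\<integral>\<^sup>+w. F (X \<omega>, w) \<partial>(\<kappa> (X \<omega>) \<bind> \<rho> (X \<omega>))) = (\<integral>\<^sup>+v. (\<integral>\<^sup>+w. F (X \<omega>, w) \<partial>\<rho> (X \<omega>) v) \<partial>\<kappa> (X \<omega>))"
        using measurable_space[OF \<kappa> x] by (rule nn_integral_bind_prob[where L = ?J]) measurable
      also have "\<dots> = (\<integral>\<^sup>+v. (\<integral>\<^sup>+r. F (X \<omega>, v(i := r)) \<partial>\<kappa>' (X \<omega>, v)) \<partial>\<kappa> (X \<omega>))"
      proof (rule nn_integral_cong)
        fix v assume "v \<in> space (\<kappa> (X \<omega>))"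
        then have v[measurable]: "v \<in> space ?I" by (simp add: kernel_space[OF \<kappa> x])
        then have "(X \<omega>, v) \<in> space (MX \<Otimes>\<^sub>M ?I)" using x by (simp add: space_pair_measure)
        from measurable_space[OF \<kappa>' this]
        show "(\<integral>\<^sup>+w. F (X \<omega>, w) \<partial>\<rho> (X \<omega>) v) = (\<integral>\<^sup>+r. F (X \<omega>, v(i := r)) \<partial>\<kappa>' (X \<omega>, v))"
          unfolding \<rho>_def by (rule nn_integral_distr_kernel) measurable
      qed
      finally show "(\<integral>\<^sup>+v. (\<integral>\<^sup>+r. F (X \<omega>, v(i := r)) \<partial>\<kappa>' (X \<omega>, v)) \<partial>\<kappa> (X \<omega>))
        = (\<integral>\<^sup>+w. F (X \<omega>, w) \<partial>(\<kappa> (X \<omega>) \<bind> \<rho> (X \<omega>)))" by simp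
    qed
    finally show "(\<integral>\<^sup>+\<omega>. F (X \<omega>, \<lambda>i\<in>insert i I. Z i \<omega>) \<partial>M)
      = (\<integral>\<^sup>+\<omega>. (\<integral>\<^sup>+w. F (X \<omega>, w) \<partial>(\<kappa> (X \<omega>) \<bind> \<rho> (X \<omega>))) \<partial>M)" .
  qed
  then show ?case by blast
qed

lemma ex_disintegrates_vec:
  fixes Z :: "'w \<Rightarrow> real^'d"
  assumes "prob_space M" and X[measurable]: "X \<in> M \<rightarrow>\<^sub>M MX" and Z[measurable]: "Z \<in> borel_measurable M"
  shows "\<exists>\<kappa>. disintegrates M X MX Z borel \<kappa>"
proof -
  have [measurable]: "(\<lambda>\<omega>. Z \<omega> $ i) \<in> borel_measurable M" for i
    by (rule measurable_compose[OF Z]) (intro borel_measurable_continuous_onI continuous_intros)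
  obtain \<kappa> where d: "disintegrates M X MX (\<lambda>\<omega>. \<lambda>i\<in>UNIV. Z \<omega> $ i) (PiM UNIV (\<lambda>_. borel)) \<kappa>"
    using ex_disintegrates_PiM[OF assms(1,2), of UNIV "\<lambda>i \<omega>. Z \<omega> $ i"] by auto
  have "(\<lambda>v::'d \<Rightarrow> real. \<chi> i. v i) \<in> borel_measurable (PiM UNIV (\<lambda>_. borel))"
    by (subst borel_measurable_euclidean_space) (auto simp: Basis_vec_def inner_axis)
  from disintegrates_cong_MZ[OF d this X] show ?thesis by (auto simp: restrict_UNIV)
qed

lemma measurable_restrict_path [measurable]:
  "s \<le> t \<Longrightarrow> (\<lambda>x. restrict x {1..s}) \<in> path_space t \<rightarrow>\<^sub>M path_space s"
  unfolding path_space_def by (rule measurable_restrict_subset) auto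

lemma measurable_path_component:
  "s \<in> {1..t} \<Longrightarrow> (\<lambda>x. x s) \<in> path_space t \<rightarrow>\<^sub>M borel"
  unfolding path_space_def by (rule measurable_component_singleton)

text \<open>Existence of a regular conditional law is what makes the choice in
  \<open>cond_law\<close> a conditional law at all; the rectangle identity in
  \<open>is_cond_law\<close> is then upgraded to arbitrary integrands by
  \<open>disintegratesI\<close>.\<close>

lemma disintegrates_cond_law:
  fixes \<mu> :: "(nat \<Rightarrow> real^'d) measure"
  assumes \<mu>: "prob_space \<mu>" "sets \<mu> = sets (path_space T)" and "t < T"
  shows "disintegrates \<mu> (\<lambda>x. restrict x {1..t}) (path_space t) (\<lambda>x. x (Suc t)) borel (cond_law \<mu> t)"
proof -
  note [measurable_cong] = \<mu>(2)
  have X[measurable]: "(\<lambda>x. restrict x {1..t}) \<in> \<mu> \<rightarrow>\<^sub>M path_space t"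
    unfolding measurable_cong_sets[OF \<mu>(2) refl] using \<open>t < T\<close> by (intro measurable_restrict_path) simp
  have Z[measurable]: "(\<lambda>x. x (Suc t)) \<in> borel_measurable \<mu>"
    unfolding measurable_cong_sets[OF \<mu>(2) refl] using \<open>t < T\<close> by (intro measurable_path_component) simp
  obtain \<kappa> where d: "disintegrates \<mu> (\<lambda>x. restrict x {1..t}) (path_space t) (\<lambda>x. x (Suc t)) borel \<kappa>"
    using ex_disintegrates_vec[OF \<mu>(1) X Z] by blast
  have "is_cond_law \<mu> t \<kappa>"
    unfolding is_cond_law_def
  proof (intro conjI ballI disintegrates_kernel[OF d])
    fix A :: "(nat \<Rightarrow> real^'d) set" and B :: "(real^'d) set" assume [measurable]: "A \<in> sets (path_space t)" "B \<in> sets borel"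
    have "emeasure \<mu> {x\<in>space \<mu>. restrict x {1..t} \<in> A \<and> x (Suc t) \<in> B}
        = (\<integral>\<^sup>+x. indicator A (restrict x {1..t}) * indicator B (x (Suc t)) \<partial>\<mu>)"
      by (subst nn_integral_indicator[symmetric], measurable)
        (auto intro!: nn_integral_cong split: split_indicator)
    also have "\<dots> = (\<integral>\<^sup>+x. (\<integral>\<^sup>+z. indicator A (restrict x {1..t}) * indicator B z \<partial>\<kappa> (restrict x {1..t})) \<partial>\<mu>)"
      using disintegrates_nn_integral[OF d, of "\<lambda>(x, z). indicator A x * indicator B z"] by simp
    also have "\<dots> = (\<integral>\<^sup>+x. indicator A (restrict x {1..t}) * emeasure (\<kappa> (restrict x {1..t})) B \<partial>\<mu>)"
    proof (rule nn_integral_cong)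
      fix x assume "x \<in> space \<mu>"
      then have "restrict x {1..t} \<in> space (path_space t)" by (rule measurable_space[OF X])
      note ks = kernel_sets[OF disintegrates_kernel[OF d] this]
      show "(\<integral>\<^sup>+z. indicator A (restrict x {1..t}) * indicator B z \<partial>\<kappa> (restrict x {1..t})) =
        indicator A (restrict x {1..t}) * emeasure (\<kappa> (restrict x {1..t})) B"
        using \<open>B \<in> sets borel\<close> by (subst nn_integral_cmult) (simp_all add: ks borel_measurable_indicator del: One_nat_def)
    qed
    finally show "emeasure \<mu> {x\<in>space \<mu>. restrict x {1..t} \<in> A \<and> x (Suc t) \<in> B}
        = (\<integral>\<^sup>+x. indicator A (restrict x {1..t}) * emeasure (\<kappa> (restrict x {1..t})) B \<partial>\<mu>)" .
  qed
  then have "is_cond_law \<mu> t (cond_law \<mu> t)" unfolding cond_law_def by (rule someI[of "is_cond_law \<mu> t"])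
  then show ?thesis
    unfolding is_cond_law_def by (intro disintegratesI \<mu>(1) X Z) auto
qed

section \<open>Convexity and Minkowski's inequality for extended integrals\<close>

lemma powr_convex_nonneg:
  fixes x y u :: real
  assumes p: "1 \<le> p" and "0 \<le> x" "0 \<le> y" and u: "0 < u" "u < 1"
  shows "(u * x + (1 - u) * y) powr p \<le> u * x powr p + (1 - u) * y powr p"
proof -
  \<comment> \<open>If one of the two arguments is zero, the claim reduces to this inequality, which
    holds because \<open>v powr p \<le> v\<close> for \<open>v\<close> between 0 and 1.\<close>
  have scale: "(v * z) powr p \<le> v * z powr p" if "0 < v" "v < 1" "0 \<le> z" for v z :: real
  proof -
    have "v powr p \<le> v powr 1" using that p by (intro powr_mono') auto
    then show ?thesis using that by (simp add: powr_mult mult_right_mono)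
  qed
  consider "x = 0" | "y = 0" | "0 < x" "0 < y" using assms by linarith
  then show ?thesis
  proof cases
    case 1 then show ?thesis using scale[of "1 - u" y] assms by simp
  next
    case 2 then show ?thesis using scale[of u x] assms by simp
  next
    case 3
    then show ?thesis
      using convex_onD[OF powr_convex[OF p], of "1 - u" x y] u by simp
  qed
qed

text \<open>Bounds \<open>a\<close> and \<open>b\<close> stand in for the two norms, so that no
  roots of possibly infinite integrals appear. Convexity is applied to \<open>f / a\<close> and
  \<open>g / b\<close> with weights proportional to \<open>a\<close> and \<open>b\<close>, for which
  the convex combination is \<open>(f + g) / (a + b)\<close>; a zero bound forces its function to
  vanish almost everywhere.\<close>

lemma minkowski_nn_integral:
  fixes f g :: "'a \<Rightarrow> real"
  assumes p: "1 \<le> p" and [measurable]: "f \<in> borel_measurable M" "g \<in> borel_measurable M"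
    and f0: "\<And>x. 0 \<le> f x" and g0: "\<And>x. 0 \<le> g x"
    and ab: "0 \<le> a" "0 \<le> b"
    and f: "(\<integral>\<^sup>+x. ennreal (f x powr p) \<partial>M) \<le> ennreal (a powr p)"
    and g: "(\<integral>\<^sup>+x. ennreal (g x powr p) \<partial>M) \<le> ennreal (b powr p)"
  shows "(\<integral>\<^sup>+x. ennreal ((f x + g x) powr p) \<partial>M) \<le> ennreal ((a + b) powr p)"
proof -
  have zero: "AE x in M. h x = 0" if [measurable]: "h \<in> borel_measurable M" and h0: "\<And>x. 0 \<le> h x"
    and h: "(\<integral>\<^sup>+x. ennreal (h x powr p) \<partial>M) \<le> ennreal (0 powr p)" for h :: "'a \<Rightarrow> real"
  proof -
    have "(\<integral>\<^sup>+x. ennreal (h x powr p) \<partial>M) = 0" using h by simp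
    then have "AE x in M. ennreal (h x powr p) = 0" by (subst (asm) nn_integral_0_iff_AE) auto
    then show ?thesis by (rule AE_mp) (auto simp: ennreal_eq_0_iff)
  qed
  consider "a = 0" | "b = 0" | "0 < a" "0 < b" using ab by linarith
  then show ?thesis
  proof cases
    case 1
    then have "AE x in M. f x = 0" using f f0 by (intro zero) auto
    then have "(\<integral>\<^sup>+x. ennreal ((f x + g x) powr p) \<partial>M) = (\<integral>\<^sup>+x. ennreal (g x powr p) \<partial>M)"
      by (intro nn_integral_cong_AE) auto
    then show ?thesis using g 1 by simp
  next
    case 2
    then have "AE x in M. g x = 0" using g g0 by (intro zero) auto
    then have "(\<integral>\<^sup>+x. ennreal ((f x + g x) powr p) \<partial>M) = (\<integral>\<^sup>+x. ennreal (f x powr p) \<partial>M)"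
      by (intro nn_integral_cong_AE) auto
    then show ?thesis using f 2 by simp
  next
    case 3
    define u where "u = a / (a + b)"
    have u: "0 < u" "u < 1" "1 - u = b / (a + b)" using 3 by (auto simp: u_def field_simps)
    have conv: "((f x + g x)) powr p \<le> (a + b) powr p * (u * (f x powr p / a powr p) + (1 - u) * (g x powr p / b powr p))" for x
    proof -
      have "(u * (f x / a) + (1 - u) * (g x / b)) powr p \<le> u * (f x / a) powr p + (1 - u) * (g x / b) powr p"
        using u 3 f0[of x] g0[of x] by (intro powr_convex_nonneg p) auto
      moreover have "u * (f x / a) + (1 - u) * (g x / b) = (f x + g x) / (a + b)"
        using 3 unfolding u(3) by (simp add: u_def add_divide_distrib)
      moreover have "(f x + g x) powr p = (a + b) powr p * ((f x + g x) / (a + b)) powr p"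
        using 3 f0[of x] g0[of x] by (simp flip: powr_mult)
      ultimately have "(f x + g x) powr p \<le> (a + b) powr p * (u * (f x / a) powr p + (1 - u) * (g x / b) powr p)"
        by (metis mult_left_mono powr_ge_zero)
      then show ?thesis using f0[of x] g0[of x] 3 by (simp add: powr_divide)
    qed
    have "(\<integral>\<^sup>+x. ennreal ((f x + g x) powr p) \<partial>M)
      \<le> (\<integral>\<^sup>+x. ennreal ((a + b) powr p) * (ennreal (u / a powr p) * ennreal (f x powr p)
          + ennreal ((1 - u) / b powr p) * ennreal (g x powr p)) \<partial>M)"
    proof (rule nn_integral_mono)
      fix x
      show "ennreal ((f x + g x) powr p) \<le> ennreal ((a + b) powr p) * (ennreal (u / a powr p) * ennreal (f x powr p)
          + ennreal ((1 - u) / b powr p) * ennreal (g x powr p))"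
        using conv[of x] u(1,2) by (simp flip: ennreal_mult ennreal_plus)
    qed
    also have "\<dots> = ennreal ((a + b) powr p) * (ennreal (u / a powr p) * (\<integral>\<^sup>+x. ennreal (f x powr p) \<partial>M)
          + ennreal ((1 - u) / b powr p) * (\<integral>\<^sup>+x. ennreal (g x powr p) \<partial>M))"
      by (simp add: nn_integral_cmult nn_integral_add)
    also have "\<dots> \<le> ennreal ((a + b) powr p) * (ennreal (u / a powr p) * ennreal (a powr p)
          + ennreal ((1 - u) / b powr p) * ennreal (b powr p))"
      by (intro mult_left_mono add_mono f g) auto
    also have "\<dots> = ennreal ((a + b) powr p)"
      using u 3 by (simp flip: ennreal_mult ennreal_plus)
    finally show ?thesis .
  qed
qed

lemma minkowski_nn_integral_sum:
  fixes f :: "'i \<Rightarrow> 'a \<Rightarrow> real"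
  assumes p: "1 \<le> p" and "finite I" and "\<And>i. i \<in> I \<Longrightarrow> f i \<in> borel_measurable M"
    and "\<And>i x. i \<in> I \<Longrightarrow> 0 \<le> f i x" and "\<And>i. i \<in> I \<Longrightarrow> 0 \<le> a i"
    and "\<And>i. i \<in> I \<Longrightarrow> (\<integral>\<^sup>+x. ennreal (f i x powr p) \<partial>M) \<le> ennreal (a i powr p)"
  shows "(\<integral>\<^sup>+x. ennreal ((\<Sum>i\<in>I. f i x) powr p) \<partial>M) \<le> ennreal ((\<Sum>i\<in>I. a i) powr p)"
  using assms(2-)
proof induction
  case (insert i I)
  have "(\<integral>\<^sup>+x. ennreal ((f i x + (\<Sum>i\<in>I. f i x)) powr p) \<partial>M) \<le> ennreal ((a i + (\<Sum>i\<in>I. a i)) powr p)"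
    using insert by (intro minkowski_nn_integral p) (auto intro!: sum_nonneg)
  then show ?case using insert by simp
qed simp

section \<open>Measurable choice of nearly optimal couplings\<close>

lemma couplings_D:
  assumes "\<pi> \<in> couplings M N"
  shows "prob_space \<pi>" "sets \<pi> = sets (M \<Otimes>\<^sub>M N)" "space \<pi> = space M \<times> space N"
    "distr \<pi> M fst = M" "distr \<pi> N snd = N"
proof -
  show *: "sets \<pi> = sets (M \<Otimes>\<^sub>M N)" and "prob_space \<pi>" "distr \<pi> M fst = M" "distr \<pi> N snd = N"
    using assms unfolding couplings_def by blast+
  show "space \<pi> = space M \<times> space N" using sets_eq_imp_space_eq[OF *] by (simp add: space_pair_measure)
qed

lemma couplings_nn_integral_fst:
  assumes "\<pi> \<in> couplings M N" "f \<in> borel_measurable M"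
  shows "(\<integral>\<^sup>+\<omega>. f (fst \<omega>) \<partial>\<pi>) = (\<integral>\<^sup>+x. f x \<partial>M)"
proof -
  note c = couplings_D[OF assms(1)]
  have "fst \<in> \<pi> \<rightarrow>\<^sub>M M" by (simp add: measurable_cong_sets[OF c(2) refl])
  from nn_integral_distr[OF this, of f] show ?thesis using assms(2) by (simp add: c(4))
qed

lemma couplings_nn_integral_snd:
  assumes "\<pi> \<in> couplings M N" "f \<in> borel_measurable N"
  shows "(\<integral>\<^sup>+\<omega>. f (snd \<omega>) \<partial>\<pi>) = (\<integral>\<^sup>+x. f x \<partial>N)"
proof -
  note c = couplings_D[OF assms(1)]
  have "snd \<in> \<pi> \<rightarrow>\<^sub>M N" by (simp add: measurable_cong_sets[OF c(2) refl])
  from nn_integral_distr[OF this, of f] show ?thesis using assms(2) by (simp add: c(5))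
qed

text \<open>The measures built below are known through their integrals, hence this form of the
  marginal conditions.\<close>

lemma couplingsI:
  assumes \<pi>: "prob_space \<pi>" "sets \<pi> = sets (M \<Otimes>\<^sub>M N)"
    and "\<And>A. A \<in> sets M \<Longrightarrow> (\<integral>\<^sup>+\<omega>. indicator A (fst \<omega>) \<partial>\<pi>) = emeasure M A"
    and "\<And>A. A \<in> sets N \<Longrightarrow> (\<integral>\<^sup>+\<omega>. indicator A (snd \<omega>) \<partial>\<pi>) = emeasure N A"
  shows "\<pi> \<in> couplings M N"
proof -
  have m: "fst \<in> \<pi> \<rightarrow>\<^sub>M M" "snd \<in> \<pi> \<rightarrow>\<^sub>M N" by (simp_all add: measurable_cong_sets[OF \<pi>(2) refl])
  have "distr \<pi> M fst = M"
    by (rule measure_eqI) (use assms(3) in \<open>auto simp: nn_integral_distr[OF m(1)] simp flip: nn_integral_indicator\<close>)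
  moreover have "distr \<pi> N snd = N"
    by (rule measure_eqI) (use assms(4) in \<open>auto simp: nn_integral_distr[OF m(2)] simp flip: nn_integral_indicator\<close>)
  ultimately show ?thesis using \<pi> by (simp add: couplings_def)
qed

lemma couplingsI_distr:
  assumes "prob_space \<Omega>" and X: "X \<in> \<Omega> \<rightarrow>\<^sub>M M" "distr \<Omega> M X = M" and Y: "Y \<in> \<Omega> \<rightarrow>\<^sub>M N" "distr \<Omega> N Y = N"
  shows "distr \<Omega> (M \<Otimes>\<^sub>M N) (\<lambda>\<omega>. (X \<omega>, Y \<omega>)) \<in> couplings M N"
  unfolding couplings_def
  using assms by (auto simp: distr_distr comp_def intro!: prob_space.prob_space_distr)

text \<open>Tonelli in either order. The sections are required to integrate to 1 only almost
  everywhere because for a sub-coupling of full mass the quotient in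
  \<open>completed_density\<close> may degenerate on a null set.\<close>

lemma density_couplings:
  assumes "prob_space P" "prob_space Q" and h[measurable]: "h \<in> borel_measurable (P \<Otimes>\<^sub>M Q)"
    and 1: "AE z in P. (\<integral>\<^sup>+w. h (z, w) \<partial>Q) = 1" and 2: "AE w in Q. (\<integral>\<^sup>+z. h (z, w) \<partial>P) = 1"
  shows "density (P \<Otimes>\<^sub>M Q) h \<in> couplings P Q"
proof -
  interpret P: prob_space P by fact
  interpret Q: prob_space Q by fact
  interpret PQ: pair_sigma_finite P Q ..
  have eq1: "(\<integral>\<^sup>+\<omega>. h \<omega> * indicator A (fst \<omega>) \<partial>(P \<Otimes>\<^sub>M Q)) = emeasure P A" if [measurable]: "A \<in> sets P" for A
  proof -
    have "(\<integral>\<^sup>+\<omega>. h \<omega> * indicator A (fst \<omega>) \<partial>(P \<Otimes>\<^sub>M Q)) = (\<integral>\<^sup>+z. (\<integral>\<^sup>+w. h (z, w) * indicator A z \<partial>Q) \<partial>P)"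
      by (simp flip: Q.nn_integral_fst)
    also have "\<dots> = (\<integral>\<^sup>+z. (\<integral>\<^sup>+w. h (z, w) \<partial>Q) * indicator A z \<partial>P)"
      by (intro nn_integral_cong nn_integral_multc) simp
    also have "\<dots> = (\<integral>\<^sup>+z. indicator A z \<partial>P)"
      using 1 by (intro nn_integral_cong_AE) auto
    finally show ?thesis by simp
  qed
  have eq2: "(\<integral>\<^sup>+\<omega>. h \<omega> * indicator A (snd \<omega>) \<partial>(P \<Otimes>\<^sub>M Q)) = emeasure Q A" if [measurable]: "A \<in> sets Q" for A
  proof -
    have "(\<integral>\<^sup>+\<omega>. h \<omega> * indicator A (snd \<omega>) \<partial>(P \<Otimes>\<^sub>M Q)) = (\<integral>\<^sup>+w. (\<integral>\<^sup>+z. h (z, w) * indicator A w \<partial>P) \<partial>Q)"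
      by (simp flip: PQ.nn_integral_snd)
    also have "\<dots> = (\<integral>\<^sup>+w. (\<integral>\<^sup>+z. h (z, w) \<partial>P) * indicator A w \<partial>Q)"
      by (intro nn_integral_cong nn_integral_multc) simp
    also have "\<dots> = (\<integral>\<^sup>+w. indicator A w \<partial>Q)"
      using 2 by (intro nn_integral_cong_AE) auto
    finally show ?thesis by simp
  qed
  show ?thesis
  proof (rule couplingsI)
    show "prob_space (density (P \<Otimes>\<^sub>M Q) h)"
    proof
      have "emeasure (density (P \<Otimes>\<^sub>M Q) h) (space (density (P \<Otimes>\<^sub>M Q) h))
        = (\<integral>\<^sup>+\<omega>. h \<omega> * indicator (space P) (fst \<omega>) \<partial>(P \<Otimes>\<^sub>M Q))"
        by (subst emeasure_density) (auto intro!: nn_integral_cong simp: space_pair_measure split: split_indicator)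
      also have "\<dots> = 1" by (simp add: eq1 P.emeasure_space_1)
      finally show "emeasure (density (P \<Otimes>\<^sub>M Q) h) (space (density (P \<Otimes>\<^sub>M Q) h)) = 1" .
    qed
  qed (simp_all add: nn_integral_density eq1 eq2)
qed

text \<open>A sub-coupling with density \<open>f\<close> is completed by the product of its normalised residual
  marginals. If \<open>f\<close> has full mass, both residuals vanish almost everywhere and the quotient
  \<open>0 / 0 = 0\<close> is harmless.\<close>

definition completed_density :: "'a measure \<Rightarrow> 'b measure \<Rightarrow> ('a \<Rightarrow> 'b \<Rightarrow> ennreal) \<Rightarrow> 'a \<times> 'b \<Rightarrow> ennreal" where
  "completed_density P Q f = (\<lambda>(z, w). f z w +
     (1 - (\<integral>\<^sup>+w'. f z w' \<partial>Q)) * (1 - (\<integral>\<^sup>+z'. f z' w \<partial>P)) / (1 - (\<integral>\<^sup>+z'. (\<integral>\<^sup>+w'. f z' w' \<partial>Q) \<partial>P)))"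

definition completion :: "'a measure \<Rightarrow> 'b measure \<Rightarrow> ('a \<Rightarrow> 'b \<Rightarrow> ennreal) \<Rightarrow> ('a \<times> 'b) measure" where
  "completion P Q f = density (P \<Otimes>\<^sub>M Q) (completed_density P Q f)"

text \<open>If the total mass is 1, the residual marginal has integral 0 and vanishes almost
  everywhere; otherwise the quotient is 1. The other marginal is obtained from the transposed
  density, whose total mass is the same by Fubini.\<close>

lemma completion_residual:
  assumes "prob_space P" "prob_space Q" and f[measurable]: "(\<lambda>(z, w). f z w) \<in> borel_measurable (P \<Otimes>\<^sub>M Q)"
    and 1: "\<forall>z\<in>space P. (\<integral>\<^sup>+w. f z w \<partial>Q) \<le> 1"
  shows "AE z in P. (1 - (\<integral>\<^sup>+w'. f z w' \<partial>Q)) * ((1 - (\<integral>\<^sup>+z'. (\<integral>\<^sup>+w'. f z' w' \<partial>Q) \<partial>P)) / (1 - (\<integral>\<^sup>+z'. (\<integral>\<^sup>+w'. f z' w' \<partial>Q) \<partial>P)))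
      = 1 - (\<integral>\<^sup>+w'. f z w' \<partial>Q)"
    and "(\<integral>\<^sup>+z'. (1 - (\<integral>\<^sup>+w'. f z' w' \<partial>Q)) \<partial>P) = 1 - (\<integral>\<^sup>+z'. (\<integral>\<^sup>+w'. f z' w' \<partial>Q) \<partial>P)"
    and "(\<integral>\<^sup>+z'. (\<integral>\<^sup>+w'. f z' w' \<partial>Q) \<partial>P) \<le> 1"
proof -
  interpret P: prob_space P by fact
  interpret Q: prob_space Q by fact
  let ?m = "\<integral>\<^sup>+z'. (\<integral>\<^sup>+w'. f z' w' \<partial>Q) \<partial>P"
  have f1[measurable]: "(\<lambda>z. \<integral>\<^sup>+w. f z w \<partial>Q) \<in> borel_measurable P" by measurable
  have "?m \<le> (\<integral>\<^sup>+z'. 1 \<partial>P)" using 1 by (intro nn_integral_mono) auto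
  then show m: "?m \<le> 1" by (simp add: P.emeasure_space_1)
  show res: "(\<integral>\<^sup>+z'. (1 - (\<integral>\<^sup>+w'. f z' w' \<partial>Q)) \<partial>P) = 1 - ?m"
    using m 1 by (subst nn_integral_diff) (auto simp: P.emeasure_space_1 top_unique intro!: AE_I2)
  show "AE z in P. (1 - (\<integral>\<^sup>+w'. f z w' \<partial>Q)) * ((1 - ?m) / (1 - ?m)) = 1 - (\<integral>\<^sup>+w'. f z w' \<partial>Q)"
  proof (cases "1 - ?m = 0")
    case True
    then have "(\<integral>\<^sup>+z'. (1 - (\<integral>\<^sup>+w'. f z' w' \<partial>Q)) \<partial>P) = 0" by (simp add: res)
    then have "AE z in P. 1 - (\<integral>\<^sup>+w'. f z w' \<partial>Q) = 0"
      by (subst (asm) nn_integral_0_iff_AE) auto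
    then show ?thesis by eventually_elim simp
  next
    case False
    then have "(1 - ?m) / (1 - ?m) = 1" by (intro ennreal_divide_self le_less_trans[OF diff_le_self_ennreal ennreal_one_less_top])
    then show ?thesis by simp
  qed
qed

lemma completed_density_measurable:
  assumes "prob_space P" "prob_space Q" and f[measurable]: "(\<lambda>(z, w). f z w) \<in> borel_measurable (P \<Otimes>\<^sub>M Q)"
  shows "completed_density P Q f \<in> borel_measurable (P \<Otimes>\<^sub>M Q)"
proof -
  interpret P: prob_space P by fact
  interpret Q: prob_space Q by fact
  show ?thesis unfolding completed_density_def by measurable
qed

lemma completion_couplings:
  assumes PQ: "prob_space P" "prob_space Q" and f[measurable]: "(\<lambda>(z, w). f z w) \<in> borel_measurable (P \<Otimes>\<^sub>M Q)"
    and 1: "\<And>z. z \<in> space P \<Longrightarrow> (\<integral>\<^sup>+w. f z w \<partial>Q) \<le> 1" and 2: "\<And>w. w \<in> space Q \<Longrightarrow> (\<integral>\<^sup>+z. f z w \<partial>P) \<le> 1"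
  shows "completion P Q f \<in> couplings P Q"
  unfolding completion_def
proof (rule density_couplings[OF PQ completed_density_measurable[OF PQ f]])
  interpret P: prob_space P by fact
  interpret Q: prob_space Q by fact
  interpret PQ: pair_sigma_finite P Q ..
  let ?m = "\<integral>\<^sup>+z. (\<integral>\<^sup>+w. f z w \<partial>Q) \<partial>P"
  have f': "(\<lambda>(w, z). f z w) \<in> borel_measurable (Q \<Otimes>\<^sub>M P)" by measurable
  have m: "(\<integral>\<^sup>+w. (\<integral>\<^sup>+z. f z w \<partial>P) \<partial>Q) = ?m"
    by (rule PQ.Fubini') simp
  have "\<forall>z\<in>space P. (\<integral>\<^sup>+w. f z w \<partial>Q) \<le> 1" "\<forall>w\<in>space Q. (\<integral>\<^sup>+z. f z w \<partial>P) \<le> 1" using 1 2 by auto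
  note r1 = completion_residual[OF PQ f this(1)] and r2 = completion_residual[OF PQ(2,1) f' this(2), unfolded m]
  show "AE z in P. (\<integral>\<^sup>+w. completed_density P Q f (z, w) \<partial>Q) = 1"
  proof (rule AE_mp[OF r1(1)], intro AE_I2 impI)
    fix z assume z[measurable]: "z \<in> space P" and elim: "(1 - (\<integral>\<^sup>+w. f z w \<partial>Q)) * ((1 - ?m) / (1 - ?m)) = 1 - (\<integral>\<^sup>+w. f z w \<partial>Q)"
    have "(\<integral>\<^sup>+w. completed_density P Q f (z, w) \<partial>Q)
      = (\<integral>\<^sup>+w. f z w \<partial>Q) + (1 - (\<integral>\<^sup>+w. f z w \<partial>Q)) * ((\<integral>\<^sup>+w. 1 - (\<integral>\<^sup>+z. f z w \<partial>P) \<partial>Q) / (1 - ?m))"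
      unfolding completed_density_def
      by (simp add: nn_integral_add nn_integral_cmult nn_integral_divide flip: ennreal_times_divide)
    also have "\<dots> = 1" using elim 1[OF z] by (simp add: r2(2))
    finally show "(\<integral>\<^sup>+w. completed_density P Q f (z, w) \<partial>Q) = 1" .
  qed
  show "AE w in Q. (\<integral>\<^sup>+z. completed_density P Q f (z, w) \<partial>P) = 1"
  proof (rule AE_mp[OF r2(1)], intro AE_I2 impI)
    fix w assume w[measurable]: "w \<in> space Q" and elim: "(1 - (\<integral>\<^sup>+z. f z w \<partial>P)) * ((1 - ?m) / (1 - ?m)) = 1 - (\<integral>\<^sup>+z. f z w \<partial>P)"
    have "(\<integral>\<^sup>+z. completed_density P Q f (z, w) \<partial>P)
      = (\<integral>\<^sup>+z. f z w \<partial>P) + (1 - (\<integral>\<^sup>+z. f z w \<partial>P)) * ((\<integral>\<^sup>+z. 1 - (\<integral>\<^sup>+w. f z w \<partial>Q) \<partial>P) / (1 - ?m))"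
      unfolding completed_density_def
      by (simp add: nn_integral_add nn_integral_cmult nn_integral_divide
          mult.commute[of "1 - (\<integral>\<^sup>+w. f _ w \<partial>Q)"] flip: ennreal_times_divide)
    also have "\<dots> = 1" using elim 2[OF w] by (simp add: r1(2))
    finally show "(\<integral>\<^sup>+z. completed_density P Q f (z, w) \<partial>P) = 1" .
  qed
qed

text \<open>Separates the prescribed density from the residual product. An upper bound for the cost
  has to estimate both parts, a lower bound for the probability of agreement keeps the first one
  alone.\<close>

lemma nn_integral_completion:
  assumes PQ: "prob_space P" "prob_space Q" and f[measurable]: "(\<lambda>(z, w). f z w) \<in> borel_measurable (P \<Otimes>\<^sub>M Q)"
    and \<phi>[measurable]: "(\<lambda>(z, w). \<phi> z w) \<in> borel_measurable (P \<Otimes>\<^sub>M Q)"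
  shows "(\<integral>\<^sup>+(z, w). \<phi> z w \<partial>completion P Q f) =
     (\<integral>\<^sup>+z. (\<integral>\<^sup>+w. f z w * \<phi> z w \<partial>Q) \<partial>P) +
     (\<integral>\<^sup>+z. (\<integral>\<^sup>+w. (1 - (\<integral>\<^sup>+w'. f z w' \<partial>Q)) * (1 - (\<integral>\<^sup>+z'. f z' w \<partial>P)) * \<phi> z w \<partial>Q) \<partial>P)
       / (1 - (\<integral>\<^sup>+z'. (\<integral>\<^sup>+w'. f z' w' \<partial>Q) \<partial>P))"
proof -
  interpret P: prob_space P by fact
  interpret Q: prob_space Q by fact
  let ?m = "\<integral>\<^sup>+z'. (\<integral>\<^sup>+w'. f z' w' \<partial>Q) \<partial>P"
  have "(\<integral>\<^sup>+(z, w). \<phi> z w \<partial>completion P Q f) = (\<integral>\<^sup>+z. (\<integral>\<^sup>+w. completed_density P Q f (z, w) * \<phi> z w \<partial>Q) \<partial>P)"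
    using completed_density_measurable[OF PQ f]
    unfolding completion_def by (simp add: nn_integral_density split_beta' flip: Q.nn_integral_fst)
  also have "\<dots> = (\<integral>\<^sup>+z. (\<integral>\<^sup>+w. f z w * \<phi> z w + (1 - (\<integral>\<^sup>+w'. f z w' \<partial>Q)) * (1 - (\<integral>\<^sup>+z'. f z' w \<partial>P)) * \<phi> z w / (1 - ?m) \<partial>Q) \<partial>P)"
    unfolding completed_density_def
    by (simp add: distrib_left distrib_right ennreal_divide_times divide_ennreal_def mult_ac)
  also have "\<dots> = (\<integral>\<^sup>+z. (\<integral>\<^sup>+w. f z w * \<phi> z w \<partial>Q) + (\<integral>\<^sup>+w. (1 - (\<integral>\<^sup>+w'. f z w' \<partial>Q)) * (1 - (\<integral>\<^sup>+z'. f z' w \<partial>P)) * \<phi> z w \<partial>Q) / (1 - ?m) \<partial>P)"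
    by (intro nn_integral_cong) (simp add: nn_integral_add nn_integral_divide)
  also have "\<dots> = (\<integral>\<^sup>+z. (\<integral>\<^sup>+w. f z w * \<phi> z w \<partial>Q) \<partial>P) +
     (\<integral>\<^sup>+z. (\<integral>\<^sup>+w. (1 - (\<integral>\<^sup>+w'. f z w' \<partial>Q)) * (1 - (\<integral>\<^sup>+z'. f z' w \<partial>P)) * \<phi> z w \<partial>Q) \<partial>P) / (1 - ?m)"
    by (simp add: nn_integral_add nn_integral_divide)
  finally show ?thesis .
qed

text \<open>The reason for the explicit formula: the completed density consists of integrals against
  the kernels \<open>P\<close> and \<open>Q\<close>, hence is jointly measurable in \<open>s\<close>
  and the points, and so the couplings for the different \<open>s\<close> form a kernel.\<close>

lemma measurable_completion:
  assumes P[measurable]: "P \<in> S \<rightarrow>\<^sub>M prob_algebra MP" and Q[measurable]: "Q \<in> S \<rightarrow>\<^sub>M prob_algebra MQ"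
    and f[measurable]: "(\<lambda>(s, z, w). f s z w) \<in> borel_measurable (S \<Otimes>\<^sub>M MP \<Otimes>\<^sub>M MQ)"
    and 1: "\<And>s z. s \<in> space S \<Longrightarrow> z \<in> space MP \<Longrightarrow> (\<integral>\<^sup>+w. f s z w \<partial>Q s) \<le> 1"
    and 2: "\<And>s w. s \<in> space S \<Longrightarrow> w \<in> space MQ \<Longrightarrow> (\<integral>\<^sup>+z. f s z w \<partial>P s) \<le> 1"
  shows "(\<lambda>s. completion (P s) (Q s) (f s)) \<in> S \<rightarrow>\<^sub>M prob_algebra (MP \<Otimes>\<^sub>M MQ)"
    and "s \<in> space S \<Longrightarrow> completion (P s) (Q s) (f s) \<in> couplings (P s) (Q s)"
proof -
  have fs: "(\<lambda>(z, w). f s z w) \<in> borel_measurable (P s \<Otimes>\<^sub>M Q s)" if s[measurable]: "s \<in> space S" for s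
    by (subst measurable_cong_sets[OF sets_pair_measure_cong[OF kernel_sets[OF P s] kernel_sets[OF Q s]] refl]) measurable
  show c: "completion (P s) (Q s) (f s) \<in> couplings (P s) (Q s)" if s: "s \<in> space S" for s
    using s by (intro completion_couplings fs kernel_prob[OF P] kernel_prob[OF Q])
      (auto simp: kernel_space[OF P] kernel_space[OF Q] intro: 1 2)
  have [measurable (raw)]: "(\<lambda>x. f (a x) (b x) (c x)) \<in> borel_measurable N"
    if "a \<in> N \<rightarrow>\<^sub>M S" "b \<in> N \<rightarrow>\<^sub>M MP" "c \<in> N \<rightarrow>\<^sub>M MQ" for a b c and N :: "'n measure"
    using measurable_compose[OF measurable_Pair[OF that(1) measurable_Pair[OF that(2,3)]] f] by simp
  have [measurable]: "(\<lambda>(s, z). \<integral>\<^sup>+w. f s z w \<partial>Q s) \<in> borel_measurable (S \<Otimes>\<^sub>M MP)"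
    "(\<lambda>(s, w). \<integral>\<^sup>+z. f s z w \<partial>P s) \<in> borel_measurable (S \<Otimes>\<^sub>M MQ)"
    "(\<lambda>s. \<integral>\<^sup>+z. (\<integral>\<^sup>+w. f s z w \<partial>Q s) \<partial>P s) \<in> borel_measurable S"
    by measurable
  have h[measurable]: "(\<lambda>(s, y). completed_density (P s) (Q s) (f s) y) \<in> borel_measurable (S \<Otimes>\<^sub>M MP \<Otimes>\<^sub>M MQ)"
    unfolding completed_density_def by measurable
  show "(\<lambda>s. completion (P s) (Q s) (f s)) \<in> S \<rightarrow>\<^sub>M prob_algebra (MP \<Otimes>\<^sub>M MQ)"
  proof (rule measurable_prob_algebraI)
    show pr: "prob_space (completion (P s) (Q s) (f s))" if "s \<in> space S" for s
      using couplings_D(1)[OF c[OF that]] .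
    have se: "sets (P s \<Otimes>\<^sub>M Q s) = sets (MP \<Otimes>\<^sub>M MQ)" if "s \<in> space S" for s
      using that by (intro sets_pair_measure_cong kernel_sets[OF P] kernel_sets[OF Q])
    show "(\<lambda>s. completion (P s) (Q s) (f s)) \<in> S \<rightarrow>\<^sub>M subprob_algebra (MP \<Otimes>\<^sub>M MQ)"
    proof (rule measurable_subprob_algebra)
      show "subprob_space (completion (P s) (Q s) (f s))" if "s \<in> space S" for s
        using pr[OF that] by (rule prob_space_imp_subprob_space)
      show "sets (completion (P s) (Q s) (f s)) = sets (MP \<Otimes>\<^sub>M MQ)" if "s \<in> space S" for s
        using se[OF that] by (simp add: completion_def)
      fix A assume [measurable]: "A \<in> sets (MP \<Otimes>\<^sub>M MQ)"
      have "(\<lambda>s. \<integral>\<^sup>+y. completed_density (P s) (Q s) (f s) y * indicator A y \<partial>(P s \<Otimes>\<^sub>M Q s)) \<in> borel_measurable S"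
        by measurable
      moreover have "emeasure (completion (P s) (Q s) (f s)) A
          = (\<integral>\<^sup>+y. completed_density (P s) (Q s) (f s) y * indicator A y \<partial>(P s \<Otimes>\<^sub>M Q s))" if s: "s \<in> space S" for s
        unfolding completion_def using se[OF s] completed_density_measurable[OF kernel_prob[OF P s] kernel_prob[OF Q s] fs[OF s]]
        by (subst emeasure_density) auto
      ultimately show "(\<lambda>s. emeasure (completion (P s) (Q s) (f s)) A) \<in> borel_measurable S"
        by (simp cong: measurable_cong)
    qed
  qed
qed

section \<open>Countable quantisation\<close>

text \<open>Fubini with the counting measure on the values of \<open>q\<close>. Measurability of
  \<open>H\<close> is required for each fixed value, which suits families indexed by cells.\<close>

lemma nn_integral_countable_fibres:
  fixes q :: "'a \<Rightarrow> 'i::countable"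
  assumes "sigma_finite_measure M" and q[measurable]: "q \<in> M \<rightarrow>\<^sub>M count_space UNIV"
    and H[measurable]: "\<And>i. H i \<in> borel_measurable M"
  shows "(\<integral>\<^sup>+z. H (q z) z \<partial>M) = (\<integral>\<^sup>+i. (\<integral>\<^sup>+z. H i z * indicator {i} (q z) \<partial>M) \<partial>count_space UNIV)"
proof -
  interpret M: sigma_finite_measure M by fact
  interpret C: sigma_finite_measure "count_space (UNIV :: 'i set)"
    by (rule sigma_finite_measure_count_space)
  interpret pair_sigma_finite M "count_space (UNIV :: 'i set)" ..
  have [measurable]: "(\<lambda>(z, i). H i z * indicator {i} (q z)) \<in> borel_measurable (M \<Otimes>\<^sub>M count_space UNIV)"
    unfolding split_beta'
    by (rule measurable_compose_countable[where f = "\<lambda>i x. H i (fst x) * indicator {i} (q (fst x))"]) measurable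
  have "(\<integral>\<^sup>+i. (\<integral>\<^sup>+z. H i z * indicator {i} (q z) \<partial>M) \<partial>count_space UNIV)
    = (\<integral>\<^sup>+z. (\<integral>\<^sup>+i. H i z * indicator {i} (q z) \<partial>count_space UNIV) \<partial>M)"
    by (rule Fubini') simp
  also have "\<dots> = (\<integral>\<^sup>+z. H (q z) z \<partial>M)"
  proof (rule nn_integral_cong)
    fix z
    have "(\<integral>\<^sup>+i. H i z * indicator {i} (q z) \<partial>count_space UNIV) = (\<integral>\<^sup>+i. H (q z) z * indicator {q z} i \<partial>count_space UNIV)"
      by (intro nn_integral_cong) (auto simp: indicator_def)
    then show "(\<integral>\<^sup>+i. H i z * indicator {i} (q z) \<partial>count_space UNIV) = H (q z) z"
      by (simp add: nn_integral_cmult_indicator)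
  qed
  finally show ?thesis by simp
qed

lemma nn_integral_countable:
  fixes q :: "'a \<Rightarrow> 'i::countable"
  assumes "sigma_finite_measure M" and q[measurable]: "q \<in> M \<rightarrow>\<^sub>M count_space UNIV"
  shows "(\<integral>\<^sup>+z. h (q z) \<partial>M) = (\<integral>\<^sup>+i. h i * emeasure M {z\<in>space M. q z = i} \<partial>count_space UNIV)"
proof -
  have "(\<integral>\<^sup>+z. h i * indicator {i} (q z) \<partial>M) = h i * emeasure M {z\<in>space M. q z = i}" for i
    by (subst nn_integral_indicator[symmetric], measurable, subst nn_integral_cmult[symmetric])
      (auto intro!: nn_integral_cong simp: indicator_def)
  then show ?thesis
    using nn_integral_countable_fibres[OF assms, of "\<lambda>i _. h i"] by simp
qed

text \<open>There are countably many fibres, so the null ones have a null union. Values assigned by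
  default on null cells are therefore almost surely never met.\<close>

lemma AE_fibre_nonnull:
  fixes q :: "'a \<Rightarrow> 'i::countable"
  assumes [measurable]: "q \<in> M \<rightarrow>\<^sub>M count_space UNIV"
  shows "AE z in M. emeasure M {z'\<in>space M. q z' = q z} \<noteq> 0"
proof -
  have "AE z in M. q z = i \<longrightarrow> emeasure M {z'\<in>space M. q z' = i} \<noteq> 0" for i
    by (cases "emeasure M {z'\<in>space M. q z' = i} = 0") (auto intro!: AE_I[where N = "{z'\<in>space M. q z' = i}"])
  then have "AE z in M. \<forall>i. q z = i \<longrightarrow> emeasure M {z'\<in>space M. q z' = i} \<noteq> 0"
    unfolding AE_all_countable by blast
  then show ?thesis by (rule AE_mp) auto
qed

text \<open>The codes are natural numbers, so every function of a cell is measurable;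
  \<open>r\<close> assigns to a code the point that represents its cell.\<close>

definition quantizer :: "('a::euclidean_space \<Rightarrow> nat) \<Rightarrow> (nat \<Rightarrow> 'a) \<Rightarrow> real \<Rightarrow> bool" where
  "quantizer q r \<eta> \<longleftrightarrow> q \<in> borel \<rightarrow>\<^sub>M count_space UNIV \<and> (\<forall>z. dist z (r (q z)) \<le> \<eta>)"

text \<open>All finite tables of rationals \<open>l ! i ! j / (D + 1)\<close> are enumerated, so that a measurable kernel
  can select the first one that is good enough.\<close>

definition table_entry :: "nat \<Rightarrow> nat \<Rightarrow> nat \<Rightarrow> real" where
  "table_entry n i j = (case from_nat n :: nat list list \<times> nat of (l, D) \<Rightarrow>
     if i < length l \<and> j < length (l ! i) then real (l ! i ! j) / real (Suc D) else 0)"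

lemma ex_table_entry:
  assumes "\<And>i j. 0 \<le> g i j"
  shows "\<exists>n. \<forall>i j. table_entry n i j = (if i < N \<and> j < N then real (nat \<lfloor>real (Suc D) * g i j\<rfloor>) / real (Suc D) else 0)"
proof -
  define l where "l = map (\<lambda>i. map (\<lambda>j. nat \<lfloor>real (Suc D) * g i j\<rfloor>) [0..<N]) [0..<N]"
  show ?thesis
    by (intro exI[of _ "to_nat (l, D)"] allI) (auto simp: table_entry_def l_def)
qed

lemma powr_add_le_two_powr:
  fixes x y p :: real
  assumes "0 \<le> x" "0 \<le> y" "0 \<le> p"
  shows "(x + y) powr p \<le> 2 powr p * (x powr p + y powr p)"
proof -
  have "(x + y) powr p \<le> (2 * max x y) powr p" using assms by (intro powr_mono2) auto
  also have "\<dots> = 2 powr p * max x y powr p" using assms by (simp add: powr_mult)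
  also have "max x y powr p \<le> x powr p + y powr p" by (auto simp: max_def)
  finally show ?thesis by simp
qed

lemma dist_powr_le_norm:
  "0 \<le> p \<Longrightarrow> dist z w powr p \<le> 2 powr p * (norm z powr p + norm w powr p)"
  using powr_add_le_two_powr[of "norm z" "norm w" p] powr_mono2[of p "dist z w" "norm z + norm w"]
  by (auto simp: dist_norm norm_triangle_ineq4)

text \<open>The row and column conditions under which the table is the density of a sub-coupling
  with respect to the product of the two laws.\<close>

definition table_valid :: "('a \<Rightarrow> nat) \<Rightarrow> nat \<Rightarrow> 'a measure \<Rightarrow> 'a measure \<Rightarrow> bool" where
  "table_valid q n \<alpha> \<beta> \<longleftrightarrow>
     (\<forall>i. (\<integral>\<^sup>+w. ennreal (table_entry n i (q w)) \<partial>\<beta>) \<le> 1) \<and>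
     (\<forall>j. (\<integral>\<^sup>+z. ennreal (table_entry n (q z) j) \<partial>\<alpha>) \<le> 1)"

text \<open>For an invalid table the density is 0 and the completion is the product measure. Each
  index thus gives a coupling of every pair of laws, and near optimality becomes a matter of
  choosing the index.\<close>

definition table_coupling :: "('a \<Rightarrow> nat) \<Rightarrow> nat \<Rightarrow> 'a measure \<Rightarrow> 'a measure \<Rightarrow> ('a \<times> 'a) measure" where
  "table_coupling q n \<alpha> \<beta> = completion \<alpha> \<beta>
     (\<lambda>z w. if table_valid q n \<alpha> \<beta> then ennreal (table_entry n (q z) (q w)) else 0)"

text \<open>The quantised coupling has density \<open>g\<close> with respect to the product; rounding \<open>g\<close> down to a
  finite rational table loses a residual whose moments vanish in the limit.\<close>

lemma table_coupling_near_optimal: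
  fixes \<alpha> \<beta> :: "'a::euclidean_space measure"
  assumes p: "1 \<le> p" and quant: "quantizer q r \<eta>"
    and \<alpha>: "prob_space \<alpha>" "sets \<alpha> = sets borel" and \<beta>: "prob_space \<beta>" "sets \<beta> = sets borel"
    and m\<alpha>: "(\<integral>\<^sup>+z. ennreal (norm z powr p) \<partial>\<alpha>) < \<infinity>" and m\<beta>: "(\<integral>\<^sup>+z. ennreal (norm z powr p) \<partial>\<beta>) < \<infinity>"
    and \<pi>: "\<pi> \<in> couplings \<alpha> \<beta>" and cost: "(\<integral>\<^sup>+\<omega>. ennreal (dist (fst \<omega>) (snd \<omega>) powr p) \<partial>\<pi>) \<le> ennreal (a powr p)"
    and "0 \<le> a" "0 < \<tau>"
  shows "\<exists>n. (\<integral>\<^sup>+\<omega>. ennreal (dist (fst \<omega>) (snd \<omega>) powr p) \<partial>table_coupling q n \<alpha> \<beta>) \<le> ennreal ((a + 4 * \<eta>) powr p + \<tau>)"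
proof -
  interpret \<alpha>: prob_space \<alpha> by fact
  interpret \<beta>: prob_space \<beta> by fact
  interpret \<pi>: prob_space \<pi> by (rule couplings_D(1)[OF \<pi>])
  interpret \<alpha>\<beta>: pair_sigma_finite \<alpha> \<beta> ..
  note [measurable_cong] = \<alpha>(2) \<beta>(2)
  have q[measurable]: "q \<in> borel \<rightarrow>\<^sub>M count_space UNIV" and qr: "dist z (r (q z)) \<le> \<eta>" for z
    using quant by (auto simp: quantizer_def)
  have "0 \<le> \<eta>" using qr[of undefined] zero_le_dist order_trans by blast
  have sets_\<pi>[measurable_cong]: "sets \<pi> = sets (borel \<Otimes>\<^sub>M borel)"
    using couplings_D(2)[OF \<pi>] by (simp add: \<alpha>(2) \<beta>(2) cong: sets_pair_measure_cong)
  have space_\<alpha>\<beta>[simp]: "space \<alpha> = UNIV" "space \<beta> = UNIV" "space \<pi> = UNIV"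
    using sets_eq_imp_space_eq[OF \<alpha>(2)] sets_eq_imp_space_eq[OF \<beta>(2)] sets_eq_imp_space_eq[OF sets_\<pi>]
    by (simp_all add: space_pair_measure)
  have qi[measurable]: "(\<lambda>z. indicator {i} (q z) :: ennreal) \<in> borel_measurable borel" for i
    by (rule measurable_compose[OF q]) simp
  have qi1[measurable]: "(\<lambda>\<omega>. indicator {i} (q (fst \<omega>)) :: ennreal) \<in> borel_measurable (borel \<Otimes>\<^sub>M borel)"
    and qi2[measurable]: "(\<lambda>\<omega>. indicator {i} (q (snd \<omega>)) :: ennreal) \<in> borel_measurable (borel \<Otimes>\<^sub>M borel)" for i
    by (rule measurable_compose[OF _ qi], simp)+
  define A where "A i = emeasure \<alpha> {z. q z = i}" for i
  define B where "B j = emeasure \<beta> {w. q w = j}" for j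
  define P where "P i j = emeasure \<pi> {\<omega>\<in>space \<pi>. q (fst \<omega>) = i \<and> q (snd \<omega>) = j}" for i j
  have A_eq: "A i = (\<integral>\<^sup>+\<omega>. indicator {i} (q (fst \<omega>)) \<partial>\<pi>)" for i
  proof -
    have "(\<integral>\<^sup>+\<omega>. indicator {i} (q (fst \<omega>)) \<partial>\<pi>) = (\<integral>\<^sup>+z. indicator {i} (q z) \<partial>\<alpha>)"
      by (rule couplings_nn_integral_fst[OF \<pi>]) measurable
    also have "\<dots> = (\<integral>\<^sup>+z. indicator {z. q z = i} z \<partial>\<alpha>)"
      by (intro nn_integral_cong) (auto simp: indicator_def)
    also have "\<dots> = A i" unfolding A_def by (rule nn_integral_indicator) measurable
    finally show ?thesis by simp
  qed
  have B_eq: "B j = (\<integral>\<^sup>+\<omega>. indicator {j} (q (snd \<omega>)) \<partial>\<pi>)" for j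
  proof -
    have "(\<integral>\<^sup>+\<omega>. indicator {j} (q (snd \<omega>)) \<partial>\<pi>) = (\<integral>\<^sup>+z. indicator {j} (q z) \<partial>\<beta>)"
      by (rule couplings_nn_integral_snd[OF \<pi>]) measurable
    also have "\<dots> = (\<integral>\<^sup>+z. indicator {z. q z = j} z \<partial>\<beta>)"
      by (intro nn_integral_cong) (auto simp: indicator_def)
    also have "\<dots> = B j" unfolding B_def by (rule nn_integral_indicator) measurable
    finally show ?thesis by simp
  qed
  have P_eq: "P i j = (\<integral>\<^sup>+\<omega>. indicator {i} (q (fst \<omega>)) * indicator {j} (q (snd \<omega>)) \<partial>\<pi>)" for i j
  proof -
    have "P i j = (\<integral>\<^sup>+\<omega>. indicator {\<omega>\<in>space \<pi>. q (fst \<omega>) = i \<and> q (snd \<omega>) = j} \<omega> \<partial>\<pi>)"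
      unfolding P_def by (rule nn_integral_indicator[symmetric]) measurable
    also have "\<dots> = (\<integral>\<^sup>+\<omega>. indicator {i} (q (fst \<omega>)) * indicator {j} (q (snd \<omega>)) \<partial>\<pi>)"
      by (intro nn_integral_cong) (auto simp: indicator_def)
    finally show ?thesis .
  qed
  have P_row: "(\<integral>\<^sup>+j. P i j \<partial>count_space UNIV) = A i" for i
    unfolding A_eq P_eq
    by (rule nn_integral_countable_fibres[symmetric, where H = "\<lambda>j \<omega>. indicator {i} (q (fst \<omega>))" and q = "\<lambda>\<omega>. q (snd \<omega>)"])
      (auto intro: \<pi>.sigma_finite_measure_axioms)
  have P_col: "(\<integral>\<^sup>+i. P i j \<partial>count_space UNIV) = B j" for j
    unfolding B_eq P_eq
    by (subst mult.commute, rule nn_integral_countable_fibres[symmetric, where H = "\<lambda>i \<omega>. indicator {j} (q (snd \<omega>))" and q = "\<lambda>\<omega>. q (fst \<omega>)"])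
      (auto intro: \<pi>.sigma_finite_measure_axioms)
  have P_le: "P i j \<le> A i" "P i j \<le> B j" for i j
    unfolding P_eq A_eq B_eq by (auto intro!: nn_integral_mono simp: indicator_def)
  have AB_fin: "A i < top" "B j < top" for i j
    unfolding A_def B_def using \<alpha>.emeasure_finite \<beta>.emeasure_finite by (simp_all add: less_top[symmetric])
  define g where "g i j = P i j / (A i * B j)" for i j
  \<comment> \<open>Where a cell mass vanishes, \<open>P\<close> vanishes as well, so the value
    \<open>0 / 0 = 0\<close> of the quotient is the right one.\<close>
  have g_mult: "g i j * A i * B j = P i j" for i j
  proof (cases "A i * B j = 0")
    case True
    then have "P i j = 0" using P_le[of i j] by auto
    then show ?thesis by (simp add: g_def)
  next
    case False
    have "g i j * A i * B j = P i j / (A i * B j) * (A i * B j)" by (simp only: g_def mult.assoc)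
    also have "\<dots> = P i j * ((A i * B j) / (A i * B j))" by (rule ennreal_divide_times)
    also have "\<dots> = P i j" using False AB_fin(1)[of i] AB_fin(2)[of j]
      by (subst ennreal_divide_self) (auto simp: ennreal_mult_less_top)
    finally show ?thesis .
  qed
  have g_fin: "g i j < top" for i j
  proof (cases "A i * B j = 0")
    case True
    then have "P i j = 0" using P_le[of i j] by auto
    then show ?thesis by (simp add: g_def)
  next
    case False
    then show ?thesis using le_less_trans[OF P_le(1)[of i j] AB_fin(1)]
      by (simp add: g_def ennreal_divide_eq_top_iff less_top[symmetric])
  qed
  have g_row: "(\<integral>\<^sup>+w. g i (q w) \<partial>\<beta>) = (if A i = 0 then 0 else 1)" for i
  proof -
    have "(\<integral>\<^sup>+w. g i (q w) \<partial>\<beta>) = (\<integral>\<^sup>+j. g i j * B j \<partial>count_space UNIV)"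
      unfolding B_def using nn_integral_countable[of \<beta> q "g i"] by (simp add: \<beta>.sigma_finite_measure_axioms)
    also have "\<dots> = (if A i = 0 then 0 else 1)"
    proof (cases "A i = 0")
      case True
      then have "P i j = 0" for j using P_le(1)[of i j] by auto
      then show ?thesis using True by (simp add: g_def)
    next
      case False
      have "(\<integral>\<^sup>+j. g i j * B j \<partial>count_space UNIV) * A i = (\<integral>\<^sup>+j. P i j \<partial>count_space UNIV)"
        by (subst nn_integral_multc[symmetric]) (auto simp: g_mult[symmetric] mult_ac intro!: nn_integral_cong)
      then have "(\<integral>\<^sup>+j. g i j * B j \<partial>count_space UNIV) * A i = 1 * A i" by (simp add: P_row)
      then show ?thesis using False AB_fin(1)[of i] mult_divide_eq_ennreal[of "A i"] by (metis top.not_eq_extremum)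
    qed
    finally show ?thesis .
  qed
  have g_col: "(\<integral>\<^sup>+z. g (q z) j \<partial>\<alpha>) = (if B j = 0 then 0 else 1)" for j
  proof -
    have "(\<integral>\<^sup>+z. g (q z) j \<partial>\<alpha>) = (\<integral>\<^sup>+i. g i j * A i \<partial>count_space UNIV)"
      unfolding A_def using nn_integral_countable[of \<alpha> q "\<lambda>i. g i j"] by (simp add: \<alpha>.sigma_finite_measure_axioms)
    also have "\<dots> = (if B j = 0 then 0 else 1)"
    proof (cases "B j = 0")
      case True
      then have "P i j = 0" for i using P_le(2)[of i j] by auto
      then show ?thesis using True by (simp add: g_def)
    next
      case False
      have "(\<integral>\<^sup>+i. g i j * A i \<partial>count_space UNIV) * B j = (\<integral>\<^sup>+i. P i j \<partial>count_space UNIV)"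
        by (subst nn_integral_multc[symmetric]) (auto simp: g_mult[symmetric] mult_ac intro!: nn_integral_cong)
      then have "(\<integral>\<^sup>+i. g i j * A i \<partial>count_space UNIV) * B j = 1 * B j" by (simp add: P_col)
      then show ?thesis using False AB_fin(2)[of j] mult_divide_eq_ennreal[of "B j"] by (metis top.not_eq_extremum)
    qed
    finally show ?thesis .
  qed
  have AE_A: "AE z in \<alpha>. A (q z) \<noteq> 0"
    using AE_fibre_nonnull[of q \<alpha>] by (simp add: A_def)
  have AE_B: "AE w in \<beta>. B (q w) \<noteq> 0"
    using AE_fibre_nonnull[of q \<beta>] by (simp add: B_def)
  let ?\<phi> = "\<lambda>z w. ennreal (dist z w powr p)"
  \<comment> \<open>Within each pair of cells, \<open>g\<close> redistributes the mass of \<pi> as a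
    product. Going from points to representatives costs \<open>2 * \<eta>\<close>, and so does the
    way back, which is the origin of \<open>4 * \<eta>\<close>.\<close>
  have g_cost: "(\<integral>\<^sup>+z. (\<integral>\<^sup>+w. g (q z) (q w) * ?\<phi> z w \<partial>\<beta>) \<partial>\<alpha>) \<le> ennreal ((a + 4 * \<eta>) powr p)"
  proof -
    define \<psi> where "\<psi> i j = ennreal ((dist (r i) (r j) + 2 * \<eta>) powr p)" for i j
    have "?\<phi> z w \<le> \<psi> (q z) (q w)" for z w
    proof -
      have "dist z w \<le> dist (r (q z)) (r (q w)) + 2 * \<eta>"
        using dist_triangle[of z w "r (q z)"] dist_triangle[of "r (q z)" w "r (q w)"] qr[of z] qr[of w]
        by (simp add: dist_commute)
      then show ?thesis unfolding \<psi>_def using p by (intro ennreal_leI powr_mono2) auto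
    qed
    then have "(\<integral>\<^sup>+z. (\<integral>\<^sup>+w. g (q z) (q w) * ?\<phi> z w \<partial>\<beta>) \<partial>\<alpha>) \<le> (\<integral>\<^sup>+z. (\<integral>\<^sup>+w. g (q z) (q w) * \<psi> (q z) (q w) \<partial>\<beta>) \<partial>\<alpha>)"
      by (intro nn_integral_mono mult_left_mono) auto
    also have "\<dots> = (\<integral>\<^sup>+z. (\<integral>\<^sup>+j. g (q z) j * \<psi> (q z) j * B j \<partial>count_space UNIV) \<partial>\<alpha>)"
      unfolding B_def
      using nn_integral_countable[of \<beta> q "\<lambda>j. g (q z) j * \<psi> (q z) j" for z] by (simp add: \<beta>.sigma_finite_measure_axioms)
    also have "\<dots> = (\<integral>\<^sup>+i. (\<integral>\<^sup>+j. g i j * \<psi> i j * B j \<partial>count_space UNIV) * A i \<partial>count_space UNIV)"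
      unfolding A_def
      using nn_integral_countable[of \<alpha> q "\<lambda>i. \<integral>\<^sup>+j. g i j * \<psi> i j * B j \<partial>count_space UNIV"] by (simp add: \<alpha>.sigma_finite_measure_axioms)
    also have "\<dots> = (\<integral>\<^sup>+i. (\<integral>\<^sup>+j. P i j * \<psi> i j \<partial>count_space UNIV) \<partial>count_space UNIV)"
      by (intro nn_integral_cong, subst nn_integral_multc[symmetric]) (auto simp: g_mult[symmetric] mult_ac intro!: nn_integral_cong)
    also have "\<dots> = (\<integral>\<^sup>+i. (\<integral>\<^sup>+\<omega>. \<psi> i (q (snd \<omega>)) * indicator {i} (q (fst \<omega>)) \<partial>\<pi>) \<partial>count_space UNIV)"
    proof (rule nn_integral_cong)
      fix i
      have "(\<integral>\<^sup>+\<omega>. \<psi> i (q (snd \<omega>)) * indicator {i} (q (fst \<omega>)) \<partial>\<pi>)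
        = (\<integral>\<^sup>+j. (\<integral>\<^sup>+\<omega>. \<psi> i j * indicator {i} (q (fst \<omega>)) * indicator {j} (q (snd \<omega>)) \<partial>\<pi>) \<partial>count_space UNIV)"
        by (rule nn_integral_countable_fibres[where H = "\<lambda>j \<omega>. \<psi> i j * indicator {i} (q (fst \<omega>))" and q = "\<lambda>\<omega>. q (snd \<omega>)"])
          (auto intro: \<pi>.sigma_finite_measure_axioms)
      also have "\<dots> = (\<integral>\<^sup>+j. P i j * \<psi> i j \<partial>count_space UNIV)"
        unfolding P_eq
        by (intro nn_integral_cong, subst nn_integral_multc[symmetric]) (auto simp: mult_ac intro!: nn_integral_cong)
      finally show "(\<integral>\<^sup>+j. P i j * \<psi> i j \<partial>count_space UNIV) = (\<integral>\<^sup>+\<omega>. \<psi> i (q (snd \<omega>)) * indicator {i} (q (fst \<omega>)) \<partial>\<pi>)"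
        by simp
    qed
    also have "\<dots> = (\<integral>\<^sup>+\<omega>. \<psi> (q (fst \<omega>)) (q (snd \<omega>)) \<partial>\<pi>)"
      by (rule nn_integral_countable_fibres[symmetric, where H = "\<lambda>i \<omega>. \<psi> i (q (snd \<omega>))" and q = "\<lambda>\<omega>. q (fst \<omega>)"])
        (auto intro: \<pi>.sigma_finite_measure_axioms)
    also have "\<dots> \<le> (\<integral>\<^sup>+\<omega>. ennreal ((dist (fst \<omega>) (snd \<omega>) + 4 * \<eta>) powr p) \<partial>\<pi>)"
    proof (rule nn_integral_mono)
      fix \<omega> :: "'a \<times> 'a"
      have "dist (r (q (fst \<omega>))) (r (q (snd \<omega>))) \<le> dist (fst \<omega>) (snd \<omega>) + 2 * \<eta>"
        using dist_triangle[of "r (q (fst \<omega>))" "r (q (snd \<omega>))" "fst \<omega>"] dist_triangle[of "fst \<omega>" "r (q (snd \<omega>))" "snd \<omega>"]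
          qr[of "fst \<omega>"] qr[of "snd \<omega>"] by (simp add: dist_commute)
      then show "\<psi> (q (fst \<omega>)) (q (snd \<omega>)) \<le> ennreal ((dist (fst \<omega>) (snd \<omega>) + 4 * \<eta>) powr p)"
        unfolding \<psi>_def using p \<open>0 \<le> \<eta>\<close> by (intro ennreal_leI powr_mono2) auto
    qed
    also have "\<dots> \<le> ennreal ((a + 4 * \<eta>) powr p)"
      using cost \<open>0 \<le> \<eta>\<close> \<open>0 \<le> a\<close> by (intro minkowski_nn_integral p) (auto simp: \<pi>.emeasure_space_1[simplified])
    finally show ?thesis .
  qed
  \<comment> \<open>Truncation to the first \<open>N\<close> codes and rounding down to multiples of
    \<open>1 / (N + 1)\<close>. Staying below \<open>g\<close> keeps the table valid, and it
    converges to \<open>g\<close> pointwise.\<close>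
  define c where "c N i j = (if i < N \<and> j < N then real (nat \<lfloor>real (Suc N) * enn2real (g i j)\<rfloor>) / real (Suc N) else 0)" for N i j
  have c_le: "ennreal (c N i j) \<le> g i j" for N i j
  proof -
    have "c N i j \<le> enn2real (g i j)"
      unfolding c_def by (auto simp: divide_le_eq mult.commute of_nat_floor)
    then show ?thesis using g_fin[of i j] by (metis ennreal_enn2real ennreal_leI)
  qed
  have c_lim: "(\<lambda>N. ennreal (c N i j)) \<longlonglongrightarrow> g i j" for i j
  proof -
    let ?x = "enn2real (g i j)"
    have "(\<lambda>N. c N i j) \<longlonglongrightarrow> ?x"
    proof (rule real_tendsto_sandwich)
      show "\<forall>\<^sub>F N in sequentially. c N i j \<le> ?x"
        by (auto simp: c_def divide_le_eq mult.commute of_nat_floor)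
      show "\<forall>\<^sub>F N in sequentially. ?x - 1 / real (Suc N) \<le> c N i j"
        using eventually_gt_at_top[of "max i j"]
      proof eventually_elim
        case (elim N)
        have "real (Suc N) * ?x - 1 \<le> real (nat \<lfloor>real (Suc N) * ?x\<rfloor>)" by linarith
        then have "(real (Suc N) * ?x - 1) / real (Suc N) \<le> real (nat \<lfloor>real (Suc N) * ?x\<rfloor>) / real (Suc N)"
          by (intro divide_right_mono) auto
        then show ?case using elim by (simp add: c_def diff_divide_distrib)
      qed
      show "(\<lambda>N. ?x - 1 / real (Suc N)) \<longlonglongrightarrow> ?x"
        using tendsto_diff[OF tendsto_const[of ?x] LIMSEQ_Suc[OF lim_1_over_n]] by simp
    qed simp
    then have "(\<lambda>N. ennreal (c N i j)) \<longlonglongrightarrow> ennreal ?x" by (rule tendsto_ennrealI)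
    then show ?thesis using g_fin[of i j] by simp
  qed
  define f1 where "f1 N i = (\<integral>\<^sup>+w. ennreal (c N i (q w)) \<partial>\<beta>)" for N i
  define f2 where "f2 N j = (\<integral>\<^sup>+z. ennreal (c N (q z) j) \<partial>\<alpha>)" for N j
  have f1_le: "f1 N i \<le> 1" and f2_le: "f2 N j \<le> 1" for N i j
  proof -
    have "f1 N i \<le> (\<integral>\<^sup>+w. g i (q w) \<partial>\<beta>)" unfolding f1_def by (intro nn_integral_mono c_le)
    then show "f1 N i \<le> 1" by (auto simp: g_row intro: order_trans split: if_splits)
    have "f2 N j \<le> (\<integral>\<^sup>+z. g (q z) j \<partial>\<alpha>)" unfolding f2_def by (intro nn_integral_mono c_le)
    then show "f2 N j \<le> 1" by (auto simp: g_col intro: order_trans split: if_splits)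
  qed
  have f1_lim: "(\<lambda>N. f1 N i) \<longlonglongrightarrow> 1" if "A i \<noteq> 0" for i
  proof -
    have "(\<lambda>N. f1 N i) \<longlonglongrightarrow> (\<integral>\<^sup>+w. g i (q w) \<partial>\<beta>)"
      unfolding f1_def
      by (rule nn_integral_dominated_convergence[where w = "\<lambda>w. g i (q w)"]) (auto simp: g_row c_le c_lim)
    then show ?thesis using that by (simp add: g_row)
  qed
  have f2_lim: "(\<lambda>N. f2 N j) \<longlonglongrightarrow> 1" if "B j \<noteq> 0" for j
  proof -
    have "(\<lambda>N. f2 N j) \<longlonglongrightarrow> (\<integral>\<^sup>+z. g (q z) j \<partial>\<alpha>)"
      unfolding f2_def
      by (rule nn_integral_dominated_convergence[where w = "\<lambda>z. g (q z) j"]) (auto simp: g_col c_le c_lim)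
    then show ?thesis using that by (simp add: g_col)
  qed
  \<comment> \<open>The \<open>p\<close>-th moments of the mass that the table leaves unmatched. The
    unmatched fractions tend to 0 on non-null cells, and the moments of the marginals
    dominate.\<close>
  define R1 where "R1 N = (\<integral>\<^sup>+z. (1 - f1 N (q z)) * ennreal (norm z powr p) \<partial>\<alpha>)" for N
  define R2 where "R2 N = (\<integral>\<^sup>+w. (1 - f2 N (q w)) * ennreal (norm w powr p) \<partial>\<beta>)" for N
  have sub1: "(1 - x) * y \<le> y" for x y :: ennreal
    using mult_right_mono[OF diff_le_self_ennreal[of 1 x], of y] by simp
  have "R1 \<longlonglongrightarrow> (\<integral>\<^sup>+z. 0 \<partial>\<alpha>)"
    unfolding R1_def
  proof (rule nn_integral_dominated_convergence[where w = "\<lambda>z. ennreal (norm z powr p)"])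
    show "AE z in \<alpha>. (\<lambda>N. (1 - f1 N (q z)) * ennreal (norm z powr p)) \<longlonglongrightarrow> 0"
      using AE_A
    proof eventually_elim
      case (elim z)
      have "(\<lambda>N. (1 - f1 N (q z)) * ennreal (norm z powr p)) \<longlonglongrightarrow> (1 - 1) * ennreal (norm z powr p)"
        by (intro tendsto_mult_ennreal tendsto_diff_ennreal f1_lim elim) auto
      then show ?case by simp
    qed
  qed (use m\<alpha> in \<open>auto simp: sub1\<close>)
  moreover have "R2 \<longlonglongrightarrow> (\<integral>\<^sup>+z. 0 \<partial>\<beta>)"
    unfolding R2_def
  proof (rule nn_integral_dominated_convergence[where w = "\<lambda>z. ennreal (norm z powr p)"])
    show "AE z in \<beta>. (\<lambda>N. (1 - f2 N (q z)) * ennreal (norm z powr p)) \<longlonglongrightarrow> 0"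
      using AE_B
    proof eventually_elim
      case (elim z)
      have "(\<lambda>N. (1 - f2 N (q z)) * ennreal (norm z powr p)) \<longlonglongrightarrow> (1 - 1) * ennreal (norm z powr p)"
        by (intro tendsto_mult_ennreal tendsto_diff_ennreal f2_lim elim) auto
      then show ?case by simp
    qed
  qed (use m\<beta> in \<open>auto simp: sub1\<close>)
  ultimately have "(\<lambda>N. ennreal (2 powr p) * (R1 N + R2 N)) \<longlonglongrightarrow> ennreal (2 powr p) * (0 + 0)"
    by (intro tendsto_mult_ennreal tendsto_add tendsto_const) auto
  then have "\<forall>\<^sub>F N in sequentially. ennreal (2 powr p) * (R1 N + R2 N) < ennreal \<tau>"
    using \<open>0 < \<tau>\<close> by (intro order_tendstoD) auto
  then obtain N where N: "ennreal (2 powr p) * (R1 N + R2 N) < ennreal \<tau>"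
    using eventually_happens'[OF sequentially_bot] by blast
  obtain n where n: "\<And>i j. table_entry n i j = c N i j"
    using ex_table_entry[of "\<lambda>i j. enn2real (g i j)" N N] unfolding c_def by auto
  have valid: "table_valid q n \<alpha> \<beta>"
    using f1_le f2_le unfolding table_valid_def n f1_def f2_def by auto
  let ?f = "\<lambda>z w. ennreal (c N (q z) (q w))"
  let ?m = "\<integral>\<^sup>+z. f1 N (q z) \<partial>\<alpha>"
  have fm[measurable]: "(\<lambda>(z, w). ?f z w) \<in> borel_measurable (\<alpha> \<Otimes>\<^sub>M \<beta>)"
    by measurable
  note r1 = completion_residual[OF \<alpha>(1) \<beta>(1) fm, folded f1_def]
  have f': "(\<lambda>(w, z). ?f z w) \<in> borel_measurable (\<beta> \<Otimes>\<^sub>M \<alpha>)" by measurable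
  have m: "(\<integral>\<^sup>+w. f2 N (q w) \<partial>\<beta>) = ?m"
    unfolding f1_def f2_def by (rule \<alpha>\<beta>.Fubini') simp
  note r2 = completion_residual[OF \<beta>(1) \<alpha>(1) f', folded f2_def, unfolded m]
  have quot: "x * (1 - ?m) / (1 - ?m) \<le> x" for x
  proof (cases "1 - ?m = 0")
    case True
    show ?thesis unfolding True by simp
  next
    case False
    then show ?thesis
      using le_less_trans[OF diff_le_self_ennreal[of 1 ?m] ennreal_one_less_top]
      by (subst mult_divide_eq_ennreal) auto
  qed
  have "(\<integral>\<^sup>+\<omega>. ennreal (dist (fst \<omega>) (snd \<omega>) powr p) \<partial>table_coupling q n \<alpha> \<beta>)
     = (\<integral>\<^sup>+(z, w). ?\<phi> z w \<partial>completion \<alpha> \<beta> ?f)"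
    using valid by (simp add: table_coupling_def n split_beta')
  also have "\<dots> = (\<integral>\<^sup>+z. (\<integral>\<^sup>+w. ?f z w * ?\<phi> z w \<partial>\<beta>) \<partial>\<alpha>)
     + (\<integral>\<^sup>+z. (\<integral>\<^sup>+w. (1 - f1 N (q z)) * (1 - f2 N (q w)) * ?\<phi> z w \<partial>\<beta>) \<partial>\<alpha>) / (1 - ?m)"
    unfolding f1_def f2_def by (rule nn_integral_completion[OF \<alpha>(1) \<beta>(1) fm]) measurable
  \<comment> \<open>In the residual product the distance is split into the two norms. The variable
    that a norm does not involve integrates to the unmatched mass \<open>1 - ?m\<close>, which
    cancels the normaliser and leaves the moments \<open>R1 N\<close> and
    \<open>R2 N\<close>.\<close>
  also have "\<dots> \<le> ennreal ((a + 4 * \<eta>) powr p) + ennreal \<tau>"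
  proof (rule add_mono)
    have "(\<integral>\<^sup>+z. (\<integral>\<^sup>+w. ?f z w * ?\<phi> z w \<partial>\<beta>) \<partial>\<alpha>) \<le> (\<integral>\<^sup>+z. (\<integral>\<^sup>+w. g (q z) (q w) * ?\<phi> z w \<partial>\<beta>) \<partial>\<alpha>)"
      by (intro nn_integral_mono mult_right_mono c_le) auto
    also note g_cost
    finally show "(\<integral>\<^sup>+z. (\<integral>\<^sup>+w. ?f z w * ?\<phi> z w \<partial>\<beta>) \<partial>\<alpha>) \<le> ennreal ((a + 4 * \<eta>) powr p)" .
    have "(\<integral>\<^sup>+z. (\<integral>\<^sup>+w. (1 - f1 N (q z)) * (1 - f2 N (q w)) * ?\<phi> z w \<partial>\<beta>) \<partial>\<alpha>)
      \<le> (\<integral>\<^sup>+z. (\<integral>\<^sup>+w. (1 - f1 N (q z)) * (1 - f2 N (q w)) * (ennreal (2 powr p) * (ennreal (norm z powr p) + ennreal (norm w powr p))) \<partial>\<beta>) \<partial>\<alpha>)"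
      using p by (intro nn_integral_mono mult_left_mono)
        (auto simp flip: ennreal_plus ennreal_mult intro!: ennreal_leI dist_powr_le_norm)
    also have "\<dots> = (\<integral>\<^sup>+z. ennreal (2 powr p) * ((1 - f1 N (q z)) * ennreal (norm z powr p)) * (\<integral>\<^sup>+w. 1 - f2 N (q w) \<partial>\<beta>)
         + ennreal (2 powr p) * (1 - f1 N (q z)) * R2 N \<partial>\<alpha>)"
      unfolding R2_def
      by (intro nn_integral_cong) (simp add: nn_integral_cmult[symmetric] nn_integral_add[symmetric] algebra_simps)
    also have "\<dots> = ennreal (2 powr p) * R1 N * (\<integral>\<^sup>+w. 1 - f2 N (q w) \<partial>\<beta>) + ennreal (2 powr p) * (\<integral>\<^sup>+z. 1 - f1 N (q z) \<partial>\<alpha>) * R2 N"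
      unfolding R1_def by (simp add: nn_integral_add nn_integral_cmult nn_integral_multc)
    also have "\<dots> = ennreal (2 powr p) * (R1 N + R2 N) * (1 - ?m)"
      using f1_le f2_le by (simp add: r1(2) r2(2) algebra_simps)
    finally have "(\<integral>\<^sup>+z. (\<integral>\<^sup>+w. (1 - f1 N (q z)) * (1 - f2 N (q w)) * ?\<phi> z w \<partial>\<beta>) \<partial>\<alpha>) / (1 - ?m)
        \<le> ennreal (2 powr p) * (R1 N + R2 N) * (1 - ?m) / (1 - ?m)"
      by (rule divide_right_mono_ennreal)
    also have "\<dots> \<le> ennreal (2 powr p) * (R1 N + R2 N)" by (rule quot)
    also have "\<dots> \<le> ennreal \<tau>" using N by simp
    finally show "(\<integral>\<^sup>+z. (\<integral>\<^sup>+w. (1 - f1 N (q z)) * (1 - f2 N (q w)) * ?\<phi> z w \<partial>\<beta>) \<partial>\<alpha>) / (1 - ?m) \<le> ennreal \<tau>" .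
  qed
  also have "\<dots> = ennreal ((a + 4 * \<eta>) powr p + \<tau>)" using \<open>0 < \<tau>\<close> by simp
  finally show ?thesis by blast
qed

section \<open>Measurable selection among the tables\<close>

lemma measurable_pred_kernel_le:
  assumes "\<kappa> \<in> S \<rightarrow>\<^sub>M prob_algebra N" and f: "f \<in> borel_measurable N"
  shows "Measurable.pred S (\<lambda>s. (\<integral>\<^sup>+w. f w \<partial>\<kappa> s) \<le> (1::ennreal))"
proof -
  have [measurable]: "(\<lambda>s. \<integral>\<^sup>+w. f w \<partial>\<kappa> s) \<in> borel_measurable S"
    using assms(1) measurable_compose[OF measurable_snd f] by (intro nn_integral_kernel_measurable) (auto simp: split_beta')
  show ?thesis by measurable
qed

lemma table_coupling_kernel:
  fixes \<alpha> \<beta> :: "'s \<Rightarrow> 'a::euclidean_space measure"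
  assumes quant: "quantizer q r \<eta>"
    and \<alpha>[measurable]: "\<alpha> \<in> S \<rightarrow>\<^sub>M prob_algebra borel" and \<beta>[measurable]: "\<beta> \<in> S \<rightarrow>\<^sub>M prob_algebra borel"
  shows "(\<lambda>s. table_coupling q n (\<alpha> s) (\<beta> s)) \<in> S \<rightarrow>\<^sub>M prob_algebra (borel \<Otimes>\<^sub>M borel)"
    and "s \<in> space S \<Longrightarrow> table_coupling q n (\<alpha> s) (\<beta> s) \<in> couplings (\<alpha> s) (\<beta> s)"
proof -
  have q[measurable]: "q \<in> borel \<rightarrow>\<^sub>M count_space UNIV" using quant by (auto simp: quantizer_def)
  have e1: "(\<lambda>w. ennreal (table_entry n i (q w))) \<in> borel_measurable borel"
    and e2: "(\<lambda>w. ennreal (table_entry n (q w) i)) \<in> borel_measurable borel" for i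
    by (rule measurable_compose[OF q], simp)+
  have valid[measurable]: "Measurable.pred S (\<lambda>s. table_valid q n (\<alpha> s) (\<beta> s))"
    unfolding table_valid_def using measurable_pred_kernel_le[OF \<beta> e1] measurable_pred_kernel_le[OF \<alpha> e2] by measurable
  have t: "(\<lambda>(z, w). ennreal (table_entry n (q z) (q w))) \<in> borel_measurable (borel \<Otimes>\<^sub>M borel)"
    by measurable
  have [measurable]: "(\<lambda>x. ennreal (table_entry n (q (fst (snd x))) (q (snd (snd x))))) \<in> borel_measurable (S \<Otimes>\<^sub>M borel \<Otimes>\<^sub>M borel)"
    using measurable_compose[OF measurable_snd t, of S] by (simp add: split_beta')
  have f: "(\<lambda>(s, z, w). if table_valid q n (\<alpha> s) (\<beta> s) then ennreal (table_entry n (q z) (q w)) else 0)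
      \<in> borel_measurable (S \<Otimes>\<^sub>M borel \<Otimes>\<^sub>M borel)"
    unfolding split_beta' by measurable
  have 1: "(\<integral>\<^sup>+w. (if table_valid q n (\<alpha> s) (\<beta> s) then ennreal (table_entry n (q z) (q w)) else 0) \<partial>\<beta> s) \<le> 1"
    and 2: "(\<integral>\<^sup>+z. (if table_valid q n (\<alpha> s) (\<beta> s) then ennreal (table_entry n (q z) (q w)) else 0) \<partial>\<alpha> s) \<le> 1" for s z w
    by (cases "table_valid q n (\<alpha> s) (\<beta> s)"; simp; simp add: table_valid_def)+
  show "(\<lambda>s. table_coupling q n (\<alpha> s) (\<beta> s)) \<in> S \<rightarrow>\<^sub>M prob_algebra (borel \<Otimes>\<^sub>M borel)"
    unfolding table_coupling_def by (rule measurable_completion(1)[OF \<alpha> \<beta> f]) (rule 1 2)+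
  show "s \<in> space S \<Longrightarrow> table_coupling q n (\<alpha> s) (\<beta> s) \<in> couplings (\<alpha> s) (\<beta> s)"
    unfolding table_coupling_def by (rule measurable_completion(2)[OF \<alpha> \<beta> f]) (rule 1 2 | assumption)+
qed

lemma coupling_cost_finite:
  fixes \<alpha> \<beta> :: "'a::euclidean_space measure"
  assumes p: "0 \<le> p" and \<alpha>: "sets \<alpha> = sets borel" and \<beta>: "sets \<beta> = sets borel"
    and m: "(\<integral>\<^sup>+z. ennreal (norm z powr p) \<partial>\<alpha>) < \<infinity>" "(\<integral>\<^sup>+z. ennreal (norm z powr p) \<partial>\<beta>) < \<infinity>"
    and \<pi>: "\<pi> \<in> couplings \<alpha> \<beta>"
  shows "(\<integral>\<^sup>+\<omega>. ennreal (dist (fst \<omega>) (snd \<omega>) powr p) \<partial>\<pi>) < \<infinity>"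
proof -
  have sets_\<pi>[measurable_cong]: "sets \<pi> = sets (borel \<Otimes>\<^sub>M borel)"
    using couplings_D(2)[OF \<pi>] by (simp add: \<alpha> \<beta> cong: sets_pair_measure_cong)
  note [measurable_cong] = \<alpha> \<beta>
  have "(\<integral>\<^sup>+\<omega>. ennreal (dist (fst \<omega>) (snd \<omega>) powr p) \<partial>\<pi>)
    \<le> (\<integral>\<^sup>+\<omega>. ennreal (2 powr p) * (ennreal (norm (fst \<omega>) powr p) + ennreal (norm (snd \<omega>) powr p)) \<partial>\<pi>)"
    using p by (intro nn_integral_mono) (auto simp flip: ennreal_plus ennreal_mult intro!: ennreal_leI dist_powr_le_norm)
  also have "\<dots> = ennreal (2 powr p) * ((\<integral>\<^sup>+z. ennreal (norm z powr p) \<partial>\<alpha>) + (\<integral>\<^sup>+z. ennreal (norm z powr p) \<partial>\<beta>))"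
    by (simp add: nn_integral_cmult nn_integral_add
        couplings_nn_integral_fst[OF \<pi>, of "\<lambda>z. ennreal (norm z powr p)"]
        couplings_nn_integral_snd[OF \<pi>, of "\<lambda>z. ennreal (norm z powr p)"])
  also have "\<dots> < \<infinity>" using m by (simp add: ennreal_mult_less_top)
  finally show ?thesis .
qed

text \<open>Write \<open>x powr p\<close> as \<open>x * x powr (p - 1)\<close> and enlarge the base
  of the second factor to \<open>x + y\<close>.\<close>

lemma powr_superadditive:
  fixes x y p :: real
  assumes "0 \<le> x" "0 \<le> y" "1 \<le> p"
  shows "x powr p + y powr p \<le> (x + y) powr p"
proof (cases "x + y = 0")
  case False
  have "x powr p + y powr p = x * x powr (p - 1) + y * y powr (p - 1)"
    using assms by (simp add: powr_mult_base)
  also have "\<dots> \<le> x * (x + y) powr (p - 1) + y * (x + y) powr (p - 1)"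
    using assms by (intro add_mono mult_left_mono powr_mono2) auto
  also have "\<dots> = (x + y) powr p"
    using assms powr_mult_base[of "x + y" "p - 1"] by (simp add: distrib_right)
  finally show ?thesis .
next
  case True
  then have "x = 0" "y = 0" using assms by linarith+
  then show ?thesis by simp
qed

text \<open>Measurability of the optimal cost in \<open>s\<close> is bypassed: \<open>c\<close> is a
  measurable lower bound for its \<open>p\<close>-th root, which \<open>K\<close> attains up to
  \<epsilon>. The cost of each table is measurable in \<open>s\<close>, there are countably many
  tables, and their infimum is nearly optimal by \<open>table_coupling_near_optimal\<close>.\<close>

lemma ex_near_optimal_kernel:
  fixes \<alpha> \<beta> :: "'s \<Rightarrow> 'a::euclidean_space measure" and q :: "'a \<Rightarrow> nat"
  assumes p: "1 \<le> p" and \<epsilon>: "0 < \<epsilon>" and quant: "quantizer q r (\<epsilon> / 8)"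
    and \<alpha>[measurable]: "\<alpha> \<in> S \<rightarrow>\<^sub>M prob_algebra borel" and \<beta>[measurable]: "\<beta> \<in> S \<rightarrow>\<^sub>M prob_algebra borel"
  obtains K c where
    "K \<in> S \<rightarrow>\<^sub>M prob_algebra (borel \<Otimes>\<^sub>M borel)" "c \<in> borel_measurable S"
    "\<And>s. s \<in> space S \<Longrightarrow> K s \<in> couplings (\<alpha> s) (\<beta> s)" "\<And>s. (0::real) \<le> c s"
    "\<And>s. s \<in> space S \<Longrightarrow> (\<integral>\<^sup>+z. ennreal (norm z powr p) \<partial>\<alpha> s) < \<infinity> \<Longrightarrow>
      (\<integral>\<^sup>+z. ennreal (norm z powr p) \<partial>\<beta> s) < \<infinity> \<Longrightarrow>
      (\<integral>\<^sup>+\<omega>. ennreal (dist (fst \<omega>) (snd \<omega>) powr p) \<partial>K s) \<le> ennreal ((c s + \<epsilon>) powr p) \<and>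
      ennreal (c s powr p) \<le> (INF \<pi>\<in>couplings (\<alpha> s) (\<beta> s). \<integral>\<^sup>+\<omega>. ennreal (dist (fst \<omega>) (snd \<omega>) powr p) \<partial>\<pi>)"
proof -
  define cost :: "('a \<times> 'a) measure \<Rightarrow> ennreal" where "cost \<pi> = (\<integral>\<^sup>+\<omega>. ennreal (dist (fst \<omega>) (snd \<omega>) powr p) \<partial>\<pi>)" for \<pi>
  define L where "L n s = table_coupling q n (\<alpha> s) (\<beta> s)" for n s
  note L = table_coupling_kernel[OF quant \<alpha> \<beta>, folded L_def]
  have costL[measurable]: "(\<lambda>s. cost (L n s)) \<in> borel_measurable S" for n
    unfolding cost_def using L(1) by (rule nn_integral_kernel_measurable) measurable
  \<comment> \<open>Two losses of \<tau> will occur, one from the table and one from the choice of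
    the index. Together they make \<open>(\<epsilon> / 2) powr p\<close>, while the radius
    \<open>\<epsilon> / 8\<close> of the cells adds
    \<open>4 * (\<epsilon> / 8) = \<epsilon> / 2\<close> to the root; superadditivity merges the two
    halves.\<close>
  define \<tau> where "\<tau> = (\<epsilon> / 2) powr p / 2"
  have \<tau>: "0 < \<tau>" using \<epsilon> by (simp add: \<tau>_def)
  define v where "v s = (INF n. cost (L n s))" for s
  have [measurable]: "v \<in> borel_measurable S" unfolding v_def by measurable
  \<comment> \<open>The least admissible index depends measurably on \<open>s\<close>, being decided
    by countably many comparisons of measurable functions.\<close>
  define N where "N s = (LEAST n. cost (L n s) \<le> v s + ennreal \<tau>)" for s
  have N_meas[measurable]: "N \<in> S \<rightarrow>\<^sub>M count_space UNIV" unfolding N_def by measurable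
  have N: "cost (L (N s) s) \<le> v s + ennreal \<tau>" for s
  proof -
    have "\<exists>n. cost (L n s) \<le> v s + ennreal \<tau>"
    proof (cases "v s = top")
      case False
      then have "v s < v s + ennreal \<tau>" using \<tau> by (cases "v s") (auto simp: ennreal_less_iff simp flip: ennreal_plus)
      then show ?thesis unfolding v_def INF_less_iff by (auto intro: less_imp_le)
    qed simp
    then show ?thesis unfolding N_def by (rule LeastI_ex)
  qed
  define K where "K s = L (N s) s" for s
  have K[measurable]: "K \<in> S \<rightarrow>\<^sub>M prob_algebra (borel \<Otimes>\<^sub>M borel)"
    unfolding K_def by (rule measurable_compose_countable[OF L(1) N_meas])
  have costK[measurable]: "(\<lambda>s. cost (K s)) \<in> borel_measurable S"
    unfolding cost_def using K by (rule nn_integral_kernel_measurable) measurable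
  have KC: "K s \<in> couplings (\<alpha> s) (\<beta> s)" if "s \<in> space S" for s
    unfolding K_def by (rule L(2)[OF that])
  \<comment> \<open>The root of the cost of \<open>K\<close> less \<epsilon>, cut at 0: the upper
    bound for \<open>K\<close> is then immediate, and the lower bound says that \<open>K\<close> is
    optimal up to \<epsilon>.\<close>
  define c where "c s = max 0 (enn2real (cost (K s)) powr (1 / p) - \<epsilon>)" for s
  show ?thesis
  proof (rule that[OF K _ KC])
    show "c \<in> borel_measurable S" unfolding c_def by measurable
    show "0 \<le> c s" for s by (simp add: c_def)
    fix s assume s: "s \<in> space S"
      and m\<alpha>: "(\<integral>\<^sup>+z. ennreal (norm z powr p) \<partial>\<alpha> s) < \<infinity>" and m\<beta>: "(\<integral>\<^sup>+z. ennreal (norm z powr p) \<partial>\<beta> s) < \<infinity>"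
    note \<alpha>s = kernel_prob[OF \<alpha> s] kernel_sets[OF \<alpha> s] and \<beta>s = kernel_prob[OF \<beta> s] kernel_sets[OF \<beta> s]
    have fin: "cost \<pi> < top" if "\<pi> \<in> couplings (\<alpha> s) (\<beta> s)" for \<pi>
      using coupling_cost_finite[OF _ \<alpha>s(2) \<beta>s(2) m\<alpha> m\<beta> that] p by (simp add: cost_def)
    have fK: "cost (K s) < top" using fin[OF KC[OF s]] .
    have root: "enn2real (cost (K s)) = (enn2real (cost (K s)) powr (1 / p)) powr p"
      using p by (simp add: powr_powr)
    have le1: "cost (K s) \<le> ennreal ((c s + \<epsilon>) powr p)"
    proof -
      have "enn2real (cost (K s)) \<le> (c s + \<epsilon>) powr p"
        by (subst root, rule powr_mono2) (use p in \<open>auto simp: c_def\<close>)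
      then show ?thesis using fK by (metis ennreal_enn2real ennreal_leI)
    qed
    have le2: "ennreal (c s powr p) \<le> cost \<pi>" if \<pi>: "\<pi> \<in> couplings (\<alpha> s) (\<beta> s)" for \<pi>
    proof -
      define a where "a = enn2real (cost \<pi>) powr (1 / p)"
      have a: "0 \<le> a" "cost \<pi> = ennreal (a powr p)"
        using p fin[OF \<pi>] by (simp_all add: a_def powr_powr)
      obtain n where "cost (L n s) \<le> ennreal ((a + \<epsilon> / 2) powr p + \<tau>)"
        using table_coupling_near_optimal[OF p quant \<alpha>s \<beta>s m\<alpha> m\<beta> \<pi> _ a(1) \<tau>] a(2)
        by (auto simp: cost_def L_def)
      then have "v s \<le> ennreal ((a + \<epsilon> / 2) powr p + \<tau>)"
        unfolding v_def by (rule INF_lower2[rotated]) simp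
      with N[of s] have "cost (K s) \<le> ennreal ((a + \<epsilon> / 2) powr p + \<tau>) + ennreal \<tau>"
        unfolding K_def by (meson add_right_mono order_trans)
      also have "\<dots> = ennreal ((a + \<epsilon> / 2) powr p + (\<epsilon> / 2) powr p)"
        using \<tau> by (subst ennreal_plus[symmetric]) (auto simp: \<tau>_def)
      also have "\<dots> \<le> ennreal ((a + \<epsilon>) powr p)"
        using powr_superadditive[of "a + \<epsilon> / 2" "\<epsilon> / 2" p] a(1) \<epsilon> p by (intro ennreal_leI) (simp add: add.commute)
      finally have "enn2real (cost (K s)) \<le> (a + \<epsilon>) powr p"
        by (intro enn2real_leI) auto
      then have "enn2real (cost (K s)) powr (1 / p) \<le> ((a + \<epsilon>) powr p) powr (1 / p)"
        using p by (intro powr_mono2) auto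
      also have "\<dots> = a + \<epsilon>" using p a(1) \<epsilon> by (simp add: powr_powr)
      finally have "c s \<le> a" using a(1) by (simp add: c_def)
      then show ?thesis unfolding a(2) using p by (intro ennreal_leI powr_mono2) (auto simp: c_def)
    qed
    show "(\<integral>\<^sup>+\<omega>. ennreal (dist (fst \<omega>) (snd \<omega>) powr p) \<partial>K s) \<le> ennreal ((c s + \<epsilon>) powr p) \<and>
      ennreal (c s powr p) \<le> (INF \<pi>\<in>couplings (\<alpha> s) (\<beta> s). \<integral>\<^sup>+\<omega>. ennreal (dist (fst \<omega>) (snd \<omega>) powr p) \<partial>\<pi>)"
      using le1 le2 by (auto simp: cost_def intro: INF_greatest)
  qed
qed

section \<open>Shifted grids\<close>

definition grid_cell :: "real \<Rightarrow> real \<Rightarrow> real^'d \<Rightarrow> int^'d" where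
  "grid_cell h u z = (\<chi> i. \<lfloor>(z $ i + u) / h\<rfloor>)"

definition grid_index :: "real \<Rightarrow> real \<Rightarrow> real^'d \<Rightarrow> nat" where
  "grid_index h u z = to_nat (grid_cell h u z)"

text \<open>The corner of the cell with the smallest coordinates.\<close>

definition grid_point :: "real \<Rightarrow> real \<Rightarrow> nat \<Rightarrow> real^'d" where
  "grid_point h u n = (\<chi> i. h * of_int ((from_nat n :: int^'d) $ i) - u)"

text \<open>Each coordinate is within \<open>h\<close> of that of the corner, and the Euclidean norm
  is at most the sum of the absolute coordinates, whence the factor \<open>CARD('d)\<close>.\<close>

lemma quantizer_grid:
  assumes "0 < h"
  shows "quantizer (grid_index h u :: real^'d \<Rightarrow> nat) (grid_point h u) (real CARD('d) * h)"
  unfolding quantizer_def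
proof (intro conjI allI)
  have "(grid_cell h u :: real^'d \<Rightarrow> int^'d) \<in> borel \<rightarrow>\<^sub>M count_space UNIV"
  proof (subst measurable_count_space_eq2_countable, intro conjI ballI)
    fix a :: "int^'d"
    have [measurable]: "(\<lambda>z::real^'d. z $ i) \<in> borel_measurable borel" for i
      by (intro borel_measurable_continuous_onI continuous_intros)
    have "grid_cell h u -` {a} \<inter> space borel = {z\<in>space borel. \<forall>i. \<lfloor>(z $ i + u) / h\<rfloor> = a $ i}"
      by (auto simp: grid_cell_def vec_eq_iff)
    also have "\<dots> \<in> sets borel" by measurable
    finally show "grid_cell h u -` {a} \<inter> space borel \<in> sets borel" .
  qed auto
  then show "(grid_index h u :: real^'d \<Rightarrow> nat) \<in> borel \<rightarrow>\<^sub>M count_space UNIV"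
    unfolding grid_index_def[abs_def] by (rule measurable_compose) simp
  fix z :: "real^'d"
  have "dist z (grid_point h u (grid_index h u z)) \<le> (\<Sum>i\<in>UNIV. \<bar>(z - grid_point h u (grid_index h u z)) $ i\<bar>)"
    unfolding dist_norm by (rule norm_le_l1_cart)
  also have "\<dots> \<le> (\<Sum>i\<in>(UNIV::'d set). h)"
  proof (rule sum_mono)
    fix i
    let ?k = "\<lfloor>(z $ i + u) / h\<rfloor>"
    have "of_int ?k \<le> (z $ i + u) / h" "(z $ i + u) / h < of_int ?k + 1" by linarith+
    then have "of_int ?k * h \<le> z $ i + u" "z $ i + u < (of_int ?k + 1) * h"
      unfolding pos_le_divide_eq[OF assms] pos_divide_less_eq[OF assms] .
    then have "h * of_int ?k \<le> z $ i + u" "z $ i + u < h * of_int ?k + h"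
      by (simp_all add: algebra_simps)
    then show "\<bar>(z - grid_point h u (grid_index h u z)) $ i\<bar> \<le> h"
      by (simp add: grid_point_def grid_index_def grid_cell_def)
  qed
  finally show "dist z (grid_point h u (grid_index h u z)) \<le> real CARD('d) * h" by simp
qed

lemma ex_quantizer: "0 < \<eta> \<Longrightarrow> \<exists>q (r :: nat \<Rightarrow> real^'d). quantizer q r \<eta>"
  using quantizer_grid[of "\<eta> / real CARD('d)" 0, where ?'d = 'd] by auto

section \<open>Coupling a path with a cell sequence\<close>

declare One_nat_def [simp del]

lemma measurable_Cons [measurable (raw)]:
  fixes f :: "'a \<Rightarrow> 'i::countable"
  assumes "f \<in> M \<rightarrow>\<^sub>M count_space UNIV" "g \<in> M \<rightarrow>\<^sub>M count_space UNIV"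
  shows "(\<lambda>x. f x # g x) \<in> M \<rightarrow>\<^sub>M count_space UNIV"
proof -
  have "(\<lambda>x. i # g x) \<in> M \<rightarrow>\<^sub>M count_space UNIV" for i
    by (rule measurable_compose[OF assms(2)]) simp
  then show ?thesis by (rule measurable_compose_countable[OF _ assms(1)])
qed

lemma measurable_path_upd [measurable (raw)]:
  assumes "f \<in> M \<rightarrow>\<^sub>M path_space t" "g \<in> M \<rightarrow>\<^sub>M borel"
  shows "(\<lambda>x. (f x)(Suc t := g x)) \<in> M \<rightarrow>\<^sub>M path_space (Suc t)"
proof -
  have "(\<lambda>(x, z). x(Suc t := z)) \<in> PiM {1..t} (\<lambda>_. borel) \<Otimes>\<^sub>M borel \<rightarrow>\<^sub>M PiM (insert (Suc t) {1..t}) (\<lambda>_. borel)"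
    by (rule measurable_add_dim)
  moreover have "insert (Suc t) {1..t} = {1..Suc t}" by auto
  ultimately have "(\<lambda>(x, z). x(Suc t := z)) \<in> path_space t \<Otimes>\<^sub>M borel \<rightarrow>\<^sub>M path_space (Suc t)"
    by (simp add: path_space_def)
  from measurable_compose[OF measurable_Pair[OF assms] this] show ?thesis by simp
qed

lemma restrict_path_Suc: "restrict x {1..Suc t} = (restrict x {1..t})(Suc t := x (Suc t))"
  by (auto simp: restrict_def fun_eq_iff)

lemma space_path_0: "x \<in> space (path_space 0) \<longleftrightarrow> x = (\<lambda>_. undefined)"
  by (simp add: path_space_def space_PiM)

lemma restrict_path_id: "x \<in> space (path_space t) \<Longrightarrow> restrict x {1..t} = x"
  unfolding path_space_def space_PiM by (rule PiE_restrict)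

lemma restrict_path_upd: "restrict (x(Suc t := z)) {1..t} = restrict x {1..t}"
  by (auto simp: restrict_def fun_eq_iff)

text \<open>The newest cell comes first, so \<open>drop (n - t)\<close> recovers the first \<open>t\<close> of \<open>n\<close> cells.\<close>

primrec qlist :: "('v \<Rightarrow> 'i) \<Rightarrow> nat \<Rightarrow> (nat \<Rightarrow> 'v) \<Rightarrow> 'i list" where
  "qlist q 0 x = []"
| "qlist q (Suc t) x = q (x (Suc t)) # qlist q t x"

lemma qlist_cong: "(\<And>s. s \<in> {1..t} \<Longrightarrow> x s = y s) \<Longrightarrow> qlist q t x = qlist q t y"
  by (induction t) auto

lemma qlist_restrict: "t \<le> n \<Longrightarrow> qlist q t (restrict x {1..n}) = qlist q t x"
  by (rule qlist_cong) auto

lemma drop_qlist: "t \<le> n \<Longrightarrow> drop (n - t) (qlist q n x) = qlist q t x"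
proof (induction n)
  case (Suc n)
  then show ?case by (cases "t = Suc n") (auto simp: Suc_diff_le)
qed simp

lemma measurable_qlist:
  fixes q :: "real^'d \<Rightarrow> nat"
  assumes q: "q \<in> borel \<rightarrow>\<^sub>M count_space UNIV"
  shows "t \<le> n \<Longrightarrow> qlist q t \<in> path_space n \<rightarrow>\<^sub>M count_space UNIV"
proof (induction t)
  case (Suc t)
  have "(\<lambda>x. q (x (Suc t))) \<in> path_space n \<rightarrow>\<^sub>M count_space UNIV"
    using Suc by (intro measurable_compose[OF measurable_path_component q]) auto
  from measurable_Cons[OF this] Suc show ?case by simp
next
  case 0
  have "qlist q 0 = (\<lambda>_. [])" by auto
  then show ?case by simp
qed

section \<open>The chain of paths and cells for one law\<close>

text \<open>Of \<open>K\<close> the marginals are recorded here. How close its couplings are to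
  optimal affects the size of the error, treated in \<open>quantised_law_error\<close>, but neither
  the laws of the two components nor causality.\<close>

locale quantised_law =
  fixes \<gamma> :: "(nat \<Rightarrow> real^'d) measure" and T :: nat and \<kappa> :: "nat \<Rightarrow> (nat \<Rightarrow> real^'d) \<Rightarrow> (real^'d) measure"
    and q :: "real^'d \<Rightarrow> nat"
    and K :: "nat \<Rightarrow> (nat \<Rightarrow> real^'d) \<times> (nat \<Rightarrow> real^'d) \<Rightarrow> ((real^'d) \<times> (real^'d)) measure"
  assumes prob_\<gamma>: "prob_space \<gamma>" and sets_\<gamma>: "sets \<gamma> = sets (path_space T)"
    and disint: "t < T \<Longrightarrow> disintegrates \<gamma> (\<lambda>x. restrict x {1..t}) (path_space t) (\<lambda>x. x (Suc t)) borel (\<kappa> t)"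
    and q_meas[measurable]: "q \<in> borel \<rightarrow>\<^sub>M count_space UNIV"
    and K: "t < T \<Longrightarrow> K t \<in> path_space t \<Otimes>\<^sub>M path_space t \<rightarrow>\<^sub>M prob_algebra (borel \<Otimes>\<^sub>M borel)"
    and K_couplings: "t < T \<Longrightarrow> x \<in> space (path_space t) \<Longrightarrow> x' \<in> space (path_space t) \<Longrightarrow>
      K t (x, x') \<in> couplings (\<kappa> t x) (\<kappa> t x')"
begin

sublocale prob_space \<gamma> by (rule prob_\<gamma>)

lemma \<kappa>: "t < T \<Longrightarrow> \<kappa> t \<in> path_space t \<rightarrow>\<^sub>M prob_algebra borel"
  using disintegrates_kernel[OF disint] .

lemma space_\<gamma>: "space \<gamma> = space (path_space T)"
  by (rule sets_eq_imp_space_eq[OF sets_\<gamma>])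

lemma \<gamma>_measurable: "f \<in> path_space T \<rightarrow>\<^sub>M N \<Longrightarrow> f \<in> \<gamma> \<rightarrow>\<^sub>M N"
  by (simp add: measurable_cong_sets[OF sets_\<gamma> refl])

lemma qlist_meas: "t \<le> T \<Longrightarrow> qlist q t \<in> \<gamma> \<rightarrow>\<^sub>M count_space UNIV"
  by (intro \<gamma>_measurable measurable_qlist q_meas)

lemma restrict_meas: "t \<le> T \<Longrightarrow> (\<lambda>x. restrict x {1..t}) \<in> \<gamma> \<rightarrow>\<^sub>M path_space t"
  by (intro \<gamma>_measurable measurable_restrict_path)

definition cell :: "nat \<Rightarrow> nat list \<Rightarrow> (nat \<Rightarrow> real^'d) set" where
  "cell t g = {x\<in>space \<gamma>. qlist q t x = g}"

text \<open>On a null cell \<gamma> serves as a default that keeps this a probability kernel; the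
  chain visits such cells with probability 0, see \<open>AE_chain_cell\<close>.\<close>

definition cell_law :: "nat \<Rightarrow> nat list \<Rightarrow> (nat \<Rightarrow> real^'d) measure" where
  "cell_law t g = (if emeasure \<gamma> (cell t g) = 0 then \<gamma> else uniform_measure \<gamma> (cell t g))"

lemma sets_cell: "t \<le> T \<Longrightarrow> cell t g \<in> sets \<gamma>"
  using measurable_sets[OF qlist_meas, of t "{g}"] by (simp add: cell_def vimage_def Int_def conj_commute)

lemma cell_law_space: "t \<le> T \<Longrightarrow> cell_law t g \<in> space (prob_algebra (path_space T))"
  using prob_\<gamma> sets_\<gamma> by (auto simp: cell_law_def space_prob_algebra emeasure_eq_measure intro!: prob_space_uniform_measure)

lemma cell_law_kernel: "t \<le> T \<Longrightarrow> cell_law t \<in> count_space UNIV \<rightarrow>\<^sub>M prob_algebra (path_space T)"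
  using cell_law_space by (auto simp: measurable_count_space_eq1)

text \<open>Multiplied through by the mass of the cell, the formula for conditioning covers null
  cells, where both sides are 0.\<close>

lemma nn_integral_cell_law:
  assumes t: "t \<le> T" and F[measurable]: "F \<in> borel_measurable \<gamma>"
  shows "emeasure \<gamma> (cell t g) * (\<integral>\<^sup>+x. F x \<partial>cell_law t g) = (\<integral>\<^sup>+x. F x * indicator {g} (qlist q t x) \<partial>\<gamma>)"
proof -
  have [measurable]: "cell t g \<in> sets \<gamma>" by (rule sets_cell[OF t])
  have eq: "(\<integral>\<^sup>+x. F x * indicator {g} (qlist q t x) \<partial>\<gamma>) = (\<integral>\<^sup>+x. F x * indicator (cell t g) x \<partial>\<gamma>)"
    by (intro nn_integral_cong) (auto simp: cell_def indicator_def)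
  show ?thesis
  proof (cases "emeasure \<gamma> (cell t g) = 0")
    case True
    then have "AE x in \<gamma>. x \<notin> cell t g" by (intro AE_not_in) auto
    then have "(\<integral>\<^sup>+x. F x * indicator (cell t g) x \<partial>\<gamma>) = (\<integral>\<^sup>+x. 0 \<partial>\<gamma>)"
      by (intro nn_integral_cong_AE) (auto simp: indicator_def)
    then show ?thesis using True eq by simp
  next
    case False
    then have "(\<integral>\<^sup>+x. F x \<partial>cell_law t g) = (\<integral>\<^sup>+x. F x * indicator (cell t g) x \<partial>\<gamma>) / emeasure \<gamma> (cell t g)"
      by (simp add: cell_law_def nn_integral_uniform_measure)
    moreover have "a * (b / a) = b" if "a \<noteq> 0" "a \<noteq> top" for a b :: ennreal
      using that by (simp add: ennreal_times_divide mult.commute[of a] mult_divide_eq_ennreal)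
    ultimately show ?thesis using False eq emeasure_finite by simp
  qed
qed

lemma AE_cell_law: "t \<le> T \<Longrightarrow> emeasure \<gamma> (cell t g) \<noteq> 0 \<Longrightarrow> AE x in cell_law t g. qlist q t x = g"
  unfolding cell_law_def
  by (auto intro!: AE_uniform_measureI sets_cell) (auto simp: cell_def)

text \<open>Law of total probability over countably many cells: a path drawn from \<gamma> given the
  cells of a \<gamma>-path has, jointly with these cells, the law of the original path. Resampling
  from cells with the right law therefore returns \<gamma>.\<close>

lemma nn_integral_cell_mixture:
  assumes t: "t \<le> T" and F: "\<And>g. F g \<in> borel_measurable \<gamma>"
  shows "(\<integral>\<^sup>+x. (\<integral>\<^sup>+x'. F (qlist q t x) x' \<partial>cell_law t (qlist q t x)) \<partial>\<gamma>) = (\<integral>\<^sup>+x. F (qlist q t x) x \<partial>\<gamma>)"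
proof -
  note [measurable] = qlist_meas[OF t]
  have "(\<integral>\<^sup>+x. (\<integral>\<^sup>+x'. F (qlist q t x) x' \<partial>cell_law t (qlist q t x)) \<partial>\<gamma>)
      = (\<integral>\<^sup>+g. (\<integral>\<^sup>+x'. F g x' \<partial>cell_law t g) * emeasure \<gamma> (cell t g) \<partial>count_space UNIV)"
    unfolding cell_def using nn_integral_countable[OF sigma_finite_measure_axioms qlist_meas[OF t], of "\<lambda>g. \<integral>\<^sup>+x'. F g x' \<partial>cell_law t g"] .
  also have "\<dots> = (\<integral>\<^sup>+g. (\<integral>\<^sup>+x. F g x * indicator {g} (qlist q t x) \<partial>\<gamma>) \<partial>count_space UNIV)"
    by (simp add: nn_integral_cell_law[OF t F, symmetric] mult.commute)
  also have "\<dots> = (\<integral>\<^sup>+x. F (qlist q t x) x \<partial>\<gamma>)"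
    by (rule nn_integral_countable_fibres[symmetric, OF sigma_finite_measure_axioms qlist_meas[OF t] F])
  finally show ?thesis .
qed

text \<open>Given the past \<open>x\<close> and the past cells \<open>g\<close>, the next point is coupled with the cell of the
  successor of a path that is resampled from \<open>\<gamma>\<close> conditioned on \<open>g\<close>. The second marginal
  therefore depends on \<open>g\<close> only.\<close>

definition step :: "nat \<Rightarrow> (nat \<Rightarrow> real^'d) \<times> nat list \<Rightarrow> ((real^'d) \<times> nat) measure" where
  "step t s = cell_law t (snd s) \<bind>
     (\<lambda>x'. distr (K t (fst s, restrict x' {1..t})) (borel \<Otimes>\<^sub>M count_space UNIV) (\<lambda>y. (fst y, q (snd y))))"

abbreviation states :: "nat \<Rightarrow> ((nat \<Rightarrow> real^'d) \<times> nat list) measure" where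
  "states t \<equiv> path_space t \<Otimes>\<^sub>M count_space UNIV"

lemma step_inner:
  assumes t: "t < T"
  shows "(\<lambda>(s, x'). distr (K t (fst s, restrict x' {1..t})) (borel \<Otimes>\<^sub>M count_space UNIV) (\<lambda>y. (fst y, q (snd y))))
    \<in> states t \<Otimes>\<^sub>M path_space T \<rightarrow>\<^sub>M prob_algebra (borel \<Otimes>\<^sub>M count_space UNIV)"
proof -
  note [measurable] = K[OF t] measurable_restrict_path[OF less_imp_le[OF t]]
  show ?thesis by measurable
qed

lemma step_kernel:
  assumes t: "t < T"
  shows "step t \<in> states t \<rightarrow>\<^sub>M prob_algebra (borel \<Otimes>\<^sub>M count_space UNIV)"
proof -
  note [measurable] = step_inner[OF t] cell_law_kernel[OF less_imp_le[OF t]]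
  show ?thesis unfolding step_def[abs_def] by measurable
qed

lemma nn_integral_step:
  assumes t: "t < T" and x: "x \<in> space (path_space t)"
    and F[measurable]: "F \<in> borel_measurable (borel \<Otimes>\<^sub>M count_space UNIV)"
  shows "(\<integral>\<^sup>+y. F y \<partial>step t (x, g)) =
    (\<integral>\<^sup>+x'. (\<integral>\<^sup>+y. F (fst y, q (snd y)) \<partial>K t (x, restrict x' {1..t})) \<partial>cell_law t g)"
proof -
  have s: "(x, g) \<in> space (states t)" using x by (simp add: space_pair_measure)
  note [measurable] = step_inner[OF t] s
  have "(\<integral>\<^sup>+y. F y \<partial>step t (x, g)) = (\<integral>\<^sup>+x'. (\<integral>\<^sup>+y. F y
     \<partial>distr (K t (x, restrict x' {1..t})) (borel \<Otimes>\<^sub>M count_space UNIV) (\<lambda>y. (fst y, q (snd y)))) \<partial>cell_law t g)"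
    unfolding step_def fst_conv snd_conv
  proof (rule nn_integral_bind_prob[OF cell_law_space _ F])
    show "(\<lambda>x'. distr (K t (x, restrict x' {1..t})) (borel \<Otimes>\<^sub>M count_space UNIV) (\<lambda>y. (fst y, q (snd y))))
      \<in> path_space T \<rightarrow>\<^sub>M prob_algebra (borel \<Otimes>\<^sub>M count_space UNIV)"
      using measurable_compose[OF measurable_Pair1'[OF s] step_inner[OF t]] by simp
  qed (use t in auto)
  also have "\<dots> = (\<integral>\<^sup>+x'. (\<integral>\<^sup>+y. F (fst y, q (snd y)) \<partial>K t (x, restrict x' {1..t})) \<partial>cell_law t g)"
  proof (rule nn_integral_cong)
    fix x' assume "x' \<in> space (cell_law t g)"
    then have "x' \<in> space (path_space T)"
      using cell_law_space[of t g] t by (auto simp: space_prob_algebra dest!: sets_eq_imp_space_eq)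
    then have "restrict x' {1..t} \<in> space (path_space t)"
      using t by (intro measurable_space[OF measurable_restrict_path]) auto
    then have "K t (x, restrict x' {1..t}) \<in> space (prob_algebra (borel \<Otimes>\<^sub>M borel))"
      using x by (intro measurable_space[OF K[OF t]]) (simp add: space_pair_measure)
    then show "(\<integral>\<^sup>+y. F y \<partial>distr (K t (x, restrict x' {1..t})) (borel \<Otimes>\<^sub>M count_space UNIV) (\<lambda>y. (fst y, q (snd y))))
       = (\<integral>\<^sup>+y. F (fst y, q (snd y)) \<partial>K t (x, restrict x' {1..t}))"
      by (rule nn_integral_distr_kernel) measurable
  qed
  finally show ?thesis .
qed

lemma cell_law_restrict:
  assumes "t \<le> T" "x' \<in> space (cell_law t g)"
  shows "restrict x' {1..t} \<in> space (path_space t)"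
proof -
  have "x' \<in> space (path_space T)"
    using cell_law_space[OF assms(1), of g] assms(2) by (auto simp: space_prob_algebra dest!: sets_eq_imp_space_eq)
  then show ?thesis using assms(1) by (intro measurable_space[OF measurable_restrict_path]) auto
qed

text \<open>Whatever \<open>x'\<close> is drawn, \<open>K t\<close> has the first marginal
  \<open>\<kappa> t x\<close>, so the average over \<open>x'\<close> disappears. This is one-step
  causality: knowledge of the past cells does not alter the law of the next point.\<close>

lemma nn_integral_step_fst:
  assumes t: "t < T" and x: "x \<in> space (path_space t)" and f[measurable]: "f \<in> borel_measurable borel"
  shows "(\<integral>\<^sup>+y. f (fst y) \<partial>step t (x, g)) = (\<integral>\<^sup>+z. f z \<partial>\<kappa> t x)"
proof -
  have "(\<integral>\<^sup>+y. f (fst y) \<partial>step t (x, g)) = (\<integral>\<^sup>+x'. (\<integral>\<^sup>+y. f (fst y) \<partial>K t (x, restrict x' {1..t})) \<partial>cell_law t g)"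
    by (subst nn_integral_step[OF t x]) auto
  also have "\<dots> = (\<integral>\<^sup>+x'. (\<integral>\<^sup>+z. f z \<partial>\<kappa> t x) \<partial>cell_law t g)"
  proof (rule nn_integral_cong)
    fix x' assume "x' \<in> space (cell_law t g)"
    then have "restrict x' {1..t} \<in> space (path_space t)" using t by (intro cell_law_restrict) auto
    from K_couplings[OF t x this]
    show "(\<integral>\<^sup>+y. f (fst y) \<partial>K t (x, restrict x' {1..t})) = (\<integral>\<^sup>+z. f z \<partial>\<kappa> t x)"
      by (rule couplings_nn_integral_fst) (simp add: measurable_cong_sets[OF kernel_sets[OF \<kappa>[OF t] x] refl])
  qed
  also have "\<dots> = (\<integral>\<^sup>+z. f z \<partial>\<kappa> t x)"
    using cell_law_space[of t g] t by (simp add: space_prob_algebra prob_space.emeasure_space_1)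
  finally show ?thesis .
qed

text \<open>Here the past \<open>x\<close> drops out instead, the second marginal of
  \<open>K t\<close> being determined by \<open>x'\<close>. Such an autonomous chain of cells can be
  coupled with that of another law without looking at the paths.\<close>

lemma nn_integral_step_snd:
  assumes t: "t < T" and x: "x \<in> space (path_space t)"
  shows "(\<integral>\<^sup>+y. h (snd y) \<partial>step t (x, g)) = (\<integral>\<^sup>+x'. (\<integral>\<^sup>+z. h (q z) \<partial>\<kappa> t (restrict x' {1..t})) \<partial>cell_law t g)"
proof -
  have h[measurable]: "(\<lambda>z. h (q z)) \<in> borel_measurable borel"
    by (rule measurable_compose[OF q_meas]) simp
  have "(\<integral>\<^sup>+y. h (snd y) \<partial>step t (x, g)) = (\<integral>\<^sup>+x'. (\<integral>\<^sup>+y. h (q (snd y)) \<partial>K t (x, restrict x' {1..t})) \<partial>cell_law t g)"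
    using measurable_compose[OF measurable_snd, of h "count_space UNIV" borel borel]
    by (subst nn_integral_step[OF t x]) auto
  also have "\<dots> = (\<integral>\<^sup>+x'. (\<integral>\<^sup>+z. h (q z) \<partial>\<kappa> t (restrict x' {1..t})) \<partial>cell_law t g)"
  proof (rule nn_integral_cong)
    fix x' assume "x' \<in> space (cell_law t g)"
    then have x': "restrict x' {1..t} \<in> space (path_space t)" using t by (intro cell_law_restrict) auto
    from K_couplings[OF t x this]
    show "(\<integral>\<^sup>+y. h (q (snd y)) \<partial>K t (x, restrict x' {1..t})) = (\<integral>\<^sup>+z. h (q z) \<partial>\<kappa> t (restrict x' {1..t}))"
      by (rule couplings_nn_integral_snd[where f = "\<lambda>z. h (q z)"])
        (simp add: measurable_cong_sets[OF kernel_sets[OF \<kappa>[OF t] x'] refl] h)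
  qed
  finally show ?thesis .
qed

definition next_cell :: "nat \<Rightarrow> nat list \<Rightarrow> nat \<Rightarrow> ennreal" where
  "next_cell t g j = (\<integral>\<^sup>+x'. (\<integral>\<^sup>+z. indicator {j} (q z) \<partial>\<kappa> t (restrict x' {1..t})) \<partial>cell_law t g)"

lemma nn_integral_disint:
  assumes t: "t < T" and F: "F \<in> borel_measurable (path_space t \<Otimes>\<^sub>M borel)"
  shows "(\<integral>\<^sup>+x. (\<integral>\<^sup>+z. F (restrict x {1..t}, z) \<partial>\<kappa> t (restrict x {1..t})) \<partial>\<gamma>) = (\<integral>\<^sup>+x. F (restrict x {1..t}, x (Suc t)) \<partial>\<gamma>)"
  using disintegrates_nn_integral[OF disint[OF t] F] by simp

text \<open>Identifies \<open>next_cell\<close> as the transition probability of the cell sequence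
  of a \<gamma>-path; in product form this holds for null cells too.\<close>

lemma cell_Suc:
  assumes t: "t < T"
  shows "emeasure \<gamma> (cell (Suc t) (j # g)) = emeasure \<gamma> (cell t g) * next_cell t g j"
proof -
  have [measurable]: "(\<lambda>z. indicator {j} (q z) :: ennreal) \<in> borel_measurable borel"
    by (rule measurable_compose[OF q_meas]) simp
  have Q[measurable]: "(\<lambda>x. indicator {g} (qlist q t x) :: ennreal) \<in> borel_measurable (path_space t)"
    by (rule measurable_compose[OF measurable_qlist[OF q_meas order_refl]]) simp
  note [measurable] = \<kappa>[OF t] restrict_meas[OF less_imp_le[OF t]]
  have "emeasure \<gamma> (cell t g) * next_cell t g j
    = (\<integral>\<^sup>+x. (\<integral>\<^sup>+z. indicator {j} (q z) \<partial>\<kappa> t (restrict x {1..t})) * indicator {g} (qlist q t x) \<partial>\<gamma>)"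
    unfolding next_cell_def using t by (intro nn_integral_cell_law) auto
  also have "\<dots> = (\<integral>\<^sup>+x. (\<integral>\<^sup>+z. indicator {j} (q z) * indicator {g} (qlist q t (restrict x {1..t})) \<partial>\<kappa> t (restrict x {1..t})) \<partial>\<gamma>)"
  proof (rule nn_integral_cong)
    fix x assume "x \<in> space \<gamma>"
    then have x: "restrict x {1..t} \<in> space (path_space t)"
      using t by (intro measurable_space[OF restrict_meas]) auto
    show "(\<integral>\<^sup>+z. indicator {j} (q z) \<partial>\<kappa> t (restrict x {1..t})) * indicator {g} (qlist q t x)
      = (\<integral>\<^sup>+z. indicator {j} (q z) * indicator {g} (qlist q t (restrict x {1..t})) \<partial>\<kappa> t (restrict x {1..t}))"
      by (subst nn_integral_multc) (simp_all add: measurable_cong_sets[OF kernel_sets[OF \<kappa>[OF t] x] refl] qlist_restrict del: One_nat_def)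
  qed
  also have "\<dots> = (\<integral>\<^sup>+x. indicator {j} (q (x (Suc t))) * indicator {g} (qlist q t (restrict x {1..t})) \<partial>\<gamma>)"
    using nn_integral_disint[OF t, of "\<lambda>(x, z). indicator {j} (q z) * indicator {g} (qlist q t x)"] by simp
  also have "\<dots> = (\<integral>\<^sup>+x. indicator (cell (Suc t) (j # g)) x \<partial>\<gamma>)"
    by (intro nn_integral_cong) (auto simp: cell_def qlist_restrict indicator_def simp del: One_nat_def)
  also have "\<dots> = emeasure \<gamma> (cell (Suc t) (j # g))"
    using t by (intro nn_integral_indicator sets_cell) auto
  finally show ?thesis by simp
qed

definition extend :: "nat \<Rightarrow> (nat \<Rightarrow> real^'d) \<times> nat list \<Rightarrow> (real^'d) \<times> nat \<Rightarrow> (nat \<Rightarrow> real^'d) \<times> nat list" where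
  "extend t s y = ((fst s)(Suc t := fst y), snd y # snd s)"

lemma measurable_extend [measurable (raw)]:
  assumes [measurable]: "f \<in> M \<rightarrow>\<^sub>M states t" "g \<in> M \<rightarrow>\<^sub>M borel \<Otimes>\<^sub>M count_space UNIV"
  shows "(\<lambda>x. extend t (f x) (g x)) \<in> M \<rightarrow>\<^sub>M states (Suc t)"
  unfolding extend_def by measurable

primrec chain :: "nat \<Rightarrow> ((nat \<Rightarrow> real^'d) \<times> nat list) measure" where
  "chain 0 = return (states 0) (\<lambda>_. undefined, [])"
| "chain (Suc t) = chain t \<bind> (\<lambda>s. distr (step t s) (states (Suc t)) (extend t s))"

lemma chain_step_kernel: "t < T \<Longrightarrow> (\<lambda>s. distr (step t s) (states (Suc t)) (extend t s)) \<in> states t \<rightarrow>\<^sub>M prob_algebra (states (Suc t))"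
  using step_kernel[measurable] by measurable

lemma chain_space: "t \<le> T \<Longrightarrow> chain t \<in> space (prob_algebra (states t))"
proof (induction t)
  case 0
  have "(\<lambda>_. undefined, []) \<in> space (states 0)" by (simp add: space_pair_measure space_path_0)
  from measurable_space[OF measurable_return_prob_space this] show ?case by simp
next
  case (Suc t)
  then have "chain t \<in> space (prob_algebra (states t))" by simp
  from measurable_space[OF measurable_bind_prob_space[OF measurable_const[OF this] chain_step_kernel], of "()" "count_space UNIV"] Suc
  show ?case by simp
qed

lemma nn_integral_chain_Suc:
  assumes t: "t < T" and F[measurable]: "F \<in> borel_measurable (states (Suc t))"
  shows "(\<integral>\<^sup>+s. F s \<partial>chain (Suc t)) = (\<integral>\<^sup>+s. (\<integral>\<^sup>+y. F (extend t s y) \<partial>step t s) \<partial>chain t)"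
proof -
  have C: "chain t \<in> space (prob_algebra (states t))" using t by (simp add: chain_space)
  have "(\<integral>\<^sup>+s. F s \<partial>chain (Suc t)) = (\<integral>\<^sup>+s. (\<integral>\<^sup>+y. F y \<partial>distr (step t s) (states (Suc t)) (extend t s)) \<partial>chain t)"
    unfolding chain.simps by (rule nn_integral_bind_prob[OF C chain_step_kernel[OF t] F])
  also have "\<dots> = (\<integral>\<^sup>+s. (\<integral>\<^sup>+y. F (extend t s y) \<partial>step t s) \<partial>chain t)"
  proof (rule nn_integral_cong)
    fix s assume "s \<in> space (chain t)"
    then have s[measurable]: "s \<in> space (states t)" using C by (auto simp: space_prob_algebra dest!: sets_eq_imp_space_eq)
    from measurable_space[OF step_kernel[OF t] s]
    show "(\<integral>\<^sup>+y. F y \<partial>distr (step t s) (states (Suc t)) (extend t s)) = (\<integral>\<^sup>+y. F (extend t s y) \<partial>step t s)"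
      by (rule nn_integral_distr_kernel) measurable
  qed
  finally show ?thesis .
qed

lemma sets_chain: "t \<le> T \<Longrightarrow> sets (chain t) = sets (states t)"
  using chain_space[of t] by (simp add: space_prob_algebra)

lemma space_chain: "t \<le> T \<Longrightarrow> space (chain t) = space (path_space t) \<times> UNIV"
  using sets_eq_imp_space_eq[OF sets_chain] by (simp add: space_pair_measure)

text \<open>By \<open>nn_integral_step_fst\<close> every step extends the path by the conditional
  law of \<gamma>, so the first component reproduces \<gamma> coordinate by coordinate.\<close>

lemma nn_integral_chain_fst:
  assumes "t \<le> T" "f \<in> borel_measurable (path_space t)"
  shows "(\<integral>\<^sup>+s. f (fst s) \<partial>chain t) = (\<integral>\<^sup>+x. f (restrict x {1..t}) \<partial>\<gamma>)"
  using assms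
proof (induction t arbitrary: f)
  case 0
  note [measurable] = \<open>f \<in> _\<close>
  have [measurable]: "(\<lambda>s. f (fst s)) \<in> borel_measurable (states 0)" by measurable
  have "(\<integral>\<^sup>+s. f (fst s) \<partial>chain 0) = f (\<lambda>_. undefined)"
    unfolding chain.simps by (subst nn_integral_return) (auto simp: space_pair_measure space_path_0)
  also have "\<dots> = (\<integral>\<^sup>+x. f (restrict x {1..0}) \<partial>\<gamma>)" by (simp add: restrict_def emeasure_space_1)
  finally show ?case .
next
  case (Suc t)
  then have t: "t < T" by simp
  note [measurable] = \<open>f \<in> _\<close> \<kappa>[OF t]
  have "(\<integral>\<^sup>+s. f (fst s) \<partial>chain (Suc t)) = (\<integral>\<^sup>+s. (\<integral>\<^sup>+y. f ((fst s)(Suc t := fst y)) \<partial>step t s) \<partial>chain t)"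
    by (subst nn_integral_chain_Suc[OF t]) (auto simp: extend_def)
  also have "\<dots> = (\<integral>\<^sup>+s. (\<integral>\<^sup>+z. f ((fst s)(Suc t := z)) \<partial>\<kappa> t (fst s)) \<partial>chain t)"
  proof (rule nn_integral_cong)
    fix s assume "s \<in> space (chain t)"
    then obtain x g where s: "s = (x, g)" and x[measurable]: "x \<in> space (path_space t)" using t by (auto simp: space_chain)
    show "(\<integral>\<^sup>+y. f ((fst s)(Suc t := fst y)) \<partial>step t s) = (\<integral>\<^sup>+z. f ((fst s)(Suc t := z)) \<partial>\<kappa> t (fst s))"
      unfolding s fst_conv by (rule nn_integral_step_fst[OF t x]) measurable
  qed
  also have "\<dots> = (\<integral>\<^sup>+x. (\<integral>\<^sup>+z. f ((restrict x {1..t})(Suc t := z)) \<partial>\<kappa> t (restrict x {1..t})) \<partial>\<gamma>)"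
  proof (rule Suc.IH)
    show "(\<lambda>x. \<integral>\<^sup>+z. f (x(Suc t := z)) \<partial>\<kappa> t x) \<in> borel_measurable (path_space t)" by measurable
  qed (use t in simp)
  also have "\<dots> = (\<integral>\<^sup>+x. f (restrict x {1..Suc t}) \<partial>\<gamma>)"
    unfolding restrict_path_Suc using nn_integral_disint[OF t, of "\<lambda>(x, z). f (x(Suc t := z))"] by simp
  finally show ?case .
qed

text \<open>The second component is not the cell list of the first one, yet has the law of the cell
  list of a \<gamma>-path: the next cell is that of a path conditioned on the current cells, and
  \<open>nn_integral_cell_mixture\<close> undoes the conditioning.\<close>

lemma nn_integral_chain_snd:
  assumes "t \<le> T"
  shows "(\<integral>\<^sup>+s. h (snd s) \<partial>chain t) = (\<integral>\<^sup>+x. h (qlist q t x) \<partial>\<gamma>)"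
  using assms
proof (induction t arbitrary: h)
  case 0
  have [measurable]: "(\<lambda>s. h (snd s)) \<in> borel_measurable (states 0)" by measurable
  have "(\<integral>\<^sup>+s. h (snd s) \<partial>chain 0) = h []"
    unfolding chain.simps by (subst nn_integral_return) (auto simp: space_pair_measure space_path_0)
  then show ?case by (simp add: emeasure_space_1)
next
  case (Suc t)
  then have t: "t < T" by simp
  note [measurable] = \<kappa>[OF t] restrict_meas[OF less_imp_le[OF t]]
  have hm[measurable]: "(\<lambda>z. h (q z # g)) \<in> borel_measurable borel" for g
    by (rule measurable_compose[OF q_meas]) simp
  define F where "F g x' = (\<integral>\<^sup>+z. h (q z # g) \<partial>\<kappa> t (restrict x' {1..t}))" for g x'
  have F[measurable]: "F g \<in> borel_measurable \<gamma>" for g unfolding F_def by measurable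
  have "(\<integral>\<^sup>+s. h (snd s) \<partial>chain (Suc t)) = (\<integral>\<^sup>+s. (\<integral>\<^sup>+y. h (snd y # snd s) \<partial>step t s) \<partial>chain t)"
    by (subst nn_integral_chain_Suc[OF t]) (auto simp: extend_def intro: measurable_compose[OF measurable_snd])
  also have "\<dots> = (\<integral>\<^sup>+s. (\<integral>\<^sup>+x'. F (snd s) x' \<partial>cell_law t (snd s)) \<partial>chain t)"
    unfolding F_def using t by (intro nn_integral_cong)
      (auto simp: space_chain nn_integral_step_snd[OF t, where h = "\<lambda>j. h (j # _)"])
  also have "\<dots> = (\<integral>\<^sup>+x. (\<integral>\<^sup>+x'. F (qlist q t x) x' \<partial>cell_law t (qlist q t x)) \<partial>\<gamma>)"
    using t Suc.IH[of "\<lambda>g. \<integral>\<^sup>+x'. F g x' \<partial>cell_law t g"] by simp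
  also have "\<dots> = (\<integral>\<^sup>+x. F (qlist q t x) x \<partial>\<gamma>)"
    using t by (intro nn_integral_cell_mixture F) auto
  also have "\<dots> = (\<integral>\<^sup>+x. h (qlist q (Suc t) x) \<partial>\<gamma>)"
  proof -
    have m: "(\<lambda>x. q (snd x) # qlist q t (fst x)) \<in> path_space t \<Otimes>\<^sub>M borel \<rightarrow>\<^sub>M count_space UNIV"
      using measurable_qlist[OF q_meas order_refl, of t] by measurable
    have "(\<lambda>x. h (q (snd x) # qlist q t (fst x))) \<in> borel_measurable (path_space t \<Otimes>\<^sub>M borel)"
      using measurable_compose[OF m, of h borel] by simp
    from nn_integral_disint[OF t this] show ?thesis
      by (simp add: F_def qlist_restrict del: One_nat_def)
  qed
  finally show ?case .
qed

text \<open>Later steps are probability kernels that leave the earlier coordinates and cells in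
  place. All times can therefore be studied on the one space of \<open>chain T\<close>.\<close>

lemma nn_integral_chain_prefix:
  assumes "t \<le> n" "n \<le> T" and F: "F \<in> borel_measurable (states t)"
  shows "(\<integral>\<^sup>+s. F (restrict (fst s) {1..t}, drop (n - t) (snd s)) \<partial>chain n) = (\<integral>\<^sup>+s. F s \<partial>chain t)"
  using assms(1,2)
proof (induction n rule: dec_induct)
  case base
  then show ?case
  proof (intro nn_integral_cong)
    fix s assume "s \<in> space (chain t)"
    then have "fst s \<in> space (path_space t)" using base by (auto simp: space_chain)
    then show "F (restrict (fst s) {1..t}, drop (t - t) (snd s)) = F s"
      by (simp only: restrict_path_id diff_self_eq_0 drop_0 prod.collapse)
  qed
next
  case (step n)
  then have n: "n < T" by simp
  note [measurable] = F measurable_restrict_path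
  have [measurable]: "(\<lambda>s. drop k (snd s)) \<in> states m \<rightarrow>\<^sub>M count_space UNIV" for k m
    by (rule measurable_compose[OF measurable_snd]) simp
  have "(\<lambda>s. restrict (fst s) {1..t}) \<in> states (Suc n) \<rightarrow>\<^sub>M path_space t"
    using step by (intro measurable_compose[OF measurable_fst measurable_restrict_path]) auto
  then have "(\<lambda>s. F (restrict (fst s) {1..t}, drop (Suc n - t) (snd s))) \<in> borel_measurable (states (Suc n))"
    by measurable
  then have "(\<integral>\<^sup>+s. F (restrict (fst s) {1..t}, drop (Suc n - t) (snd s)) \<partial>chain (Suc n))
    = (\<integral>\<^sup>+s. (\<integral>\<^sup>+y. F (restrict (fst (extend n s y)) {1..t}, drop (Suc n - t) (snd (extend n s y))) \<partial>local.step n s) \<partial>chain n)"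
    by (rule nn_integral_chain_Suc[OF n])
  also have "\<dots> = (\<integral>\<^sup>+s. F (restrict (fst s) {1..t}, drop (n - t) (snd s)) \<partial>chain n)"
  proof (rule nn_integral_cong)
    fix s assume "s \<in> space (chain n)"
    then have s: "s \<in> space (states n)" using n by (simp add: space_chain space_pair_measure)
    have "restrict (fst (extend n s y)) {1..t} = restrict (fst s) {1..t}" for y
      using \<open>t \<le> n\<close> by (auto simp: extend_def restrict_def fun_eq_iff)
    moreover have "drop (Suc n - t) (snd (extend n s y)) = drop (n - t) (snd s)" for y
      using \<open>t \<le> n\<close> by (simp add: extend_def Suc_diff_le)
    ultimately show "(\<integral>\<^sup>+y. F (restrict (fst (extend n s y)) {1..t}, drop (Suc n - t) (snd (extend n s y))) \<partial>local.step n s)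
      = F (restrict (fst s) {1..t}, drop (n - t) (snd s))"
      using prob_space.emeasure_space_1[OF kernel_prob[OF step_kernel[OF n] s]] by simp
  qed
  also have "\<dots> = (\<integral>\<^sup>+s. F s \<partial>chain t)" using n by (intro step.IH) simp
  finally show ?case .
qed

end

section \<open>The bicausal coupling\<close>

text \<open>The hypothesis expresses that the conditional probability of \<open>V \<in> B\<close>
  given \<open>U\<close> and \<open>Z\<close> is a function \<open>k\<close> of \<open>Z\<close>
  alone. With the whole space for \<open>A\<close> it identifies \<open>k\<close> as the conditional
  probability given \<open>Z\<close>; being measurable with respect to \<open>Z\<close>, this factor
  can be pulled out of the conditional expectation of the joint event.\<close>

lemma cond_indepI:
  assumes "prob_space M" and [measurable]: "U \<in> M \<rightarrow>\<^sub>M MU" "V \<in> M \<rightarrow>\<^sub>M MV" "Z \<in> M \<rightarrow>\<^sub>M MZ"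
    and k: "\<And>B. B \<in> sets MV \<Longrightarrow> \<exists>k\<in>borel_measurable MZ. (\<forall>z. k z \<le> (1::ennreal)) \<and>
      (\<forall>A\<in>sets MU. \<forall>D\<in>sets MZ. (\<integral>\<^sup>+\<omega>. indicator A (U \<omega>) * indicator D (Z \<omega>) * indicator B (V \<omega>) \<partial>M) =
         (\<integral>\<^sup>+\<omega>. indicator A (U \<omega>) * indicator D (Z \<omega>) * k (Z \<omega>) \<partial>M))"
  shows "cond_indep M MU U MV V MZ Z"
  unfolding cond_indep_def
proof (intro ballI)
  interpret prob_space M by fact
  fix A B assume A[measurable]: "A \<in> sets MU" and B[measurable]: "B \<in> sets MV"
  define F where "F = vimage_algebra (space M) Z MZ"
  have sets_F: "sets F = {Z -` D \<inter> space M | D. D \<in> sets MZ}"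
    unfolding F_def using measurable_space[of Z M MZ] by (intro sets_vimage_algebra2) auto
  have space_F: "space F = space M" by (simp add: F_def)
  have "subalgebra M F"
    unfolding subalgebra_def using space_F by (auto simp: sets_F)
  then interpret finite_measure_subalgebra M F by unfold_locales
  have ZF: "Z \<in> F \<rightarrow>\<^sub>M MZ"
    unfolding F_def using measurable_space[of Z M MZ] by (intro measurable_vimage_algebra1) auto
  from k[OF B] obtain k where k_meas[measurable]: "k \<in> borel_measurable MZ" and k1: "\<And>z. k z \<le> 1"
    and keq: "\<And>A D. A \<in> sets MU \<Longrightarrow> D \<in> sets MZ \<Longrightarrow> (\<integral>\<^sup>+\<omega>. indicator A (U \<omega>) * indicator D (Z \<omega>) * indicator B (V \<omega>) \<partial>M) =
         (\<integral>\<^sup>+\<omega>. indicator A (U \<omega>) * indicator D (Z \<omega>) * k (Z \<omega>) \<partial>M)" by blast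
  define kr where "kr \<omega> = enn2real (k (Z \<omega>))" for \<omega>
  have kr_F[measurable]: "kr \<in> borel_measurable F"
    unfolding kr_def using ZF by measurable
  have kr_M[measurable]: "kr \<in> borel_measurable M" unfolding kr_def by measurable
  have kr01: "0 \<le> kr \<omega>" "kr \<omega> \<le> 1" for \<omega>
    using enn2real_leI[of 1 "k (Z \<omega>)"] k1 by (auto simp: kr_def)
  have kr_enn: "ennreal (kr \<omega>) = k (Z \<omega>)" for \<omega>
    unfolding kr_def using le_less_trans[OF k1 ennreal_one_less_top] by (simp add: less_top[symmetric])
  have int[simp]: "integrable M f" if [measurable]: "f \<in> borel_measurable M" and "\<And>\<omega>. 0 \<le> f \<omega>" "\<And>\<omega>. f \<omega> \<le> 1" for f :: "_ \<Rightarrow> real"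
    using that by (intro integrable_const_bound[of _ 1]) auto
  let ?IA = "\<lambda>\<omega>. indicator A (U \<omega>) :: real" and ?IB = "\<lambda>\<omega>. indicator B (V \<omega>) :: real"
  have key: "(\<integral>\<omega>. indicator A' (U \<omega>) * indicator D (Z \<omega>) * ?IB \<omega> \<partial>M) = (\<integral>\<omega>. indicator A' (U \<omega>) * indicator D (Z \<omega>) * kr \<omega> \<partial>M)"
    if [measurable]: "A' \<in> sets MU" "D \<in> sets MZ" for A' D
  proof -
    have "(\<integral>\<omega>. indicator A' (U \<omega>) * indicator D (Z \<omega>) * ?IB \<omega> \<partial>M)
      = enn2real (\<integral>\<^sup>+\<omega>. indicator A' (U \<omega>) * indicator D (Z \<omega>) * indicator B (V \<omega>) \<partial>M)"
      by (subst integral_eq_nn_integral) (auto intro!: arg_cong[where f = enn2real] nn_integral_cong simp: indicator_def)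
    also have "\<dots> = enn2real (\<integral>\<^sup>+\<omega>. indicator A' (U \<omega>) * indicator D (Z \<omega>) * ennreal (kr \<omega>) \<partial>M)"
      by (simp add: keq[OF that] kr_enn)
    also have "\<dots> = (\<integral>\<omega>. indicator A' (U \<omega>) * indicator D (Z \<omega>) * kr \<omega> \<partial>M)"
      using kr01 by (subst integral_eq_nn_integral) (auto intro!: arg_cong[where f = enn2real] nn_integral_cong simp: indicator_def)
    finally show ?thesis .
  qed
  have condB: "AE \<omega> in M. real_cond_exp M F ?IB \<omega> = kr \<omega>"
  proof (rule real_cond_exp_charact)
    fix E assume "E \<in> sets F"
    then obtain D where E: "E = Z -` D \<inter> space M" and D[measurable]: "D \<in> sets MZ" by (auto simp: sets_F)
    have top[measurable]: "space MU \<in> sets MU" by simp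
    have ind: "indicator (space MU) (U \<omega>) = (1::real)" "indicator E \<omega> = (indicator D (Z \<omega>) :: real)" if "\<omega> \<in> space M" for \<omega>
      using measurable_space[of U M MU \<omega>] that by (auto simp: E indicator_def)
    have "(LINT \<omega>:E|M. ?IB \<omega>) = (\<integral>\<omega>. indicator (space MU) (U \<omega>) * indicator D (Z \<omega>) * ?IB \<omega> \<partial>M)"
      unfolding set_lebesgue_integral_def by (intro Bochner_Integration.integral_cong) (auto simp: ind)
    also have "\<dots> = (LINT \<omega>:E|M. kr \<omega>)"
      unfolding key[OF top D] set_lebesgue_integral_def by (intro Bochner_Integration.integral_cong) (auto simp: ind)
    finally show "(LINT \<omega>:E|M. ?IB \<omega>) = (LINT \<omega>:E|M. kr \<omega>)" .
  qed (auto simp: kr01 indicator_def)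
  have condAB: "AE \<omega> in M. real_cond_exp M F (\<lambda>\<omega>. ?IA \<omega> * ?IB \<omega>) \<omega> = real_cond_exp M F (\<lambda>\<omega>. kr \<omega> * ?IA \<omega>) \<omega>"
  proof (rule real_cond_exp_charact)
    have int': "integrable M (\<lambda>\<omega>. kr \<omega> * ?IA \<omega>)" using kr01 by (intro int) (auto simp: indicator_def)
    then show "integrable M (real_cond_exp M F (\<lambda>\<omega>. kr \<omega> * ?IA \<omega>))" by (rule real_cond_exp_int(1))
    fix E assume EF: "E \<in> sets F"
    then obtain D where E: "E = Z -` D \<inter> space M" and D[measurable]: "D \<in> sets MZ" by (auto simp: sets_F)
    have ind: "indicator E \<omega> = (indicator D (Z \<omega>) :: real)" if "\<omega> \<in> space M" for \<omega>
      using that by (auto simp: E indicator_def)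
    have "(LINT \<omega>:E|M. ?IA \<omega> * ?IB \<omega>) = (\<integral>\<omega>. ?IA \<omega> * indicator D (Z \<omega>) * ?IB \<omega> \<partial>M)"
      unfolding set_lebesgue_integral_def by (intro Bochner_Integration.integral_cong) (auto simp: ind)
    also have "\<dots> = (LINT \<omega>:E|M. kr \<omega> * ?IA \<omega>)"
      unfolding key[OF A D] set_lebesgue_integral_def by (intro Bochner_Integration.integral_cong) (auto simp: ind)
    also have "\<dots> = (LINT \<omega>:E|M. real_cond_exp M F (\<lambda>\<omega>. kr \<omega> * ?IA \<omega>) \<omega>)"
      by (rule real_cond_exp_intA[OF int' EF])
    finally show "(LINT \<omega>:E|M. ?IA \<omega> * ?IB \<omega>) = (LINT \<omega>:E|M. real_cond_exp M F (\<lambda>\<omega>. kr \<omega> * ?IA \<omega>) \<omega>)" .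
  qed (auto simp: indicator_def)
  have "AE \<omega> in M. real_cond_exp M F (\<lambda>\<omega>. kr \<omega> * ?IA \<omega>) \<omega> = kr \<omega> * real_cond_exp M F ?IA \<omega>"
    using kr01 by (intro real_cond_exp_mult) (auto simp: indicator_def)
  with condAB condB have AE: "AE \<omega> in M. real_cond_exp M F (\<lambda>\<omega>. ?IA \<omega> * ?IB \<omega>) \<omega> = real_cond_exp M F ?IA \<omega> * real_cond_exp M F ?IB \<omega>"
    by eventually_elim simp
  have cong: "AE \<omega> in M. real_cond_exp M F f \<omega> = real_cond_exp M F g \<omega>"
    if "\<And>\<omega>. \<omega> \<in> space M \<Longrightarrow> f \<omega> = g \<omega>" "f \<in> borel_measurable M" "g \<in> borel_measurable M" for f g
    using that by (intro real_cond_exp_cong) auto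
  have "AE \<omega> in M. real_cond_exp M F (indicator {\<omega>'\<in>space M. U \<omega>' \<in> A \<and> V \<omega>' \<in> B}) \<omega> = real_cond_exp M F (\<lambda>\<omega>. ?IA \<omega> * ?IB \<omega>) \<omega>"
    "AE \<omega> in M. real_cond_exp M F (indicator {\<omega>'\<in>space M. U \<omega>' \<in> A}) \<omega> = real_cond_exp M F ?IA \<omega>"
    "AE \<omega> in M. real_cond_exp M F (indicator {\<omega>'\<in>space M. V \<omega>' \<in> B}) \<omega> = real_cond_exp M F ?IB \<omega>"
    by (rule cong; auto simp: indicator_def)+
  with AE show "AE \<omega> in M. cond_prob_given M MZ Z {\<omega>'\<in>space M. U \<omega>' \<in> A \<and> V \<omega>' \<in> B} \<omega> =
        cond_prob_given M MZ Z {\<omega>'\<in>space M. U \<omega>' \<in> A} \<omega> *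
        cond_prob_given M MZ Z {\<omega>'\<in>space M. V \<omega>' \<in> B} \<omega>"
    unfolding cond_prob_given_def F_def by eventually_elim simp
qed

text \<open>One-step causality gives causality with respect to the whole future: a function of
  \<open>X\<close> up to time \<open>n\<close> is averaged against \<kappa>, one coordinate at a
  time, until it depends on the first \<open>t\<close> coordinates only. The weight \<psi> of both
  pasts stays untouched, since it does not see the coordinates after \<open>t\<close>.\<close>

lemma causal_cond_indep:
  fixes X Y :: "'w \<Rightarrow> nat \<Rightarrow> real^'d"
  assumes \<Omega>: "prob_space \<Omega>" and X[measurable]: "X \<in> \<Omega> \<rightarrow>\<^sub>M path_space T" and Y[measurable]: "Y \<in> \<Omega> \<rightarrow>\<^sub>M path_space T"
    and \<kappa>: "\<And>n. n < T \<Longrightarrow> \<kappa> n \<in> path_space n \<rightarrow>\<^sub>M prob_algebra borel"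
    and onestep: "\<And>n F. n < T \<Longrightarrow> F \<in> borel_measurable (path_space (Suc n) \<Otimes>\<^sub>M path_space n) \<Longrightarrow>
      (\<integral>\<^sup>+\<omega>. F (restrict (X \<omega>) {1..Suc n}, restrict (Y \<omega>) {1..n}) \<partial>\<Omega>) =
      (\<integral>\<^sup>+\<omega>. (\<integral>\<^sup>+z. F ((restrict (X \<omega>) {1..n})(Suc n := z), restrict (Y \<omega>) {1..n}) \<partial>\<kappa> n (restrict (X \<omega>) {1..n})) \<partial>\<Omega>)"
    and t: "t \<in> {1..<T}"
  shows "cond_indep \<Omega> (path_space t) (\<lambda>\<omega>. restrict (Y \<omega>) {1..t})
     (PiM {Suc t..T} (\<lambda>_. borel)) (\<lambda>\<omega>. restrict (X \<omega>) {Suc t..T})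
     (path_space t) (\<lambda>\<omega>. restrict (X \<omega>) {1..t})"
proof -
  interpret prob_space \<Omega> by fact
  have Xr[measurable]: "(\<lambda>\<omega>. restrict (X \<omega>) {1..n}) \<in> \<Omega> \<rightarrow>\<^sub>M path_space n" if "n \<le> T" for n
    using measurable_compose[OF X measurable_restrict_path[OF that]] .
  have Yr[measurable]: "(\<lambda>\<omega>. restrict (Y \<omega>) {1..n}) \<in> \<Omega> \<rightarrow>\<^sub>M path_space n" if "n \<le> T" for n
    using measurable_compose[OF Y measurable_restrict_path[OF that]] .
  have main: "\<exists>k\<in>borel_measurable (path_space t). (\<forall>x. k x \<le> 1) \<and>
     (\<forall>\<psi>\<in>borel_measurable (path_space t \<Otimes>\<^sub>M path_space t).
       (\<integral>\<^sup>+\<omega>. \<phi> (restrict (X \<omega>) {1..n}) * \<psi> (restrict (X \<omega>) {1..t}, restrict (Y \<omega>) {1..t}) \<partial>\<Omega>) =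
       (\<integral>\<^sup>+\<omega>. k (restrict (X \<omega>) {1..t}) * \<psi> (restrict (X \<omega>) {1..t}, restrict (Y \<omega>) {1..t}) \<partial>\<Omega>))"
    if "t \<le> n" "n \<le> T" "\<phi> \<in> borel_measurable (path_space n)" "\<forall>x. \<phi> x \<le> 1" for n and \<phi> :: "_ \<Rightarrow> ennreal"
    using that
  proof (induction n arbitrary: \<phi> rule: dec_induct)
    case base
    then show ?case by (intro bexI[of _ \<phi>]) auto
  next
    case (step n)
    then have n: "n < T" by simp
    note [measurable] = \<open>\<phi> \<in> _\<close> \<kappa>[OF n]
    \<comment> \<open>The bound by 1 is claimed for all arguments; the minimum enforces it outside
      \<open>path_space n\<close>, where \<kappa> need not be a probability measure.\<close>
    define \<phi>' where "\<phi>' x = min 1 (\<integral>\<^sup>+z. \<phi> (x(Suc n := z)) \<partial>\<kappa> n x)" for x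
    have \<phi>'_eq: "\<phi>' x = (\<integral>\<^sup>+z. \<phi> (x(Suc n := z)) \<partial>\<kappa> n x)" if "x \<in> space (path_space n)" for x
    proof -
      have "(\<integral>\<^sup>+z. \<phi> (x(Suc n := z)) \<partial>\<kappa> n x) \<le> (\<integral>\<^sup>+z. 1 \<partial>\<kappa> n x)"
        using step.prems by (intro nn_integral_mono) auto
      then show ?thesis using prob_space.emeasure_space_1[OF kernel_prob[OF \<kappa>[OF n] that]]
        by (simp add: \<phi>'_def min_def)
    qed
    have "\<phi>' \<in> borel_measurable (path_space n)" "\<forall>x. \<phi>' x \<le> 1" unfolding \<phi>'_def by simp_all
    from step.IH[OF less_imp_le[OF n] this] obtain k where k: "k \<in> borel_measurable (path_space t)" "\<forall>x. k x \<le> 1"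
      and keq: "\<And>\<psi>. \<psi> \<in> borel_measurable (path_space t \<Otimes>\<^sub>M path_space t) \<Longrightarrow>
       (\<integral>\<^sup>+\<omega>. \<phi>' (restrict (X \<omega>) {1..n}) * \<psi> (restrict (X \<omega>) {1..t}, restrict (Y \<omega>) {1..t}) \<partial>\<Omega>) =
       (\<integral>\<^sup>+\<omega>. k (restrict (X \<omega>) {1..t}) * \<psi> (restrict (X \<omega>) {1..t}, restrict (Y \<omega>) {1..t}) \<partial>\<Omega>)"
      by blast
    show ?case
    proof (intro bexI[OF _ k(1)] conjI k(2) ballI)
      fix \<psi> :: "(nat \<Rightarrow> real^'d) \<times> (nat \<Rightarrow> real^'d) \<Rightarrow> ennreal" assume \<psi>[measurable]: "\<psi> \<in> borel_measurable (path_space t \<Otimes>\<^sub>M path_space t)"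
      have rt: "restrict (restrict x {1..Suc n}) {1..t} = restrict x {1..t}" "restrict (restrict x {1..n}) {1..t} = restrict x {1..t}"
        "restrict ((restrict x {1..n})(Suc n := z)) {1..t} = restrict x {1..t}" for x :: "nat \<Rightarrow> real^'d" and z
        using \<open>t \<le> n\<close> by (auto simp: fun_eq_iff)
      have [measurable]: "(\<lambda>x. restrict x {1..t}) \<in> path_space (Suc n) \<rightarrow>\<^sub>M path_space t" "(\<lambda>x. restrict x {1..t}) \<in> path_space n \<rightarrow>\<^sub>M path_space t"
        using \<open>t \<le> n\<close> by (intro measurable_restrict_path; simp)+
      have m: "(\<lambda>(x, y). \<phi> x * \<psi> (restrict x {1..t}, restrict y {1..t})) \<in> borel_measurable (path_space (Suc n) \<Otimes>\<^sub>M path_space n)"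
        by measurable
      have "(\<integral>\<^sup>+\<omega>. \<phi> (restrict (X \<omega>) {1..Suc n}) * \<psi> (restrict (X \<omega>) {1..t}, restrict (Y \<omega>) {1..t}) \<partial>\<Omega>)
        = (\<integral>\<^sup>+\<omega>. (\<integral>\<^sup>+z. \<phi> ((restrict (X \<omega>) {1..n})(Suc n := z)) * \<psi> (restrict (X \<omega>) {1..t}, restrict (Y \<omega>) {1..t}) \<partial>\<kappa> n (restrict (X \<omega>) {1..n})) \<partial>\<Omega>)"
        using onestep[OF n m] by (simp only: rt prod.case)
      also have "\<dots> = (\<integral>\<^sup>+\<omega>. \<phi>' (restrict (X \<omega>) {1..n}) * \<psi> (restrict (X \<omega>) {1..t}, restrict (Y \<omega>) {1..t}) \<partial>\<Omega>)"
      proof (rule nn_integral_cong)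
        fix \<omega> assume "\<omega> \<in> space \<Omega>"
        then have x[measurable]: "restrict (X \<omega>) {1..n} \<in> space (path_space n)"
          using n by (intro measurable_space[OF Xr]) auto
        note [measurable_cong] = kernel_sets[OF \<kappa>[OF n] x]
        show "(\<integral>\<^sup>+z. \<phi> ((restrict (X \<omega>) {1..n})(Suc n := z)) * \<psi> (restrict (X \<omega>) {1..t}, restrict (Y \<omega>) {1..t}) \<partial>\<kappa> n (restrict (X \<omega>) {1..n}))
          = \<phi>' (restrict (X \<omega>) {1..n}) * \<psi> (restrict (X \<omega>) {1..t}, restrict (Y \<omega>) {1..t})"
          unfolding \<phi>'_eq[OF x] by (rule nn_integral_multc) measurable
      qed
      also have "\<dots> = (\<integral>\<^sup>+\<omega>. k (restrict (X \<omega>) {1..t}) * \<psi> (restrict (X \<omega>) {1..t}, restrict (Y \<omega>) {1..t}) \<partial>\<Omega>)"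
        by (rule keq[OF \<psi>])
      finally show "(\<integral>\<^sup>+\<omega>. \<phi> (restrict (X \<omega>) {1..Suc n}) * \<psi> (restrict (X \<omega>) {1..t}, restrict (Y \<omega>) {1..t}) \<partial>\<Omega>)
        = (\<integral>\<^sup>+\<omega>. k (restrict (X \<omega>) {1..t}) * \<psi> (restrict (X \<omega>) {1..t}, restrict (Y \<omega>) {1..t}) \<partial>\<Omega>)" .
    qed
  qed
  have fut: "(\<lambda>x. restrict x {Suc t..T}) \<in> path_space T \<rightarrow>\<^sub>M PiM {Suc t..T} (\<lambda>_. borel :: (real^'d) measure)"
    unfolding path_space_def by (rule measurable_restrict_subset) auto
  show ?thesis
  proof (rule cond_indepI[OF \<Omega>])
    show "(\<lambda>\<omega>. restrict (X \<omega>) {Suc t..T}) \<in> \<Omega> \<rightarrow>\<^sub>M PiM {Suc t..T} (\<lambda>_. borel)"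
      by (rule measurable_compose[OF X fut])
  next
    fix B assume [measurable]: "B \<in> sets (PiM {Suc t..T} (\<lambda>_. borel :: (real^'d) measure))"
    have ind: "(\<lambda>x. indicator B (restrict x {Suc t..T}) :: ennreal) \<in> borel_measurable (path_space T)"
      by (rule measurable_compose[OF fut]) simp
    have "t \<le> T" "\<forall>x. indicator B (restrict x {Suc t..T}) \<le> (1::ennreal)" using t by (auto simp: indicator_def)
    from main[OF this(1) order_refl ind this(2)] obtain k where k: "k \<in> borel_measurable (path_space t)" "\<forall>x. k x \<le> 1"
      and keq: "\<And>\<psi>. \<psi> \<in> borel_measurable (path_space t \<Otimes>\<^sub>M path_space t) \<Longrightarrow>
       (\<integral>\<^sup>+\<omega>. indicator B (restrict (restrict (X \<omega>) {1..T}) {Suc t..T}) * \<psi> (restrict (X \<omega>) {1..t}, restrict (Y \<omega>) {1..t}) \<partial>\<Omega>) =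
       (\<integral>\<^sup>+\<omega>. k (restrict (X \<omega>) {1..t}) * \<psi> (restrict (X \<omega>) {1..t}, restrict (Y \<omega>) {1..t}) \<partial>\<Omega>)"
      by blast
    have rr: "restrict (restrict x {1..T}) {Suc t..T} = restrict x {Suc t..T}" for x :: "nat \<Rightarrow> real^'d"
      by (auto simp: fun_eq_iff)
    show "\<exists>k\<in>borel_measurable (path_space t). (\<forall>z. k z \<le> (1::ennreal)) \<and>
      (\<forall>A\<in>sets (path_space t). \<forall>D\<in>sets (path_space t).
        (\<integral>\<^sup>+\<omega>. indicator A (restrict (Y \<omega>) {1..t}) * indicator D (restrict (X \<omega>) {1..t}) * indicator B (restrict (X \<omega>) {Suc t..T}) \<partial>\<Omega>) =
         (\<integral>\<^sup>+\<omega>. indicator A (restrict (Y \<omega>) {1..t}) * indicator D (restrict (X \<omega>) {1..t}) * k (restrict (X \<omega>) {1..t}) \<partial>\<Omega>))"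
    proof (intro bexI[OF _ k(1)] conjI k(2) ballI)
      fix A D :: "(nat \<Rightarrow> real^'d) set" assume [measurable]: "A \<in> sets (path_space t)" "D \<in> sets (path_space t)"
      show "(\<integral>\<^sup>+\<omega>. indicator A (restrict (Y \<omega>) {1..t}) * indicator D (restrict (X \<omega>) {1..t}) * indicator B (restrict (X \<omega>) {Suc t..T}) \<partial>\<Omega>) =
         (\<integral>\<^sup>+\<omega>. indicator A (restrict (Y \<omega>) {1..t}) * indicator D (restrict (X \<omega>) {1..t}) * k (restrict (X \<omega>) {1..t}) \<partial>\<Omega>)"
        using keq[of "\<lambda>(x, y). indicator A y * indicator D x"] by (simp add: rr mult.commute)
    qed
  next
    show "(\<lambda>\<omega>. restrict (Y \<omega>) {1..t}) \<in> \<Omega> \<rightarrow>\<^sub>M path_space t" "(\<lambda>\<omega>. restrict (X \<omega>) {1..t}) \<in> \<Omega> \<rightarrow>\<^sub>M path_space t"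
      using t by (auto intro!: Xr Yr simp del: One_nat_def)
  qed
qed

lemma measurable_count_Pair:
  fixes f :: "'a \<Rightarrow> 'i::countable" and g :: "'a \<Rightarrow> 'j"
  assumes "f \<in> M \<rightarrow>\<^sub>M count_space UNIV" "g \<in> M \<rightarrow>\<^sub>M count_space UNIV"
  shows "(\<lambda>x. (f x, g x)) \<in> M \<rightarrow>\<^sub>M count_space UNIV"
proof -
  have "(\<lambda>x. (i, g x)) \<in> M \<rightarrow>\<^sub>M count_space UNIV" for i :: 'i
    by (rule measurable_compose[OF assms(2)]) simp
  then show ?thesis by (rule measurable_compose_countable[OF _ assms(1)])
qed

lemma (in quantised_law) nn_integral_step_cell:
  assumes t: "t < T" and s: "s \<in> space (states t)"
  shows "(\<integral>\<^sup>+y. h (snd y) * indicator {j} (snd y) \<partial>step t s) = h j * next_cell t (snd s) j"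
proof -
  obtain x g where s_eq: "s = (x, g)" and x: "x \<in> space (path_space t)"
    using s by (cases s) (auto simp: space_pair_measure)
  have m: "(\<lambda>y. indicator {j} (snd y)) \<in> borel_measurable (step t s)"
    unfolding measurable_cong_sets[OF kernel_sets[OF step_kernel[OF t] s] refl]
    by (rule measurable_compose[OF measurable_snd]) simp
  have "(\<integral>\<^sup>+y. h (snd y) * indicator {j} (snd y) \<partial>step t s) = (\<integral>\<^sup>+y. h j * indicator {j} (snd y) \<partial>step t s)"
    by (intro nn_integral_cong) (auto simp: indicator_def)
  also have "\<dots> = h j * (\<integral>\<^sup>+y. indicator {j} (snd y) \<partial>step t s)"
    by (rule nn_integral_cmult[OF m])
  also have "\<dots> = h j * next_cell t (snd s) j"
    unfolding next_cell_def s_eq snd_conv by (subst nn_integral_step_snd[OF t x]) simp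
  finally show ?thesis .
qed

section \<open>The joint chain of two laws with common cells\<close>

locale coupled_laws =
  A: quantised_law \<mu> T \<kappa> q K + B: quantised_law \<nu> T \<kappa>' q K'
  for \<mu> \<nu> :: "(nat \<Rightarrow> real^'d) measure" and T \<kappa> \<kappa>' q K K'
begin

abbreviation states :: "nat \<Rightarrow> ((nat \<Rightarrow> real^'d) \<times> nat list) measure" where
  "states t \<equiv> path_space t \<Otimes>\<^sub>M count_space UNIV"

abbreviation (input) steps :: "((real^'d) \<times> nat) measure" where
  "steps \<equiv> borel \<Otimes>\<^sub>M count_space UNIV"

text \<open>While the past cells agree, the next cells are coupled maximally: with respect to the product
  of the two laws of the next cell, the common part \<open>min a b\<close> on the diagonal has density
  \<open>min a b / (a * b) = 1 / max a b\<close>.\<close>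

definition overlap :: "nat \<Rightarrow> nat list \<times> nat list \<times> nat \<times> nat \<Rightarrow> ennreal" where
  "overlap t = (\<lambda>(g, g', j, j'). if g = g' \<and> j = j' then 1 / max (A.next_cell t g j) (B.next_cell t g j) else 0)"

text \<open>If the past cells differ, \<open>overlap\<close> is 0 and the two steps are made
  independently. In either case the completion keeps both marginals, so each path still moves by its
  own conditional law given both pasts.\<close>

definition joint_step ::
  "nat \<Rightarrow> ((nat \<Rightarrow> real^'d) \<times> nat list) \<times> ((nat \<Rightarrow> real^'d) \<times> nat list) \<Rightarrow> (((real^'d) \<times> nat) \<times> ((real^'d) \<times> nat)) measure" where
  "joint_step t s = completion (A.step t (fst s)) (B.step t (snd s))
     (\<lambda>y y'. overlap t (snd (fst s), snd (snd s), snd y, snd y'))"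

lemma ennreal_times_inverse_max_le: "(b::ennreal) * (1 / max a b) \<le> 1" "(a::ennreal) * (1 / max a b) \<le> 1"
proof -
  have *: "x * (1 / y) \<le> 1" if "x \<le> y" for x y :: ennreal
  proof (cases "y = 0 \<or> y = top")
    case False
    then have "x * (1 / y) \<le> y * (1 / y)" using that by (intro mult_right_mono) auto
    also have "\<dots> = 1" using False by (simp add: ennreal_times_divide ennreal_divide_self less_top)
    finally show ?thesis .
  qed (use that in auto)
  show "b * (1 / max a b) \<le> 1" "a * (1 / max a b) \<le> 1" by (rule *; simp)+
qed

text \<open>With \<open>a\<close> and \<open>b\<close> the two probabilities of the cell in
  question, the integral of \<open>overlap\<close> is \<open>b / max a b\<close> over the second
  step and \<open>a / max a b\<close> over the first; both are at most 1, as a sub-coupling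
  requires.\<close>

lemma joint_step:
  assumes t: "t < T"
  shows joint_step_kernel: "joint_step t \<in> states t \<Otimes>\<^sub>M states t \<rightarrow>\<^sub>M prob_algebra (steps \<Otimes>\<^sub>M steps)"
    and joint_step_couplings: "s \<in> space (states t \<Otimes>\<^sub>M states t) \<Longrightarrow> joint_step t s \<in> couplings (A.step t (fst s)) (B.step t (snd s))"
proof -
  have P: "(\<lambda>s. A.step t (fst s)) \<in> states t \<Otimes>\<^sub>M states t \<rightarrow>\<^sub>M prob_algebra steps"
    and Q: "(\<lambda>s. B.step t (snd s)) \<in> states t \<Otimes>\<^sub>M states t \<rightarrow>\<^sub>M prob_algebra steps"
    using A.step_kernel[OF t] B.step_kernel[OF t] by measurable
  have "(\<lambda>(s, y, y'). (snd (fst s), snd (snd s), snd y, snd y'))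
    \<in> (states t \<Otimes>\<^sub>M states t) \<Otimes>\<^sub>M steps \<Otimes>\<^sub>M steps \<rightarrow>\<^sub>M count_space UNIV"
    unfolding split_beta' by (intro measurable_count_Pair) measurable
  from measurable_compose[OF this, of "overlap t" borel]
  have f: "(\<lambda>(s, y, y'). overlap t (snd (fst s), snd (snd s), snd y, snd y'))
    \<in> borel_measurable ((states t \<Otimes>\<^sub>M states t) \<Otimes>\<^sub>M steps \<Otimes>\<^sub>M steps)"
    by (simp add: split_beta')
  have 1: "(\<integral>\<^sup>+y'. overlap t (snd (fst s), snd (snd s), snd y, snd y') \<partial>B.step t (snd s)) \<le> 1"
    if "s \<in> space (states t \<Otimes>\<^sub>M states t)" for s y
  proof (cases "snd (fst s) = snd (snd s)")
    case True
    let ?c = "1 / max (A.next_cell t (snd (snd s)) (snd y)) (B.next_cell t (snd (snd s)) (snd y))"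
    have s: "snd s \<in> space (states t)" using that by (cases s) (auto simp: space_pair_measure)
    have "(\<integral>\<^sup>+y'. overlap t (snd (fst s), snd (snd s), snd y, snd y') \<partial>B.step t (snd s))
      = (\<integral>\<^sup>+y'. ?c * indicator {snd y} (snd y') \<partial>B.step t (snd s))"
      using True by (intro nn_integral_cong) (auto simp: overlap_def indicator_def)
    also have "\<dots> = ?c * B.next_cell t (snd (snd s)) (snd y)"
      by (rule B.nn_integral_step_cell[OF t s, where h = "\<lambda>_. ?c"])
    also have "\<dots> \<le> 1" by (subst mult.commute) (rule ennreal_times_inverse_max_le)
    finally show ?thesis .
  qed (simp add: overlap_def)
  have 2: "(\<integral>\<^sup>+y. overlap t (snd (fst s), snd (snd s), snd y, snd y') \<partial>A.step t (fst s)) \<le> 1"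
    if "s \<in> space (states t \<Otimes>\<^sub>M states t)" for s y'
  proof (cases "snd (fst s) = snd (snd s)")
    case True
    let ?c = "1 / max (A.next_cell t (snd (fst s)) (snd y')) (B.next_cell t (snd (fst s)) (snd y'))"
    have s: "fst s \<in> space (states t)" using that by (cases s) (auto simp: space_pair_measure)
    have "(\<integral>\<^sup>+y. overlap t (snd (fst s), snd (snd s), snd y, snd y') \<partial>A.step t (fst s))
      = (\<integral>\<^sup>+y. ?c * indicator {snd y'} (snd y) \<partial>A.step t (fst s))"
      using True by (intro nn_integral_cong) (auto simp: overlap_def indicator_def)
    also have "\<dots> = ?c * A.next_cell t (snd (fst s)) (snd y')"
      by (rule A.nn_integral_step_cell[OF t s, where h = "\<lambda>_. ?c"])
    also have "\<dots> \<le> 1" by (subst mult.commute) (rule ennreal_times_inverse_max_le)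
    finally show ?thesis .
  qed (simp add: overlap_def)
  show "joint_step t \<in> states t \<Otimes>\<^sub>M states t \<rightarrow>\<^sub>M prob_algebra (steps \<Otimes>\<^sub>M steps)"
    unfolding joint_step_def[abs_def] by (rule measurable_completion(1)[OF P Q f 1 2])
  show "s \<in> space (states t \<Otimes>\<^sub>M states t) \<Longrightarrow> joint_step t s \<in> couplings (A.step t (fst s)) (B.step t (snd s))"
    unfolding joint_step_def by (rule measurable_completion(2)[OF P Q f 1 2])
qed

definition joint_extend ::
  "nat \<Rightarrow> ((nat \<Rightarrow> real^'d) \<times> nat list) \<times> ((nat \<Rightarrow> real^'d) \<times> nat list) \<Rightarrow> ((real^'d) \<times> nat) \<times> ((real^'d) \<times> nat)
    \<Rightarrow> ((nat \<Rightarrow> real^'d) \<times> nat list) \<times> ((nat \<Rightarrow> real^'d) \<times> nat list)" where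
  "joint_extend t s y = (A.extend t (fst s) (fst y), A.extend t (snd s) (snd y))"

lemma measurable_joint_extend [measurable (raw)]:
  assumes [measurable]: "f \<in> M \<rightarrow>\<^sub>M states t \<Otimes>\<^sub>M states t" "g \<in> M \<rightarrow>\<^sub>M steps \<Otimes>\<^sub>M steps"
  shows "(\<lambda>x. joint_extend t (f x) (g x)) \<in> M \<rightarrow>\<^sub>M states (Suc t) \<Otimes>\<^sub>M states (Suc t)"
  unfolding joint_extend_def by measurable

primrec joint_chain :: "nat \<Rightarrow> (((nat \<Rightarrow> real^'d) \<times> nat list) \<times> ((nat \<Rightarrow> real^'d) \<times> nat list)) measure" where
  "joint_chain 0 = return (states 0 \<Otimes>\<^sub>M states 0) ((\<lambda>_. undefined, []), (\<lambda>_. undefined, []))"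
| "joint_chain (Suc t) = joint_chain t \<bind>
     (\<lambda>s. distr (joint_step t s) (states (Suc t) \<Otimes>\<^sub>M states (Suc t)) (joint_extend t s))"

lemma joint_chain_step_kernel:
  "t < T \<Longrightarrow> (\<lambda>s. distr (joint_step t s) (states (Suc t) \<Otimes>\<^sub>M states (Suc t)) (joint_extend t s))
    \<in> states t \<Otimes>\<^sub>M states t \<rightarrow>\<^sub>M prob_algebra (states (Suc t) \<Otimes>\<^sub>M states (Suc t))"
  using joint_step_kernel[measurable] by measurable

lemma joint_chain_space: "t \<le> T \<Longrightarrow> joint_chain t \<in> space (prob_algebra (states t \<Otimes>\<^sub>M states t))"
proof (induction t)
  case 0
  have "((\<lambda>_. undefined, []), (\<lambda>_. undefined, [])) \<in> space (states 0 \<Otimes>\<^sub>M states 0)"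
    by (simp add: space_pair_measure space_path_0)
  from measurable_space[OF measurable_return_prob_space this] show ?case by simp
next
  case (Suc t)
  then have "joint_chain t \<in> space (prob_algebra (states t \<Otimes>\<^sub>M states t))" by simp
  from measurable_space[OF measurable_bind_prob_space[OF measurable_const[OF this] joint_chain_step_kernel], of "()" "count_space UNIV"] Suc
  show ?case by simp
qed

lemma sets_joint_chain: "t \<le> T \<Longrightarrow> sets (joint_chain t) = sets (states t \<Otimes>\<^sub>M states t)"
  using joint_chain_space[of t] by (simp add: space_prob_algebra)

lemma space_joint_chain: "t \<le> T \<Longrightarrow> space (joint_chain t) = space (states t \<Otimes>\<^sub>M states t)"
  by (rule sets_eq_imp_space_eq[OF sets_joint_chain])

lemma prob_joint_chain: "t \<le> T \<Longrightarrow> prob_space (joint_chain t)"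
  using joint_chain_space[of t] by (simp add: space_prob_algebra)

lemma nn_integral_joint_chain_Suc:
  assumes t: "t < T" and F[measurable]: "F \<in> borel_measurable (states (Suc t) \<Otimes>\<^sub>M states (Suc t))"
  shows "(\<integral>\<^sup>+s. F s \<partial>joint_chain (Suc t)) = (\<integral>\<^sup>+s. (\<integral>\<^sup>+y. F (joint_extend t s y) \<partial>joint_step t s) \<partial>joint_chain t)"
proof -
  have C: "joint_chain t \<in> space (prob_algebra (states t \<Otimes>\<^sub>M states t))" using t by (simp add: joint_chain_space)
  have "(\<integral>\<^sup>+s. F s \<partial>joint_chain (Suc t))
    = (\<integral>\<^sup>+s. (\<integral>\<^sup>+y. F y \<partial>distr (joint_step t s) (states (Suc t) \<Otimes>\<^sub>M states (Suc t)) (joint_extend t s)) \<partial>joint_chain t)"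
    unfolding joint_chain.simps by (rule nn_integral_bind_prob[OF C joint_chain_step_kernel[OF t] F])
  also have "\<dots> = (\<integral>\<^sup>+s. (\<integral>\<^sup>+y. F (joint_extend t s y) \<partial>joint_step t s) \<partial>joint_chain t)"
  proof (rule nn_integral_cong)
    fix s assume "s \<in> space (joint_chain t)"
    then have s[measurable]: "s \<in> space (states t \<Otimes>\<^sub>M states t)" using t by (simp add: space_joint_chain)
    from measurable_space[OF joint_step_kernel[OF t] s]
    show "(\<integral>\<^sup>+y. F y \<partial>distr (joint_step t s) (states (Suc t) \<Otimes>\<^sub>M states (Suc t)) (joint_extend t s))
      = (\<integral>\<^sup>+y. F (joint_extend t s y) \<partial>joint_step t s)"
      by (rule nn_integral_distr_kernel) measurable
  qed
  finally show ?thesis .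
qed

lemma nn_integral_joint_step_fst:
  assumes t: "t < T" and s: "s \<in> space (states t \<Otimes>\<^sub>M states t)" and f: "f \<in> borel_measurable steps"
  shows "(\<integral>\<^sup>+y. f (fst y) \<partial>joint_step t s) = (\<integral>\<^sup>+y. f y \<partial>A.step t (fst s))"
proof (rule couplings_nn_integral_fst[OF joint_step_couplings[OF t s]])
  have "fst s \<in> space (states t)" using s by (auto simp: space_pair_measure)
  then show "f \<in> borel_measurable (A.step t (fst s))"
    using f by (simp add: measurable_cong_sets[OF kernel_sets[OF A.step_kernel[OF t]] refl])
qed

lemma nn_integral_joint_step_snd:
  assumes t: "t < T" and s: "s \<in> space (states t \<Otimes>\<^sub>M states t)" and f: "f \<in> borel_measurable steps"
  shows "(\<integral>\<^sup>+y. f (snd y) \<partial>joint_step t s) = (\<integral>\<^sup>+y. f y \<partial>B.step t (snd s))"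
proof (rule couplings_nn_integral_snd[OF joint_step_couplings[OF t s]])
  have "snd s \<in> space (states t)" using s by (auto simp: space_pair_measure)
  then show "f \<in> borel_measurable (B.step t (snd s))"
    using f by (simp add: measurable_cong_sets[OF kernel_sets[OF B.step_kernel[OF t]] refl])
qed

text \<open>As \<open>joint_step\<close> couples the two single steps, each component of the joint
  chain evolves as its own chain.\<close>

lemma nn_integral_joint_chain_fst:
  assumes "t \<le> T" "F \<in> borel_measurable (states t)"
  shows "(\<integral>\<^sup>+s. F (fst s) \<partial>joint_chain t) = (\<integral>\<^sup>+s. F s \<partial>A.chain t)"
  using assms
proof (induction t arbitrary: F)
  case 0
  note [measurable] = \<open>F \<in> _\<close>
  have "(\<lambda>s. F (fst s)) \<in> borel_measurable (states 0 \<Otimes>\<^sub>M states 0)" by measurable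
  then show ?case using 0
    by (simp add: nn_integral_return space_pair_measure space_path_0)
next
  case (Suc t)
  then have t: "t < T" by simp
  note [measurable] = \<open>F \<in> _\<close> A.step_kernel[OF t]
  have "(\<integral>\<^sup>+s. F (fst s) \<partial>joint_chain (Suc t))
    = (\<integral>\<^sup>+s. (\<integral>\<^sup>+y. F (A.extend t (fst s) (fst y)) \<partial>joint_step t s) \<partial>joint_chain t)"
    by (subst nn_integral_joint_chain_Suc[OF t]) (auto simp: joint_extend_def)
  also have "\<dots> = (\<integral>\<^sup>+s. (\<integral>\<^sup>+y. F (A.extend t (fst s) y) \<partial>A.step t (fst s)) \<partial>joint_chain t)"
  proof (rule nn_integral_cong)
    fix s assume "s \<in> space (joint_chain t)"
    then have s[measurable]: "s \<in> space (states t \<Otimes>\<^sub>M states t)" using t by (simp add: space_joint_chain)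
    show "(\<integral>\<^sup>+y. F (A.extend t (fst s) (fst y)) \<partial>joint_step t s) = (\<integral>\<^sup>+y. F (A.extend t (fst s) y) \<partial>A.step t (fst s))"
      by (rule nn_integral_joint_step_fst[OF t s]) measurable
  qed
  also have "\<dots> = (\<integral>\<^sup>+s. (\<integral>\<^sup>+y. F (A.extend t s y) \<partial>A.step t s) \<partial>A.chain t)"
  proof (rule Suc.IH)
    show "(\<lambda>s. \<integral>\<^sup>+y. F (A.extend t s y) \<partial>A.step t s) \<in> borel_measurable (states t)" by measurable
  qed (use t in simp)
  also have "\<dots> = (\<integral>\<^sup>+s. F s \<partial>A.chain (Suc t))" using Suc by (intro A.nn_integral_chain_Suc[symmetric, OF t])
  finally show ?case .
qed

lemma nn_integral_joint_chain_snd: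
  assumes "t \<le> T" "F \<in> borel_measurable (states t)"
  shows "(\<integral>\<^sup>+s. F (snd s) \<partial>joint_chain t) = (\<integral>\<^sup>+s. F s \<partial>B.chain t)"
  using assms
proof (induction t arbitrary: F)
  case 0
  note [measurable] = \<open>F \<in> _\<close>
  have "(\<lambda>s. F (snd s)) \<in> borel_measurable (states 0 \<Otimes>\<^sub>M states 0)" by measurable
  then show ?case using 0
    by (simp add: nn_integral_return space_pair_measure space_path_0)
next
  case (Suc t)
  then have t: "t < T" by simp
  note [measurable] = \<open>F \<in> _\<close> B.step_kernel[OF t]
  have "(\<integral>\<^sup>+s. F (snd s) \<partial>joint_chain (Suc t))
    = (\<integral>\<^sup>+s. (\<integral>\<^sup>+y. F (B.extend t (snd s) (snd y)) \<partial>joint_step t s) \<partial>joint_chain t)"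
    by (subst nn_integral_joint_chain_Suc[OF t]) (auto simp: joint_extend_def)
  also have "\<dots> = (\<integral>\<^sup>+s. (\<integral>\<^sup>+y. F (B.extend t (snd s) y) \<partial>B.step t (snd s)) \<partial>joint_chain t)"
  proof (rule nn_integral_cong)
    fix s assume "s \<in> space (joint_chain t)"
    then have s[measurable]: "s \<in> space (states t \<Otimes>\<^sub>M states t)" using t by (simp add: space_joint_chain)
    show "(\<integral>\<^sup>+y. F (B.extend t (snd s) (snd y)) \<partial>joint_step t s) = (\<integral>\<^sup>+y. F (B.extend t (snd s) y) \<partial>B.step t (snd s))"
      by (rule nn_integral_joint_step_snd[OF t s]) measurable
  qed
  also have "\<dots> = (\<integral>\<^sup>+s. (\<integral>\<^sup>+y. F (B.extend t s y) \<partial>B.step t s) \<partial>B.chain t)"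
  proof (rule Suc.IH)
    show "(\<lambda>s. \<integral>\<^sup>+y. F (B.extend t s y) \<partial>B.step t s) \<in> borel_measurable (states t)" by measurable
  qed (use t in simp)
  also have "\<dots> = (\<integral>\<^sup>+s. F s \<partial>B.chain (Suc t))" using Suc by (intro B.nn_integral_chain_Suc[symmetric, OF t])
  finally show ?case .
qed

lemma nn_integral_joint_chain_prefix:
  assumes "n \<le> m" "m \<le> T" and F: "F \<in> borel_measurable (path_space n \<Otimes>\<^sub>M path_space n)"
  shows "(\<integral>\<^sup>+s. F (restrict (fst (fst s)) {1..n}, restrict (fst (snd s)) {1..n}) \<partial>joint_chain m)
    = (\<integral>\<^sup>+s. F (fst (fst s), fst (snd s)) \<partial>joint_chain n)"
  using assms(1,2)
proof (induction m rule: dec_induct)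
  case base
  show ?case
  proof (intro nn_integral_cong)
    fix s assume "s \<in> space (joint_chain n)"
    then have "fst (fst s) \<in> space (path_space n)" "fst (snd s) \<in> space (path_space n)"
      using base by (auto simp: space_joint_chain space_pair_measure)
    then show "F (restrict (fst (fst s)) {1..n}, restrict (fst (snd s)) {1..n}) = F (fst (fst s), fst (snd s))"
      by (simp only: restrict_path_id)
  qed
next
  case (step m)
  then have m: "m < T" by simp
  note [measurable] = F
  have r: "(\<lambda>x. restrict x {1..n}) \<in> path_space (Suc m) \<rightarrow>\<^sub>M path_space n"
    using step by (intro measurable_restrict_path) auto
  have "(\<lambda>s. F (restrict (fst (fst s)) {1..n}, restrict (fst (snd s)) {1..n})) \<in> borel_measurable (states (Suc m) \<Otimes>\<^sub>M states (Suc m))"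
    using measurable_compose[OF _ r, measurable (raw)] by measurable
  then have "(\<integral>\<^sup>+s. F (restrict (fst (fst s)) {1..n}, restrict (fst (snd s)) {1..n}) \<partial>joint_chain (Suc m))
    = (\<integral>\<^sup>+s. (\<integral>\<^sup>+y. F (restrict (fst (fst (joint_extend m s y))) {1..n}, restrict (fst (snd (joint_extend m s y))) {1..n}) \<partial>joint_step m s) \<partial>joint_chain m)"
    by (rule nn_integral_joint_chain_Suc[OF m])
  also have "\<dots> = (\<integral>\<^sup>+s. F (restrict (fst (fst s)) {1..n}, restrict (fst (snd s)) {1..n}) \<partial>joint_chain m)"
  proof (rule nn_integral_cong)
    fix s assume "s \<in> space (joint_chain m)"
    then have s: "s \<in> space (states m \<Otimes>\<^sub>M states m)" using m by (simp add: space_joint_chain)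
    have "restrict (fst (fst (joint_extend m s y))) {1..n} = restrict (fst (fst s)) {1..n}"
      "restrict (fst (snd (joint_extend m s y))) {1..n} = restrict (fst (snd s)) {1..n}" for y
      using \<open>n \<le> m\<close> by (auto simp: joint_extend_def A.extend_def restrict_def fun_eq_iff)
    then show "(\<integral>\<^sup>+y. F (restrict (fst (fst (joint_extend m s y))) {1..n}, restrict (fst (snd (joint_extend m s y))) {1..n}) \<partial>joint_step m s)
      = F (restrict (fst (fst s)) {1..n}, restrict (fst (snd s)) {1..n})"
      using prob_space.emeasure_space_1[OF kernel_prob[OF joint_step_kernel[OF m] s]] by simp
  qed
  also have "\<dots> = (\<integral>\<^sup>+s. F (fst (fst s), fst (snd s)) \<partial>joint_chain n)" using m by (intro step.IH) simp
  finally show ?case .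
qed

text \<open>The first marginal of the joint step is the single step, and its point marginal is
  \<open>\<kappa> n\<close> of the past path; the cells and the second path drop out. This is the
  hypothesis of \<open>causal_cond_indep\<close> for the pair of paths.\<close>

lemma joint_chain_onestep_fst:
  assumes n: "n < T" and F[measurable]: "F \<in> borel_measurable (path_space (Suc n) \<Otimes>\<^sub>M path_space n)"
  shows "(\<integral>\<^sup>+s. F (restrict (fst (fst s)) {1..Suc n}, restrict (fst (snd s)) {1..n}) \<partial>joint_chain T)
    = (\<integral>\<^sup>+s. (\<integral>\<^sup>+z. F ((restrict (fst (fst s)) {1..n})(Suc n := z), restrict (fst (snd s)) {1..n}) \<partial>\<kappa> n (restrict (fst (fst s)) {1..n})) \<partial>joint_chain T)"
proof -
  note [measurable] = A.\<kappa>[OF n]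
  have [measurable]: "(\<lambda>x. restrict x {1..n}) \<in> path_space (Suc n) \<rightarrow>\<^sub>M path_space n"
    by (intro measurable_restrict_path) auto
  have rr: "restrict (restrict x {1..Suc n}) {1..n} = restrict x {1..n}" for x :: "nat \<Rightarrow> real^'d" by (auto simp: fun_eq_iff)
  have m1: "(\<lambda>w. F (fst w, restrict (snd w) {1..n})) \<in> borel_measurable (path_space (Suc n) \<Otimes>\<^sub>M path_space (Suc n))"
    by measurable
  have m2: "(\<lambda>w. \<integral>\<^sup>+z. F ((fst w)(Suc n := z), snd w) \<partial>\<kappa> n (fst w)) \<in> borel_measurable (path_space n \<Otimes>\<^sub>M path_space n)"
    by measurable
  have "(\<integral>\<^sup>+s. F (restrict (fst (fst s)) {1..Suc n}, restrict (fst (snd s)) {1..n}) \<partial>joint_chain T)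
    = (\<integral>\<^sup>+s. F (fst (fst s), restrict (fst (snd s)) {1..n}) \<partial>joint_chain (Suc n))"
    using nn_integral_joint_chain_prefix[OF _ order_refl m1] n by (simp only: rr fst_conv snd_conv Suc_leI)
  also have "\<dots> = (\<integral>\<^sup>+s. (\<integral>\<^sup>+y. F (fst (fst (joint_extend n s y)), restrict (fst (snd (joint_extend n s y))) {1..n}) \<partial>joint_step n s) \<partial>joint_chain n)"
    by (rule nn_integral_joint_chain_Suc[OF n]) measurable
  also have "\<dots> = (\<integral>\<^sup>+s. (\<integral>\<^sup>+z. F ((fst (fst s))(Suc n := z), fst (snd s)) \<partial>\<kappa> n (fst (fst s))) \<partial>joint_chain n)"
  proof (rule nn_integral_cong)
    fix s assume "s \<in> space (joint_chain n)"
    then have s: "s \<in> space (states n \<Otimes>\<^sub>M states n)" using n by (simp add: space_joint_chain)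
    then obtain x g y' g' where s_eq: "s = ((x, g), (y', g'))" and x[measurable]: "x \<in> space (path_space n)"
      and y': "y' \<in> space (path_space n)" and [measurable]: "restrict y' {1..n} \<in> space (path_space n)"
      by (auto simp: space_pair_measure restrict_path_id)
    have "(\<integral>\<^sup>+y. F (fst (fst (joint_extend n s y)), restrict (fst (snd (joint_extend n s y))) {1..n}) \<partial>joint_step n s)
      = (\<integral>\<^sup>+y. F (x(Suc n := fst (fst y)), restrict y' {1..n}) \<partial>joint_step n s)"
      by (simp only: joint_extend_def A.extend_def s_eq fst_conv snd_conv restrict_path_upd)
    also have "\<dots> = (\<integral>\<^sup>+y. F (x(Suc n := fst y), restrict y' {1..n}) \<partial>A.step n (fst s))"
      by (rule nn_integral_joint_step_fst[OF n s, where f = "\<lambda>y. F (x(Suc n := fst y), restrict y' {1..n})"]) measurable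
    also have "\<dots> = (\<integral>\<^sup>+z. F (x(Suc n := z), restrict y' {1..n}) \<partial>\<kappa> n x)"
      unfolding s_eq fst_conv
      by (rule A.nn_integral_step_fst[OF n x, where f = "\<lambda>z. F (x(Suc n := z), restrict y' {1..n})"]) measurable
    finally show "(\<integral>\<^sup>+y. F (fst (fst (joint_extend n s y)), restrict (fst (snd (joint_extend n s y))) {1..n}) \<partial>joint_step n s)
      = (\<integral>\<^sup>+z. F ((fst (fst s))(Suc n := z), fst (snd s)) \<partial>\<kappa> n (fst (fst s)))"
      by (simp only: s_eq fst_conv snd_conv restrict_path_id[OF y'])
  qed
  also have "\<dots> = (\<integral>\<^sup>+s. (\<integral>\<^sup>+z. F ((restrict (fst (fst s)) {1..n})(Suc n := z), restrict (fst (snd s)) {1..n}) \<partial>\<kappa> n (restrict (fst (fst s)) {1..n})) \<partial>joint_chain T)"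
    using nn_integral_joint_chain_prefix[OF less_imp_le[OF n] order_refl m2] by (simp only: fst_conv snd_conv)
  finally show ?thesis .
qed

lemma joint_chain_onestep_snd:
  assumes n: "n < T" and F[measurable]: "F \<in> borel_measurable (path_space (Suc n) \<Otimes>\<^sub>M path_space n)"
  shows "(\<integral>\<^sup>+s. F (restrict (fst (snd s)) {1..Suc n}, restrict (fst (fst s)) {1..n}) \<partial>joint_chain T)
    = (\<integral>\<^sup>+s. (\<integral>\<^sup>+z. F ((restrict (fst (snd s)) {1..n})(Suc n := z), restrict (fst (fst s)) {1..n}) \<partial>\<kappa>' n (restrict (fst (snd s)) {1..n})) \<partial>joint_chain T)"
proof -
  note [measurable] = B.\<kappa>[OF n]
  have [measurable]: "(\<lambda>x. restrict x {1..n}) \<in> path_space (Suc n) \<rightarrow>\<^sub>M path_space n"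
    by (intro measurable_restrict_path) auto
  have rr: "restrict (restrict x {1..Suc n}) {1..n} = restrict x {1..n}" for x :: "nat \<Rightarrow> real^'d" by (auto simp: fun_eq_iff)
  have m1: "(\<lambda>w. F (snd w, restrict (fst w) {1..n})) \<in> borel_measurable (path_space (Suc n) \<Otimes>\<^sub>M path_space (Suc n))"
    by measurable
  have m2: "(\<lambda>w. \<integral>\<^sup>+z. F ((snd w)(Suc n := z), fst w) \<partial>\<kappa>' n (snd w)) \<in> borel_measurable (path_space n \<Otimes>\<^sub>M path_space n)"
    by measurable
  have "(\<integral>\<^sup>+s. F (restrict (fst (snd s)) {1..Suc n}, restrict (fst (fst s)) {1..n}) \<partial>joint_chain T)
    = (\<integral>\<^sup>+s. F (fst (snd s), restrict (fst (fst s)) {1..n}) \<partial>joint_chain (Suc n))"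
    using nn_integral_joint_chain_prefix[OF _ order_refl m1] n by (simp only: rr fst_conv snd_conv Suc_leI)
  also have "\<dots> = (\<integral>\<^sup>+s. (\<integral>\<^sup>+y. F (fst (snd (joint_extend n s y)), restrict (fst (fst (joint_extend n s y))) {1..n}) \<partial>joint_step n s) \<partial>joint_chain n)"
    by (rule nn_integral_joint_chain_Suc[OF n]) measurable
  also have "\<dots> = (\<integral>\<^sup>+s. (\<integral>\<^sup>+z. F ((fst (snd s))(Suc n := z), fst (fst s)) \<partial>\<kappa>' n (fst (snd s))) \<partial>joint_chain n)"
  proof (rule nn_integral_cong)
    fix s assume "s \<in> space (joint_chain n)"
    then have s: "s \<in> space (states n \<Otimes>\<^sub>M states n)" using n by (simp add: space_joint_chain)
    then obtain x g y' g' where s_eq: "s = ((x, g), (y', g'))" and y'[measurable]: "y' \<in> space (path_space n)"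
      and x: "x \<in> space (path_space n)" and [measurable]: "restrict x {1..n} \<in> space (path_space n)"
      by (auto simp: space_pair_measure restrict_path_id)
    have "(\<integral>\<^sup>+y. F (fst (snd (joint_extend n s y)), restrict (fst (fst (joint_extend n s y))) {1..n}) \<partial>joint_step n s)
      = (\<integral>\<^sup>+y. F (y'(Suc n := fst (snd y)), restrict x {1..n}) \<partial>joint_step n s)"
      by (simp only: joint_extend_def A.extend_def s_eq fst_conv snd_conv restrict_path_upd)
    also have "\<dots> = (\<integral>\<^sup>+y. F (y'(Suc n := fst y), restrict x {1..n}) \<partial>B.step n (snd s))"
      by (rule nn_integral_joint_step_snd[OF n s, where f = "\<lambda>y. F (y'(Suc n := fst y), restrict x {1..n})"]) measurable
    also have "\<dots> = (\<integral>\<^sup>+z. F (y'(Suc n := z), restrict x {1..n}) \<partial>\<kappa>' n y')"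
      unfolding s_eq snd_conv
      by (rule B.nn_integral_step_fst[OF n y', where f = "\<lambda>z. F (y'(Suc n := z), restrict x {1..n})"]) measurable
    finally show "(\<integral>\<^sup>+y. F (fst (snd (joint_extend n s y)), restrict (fst (fst (joint_extend n s y))) {1..n}) \<partial>joint_step n s)
      = (\<integral>\<^sup>+z. F ((fst (snd s))(Suc n := z), fst (fst s)) \<partial>\<kappa>' n (fst (snd s)))"
      by (simp only: s_eq fst_conv snd_conv restrict_path_id[OF x])
  qed
  also have "\<dots> = (\<integral>\<^sup>+s. (\<integral>\<^sup>+z. F ((restrict (fst (snd s)) {1..n})(Suc n := z), restrict (fst (fst s)) {1..n}) \<partial>\<kappa>' n (restrict (fst (snd s)) {1..n})) \<partial>joint_chain T)"
    using nn_integral_joint_chain_prefix[OF less_imp_le[OF n] order_refl m2] by (simp only: fst_conv snd_conv)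
  finally show ?thesis .
qed

definition path_coupling :: "((nat \<Rightarrow> real^'d) \<times> (nat \<Rightarrow> real^'d)) measure" where
  "path_coupling = distr (joint_chain T) (\<mu> \<Otimes>\<^sub>M \<nu>) (\<lambda>s. (fst (fst s), fst (snd s)))"

lemma sets_\<mu>\<nu>: "sets (\<mu> \<Otimes>\<^sub>M \<nu>) = sets (path_space T \<Otimes>\<^sub>M path_space T)"
  by (intro sets_pair_measure_cong A.sets_\<gamma> B.sets_\<gamma>)

lemma measurable_paths: "(\<lambda>s. (fst (fst s), fst (snd s))) \<in> joint_chain T \<rightarrow>\<^sub>M \<mu> \<Otimes>\<^sub>M \<nu>"
  unfolding measurable_cong_sets[OF sets_joint_chain[OF order_refl] sets_\<mu>\<nu>] by measurable

lemma nn_integral_path_coupling: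
  "F \<in> borel_measurable (path_space T \<Otimes>\<^sub>M path_space T) \<Longrightarrow>
    (\<integral>\<^sup>+\<omega>. F \<omega> \<partial>path_coupling) = (\<integral>\<^sup>+s. F (fst (fst s), fst (snd s)) \<partial>joint_chain T)"
  unfolding path_coupling_def
  by (rule nn_integral_distr[OF measurable_paths]) (simp add: measurable_cong_sets[OF sets_\<mu>\<nu> refl])

text \<open>Bicausality concerns the two paths alone: the cells are hidden variables, integrated out
  on passing from \<open>joint_chain T\<close> to its path components, and one-step causality
  survives this.\<close>

lemma path_coupling_bicausal: "path_coupling \<in> bicausal_couplings T \<mu> \<nu>"
proof -
  note [measurable del] = measurable_restrict_path
  have prob: "prob_space path_coupling"
    unfolding path_coupling_def by (rule prob_space.prob_space_distr[OF prob_joint_chain[OF order_refl] measurable_paths])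
  have sets: "sets path_coupling = sets (path_space T \<Otimes>\<^sub>M path_space T)"
    by (simp add: path_coupling_def sets_\<mu>\<nu>)
  have X: "fst \<in> path_coupling \<rightarrow>\<^sub>M path_space T" and Y: "snd \<in> path_coupling \<rightarrow>\<^sub>M path_space T"
    by (simp_all add: measurable_cong_sets[OF sets refl])
  have r: "(\<lambda>x. restrict x {1..n}) \<in> path_space T \<rightarrow>\<^sub>M path_space n" if "n \<le> T" for n
    using that by (rule measurable_restrict_path)
  have "path_coupling \<in> couplings \<mu> \<nu>"
  proof (rule couplingsI[OF prob])
    show "sets path_coupling = sets (\<mu> \<Otimes>\<^sub>M \<nu>)" by (simp add: path_coupling_def)
    fix A assume "A \<in> sets \<mu>"
    then have A[measurable]: "A \<in> sets (path_space T)" by (simp add: A.sets_\<gamma>)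
    have "(\<integral>\<^sup>+\<omega>. indicator A (fst \<omega>) \<partial>path_coupling) = (\<integral>\<^sup>+s. indicator A (fst (fst s)) \<partial>joint_chain T)"
      by (subst nn_integral_path_coupling) auto
    also have "\<dots> = (\<integral>\<^sup>+s. indicator A (fst s) \<partial>A.chain T)"
      by (rule nn_integral_joint_chain_fst[where F = "\<lambda>s. indicator A (fst s)"]) auto
    also have "\<dots> = (\<integral>\<^sup>+x. indicator A (restrict x {1..T}) \<partial>\<mu>)"
      by (rule A.nn_integral_chain_fst) auto
    also have "\<dots> = (\<integral>\<^sup>+x. indicator A x \<partial>\<mu>)"
      by (intro nn_integral_cong) (simp add: restrict_path_id A.space_\<gamma>)
    finally show "(\<integral>\<^sup>+\<omega>. indicator A (fst \<omega>) \<partial>path_coupling) = emeasure \<mu> A" using \<open>A \<in> sets \<mu>\<close> by simp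
  next
    fix A assume "A \<in> sets \<nu>"
    then have A[measurable]: "A \<in> sets (path_space T)" by (simp add: B.sets_\<gamma>)
    have "(\<integral>\<^sup>+\<omega>. indicator A (snd \<omega>) \<partial>path_coupling) = (\<integral>\<^sup>+s. indicator A (fst (snd s)) \<partial>joint_chain T)"
      by (subst nn_integral_path_coupling) auto
    also have "\<dots> = (\<integral>\<^sup>+s. indicator A (fst s) \<partial>B.chain T)"
      by (rule nn_integral_joint_chain_snd[where F = "\<lambda>s. indicator A (fst s)"]) auto
    also have "\<dots> = (\<integral>\<^sup>+x. indicator A (restrict x {1..T}) \<partial>\<nu>)"
      by (rule B.nn_integral_chain_fst) auto
    also have "\<dots> = (\<integral>\<^sup>+x. indicator A x \<partial>\<nu>)"
      by (intro nn_integral_cong) (simp add: restrict_path_id B.space_\<gamma>)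
    finally show "(\<integral>\<^sup>+\<omega>. indicator A (snd \<omega>) \<partial>path_coupling) = emeasure \<nu> A" using \<open>A \<in> sets \<nu>\<close> by simp
  qed
  moreover have "cond_indep path_coupling (path_space t) (\<lambda>\<omega>. restrict (snd \<omega>) {1..t})
          (PiM {Suc t..T} (\<lambda>_. borel)) (\<lambda>\<omega>. restrict (fst \<omega>) {Suc t..T})
          (path_space t) (\<lambda>\<omega>. restrict (fst \<omega>) {1..t})" if t: "t \<in> {1..<T}" for t
  proof (rule causal_cond_indep[OF prob X Y A.\<kappa> _ t])
    fix n and F :: "(nat \<Rightarrow> real^'d) \<times> (nat \<Rightarrow> real^'d) \<Rightarrow> ennreal"
    assume n: "n < T" and F[measurable]: "F \<in> borel_measurable (path_space (Suc n) \<Otimes>\<^sub>M path_space n)"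
    note [measurable] = A.\<kappa>[OF n]
      measurable_compose[OF measurable_fst r[OF less_imp_le[OF n]]] measurable_compose[OF measurable_snd r[OF less_imp_le[OF n]]]
      measurable_compose[OF measurable_fst r[OF Suc_leI[OF n]]] measurable_compose[OF measurable_snd r[OF Suc_leI[OF n]]]
    have "(\<integral>\<^sup>+\<omega>. F (restrict (fst \<omega>) {1..Suc n}, restrict (snd \<omega>) {1..n}) \<partial>path_coupling)
      = (\<integral>\<^sup>+s. F (restrict (fst (fst s)) {1..Suc n}, restrict (fst (snd s)) {1..n}) \<partial>joint_chain T)"
      by (subst nn_integral_path_coupling, measurable)
    also note joint_chain_onestep_fst[OF n F]
    also have "(\<integral>\<^sup>+s. (\<integral>\<^sup>+z. F ((restrict (fst (fst s)) {1..n})(Suc n := z), restrict (fst (snd s)) {1..n}) \<partial>\<kappa> n (restrict (fst (fst s)) {1..n})) \<partial>joint_chain T)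
      = (\<integral>\<^sup>+\<omega>. (\<integral>\<^sup>+z. F ((restrict (fst \<omega>) {1..n})(Suc n := z), restrict (snd \<omega>) {1..n}) \<partial>\<kappa> n (restrict (fst \<omega>) {1..n})) \<partial>path_coupling)"
      by (subst nn_integral_path_coupling, measurable)
    finally show "(\<integral>\<^sup>+\<omega>. F (restrict (fst \<omega>) {1..Suc n}, restrict (snd \<omega>) {1..n}) \<partial>path_coupling)
      = (\<integral>\<^sup>+\<omega>. (\<integral>\<^sup>+z. F ((restrict (fst \<omega>) {1..n})(Suc n := z), restrict (snd \<omega>) {1..n}) \<partial>\<kappa> n (restrict (fst \<omega>) {1..n})) \<partial>path_coupling)" .
  qed
  moreover have "cond_indep path_coupling (path_space t) (\<lambda>\<omega>. restrict (fst \<omega>) {1..t})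
          (PiM {Suc t..T} (\<lambda>_. borel)) (\<lambda>\<omega>. restrict (snd \<omega>) {Suc t..T})
          (path_space t) (\<lambda>\<omega>. restrict (snd \<omega>) {1..t})" if t: "t \<in> {1..<T}" for t
  proof (rule causal_cond_indep[OF prob Y X B.\<kappa> _ t])
    fix n and F :: "(nat \<Rightarrow> real^'d) \<times> (nat \<Rightarrow> real^'d) \<Rightarrow> ennreal"
    assume n: "n < T" and F[measurable]: "F \<in> borel_measurable (path_space (Suc n) \<Otimes>\<^sub>M path_space n)"
    note [measurable] = B.\<kappa>[OF n]
      measurable_compose[OF measurable_fst r[OF less_imp_le[OF n]]] measurable_compose[OF measurable_snd r[OF less_imp_le[OF n]]]
      measurable_compose[OF measurable_fst r[OF Suc_leI[OF n]]] measurable_compose[OF measurable_snd r[OF Suc_leI[OF n]]]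
    have "(\<integral>\<^sup>+\<omega>. F (restrict (snd \<omega>) {1..Suc n}, restrict (fst \<omega>) {1..n}) \<partial>path_coupling)
      = (\<integral>\<^sup>+s. F (restrict (fst (snd s)) {1..Suc n}, restrict (fst (fst s)) {1..n}) \<partial>joint_chain T)"
      by (subst nn_integral_path_coupling, measurable)
    also note joint_chain_onestep_snd[OF n F]
    also have "(\<integral>\<^sup>+s. (\<integral>\<^sup>+z. F ((restrict (fst (snd s)) {1..n})(Suc n := z), restrict (fst (fst s)) {1..n}) \<partial>\<kappa>' n (restrict (fst (snd s)) {1..n})) \<partial>joint_chain T)
      = (\<integral>\<^sup>+\<omega>. (\<integral>\<^sup>+z. F ((restrict (snd \<omega>) {1..n})(Suc n := z), restrict (fst \<omega>) {1..n}) \<partial>\<kappa>' n (restrict (snd \<omega>) {1..n})) \<partial>path_coupling)"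
      by (subst nn_integral_path_coupling, measurable)
    finally show "(\<integral>\<^sup>+\<omega>. F (restrict (snd \<omega>) {1..Suc n}, restrict (fst \<omega>) {1..n}) \<partial>path_coupling)
      = (\<integral>\<^sup>+\<omega>. (\<integral>\<^sup>+z. F ((restrict (snd \<omega>) {1..n})(Suc n := z), restrict (fst \<omega>) {1..n}) \<partial>\<kappa>' n (restrict (snd \<omega>) {1..n})) \<partial>path_coupling)" .
  qed
  ultimately show ?thesis unfolding bicausal_couplings_def by blast
qed

section \<open>The probability that the cell sequences separate\<close>

text \<open>One minus the total variation distance between the two laws of the next cell after
  \<open>g\<close>.\<close>

definition cell_overlap :: "nat \<Rightarrow> nat list \<Rightarrow> ennreal" where
  "cell_overlap t g = (\<integral>\<^sup>+j. min (A.next_cell t g j) (B.next_cell t g j) \<partial>count_space UNIV)"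

text \<open>The mass that the density \<open>1 / max a b\<close> puts on a pair of equal cells.
  Finiteness matters, since \<open>1 / top = 0\<close>.\<close>

lemma min_le_times_inverse_max:
  assumes "a \<noteq> (top :: ennreal)" "b \<noteq> top"
  shows "min a b \<le> b * (1 / max a b) * a"
proof -
  have c: "x * (1 / x) = 1" if "x \<noteq> 0" "x \<noteq> top" for x :: ennreal
    using that by (simp add: ennreal_times_divide ennreal_divide_self less_top)
  consider "max a b = 0" | "max a b = a" "a \<noteq> 0" | "max a b = b" "b \<noteq> 0" by (metis max_def)
  then show ?thesis
  proof cases
    case 1
    then have "a = 0" by (metis max.cobounded1 le_zero_eq)
    then show ?thesis by simp
  next
    case 2
    have "b * (1 / a) * a = b * (a * (1 / a))" by (simp only: ac_simps)
    then show ?thesis using 2 c[OF 2(2) assms(1)] by simp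
  next
    case 3
    then show ?thesis using c[OF 3(2) assms(2)] by simp
  qed
qed

text \<open>The prescribed density already puts at least the mass \<open>cell_overlap\<close> on
  pairs of equal cells; the residual product can only add to the agreement and is dropped.\<close>

lemma joint_step_overlap:
  assumes t: "t < T" and s: "s \<in> space (states t \<Otimes>\<^sub>M states t)" and eq: "snd (fst s) = snd (snd s)"
  shows "(\<integral>\<^sup>+y. (if snd (fst y) = snd (snd y) then 0 else 1) \<partial>joint_step t s) \<le> 1 - cell_overlap t (snd (fst s))"
proof -
  have sf: "fst s \<in> space (states t)" "snd s \<in> space (states t)" using s by (auto simp: space_pair_measure)
  note PA = kernel_prob[OF A.step_kernel[OF t] sf(1)] kernel_sets[OF A.step_kernel[OF t] sf(1)]
  note PB = kernel_prob[OF B.step_kernel[OF t] sf(2)] kernel_sets[OF B.step_kernel[OF t] sf(2)]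
  note [measurable_cong] = PA(2) PB(2)
  interpret PA: prob_space "A.step t (fst s)" by (rule PA(1))
  interpret PB: prob_space "B.step t (snd s)" by (rule PB(1))
  let ?g = "snd (snd s)"
  let ?f = "\<lambda>y y'. overlap t (snd (fst s), snd (snd s), snd y, snd y')"
  let ?\<phi> = "\<lambda>y y'. if snd y = snd y' then 1 else (0::ennreal)"
  have pair: "(\<lambda>(y, y'). (snd y, snd y')) \<in> A.step t (fst s) \<Otimes>\<^sub>M B.step t (snd s) \<rightarrow>\<^sub>M count_space UNIV"
    unfolding split_beta' by (intro measurable_count_Pair) measurable
  have m: "(\<lambda>(y, y'). h (snd y, snd y')) \<in> borel_measurable (A.step t (fst s) \<Otimes>\<^sub>M B.step t (snd s))" for h :: "_ \<Rightarrow> ennreal"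
    using measurable_compose[OF pair, of h borel] by (simp add: split_beta')
  have mo: "(\<lambda>(y, y'). ?f y y') \<in> borel_measurable (A.step t (fst s) \<Otimes>\<^sub>M B.step t (snd s))"
    using m[of "\<lambda>(j, j'). overlap t (snd (fst s), snd (snd s), j, j')"] by (simp only: prod.case)
  have mi: "(\<lambda>(y, y'). ?\<phi> y y') \<in> borel_measurable (A.step t (fst s) \<Otimes>\<^sub>M B.step t (snd s))"
    using m[of "\<lambda>(j, j'). if j = j' then 1 else 0"] by (simp only: prod.case)
  have nA: "A.next_cell t ?g j \<noteq> top" "A.next_cell t ?g j = (\<integral>\<^sup>+y. indicator {j} (snd y) \<partial>A.step t (fst s))" for j
  proof -
    show *: "A.next_cell t ?g j = (\<integral>\<^sup>+y. indicator {j} (snd y) \<partial>A.step t (fst s))"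
      using A.nn_integral_step_cell[OF t sf(1), of "\<lambda>_. 1" j] eq by simp
    have "\<dots> \<le> (\<integral>\<^sup>+y. 1 \<partial>A.step t (fst s))" by (intro nn_integral_mono) (auto simp: indicator_def)
    then show "A.next_cell t ?g j \<noteq> top" using * PA.emeasure_space_1 by (auto simp: top_unique)
  qed
  have nB: "B.next_cell t ?g j \<noteq> top" for j
  proof -
    have "B.next_cell t ?g j = (\<integral>\<^sup>+y. indicator {j} (snd y) \<partial>B.step t (snd s))"
      using B.nn_integral_step_cell[OF t sf(2), of "\<lambda>_. 1" j] by simp
    also have "\<dots> \<le> (\<integral>\<^sup>+y. 1 \<partial>B.step t (snd s))" by (intro nn_integral_mono) (auto simp: indicator_def)
    finally show ?thesis using PB.emeasure_space_1 by (auto simp: top_unique)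
  qed
  have "cell_overlap t ?g \<le> (\<integral>\<^sup>+j. (\<integral>\<^sup>+y. B.next_cell t ?g j * (1 / max (A.next_cell t ?g j) (B.next_cell t ?g j))
      * indicator {j} (snd y) \<partial>A.step t (fst s)) \<partial>count_space UNIV)"
    unfolding cell_overlap_def
  proof (rule nn_integral_mono)
    fix j
    have "(\<integral>\<^sup>+y. B.next_cell t ?g j * (1 / max (A.next_cell t ?g j) (B.next_cell t ?g j)) * indicator {j} (snd y) \<partial>A.step t (fst s))
       = B.next_cell t ?g j * (1 / max (A.next_cell t ?g j) (B.next_cell t ?g j)) * A.next_cell t ?g j"
      using A.nn_integral_step_cell[OF t sf(1), of "\<lambda>_. B.next_cell t ?g j * (1 / max (A.next_cell t ?g j) (B.next_cell t ?g j))" j] eq by simp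
    then show "min (A.next_cell t ?g j) (B.next_cell t ?g j) \<le> (\<integral>\<^sup>+y. B.next_cell t ?g j * (1 / max (A.next_cell t ?g j) (B.next_cell t ?g j))
      * indicator {j} (snd y) \<partial>A.step t (fst s))"
      using min_le_times_inverse_max[OF nA(1) nB] by simp
  qed
  also have "\<dots> = (\<integral>\<^sup>+y. B.next_cell t ?g (snd y) * (1 / max (A.next_cell t ?g (snd y)) (B.next_cell t ?g (snd y))) \<partial>A.step t (fst s))"
    by (rule nn_integral_countable_fibres[symmetric, where q = snd and
          H = "\<lambda>j _. B.next_cell t ?g j * (1 / max (A.next_cell t ?g j) (B.next_cell t ?g j))"])
      (auto intro: PA.sigma_finite_measure_axioms)
  also have "\<dots> = (\<integral>\<^sup>+y. (\<integral>\<^sup>+y'. ?f y y' * ?\<phi> y y' \<partial>B.step t (snd s)) \<partial>A.step t (fst s))"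
  proof (rule nn_integral_cong)
    fix y :: "(real^'d) \<times> nat"
    have "(\<integral>\<^sup>+y'. ?f y y' * ?\<phi> y y' \<partial>B.step t (snd s))
      = (\<integral>\<^sup>+y'. (1 / max (A.next_cell t ?g (snd y)) (B.next_cell t ?g (snd y))) * indicator {snd y} (snd y') \<partial>B.step t (snd s))"
      using eq by (intro nn_integral_cong) (auto simp: overlap_def indicator_def)
    also have "\<dots> = (1 / max (A.next_cell t ?g (snd y)) (B.next_cell t ?g (snd y))) * B.next_cell t ?g (snd y)"
      by (rule B.nn_integral_step_cell[OF t sf(2), where h = "\<lambda>_. 1 / max (A.next_cell t ?g (snd y)) (B.next_cell t ?g (snd y))"])
    finally show "B.next_cell t ?g (snd y) * (1 / max (A.next_cell t ?g (snd y)) (B.next_cell t ?g (snd y)))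
      = (\<integral>\<^sup>+y'. ?f y y' * ?\<phi> y y' \<partial>B.step t (snd s))" by (simp only: mult.commute)
  qed
  also have "\<dots> \<le> (\<integral>\<^sup>+(y, y'). ?\<phi> y y' \<partial>joint_step t s)"
    unfolding joint_step_def
    by (subst nn_integral_completion[OF PA(1) PB(1) mo mi]) simp
  finally have le: "cell_overlap t ?g \<le> (\<integral>\<^sup>+(y, y'). ?\<phi> y y' \<partial>joint_step t s)" .
  interpret L: prob_space "joint_step t s" by (rule kernel_prob[OF joint_step_kernel[OF t] s])
  have ml: "(\<lambda>y. h (snd (fst y), snd (snd y))) \<in> borel_measurable (joint_step t s)" for h :: "_ \<Rightarrow> ennreal"
  proof -
    have "(\<lambda>y. (snd (fst y), snd (snd y))) \<in> steps \<Otimes>\<^sub>M steps \<rightarrow>\<^sub>M count_space UNIV"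
      by (intro measurable_count_Pair) measurable
    from measurable_compose[OF this, of h borel] show ?thesis
      by (simp add: measurable_cong_sets[OF kernel_sets[OF joint_step_kernel[OF t] s] refl])
  qed
  have "(\<integral>\<^sup>+y. (if snd (fst y) = snd (snd y) then 0 else 1) \<partial>joint_step t s) + (\<integral>\<^sup>+y. (if snd (fst y) = snd (snd y) then 1 else 0) \<partial>joint_step t s)
    = (\<integral>\<^sup>+y. (if snd (fst y) = snd (snd y) then 0 else 1) + (if snd (fst y) = snd (snd y) then 1 else 0) \<partial>joint_step t s)"
    using ml[of "\<lambda>(j, j'). if j = j' then 0 else 1"] ml[of "\<lambda>(j, j'). if j = j' then 1 else 0"]
    by (intro nn_integral_add[symmetric]) simp_all
  also have "\<dots> = (\<integral>\<^sup>+y. 1 \<partial>joint_step t s)" by (intro nn_integral_cong) simp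
  finally have sum1: "(\<integral>\<^sup>+y. (if snd (fst y) = snd (snd y) then 0 else 1) \<partial>joint_step t s) + (\<integral>\<^sup>+y. (if snd (fst y) = snd (snd y) then 1 else 0) \<partial>joint_step t s) = 1"
    by (simp add: L.emeasure_space_1)
  have le': "cell_overlap t ?g \<le> (\<integral>\<^sup>+y. (if snd (fst y) = snd (snd y) then 1 else 0) \<partial>joint_step t s)"
    using le by (simp only: split_beta')
  have le1: "(\<integral>\<^sup>+y. (if snd (fst y) = snd (snd y) then 0 else 1) \<partial>joint_step t s) + cell_overlap t ?g \<le> 1"
    by (rule order_trans[OF add_left_mono[OF le'] eq_refl[OF sum1]])
  have "cell_overlap t ?g \<noteq> top" using le1 by (auto simp: top_unique)
  then have "(\<integral>\<^sup>+y. (if snd (fst y) = snd (snd y) then 0 else 1) \<partial>joint_step t s)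
    = (\<integral>\<^sup>+y. (if snd (fst y) = snd (snd y) then 0 else 1) \<partial>joint_step t s) + cell_overlap t ?g - cell_overlap t ?g"
    by (rule ennreal_add_diff_cancel_right[symmetric])
  also have "\<dots> \<le> 1 - cell_overlap t ?g" by (rule ennreal_minus_mono[OF le1 order_refl])
  finally show ?thesis unfolding eq .
qed

text \<open>Fix past cells \<open>g\<close>. Under \<pi> let \<open>c\<close> be the mass of the
  pairs whose cells agree up to time \<open>t + 1\<close> with past \<open>g\<close>, so that the
  two laws give \<open>g\<close> the masses \<open>c + e1\<close> and \<open>c + e2\<close>, and let
  \<open>M\<close> be the larger one. For each next cell the agreeing mass is at most
  \<open>M\<close> times either transition probability; hence
  \<open>c \<le> M * cell_overlap\<close> and
  \<open>M * (1 - cell_overlap) \<le> M - c \<le> e1 + e2\<close>. The joint chain sits at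
  \<open>(g, g)\<close> with probability at most \<open>M\<close>, and summing over \<open>g\<close>
  turns each of \<open>e1\<close> and \<open>e2\<close> into the probability under \<pi> that the
  cells differ: this is the factor 2.\<close>

lemma joint_chain_decoupling_Suc:
  assumes t: "t < T" and \<pi>: "\<pi> \<in> couplings \<mu> \<nu>"
  shows "(\<integral>\<^sup>+s. (if snd (fst s) = snd (snd s) then 0 else 1) \<partial>joint_chain (Suc t))
    \<le> (\<integral>\<^sup>+s. (if snd (fst s) = snd (snd s) then 0 else 1) \<partial>joint_chain t)
      + 2 * (\<integral>\<^sup>+\<omega>. (if qlist q (Suc t) (fst \<omega>) = qlist q (Suc t) (snd \<omega>) then 0 else 1) \<partial>\<pi>)"
proof -
  interpret \<pi>: prob_space \<pi> by (rule couplings_D(1)[OF \<pi>])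
  interpret M: prob_space "joint_chain t" using t by (intro prob_joint_chain) simp
  note sets_M[measurable_cong] = sets_joint_chain[OF less_imp_le[OF t]]
  note tT = less_imp_le[OF t] Suc_leI[OF t]
  have mf: "fst \<in> \<pi> \<rightarrow>\<^sub>M \<mu>" and ms: "snd \<in> \<pi> \<rightarrow>\<^sub>M \<nu>"
    by (simp_all add: measurable_cong_sets[OF couplings_D(2)[OF \<pi>] refl])
  have Qf: "(\<lambda>\<omega>. qlist q m (fst \<omega>)) \<in> \<pi> \<rightarrow>\<^sub>M count_space UNIV"
    and Qs: "(\<lambda>\<omega>. qlist q m (snd \<omega>)) \<in> \<pi> \<rightarrow>\<^sub>M count_space UNIV" if "m \<le> T" for m
    using measurable_compose[OF mf A.qlist_meas[OF that]] measurable_compose[OF ms B.qlist_meas[OF that]] by simp_all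
  note Q[measurable] = Qf[OF tT(1)] Qs[OF tT(1)] Qf[OF tT(2)] Qs[OF tT(2)]
  have pairm: "(\<lambda>s. h (snd (fst s)) (snd (snd s))) \<in> borel_measurable (states m \<Otimes>\<^sub>M states m)" for h :: "_ \<Rightarrow> _ \<Rightarrow> ennreal" and m
  proof -
    have "(\<lambda>s. (snd (fst s), snd (snd s))) \<in> states m \<Otimes>\<^sub>M states m \<rightarrow>\<^sub>M count_space UNIV"
      by (intro measurable_count_Pair) measurable
    from measurable_compose[OF this, of "\<lambda>(a, b). h a b" borel] show ?thesis by simp
  qed
  have ind: "(\<lambda>\<omega>. indicator {g} (f \<omega>) :: ennreal) \<in> borel_measurable N" if "f \<in> N \<rightarrow>\<^sub>M count_space UNIV"
    for g :: 'g and f and N :: "'n measure"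
    by (rule measurable_compose[OF that]) simp
  let ?E = "\<lambda>\<omega>. qlist q (Suc t) (fst \<omega>) = qlist q (Suc t) (snd \<omega>)"
  have [measurable]: "Measurable.pred \<pi> ?E"
  proof -
    have "(\<lambda>\<omega>. (qlist q (Suc t) (fst \<omega>), qlist q (Suc t) (snd \<omega>))) \<in> \<pi> \<rightarrow>\<^sub>M count_space UNIV"
      by (intro measurable_count_Pair) measurable
    from measurable_compose[OF this, of "\<lambda>(a, b). a = b" "count_space UNIV"] show ?thesis by simp
  qed
  define eq :: "(nat \<Rightarrow> real^'d) \<times> (nat \<Rightarrow> real^'d) \<Rightarrow> ennreal" where "eq \<omega> = (if ?E \<omega> then 1 else 0)" for \<omega>
  define ne :: "(nat \<Rightarrow> real^'d) \<times> (nat \<Rightarrow> real^'d) \<Rightarrow> ennreal" where "ne \<omega> = (if ?E \<omega> then 0 else 1)" for \<omega>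
  have [measurable]: "eq \<in> borel_measurable \<pi>" "ne \<in> borel_measurable \<pi>" unfolding eq_def ne_def by measurable
  define w where "w g = (\<integral>\<^sup>+s. indicator {g} (snd (snd s)) * indicator {g} (snd (fst s)) \<partial>joint_chain t)" for g
  define e1 where "e1 g = (\<integral>\<^sup>+\<omega>. ne \<omega> * indicator {g} (qlist q t (fst \<omega>)) \<partial>\<pi>)" for g
  define e2 where "e2 g = (\<integral>\<^sup>+\<omega>. ne \<omega> * indicator {g} (qlist q t (snd \<omega>)) \<partial>\<pi>)" for g
  have A_cell: "emeasure \<mu> (A.cell m g) = (\<integral>\<^sup>+x. indicator {g} (qlist q m x) \<partial>\<mu>)" if "m \<le> T" for m g
    by (subst nn_integral_indicator[symmetric, OF A.sets_cell[OF that]]) (auto intro!: nn_integral_cong simp: A.cell_def indicator_def)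
  have B_cell: "emeasure \<nu> (B.cell m g) = (\<integral>\<^sup>+x. indicator {g} (qlist q m x) \<partial>\<nu>)" if "m \<le> T" for m g
    by (subst nn_integral_indicator[symmetric, OF B.sets_cell[OF that]]) (auto intro!: nn_integral_cong simp: B.cell_def indicator_def)
  have A_\<pi>: "emeasure \<mu> (A.cell m g) = (\<integral>\<^sup>+\<omega>. indicator {g} (qlist q m (fst \<omega>)) \<partial>\<pi>)" if "m \<le> T" for m g
    unfolding A_cell[OF that] by (rule couplings_nn_integral_fst[symmetric, OF \<pi>]) (rule ind[OF A.qlist_meas[OF that]])
  have B_\<pi>: "emeasure \<nu> (B.cell m g) = (\<integral>\<^sup>+\<omega>. indicator {g} (qlist q m (snd \<omega>)) \<partial>\<pi>)" if "m \<le> T" for m g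
    unfolding B_cell[OF that] by (rule couplings_nn_integral_snd[symmetric, OF \<pi>]) (rule ind[OF B.qlist_meas[OF that]])
  have w_le: "w g \<le> emeasure \<mu> (A.cell t g)" for g
  proof -
    have m: "(\<lambda>s. indicator {g} (snd s) :: ennreal) \<in> borel_measurable (states t)" by (rule ind) measurable
    have "w g \<le> (\<integral>\<^sup>+s. indicator {g} (snd (fst s)) \<partial>joint_chain t)"
      unfolding w_def by (intro nn_integral_mono) (auto simp: indicator_def)
    also have "\<dots> = (\<integral>\<^sup>+s. indicator {g} (snd s) \<partial>A.chain t)"
      by (rule nn_integral_joint_chain_fst[OF tT(1) m])
    also have "\<dots> = emeasure \<mu> (A.cell t g)"
      unfolding A_cell[OF tT(1)] by (rule A.nn_integral_chain_snd[OF tT(1)])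
    finally show ?thesis .
  qed
  have bound: "w g * (1 - cell_overlap t g) \<le> e1 g + e2 g" for g
  proof -
    let ?\<alpha> = "emeasure \<mu> (A.cell t g)" and ?\<beta> = "emeasure \<nu> (B.cell t g)"
    define M where "M = max ?\<alpha> ?\<beta>"
    define c where "c = (\<integral>\<^sup>+\<omega>. eq \<omega> * indicator {g} (qlist q t (fst \<omega>)) \<partial>\<pi>)"
    note [measurable] = ind[OF Q(1)] ind[OF Q(2)]
    have a: "?\<alpha> = c + e1 g"
    proof -
      have "c + e1 g = (\<integral>\<^sup>+\<omega>. eq \<omega> * indicator {g} (qlist q t (fst \<omega>)) + ne \<omega> * indicator {g} (qlist q t (fst \<omega>)) \<partial>\<pi>)"
        unfolding c_def e1_def by (rule nn_integral_add[symmetric]) measurable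
      also have "\<dots> = ?\<alpha>" unfolding A_\<pi>[OF tT(1)] by (intro nn_integral_cong) (simp add: eq_def ne_def)
      finally show ?thesis by simp
    qed
    have c': "c = (\<integral>\<^sup>+\<omega>. eq \<omega> * indicator {g} (qlist q t (snd \<omega>)) \<partial>\<pi>)"
      unfolding c_def by (intro nn_integral_cong) (auto simp: eq_def)
    have b: "?\<beta> = c + e2 g"
    proof -
      have "c + e2 g = (\<integral>\<^sup>+\<omega>. eq \<omega> * indicator {g} (qlist q t (snd \<omega>)) + ne \<omega> * indicator {g} (qlist q t (snd \<omega>)) \<partial>\<pi>)"
        unfolding c' e2_def by (rule nn_integral_add[symmetric]) measurable
      also have "\<dots> = ?\<beta>" unfolding B_\<pi>[OF tT(1)] by (intro nn_integral_cong) (simp add: eq_def ne_def)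
      finally show ?thesis by simp
    qed
    have c_fin: "c \<noteq> top" using a A.emeasure_finite[of "A.cell t g"] by auto
    have M_le: "M \<le> c + (e1 g + e2 g)"
      unfolding M_def a b by (auto simp: add_left_mono)
    have qm: "(\<lambda>\<omega>. q (fst \<omega> (Suc t))) \<in> \<pi> \<rightarrow>\<^sub>M count_space UNIV"
    proof -
      have "(\<lambda>x. q (x (Suc t))) \<in> \<mu> \<rightarrow>\<^sub>M count_space UNIV"
        using t by (intro A.\<gamma>_measurable measurable_compose[OF measurable_path_component A.q_meas]) auto
      from measurable_compose[OF mf this] show ?thesis .
    qed
    have "c = (\<integral>\<^sup>+j. (\<integral>\<^sup>+\<omega>. eq \<omega> * indicator {g} (qlist q t (fst \<omega>)) * indicator {j} (q (fst \<omega> (Suc t))) \<partial>\<pi>) \<partial>count_space UNIV)"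
      unfolding c_def
      by (rule nn_integral_countable_fibres[where H = "\<lambda>j \<omega>. eq \<omega> * indicator {g} (qlist q t (fst \<omega>))", OF \<pi>.sigma_finite_measure_axioms qm]) measurable
    also have "\<dots> \<le> (\<integral>\<^sup>+j. M * min (A.next_cell t g j) (B.next_cell t g j) \<partial>count_space UNIV)"
    proof (rule nn_integral_mono)
      fix j
      have "(\<integral>\<^sup>+\<omega>. eq \<omega> * indicator {g} (qlist q t (fst \<omega>)) * indicator {j} (q (fst \<omega> (Suc t))) \<partial>\<pi>)
        \<le> (\<integral>\<^sup>+\<omega>. indicator {j # g} (qlist q (Suc t) (fst \<omega>)) \<partial>\<pi>)"
        by (intro nn_integral_mono) (auto simp: eq_def indicator_def)
      also have "\<dots> = ?\<alpha> * A.next_cell t g j" unfolding A_\<pi>[OF tT(2), symmetric] by (rule A.cell_Suc[OF t])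
      also have "\<dots> \<le> M * A.next_cell t g j" by (intro mult_right_mono) (auto simp: M_def)
      finally have 1: "(\<integral>\<^sup>+\<omega>. eq \<omega> * indicator {g} (qlist q t (fst \<omega>)) * indicator {j} (q (fst \<omega> (Suc t))) \<partial>\<pi>) \<le> M * A.next_cell t g j" .
      have "(\<integral>\<^sup>+\<omega>. eq \<omega> * indicator {g} (qlist q t (fst \<omega>)) * indicator {j} (q (fst \<omega> (Suc t))) \<partial>\<pi>)
        \<le> (\<integral>\<^sup>+\<omega>. indicator {j # g} (qlist q (Suc t) (snd \<omega>)) \<partial>\<pi>)"
        by (intro nn_integral_mono) (auto simp: eq_def indicator_def)
      also have "\<dots> = ?\<beta> * B.next_cell t g j" unfolding B_\<pi>[OF tT(2), symmetric] by (rule B.cell_Suc[OF t])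
      also have "\<dots> \<le> M * B.next_cell t g j" by (intro mult_right_mono) (auto simp: M_def)
      finally show "(\<integral>\<^sup>+\<omega>. eq \<omega> * indicator {g} (qlist q t (fst \<omega>)) * indicator {j} (q (fst \<omega> (Suc t))) \<partial>\<pi>)
        \<le> M * min (A.next_cell t g j) (B.next_cell t g j)"
        using 1 by (simp add: min_def)
    qed
    also have "\<dots> = M * cell_overlap t g" unfolding cell_overlap_def by (rule nn_integral_cmult) simp
    finally have c_le: "c \<le> M * cell_overlap t g" .
    \<comment> \<open>Adding \<open>c\<close> on both sides avoids a subtraction in
      \<open>ennreal\<close>. A value of \<open>cell_overlap\<close> above 1 would make the
      truncated difference 0, so that case is immediate.\<close>
    have "c + M * (1 - cell_overlap t g) \<le> c + (e1 g + e2 g)"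
    proof (cases "cell_overlap t g \<le> 1")
      case False
      then have "1 - cell_overlap t g = 0" by (intro diff_eq_0_ennreal) auto
      then show ?thesis by simp
    next
      case True
      have "c + M * (1 - cell_overlap t g) \<le> M * cell_overlap t g + M * (1 - cell_overlap t g)"
        using c_le by (rule add_right_mono)
      also have "\<dots> = M * (cell_overlap t g + (1 - cell_overlap t g))" by (simp add: distrib_left)
      also have "\<dots> = M" using True by (simp add: add_diff_inverse_ennreal)
      finally have "c + M * (1 - cell_overlap t g) \<le> M" .
      then show ?thesis using M_le by (rule order_trans)
    qed
    then have "M * (1 - cell_overlap t g) \<le> e1 g + e2 g"
      using c_fin by (simp add: ennreal_add_left_cancel_le)
    moreover have "w g \<le> M" using w_le[of g] by (auto simp: M_def intro: le_max_iff_disj[THEN iffD2])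
    ultimately show ?thesis by (meson mult_right_mono order_trans zero_le)
  qed
  have "(\<integral>\<^sup>+s. (if snd (fst s) = snd (snd s) then 0 else 1) \<partial>joint_chain (Suc t))
    = (\<integral>\<^sup>+s. (\<integral>\<^sup>+y. (if snd (fst (joint_extend t s y)) = snd (snd (joint_extend t s y)) then 0 else 1) \<partial>joint_step t s) \<partial>joint_chain t)"
    by (rule nn_integral_joint_chain_Suc[OF t]) (rule pairm)
  \<comment> \<open>Once the cells differ, the trivial bound 1 is kept; from equal cells a new
    disagreement has conditional probability at most \<open>1 - cell_overlap\<close>.\<close>
  also have "\<dots> \<le> (\<integral>\<^sup>+s. (if snd (fst s) = snd (snd s) then 0 else 1) + (if snd (fst s) = snd (snd s) then 1 - cell_overlap t (snd (fst s)) else 0) \<partial>joint_chain t)"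
  proof (rule nn_integral_mono)
    fix s assume "s \<in> space (joint_chain t)"
    then have s: "s \<in> space (states t \<Otimes>\<^sub>M states t)" using tT by (simp add: space_joint_chain)
    show "(\<integral>\<^sup>+y. (if snd (fst (joint_extend t s y)) = snd (snd (joint_extend t s y)) then 0 else 1) \<partial>joint_step t s)
      \<le> (if snd (fst s) = snd (snd s) then 0 else 1) + (if snd (fst s) = snd (snd s) then 1 - cell_overlap t (snd (fst s)) else 0)"
    proof (cases "snd (fst s) = snd (snd s)")
      case True
      have "(\<integral>\<^sup>+y. (if snd (fst (joint_extend t s y)) = snd (snd (joint_extend t s y)) then 0 else 1) \<partial>joint_step t s)
        = (\<integral>\<^sup>+y. (if snd (fst y) = snd (snd y) then 0 else 1) \<partial>joint_step t s)"
        using True by (intro nn_integral_cong) (auto simp: joint_extend_def A.extend_def)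
      also have "\<dots> \<le> 1 - cell_overlap t (snd (fst s))" by (rule joint_step_overlap[OF t s True])
      finally show ?thesis using True by simp
    next
      case False
      have "(\<integral>\<^sup>+y. (if snd (fst (joint_extend t s y)) = snd (snd (joint_extend t s y)) then 0 else 1) \<partial>joint_step t s) \<le> (\<integral>\<^sup>+y. 1 \<partial>joint_step t s)"
        by (intro nn_integral_mono) auto
      also have "\<dots> = 1" using prob_space.emeasure_space_1[OF kernel_prob[OF joint_step_kernel[OF t] s]] by simp
      finally show ?thesis using False by simp
    qed
  qed
  also have "\<dots> = (\<integral>\<^sup>+s. (if snd (fst s) = snd (snd s) then 0 else 1) \<partial>joint_chain t)
      + (\<integral>\<^sup>+s. (if snd (fst s) = snd (snd s) then 1 - cell_overlap t (snd (fst s)) else 0) \<partial>joint_chain t)"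
    using pairm[of "\<lambda>a b. if a = b then 0 else 1" t] pairm[of "\<lambda>a b. if a = b then 1 - cell_overlap t a else 0" t]
    by (intro nn_integral_add) (simp_all add: measurable_cong_sets[OF sets_M refl])
  also have "(\<integral>\<^sup>+s. (if snd (fst s) = snd (snd s) then 1 - cell_overlap t (snd (fst s)) else 0) \<partial>joint_chain t)
    = (\<integral>\<^sup>+g. (\<integral>\<^sup>+s. (if g = snd (snd s) then 1 - cell_overlap t g else 0) * indicator {g} (snd (fst s)) \<partial>joint_chain t) \<partial>count_space UNIV)"
    by (rule nn_integral_countable_fibres[where q = "\<lambda>s. snd (fst s)" and H = "\<lambda>g s. if g = snd (snd s) then 1 - cell_overlap t g else 0", OF M.sigma_finite_measure_axioms])
      (use pairm[of "\<lambda>a b. if _ = b then 1 - cell_overlap t _ else 0" t] in \<open>simp_all add: measurable_cong_sets[OF sets_M refl]\<close>)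
  also have "\<dots> = (\<integral>\<^sup>+g. w g * (1 - cell_overlap t g) \<partial>count_space UNIV)"
  proof (rule nn_integral_cong)
    fix g
    have m: "(\<lambda>s. indicator {g} (snd (snd s)) * indicator {g} (snd (fst s)) :: ennreal) \<in> borel_measurable (joint_chain t)"
      using pairm[of "\<lambda>a b. indicator {g} b * indicator {g} a" t] by (simp add: measurable_cong_sets[OF sets_M refl])
    have "(\<integral>\<^sup>+s. (if g = snd (snd s) then 1 - cell_overlap t g else 0) * indicator {g} (snd (fst s)) \<partial>joint_chain t)
      = (\<integral>\<^sup>+s. indicator {g} (snd (snd s)) * indicator {g} (snd (fst s)) * (1 - cell_overlap t g) \<partial>joint_chain t)"
      by (intro nn_integral_cong) (auto simp: indicator_def)
    also have "\<dots> = w g * (1 - cell_overlap t g)" unfolding w_def by (rule nn_integral_multc[OF m])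
    finally show "(\<integral>\<^sup>+s. (if g = snd (snd s) then 1 - cell_overlap t g else 0) * indicator {g} (snd (fst s)) \<partial>joint_chain t) = w g * (1 - cell_overlap t g)" .
  qed
  also have "\<dots> \<le> (\<integral>\<^sup>+g. e1 g + e2 g \<partial>count_space UNIV)" by (intro nn_integral_mono bound)
  also have "\<dots> = (\<integral>\<^sup>+g. e1 g \<partial>count_space UNIV) + (\<integral>\<^sup>+g. e2 g \<partial>count_space UNIV)" by (simp add: nn_integral_add)
  also have "(\<integral>\<^sup>+g. e1 g \<partial>count_space UNIV) = (\<integral>\<^sup>+\<omega>. ne \<omega> \<partial>\<pi>)"
    unfolding e1_def by (rule nn_integral_countable_fibres[symmetric, where H = "\<lambda>_. ne", OF \<pi>.sigma_finite_measure_axioms Q(1)]) measurable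
  also have "(\<integral>\<^sup>+g. e2 g \<partial>count_space UNIV) = (\<integral>\<^sup>+\<omega>. ne \<omega> \<partial>\<pi>)"
    unfolding e2_def by (rule nn_integral_countable_fibres[symmetric, where H = "\<lambda>_. ne", OF \<pi>.sigma_finite_measure_axioms Q(2)]) measurable
  also have "(\<integral>\<^sup>+\<omega>. ne \<omega> \<partial>\<pi>) + (\<integral>\<^sup>+\<omega>. ne \<omega> \<partial>\<pi>) = 2 * (\<integral>\<^sup>+\<omega>. (if ?E \<omega> then 0 else 1) \<partial>\<pi>)"
    unfolding ne_def by (simp add: mult_2)
  finally show ?thesis by (simp add: add_left_mono)
qed

text \<open>Cell lists that differ at an earlier time still differ at time \<open>T\<close>, so
  every step costs at most twice the final probability of disagreement.\<close>

lemma joint_chain_decoupling: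
  assumes \<pi>: "\<pi> \<in> couplings \<mu> \<nu>" and "t \<le> T"
  shows "(\<integral>\<^sup>+s. (if snd (fst s) = snd (snd s) then 0 else 1) \<partial>joint_chain t)
    \<le> 2 * of_nat t * (\<integral>\<^sup>+\<omega>. (if qlist q T (fst \<omega>) = qlist q T (snd \<omega>) then 0 else 1) \<partial>\<pi>)"
  using \<open>t \<le> T\<close>
proof (induction t)
  case 0
  have "(\<integral>\<^sup>+s. (if snd (fst s) = snd (snd s) then 0 else 1) \<partial>joint_chain 0) = (0::ennreal)"
    unfolding joint_chain.simps
  proof (subst nn_integral_return)
    have "(\<lambda>s. (snd (fst s), snd (snd s))) \<in> states 0 \<Otimes>\<^sub>M states 0 \<rightarrow>\<^sub>M count_space UNIV"
      by (intro measurable_count_Pair) measurable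
    from measurable_compose[OF this, of "\<lambda>(a, b). if a = b then 0 else 1" borel]
    show "(\<lambda>s. if snd (fst s) = snd (snd s) then 0 else 1 :: ennreal) \<in> borel_measurable (states 0 \<Otimes>\<^sub>M states 0)" by simp
  qed (simp_all add: space_pair_measure space_path_0)
  then show ?case by simp
next
  case (Suc t)
  let ?\<rho> = "\<integral>\<^sup>+\<omega>. (if qlist q T (fst \<omega>) = qlist q T (snd \<omega>) then 0 else 1) \<partial>\<pi> :: ennreal"
  have "(\<integral>\<^sup>+\<omega>. (if qlist q (Suc t) (fst \<omega>) = qlist q (Suc t) (snd \<omega>) then 0 else 1) \<partial>\<pi>) \<le> ?\<rho>"
  proof (intro nn_integral_mono)
    fix \<omega> :: "(nat \<Rightarrow> real^'d) \<times> (nat \<Rightarrow> real^'d)"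
    have "qlist q (Suc t) (fst \<omega>) = qlist q (Suc t) (snd \<omega>)" if "qlist q T (fst \<omega>) = qlist q T (snd \<omega>)"
      using drop_qlist[OF Suc.prems, of q] that by metis
    then show "(if qlist q (Suc t) (fst \<omega>) = qlist q (Suc t) (snd \<omega>) then 0 else 1)
      \<le> (if qlist q T (fst \<omega>) = qlist q T (snd \<omega>) then 0 else 1 :: ennreal)"
      by (simp del: qlist.simps)
  qed
  then have "(\<integral>\<^sup>+s. (if snd (fst s) = snd (snd s) then 0 else 1) \<partial>joint_chain (Suc t)) \<le> 2 * of_nat t * ?\<rho> + 2 * ?\<rho>"
    using joint_chain_decoupling_Suc[OF _ \<pi>, of t] Suc
    by (meson Suc_le_lessD add_mono less_imp_le mult_left_mono order_trans zero_le)
  also have "\<dots> = 2 * of_nat (Suc t) * ?\<rho>" by (simp add: algebra_simps)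
  finally show ?case .
qed

end

section \<open>The error of quantisation\<close>

lemma epowr_epowr: "0 < p \<Longrightarrow> epowr (epowr x (1 / p)) p = x"
  by (cases x) (auto simp: epowr_def powr_powr)

lemma epowr_leI: "0 < p \<Longrightarrow> 0 \<le> a \<Longrightarrow> x \<le> ennreal (a powr p) \<Longrightarrow> epowr x (1 / p) \<le> ennreal a"
proof (cases x)
  case (real y)
  assume p: "0 < p" "0 \<le> a" "x \<le> ennreal (a powr p)"
  then have "y powr (1 / p) \<le> (a powr p) powr (1 / p)" using real by (intro powr_mono2) auto
  then show ?thesis using real p by (simp add: epowr_def powr_powr ennreal_leI)
qed (simp add: top_unique)

lemma epowr_leD: "0 < p \<Longrightarrow> 0 \<le> a \<Longrightarrow> epowr x (1 / p) \<le> ennreal a \<Longrightarrow> x \<le> ennreal (a powr p)"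
proof (cases x)
  case (real y)
  assume p: "0 < p" "0 \<le> a" "epowr x (1 / p) \<le> ennreal a"
  then have "y powr (1 / p) \<le> a" using real by (simp add: epowr_def)
  then have "(y powr (1 / p)) powr p \<le> a powr p" using p by (intro powr_mono2) auto
  then show ?thesis using real p by (simp add: powr_powr ennreal_leI)
qed (simp add: epowr_def top_unique)

text \<open>The diagonal coupling. It makes the transport cost of the initial step vanish, where
  both pasts are empty.\<close>

lemma wasserstein_self:
  fixes M :: "'a::euclidean_space measure"
  assumes "prob_space M" "sets M = sets borel" "0 < p"
  shows "(INF \<pi>\<in>couplings M M. \<integral>\<^sup>+\<omega>. ennreal (dist (fst \<omega>) (snd \<omega>) powr p) \<partial>\<pi>) = (0 :: ennreal)"
    (is "?I = 0")
proof -
  note [measurable_cong] = assms(2)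
  let ?\<pi> = "distr M (M \<Otimes>\<^sub>M M) (\<lambda>z. (z, z))"
  have "?\<pi> \<in> couplings M M" using assms(1) by (intro couplingsI_distr) (auto simp: distr_id[of M, unfolded id_def])
  then have "?I \<le> (\<integral>\<^sup>+\<omega>. ennreal (dist (fst \<omega>) (snd \<omega>) powr p) \<partial>?\<pi>)" by (rule INF_lower)
  also have "\<dots> = (\<integral>\<^sup>+z. ennreal (dist z z powr p) \<partial>M)" by (subst nn_integral_distr) auto
  also have "\<dots> = 0" using assms(3) by simp
  finally show ?thesis by simp
qed

text \<open>Here \<epsilon> is the loss in the choice of \<open>K\<close>, \<eta> the radius of the
  cells, and \<open>c\<close> the measurable lower bound for the root of the transport cost
  delivered by \<open>ex_near_optimal_kernel\<close>. The moduli enter as reals \<open>h\<close>,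
  that is, as finite ones. The condition \<open>small\<close> makes the losses of all steps together
  smaller than \<open>h 0 = \<sigma>\<close>, which secures the strict inequality in the
  modulus.\<close>

locale quantised_law_error = quantised_law \<gamma> T "cond_law \<gamma>" q K
  for \<gamma> :: "(nat \<Rightarrow> real^'d) measure" and T q K +
  fixes p \<epsilon> \<eta> \<sigma> :: real and r :: "nat \<Rightarrow> real^'d"
    and c :: "nat \<Rightarrow> (nat \<Rightarrow> real^'d) \<times> (nat \<Rightarrow> real^'d) \<Rightarrow> real" and h :: "nat \<Rightarrow> real"
  assumes p: "1 \<le> p" and \<epsilon>: "0 \<le> \<epsilon>" and quant: "quantizer q r \<eta>"
    and moment: "(\<integral>\<^sup>+x. ennreal (path_norm T x powr p) \<partial>\<gamma>) < \<infinity>"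
    and c_meas: "t < T \<Longrightarrow> c t \<in> borel_measurable (path_space t \<Otimes>\<^sub>M path_space t)"
    and c_nonneg: "0 \<le> c t w"
    and K_cost: "t < T \<Longrightarrow> x \<in> space (path_space t) \<Longrightarrow> x' \<in> space (path_space t) \<Longrightarrow>
      (\<integral>\<^sup>+z. ennreal (norm z powr p) \<partial>cond_law \<gamma> t x) < \<infinity> \<Longrightarrow>
      (\<integral>\<^sup>+z. ennreal (norm z powr p) \<partial>cond_law \<gamma> t x') < \<infinity> \<Longrightarrow>
      (\<integral>\<^sup>+\<omega>. ennreal (dist (fst \<omega>) (snd \<omega>) powr p) \<partial>K t (x, x')) \<le> ennreal ((c t (x, x') + \<epsilon>) powr p) \<and>
      ennreal (c t (x, x') powr p) \<le>
        (INF \<pi>\<in>couplings (cond_law \<gamma> t x) (cond_law \<gamma> t x'). \<integral>\<^sup>+\<omega>. ennreal (dist (fst \<omega>) (snd \<omega>) powr p) \<partial>\<pi>)"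
    and h: "t < T \<Longrightarrow> iter_modulus p \<gamma> t (ennreal \<sigma>) = ennreal (h t)" and h_nonneg: "0 \<le> h t" and h0: "h 0 = \<sigma>"
    and small: "real T * (\<epsilon> + 2 * \<eta>) < \<sigma>"
begin

lemma \<eta>_nonneg: "0 \<le> \<eta>" and r_q: "dist z (r (q z)) \<le> \<eta>"
proof -
  show "dist z (r (q z)) \<le> \<eta>" for z using quant by (auto simp: quantizer_def)
  from this[of undefined] show "0 \<le> \<eta>" using zero_le_dist order_trans by blast
qed

text \<open>The first step is drawn from a single law, so \<open>h 0 = \<sigma>\<close> does not contribute to its error.\<close>

definition h' :: "nat \<Rightarrow> real" where "h' t = (if t = 0 then 0 else h t)"

text \<open>The three sources of error at time \<open>t\<close>: transport between the conditional
  laws of the path and of the resampled path, the loss in choosing \<open>K\<close>, and the radius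
  of the cell. The index \<open>t - 1\<close> counts the coordinates conditioned on.\<close>

definition err :: "nat \<Rightarrow> real" where "err t = h' (t - 1) + (\<epsilon> + \<eta>)"

lemma h'_nonneg: "0 \<le> h' t" by (simp add: h'_def h_nonneg)

lemma err_nonneg: "0 \<le> err t" using h'_nonneg[of "t - 1"] \<epsilon> \<eta>_nonneg by (simp add: err_def)

text \<open>A second path that shares the cells \<open>Q\<^bsub>1:t\<^esub>\<close> of the chain. Both of its coordinates have law
  \<open>\<gamma>\<close>, so it is admissible in the modulus of continuity.\<close>

definition resampled :: "nat \<Rightarrow> ((nat \<Rightarrow> real^'d) \<times> (nat \<Rightarrow> real^'d)) measure" where
  "resampled t = chain T \<bind>
     (\<lambda>s. distr (cell_law t (drop (T - t) (snd s))) (path_space T \<Otimes>\<^sub>M path_space T) (\<lambda>x'. (fst s, x')))"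

lemma resampled_kernel:
  assumes "t \<le> T"
  shows "(\<lambda>s. distr (cell_law t (drop (T - t) (snd s))) (path_space T \<Otimes>\<^sub>M path_space T) (\<lambda>x'. (fst s, x')))
    \<in> states T \<rightarrow>\<^sub>M prob_algebra (path_space T \<Otimes>\<^sub>M path_space T)"
proof -
  have "(\<lambda>s. drop (T - t) (snd s)) \<in> states T \<rightarrow>\<^sub>M count_space UNIV"
    by (rule measurable_compose[OF measurable_snd]) simp
  from measurable_compose[OF this cell_law_kernel[OF assms]]
  have [measurable]: "(\<lambda>s. cell_law t (drop (T - t) (snd s))) \<in> states T \<rightarrow>\<^sub>M prob_algebra (path_space T)" .
  show ?thesis by measurable
qed

lemma nn_integral_resampled:
  assumes t: "t \<le> T" and F[measurable]: "F \<in> borel_measurable (path_space T \<Otimes>\<^sub>M path_space T)"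
  shows "(\<integral>\<^sup>+\<omega>. F \<omega> \<partial>resampled t) = (\<integral>\<^sup>+s. (\<integral>\<^sup>+x'. F (fst s, x') \<partial>cell_law t (drop (T - t) (snd s))) \<partial>chain T)"
proof -
  have "(\<integral>\<^sup>+\<omega>. F \<omega> \<partial>resampled t)
    = (\<integral>\<^sup>+s. (\<integral>\<^sup>+\<omega>. F \<omega> \<partial>distr (cell_law t (drop (T - t) (snd s))) (path_space T \<Otimes>\<^sub>M path_space T) (\<lambda>x'. (fst s, x'))) \<partial>chain T)"
    unfolding resampled_def
    by (rule nn_integral_bind_prob[OF chain_space[OF order_refl] resampled_kernel[OF t] F])
  also have "\<dots> = (\<integral>\<^sup>+s. (\<integral>\<^sup>+x'. F (fst s, x') \<partial>cell_law t (drop (T - t) (snd s))) \<partial>chain T)"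
  proof (rule nn_integral_cong)
    fix s assume "s \<in> space (chain T)"
    then have [measurable]: "fst s \<in> space (path_space T)" by (auto simp: space_chain)
    show "(\<integral>\<^sup>+\<omega>. F \<omega> \<partial>distr (cell_law t (drop (T - t) (snd s))) (path_space T \<Otimes>\<^sub>M path_space T) (\<lambda>x'. (fst s, x')))
      = (\<integral>\<^sup>+x'. F (fst s, x') \<partial>cell_law t (drop (T - t) (snd s)))"
      by (rule nn_integral_distr_kernel[OF cell_law_space[OF t]]) measurable
  qed
  finally show ?thesis .
qed

lemma sets_resampled: "t \<le> T \<Longrightarrow> sets (resampled t) = sets (path_space T \<Otimes>\<^sub>M path_space T)"
  and prob_resampled: "t \<le> T \<Longrightarrow> prob_space (resampled t)"
proof -
  assume t: "t \<le> T"
  from measurable_space[OF measurable_bind_prob_space[OF measurable_const[OF chain_space[OF order_refl]] resampled_kernel[OF t]], of "()" "count_space UNIV"]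
  have "resampled t \<in> space (prob_algebra (path_space T \<Otimes>\<^sub>M path_space T))" unfolding resampled_def by simp
  then show "sets (resampled t) = sets (path_space T \<Otimes>\<^sub>M path_space T)" "prob_space (resampled t)"
    by (simp_all add: space_prob_algebra)
qed

text \<open>The cells of the chain are distributed like those of a \<gamma>-path, and resampling
  within them returns \<gamma>; the other marginal is that of the chain.\<close>

lemma resampled_couplings:
  assumes t: "t \<le> T"
  shows "resampled t \<in> couplings \<gamma> \<gamma>"
proof (rule couplingsI[OF prob_resampled[OF t]])
  show "sets (resampled t) = sets (\<gamma> \<Otimes>\<^sub>M \<gamma>)"
    using sets_resampled[OF t] sets_pair_measure_cong[OF sets_\<gamma> sets_\<gamma>] by simp
  fix A assume A: "A \<in> sets \<gamma>"
  then have [measurable]: "A \<in> sets (path_space T)" by (simp add: sets_\<gamma>)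
  have "(\<integral>\<^sup>+\<omega>. indicator A (fst \<omega>) \<partial>resampled t)
    = (\<integral>\<^sup>+s. (\<integral>\<^sup>+x'. indicator A (fst s) \<partial>cell_law t (drop (T - t) (snd s))) \<partial>chain T)"
    by (subst nn_integral_resampled[OF t]) auto
  also have "\<dots> = (\<integral>\<^sup>+s. indicator A (fst s) \<partial>chain T)"
    using cell_law_space[OF t] by (simp add: space_prob_algebra prob_space.emeasure_space_1)
  also have "\<dots> = (\<integral>\<^sup>+x. indicator A (restrict x {1..T}) \<partial>\<gamma>)"
    by (rule nn_integral_chain_fst) auto
  also have "\<dots> = (\<integral>\<^sup>+x. indicator A x \<partial>\<gamma>)"
    by (intro nn_integral_cong) (simp add: restrict_path_id space_\<gamma>)
  finally show "(\<integral>\<^sup>+\<omega>. indicator A (fst \<omega>) \<partial>resampled t) = emeasure \<gamma> A" using A by simp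
  have "(\<integral>\<^sup>+\<omega>. indicator A (snd \<omega>) \<partial>resampled t)
    = (\<integral>\<^sup>+s. (\<lambda>g. \<integral>\<^sup>+x'. indicator A x' \<partial>cell_law t (drop (T - t) g)) (snd s) \<partial>chain T)"
    by (subst nn_integral_resampled[OF t]) auto
  also have "\<dots> = (\<integral>\<^sup>+x. (\<integral>\<^sup>+x'. indicator A x' \<partial>cell_law t (drop (T - t) (qlist q T x))) \<partial>\<gamma>)"
    by (rule nn_integral_chain_snd) simp
  also have "\<dots> = (\<integral>\<^sup>+x. (\<integral>\<^sup>+x'. indicator A x' \<partial>cell_law t (qlist q t x)) \<partial>\<gamma>)"
    using t by (simp add: drop_qlist)
  also have "\<dots> = (\<integral>\<^sup>+x. indicator A x \<partial>\<gamma>)"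
    by (rule nn_integral_cell_mixture[OF t]) (use A in auto)
  finally show "(\<integral>\<^sup>+\<omega>. indicator A (snd \<omega>) \<partial>resampled t) = emeasure \<gamma> A" using A by simp
qed

text \<open>Null cells are almost surely avoided by the cells of a \<gamma>-path, and the cells of
  the chain have the same law.\<close>

lemma AE_chain_cell: "t \<le> T \<Longrightarrow> AE s in chain T. emeasure \<gamma> (cell t (drop (T - t) (snd s))) \<noteq> 0"
proof -
  assume t: "t \<le> T"
  let ?f = "\<lambda>g. if emeasure \<gamma> (cell t (drop (T - t) g)) = 0 then 1 else 0 :: ennreal"
  have "(\<integral>\<^sup>+s. ?f (snd s) \<partial>chain T) = (\<integral>\<^sup>+x. ?f (qlist q T x) \<partial>\<gamma>)"
    by (rule nn_integral_chain_snd) simp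
  also have "\<dots> = (\<integral>\<^sup>+x. 0 \<partial>\<gamma>)"
    using AE_fibre_nonnull[OF qlist_meas[OF t]] t
    by (intro nn_integral_cong_AE) (auto simp: drop_qlist cell_def elim!: eventually_mono)
  finally have "(\<integral>\<^sup>+s. ?f (snd s) \<partial>chain T) = 0" by simp
  moreover have "(\<lambda>s. ?f (snd s)) \<in> borel_measurable (chain T)"
    unfolding measurable_cong_sets[OF sets_chain[OF order_refl] refl]
    by (rule measurable_compose[OF measurable_snd]) simp
  ultimately have "AE s in chain T. ?f (snd s) = 0" by (simp add: nn_integral_0_iff_AE)
  then show ?thesis by (rule AE_mp) (auto split: if_splits)
qed

section \<open>The error of the chain, by induction on time\<close>

text \<open>The newest cell is the head of the list, so this compares coordinate \<open>t\<close> of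
  the path with the representative of the cell attached to it at that time.\<close>

definition cost :: "nat \<Rightarrow> ennreal" where
  "cost t = (\<integral>\<^sup>+s. ennreal (dist (fst s t) (r (hd (snd s))) powr p) \<partial>chain t)"

lemma dist_cell_meas:
  assumes "t \<in> {1..n}"
  shows "(\<lambda>s. dist (fst s t) (r (hd (drop k (snd s))))) \<in> borel_measurable (states n)"
proof -
  have [measurable]: "(\<lambda>s. fst s t) \<in> states n \<rightarrow>\<^sub>M borel"
    by (rule measurable_compose[OF measurable_fst measurable_path_component[OF assms]])
  have "(\<lambda>s. r (hd (drop k (snd s)))) \<in> states n \<rightarrow>\<^sub>M borel"
    by (rule measurable_compose[OF measurable_snd]) simp
  then show ?thesis by measurable
qed

lemma cost_prefix:
  assumes "t \<in> {1..T}"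
  shows "(\<integral>\<^sup>+s. ennreal (dist (fst s t) (r (hd (drop (T - t) (snd s)))) powr p) \<partial>chain T) = cost t"
proof -
  have [measurable]: "(\<lambda>s. dist (fst s t) (r (hd (snd s)))) \<in> borel_measurable (states t)"
    using dist_cell_meas[of t t 0] assms by simp
  have "(\<lambda>s. ennreal (dist (fst s t) (r (hd (snd s))) powr p)) \<in> borel_measurable (states t)" by measurable
  from nn_integral_chain_prefix[OF _ order_refl this] assms show ?thesis by (simp add: cost_def)
qed

text \<open>The conditional moments integrate to a moment of \<gamma>. The cost estimate for
  \<open>K\<close>, which presupposes finite moments, is thus available almost surely.\<close>

lemma AE_cond_law_moment:
  assumes t: "t < T"
  shows "AE x in \<gamma>. (\<integral>\<^sup>+z. ennreal (norm z powr p) \<partial>cond_law \<gamma> t (restrict x {1..t})) < \<infinity>"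
proof -
  note [measurable] = \<kappa>[OF t] restrict_meas[OF less_imp_le[OF t]]
  have "(\<integral>\<^sup>+x. (\<integral>\<^sup>+z. ennreal (norm z powr p) \<partial>cond_law \<gamma> t (restrict x {1..t})) \<partial>\<gamma>) = (\<integral>\<^sup>+x. ennreal (norm (x (Suc t)) powr p) \<partial>\<gamma>)"
    using nn_integral_disint[OF t, of "\<lambda>(x, z). ennreal (norm z powr p)"] by simp
  also have "\<dots> \<le> (\<integral>\<^sup>+x. ennreal (path_norm T x powr p) \<partial>\<gamma>)"
    using t p unfolding path_norm_def
    by (intro nn_integral_mono ennreal_leI powr_mono2 member_le_L2_set) auto
  also have "\<dots> < \<infinity>" by (rule moment)
  finally have "(\<integral>\<^sup>+x. (\<integral>\<^sup>+z. ennreal (norm z powr p) \<partial>cond_law \<gamma> t (restrict x {1..t})) \<partial>\<gamma>) \<noteq> \<infinity>" by simp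
  from nn_integral_PInf_AE[OF _ this] show ?thesis
    by (rule AE_mp) (auto simp: less_top)
qed

text \<open>The resampled path passes through the cells of the chain up to time \<open>t\<close>, so
  its coordinate \<open>s\<close> is within \<eta> of the representative to which
  \<open>cost s\<close> refers; Minkowski adds \<eta> to the error.\<close>

lemma resampled_dist:
  assumes t: "t < T" and s: "s \<in> {1..t}" and IH: "cost s \<le> ennreal (err s powr p)"
  shows "(\<integral>\<^sup>+\<omega>. ennreal (dist (fst \<omega> s) (snd \<omega> s) powr p) \<partial>resampled t) \<le> ennreal ((err s + \<eta>) powr p)"
proof -
  have sT: "s \<in> {1..T}" and tT: "t \<le> T" using s t by auto
  note [measurable] = measurable_path_component[OF sT]
  interpret C: prob_space "chain T" using chain_space[OF order_refl] by (simp add: space_prob_algebra)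
  have d[measurable]: "(\<lambda>y. dist (fst y s) (r (hd (drop (T - s) (snd y))))) \<in> borel_measurable (chain T)"
    using dist_cell_meas[OF sT] by (simp add: measurable_cong_sets[OF sets_chain[OF order_refl] refl])
  have "(\<integral>\<^sup>+\<omega>. ennreal (dist (fst \<omega> s) (snd \<omega> s) powr p) \<partial>resampled t)
    = (\<integral>\<^sup>+y. (\<integral>\<^sup>+x'. ennreal (dist (fst y s) (x' s) powr p) \<partial>cell_law t (drop (T - t) (snd y))) \<partial>chain T)"
    by (subst nn_integral_resampled[OF tT]) auto
  also have "\<dots> \<le> (\<integral>\<^sup>+y. ennreal ((dist (fst y s) (r (hd (drop (T - s) (snd y)))) + \<eta>) powr p) \<partial>chain T)"
  proof (rule nn_integral_mono_AE, rule AE_mp[OF AE_chain_cell[OF tT]], intro AE_I2 impI)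
    fix y :: "(nat \<Rightarrow> real^'d) \<times> nat list" assume ne: "emeasure \<gamma> (cell t (drop (T - t) (snd y))) \<noteq> 0"
    have "(\<integral>\<^sup>+x'. ennreal (dist (fst y s) (x' s) powr p) \<partial>cell_law t (drop (T - t) (snd y)))
      \<le> (\<integral>\<^sup>+x'. ennreal ((dist (fst y s) (r (hd (drop (T - s) (snd y)))) + \<eta>) powr p) \<partial>cell_law t (drop (T - t) (snd y)))"
    proof (rule nn_integral_mono_AE, rule AE_mp[OF AE_cell_law[OF tT ne]], intro AE_I2 impI)
      fix x' assume *: "qlist q t x' = drop (T - t) (snd y)"
      obtain s' where s': "s = Suc s'" using s by (cases s) auto
      have "drop (T - s) (snd y) = drop (t - s) (qlist q t x')"
        using s t by (simp add: *)
      also have "\<dots> = qlist q s x'" using s by (intro drop_qlist) auto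
      finally have "hd (drop (T - s) (snd y)) = q (x' s)" by (simp add: s')
      then have "dist (fst y s) (x' s) \<le> dist (fst y s) (r (hd (drop (T - s) (snd y)))) + \<eta>"
        using dist_triangle[of "fst y s" "x' s" "r (q (x' s))"] r_q[of "x' s"] by (simp add: dist_commute)
      then show "ennreal (dist (fst y s) (x' s) powr p) \<le> ennreal ((dist (fst y s) (r (hd (drop (T - s) (snd y)))) + \<eta>) powr p)"
        using p by (intro ennreal_leI powr_mono2) auto
    qed
    also have "\<dots> = ennreal ((dist (fst y s) (r (hd (drop (T - s) (snd y)))) + \<eta>) powr p)"
      using cell_law_space[OF tT] by (simp add: space_prob_algebra prob_space.emeasure_space_1)
    finally show "(\<integral>\<^sup>+x'. ennreal (dist (fst y s) (x' s) powr p) \<partial>cell_law t (drop (T - t) (snd y)))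
      \<le> ennreal ((dist (fst y s) (r (hd (drop (T - s) (snd y)))) + \<eta>) powr p)" .
  qed
  also have "\<dots> \<le> ennreal ((err s + \<eta>) powr p)"
    using IH err_nonneg \<eta>_nonneg by (intro minkowski_nn_integral p d) (auto simp: cost_prefix[OF sT] C.emeasure_space_1)
  finally show ?thesis .
qed

text \<open>The Euclidean norm over times is bounded by the sum, to which Minkowski applies
  coordinate by coordinate.\<close>

lemma resampled_path_dist:
  assumes t: "t < T" and IH: "\<And>s. s \<in> {1..t} \<Longrightarrow> cost s \<le> ennreal (err s powr p)"
  shows "(\<integral>\<^sup>+\<omega>. ennreal (path_dist t (fst \<omega>) (snd \<omega>) powr p) \<partial>resampled t) \<le> ennreal ((\<Sum>s=1..t. err s + \<eta>) powr p)"
proof -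
  have "(\<integral>\<^sup>+\<omega>. ennreal (path_dist t (fst \<omega>) (snd \<omega>) powr p) \<partial>resampled t)
    \<le> (\<integral>\<^sup>+\<omega>. ennreal ((\<Sum>s=1..t. dist (fst \<omega> s) (snd \<omega> s)) powr p) \<partial>resampled t)"
    unfolding path_dist_def using p
    by (intro nn_integral_mono ennreal_leI powr_mono2 L2_set_le_sum) (auto simp: L2_set_nonneg)
  also have "\<dots> \<le> ennreal ((\<Sum>s=1..t. err s + \<eta>) powr p)"
  proof (rule minkowski_nn_integral_sum[OF p])
    fix s assume s: "s \<in> {1..t}"
    then have [measurable]: "(\<lambda>x. x s) \<in> path_space T \<rightarrow>\<^sub>M borel" using t by (intro measurable_path_component) auto
    show "(\<lambda>\<omega>. dist (fst \<omega> s) (snd \<omega> s)) \<in> borel_measurable (resampled t)"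
      unfolding measurable_cong_sets[OF sets_resampled[OF less_imp_le[OF t]] refl] by measurable
    show "(\<integral>\<^sup>+\<omega>. ennreal (dist (fst \<omega> s) (snd \<omega> s) powr p) \<partial>resampled t) \<le> ennreal ((err s + \<eta>) powr p)"
      by (rule resampled_dist[OF t s IH[OF s]])
  qed (use err_nonneg \<eta>_nonneg in auto)
  finally show ?thesis .
qed

abbreviation transport :: "nat \<Rightarrow> (nat \<Rightarrow> real^'d) \<times> (nat \<Rightarrow> real^'d) \<Rightarrow> ennreal" where
  "transport t \<omega> \<equiv> (INF \<pi>\<in>couplings (cond_law \<gamma> t (restrict (fst \<omega>) {1..t})) (cond_law \<gamma> t (restrict (snd \<omega>) {1..t})).
     \<integral>\<^sup>+\<omega>. ennreal (dist (fst \<omega>) (snd \<omega>) powr p) \<partial>\<pi>)"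

text \<open>For \<open>t = 0\<close> both conditional laws coincide and the cost is 0. For
  \<open>t > 0\<close> the distance of the pasts is at most the sum of \<open>h' s\<close> over
  \<open>s < t\<close> plus \<open>t * (\<epsilon> + 2 * \<eta>)\<close>. As \<open>h'\<close> omits
  \<sigma>, this is strictly below the argument of the iterated modulus by \<open>small\<close>, so
  the resampled pair competes in the supremum that defines \<open>h t\<close>.\<close>

lemma resampled_transport:
  assumes t: "t < T" and IH: "\<And>s. s \<in> {1..t} \<Longrightarrow> cost s \<le> ennreal (err s powr p)"
  shows "(\<integral>\<^sup>+\<omega>. transport t \<omega> \<partial>resampled t) \<le> ennreal (h' t powr p)"
proof (cases t)
  case 0
  have "restrict x {1..t} = (\<lambda>_. undefined)" for x :: "nat \<Rightarrow> real^'d" using 0 by (auto simp: restrict_def)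
  moreover have u: "(\<lambda>_. undefined) \<in> space (path_space t :: (nat \<Rightarrow> real^'d) measure)" using 0 by (simp add: space_path_0)
  ultimately have "transport t \<omega> = 0" for \<omega>
    using wasserstein_self[OF kernel_prob[OF \<kappa>[OF t] u] kernel_sets[OF \<kappa>[OF t] u], of p] p by simp
  then show ?thesis by simp
next
  case (Suc t')
  let ?\<delta> = "\<Sum>s=0..t'. iter_modulus p \<gamma> s (ennreal \<sigma>)"
  have "?\<delta> = (\<Sum>s=0..t'. ennreal (h s))" using t Suc by (intro sum.cong h) auto
  also have "\<dots> = ennreal (\<Sum>s=0..t'. h s)" by (intro sum_ennreal h_nonneg)
  finally have \<delta>: "?\<delta> = ennreal (\<Sum>s=0..t'. h s)" .
  have "(\<Sum>s=1..t. err s + \<eta>) = (\<Sum>s=1..t. h' (s - 1)) + real t * (\<epsilon> + 2 * \<eta>)"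
    unfolding err_def by (simp add: sum.distrib algebra_simps)
  also have "(\<Sum>s=1..t. h' (s - 1)) = (\<Sum>s=0..t'. h' s)"
    unfolding Suc One_nat_def by (subst sum.atLeast_Suc_atMost_Suc_shift) simp
  also have "(\<Sum>s=0..t'. h' s) = (\<Sum>s=0..t'. h s) - \<sigma>"
    by (simp add: sum.atLeast_Suc_atMost[of 0 t'] h'_def h0)
  also have "real t * (\<epsilon> + 2 * \<eta>) \<le> real T * (\<epsilon> + 2 * \<eta>)"
    using t \<epsilon> \<eta>_nonneg by (intro mult_right_mono) auto
  finally have lt: "(\<Sum>s=1..t. err s + \<eta>) < (\<Sum>s=0..t'. h s)" using small by simp
  have nonneg: "0 \<le> (\<Sum>s=1..t. err s + \<eta>)" using err_nonneg \<eta>_nonneg by (intro sum_nonneg) auto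
  have "epowr (\<integral>\<^sup>+\<omega>. ennreal (path_dist t (fst \<omega>) (snd \<omega>) powr p) \<partial>resampled t) (1 / p) \<le> ennreal (\<Sum>s=1..t. err s + \<eta>)"
    using p nonneg resampled_path_dist[OF t IH] by (intro epowr_leI) auto
  also have "\<dots> < ?\<delta>" unfolding \<delta> using lt nonneg by (simp add: ennreal_less_iff)
  finally have "resampled t \<in> {\<pi>\<in>couplings \<gamma> \<gamma>.
      epowr (\<integral>\<^sup>+\<omega>. ennreal (path_dist t (fst \<omega>) (snd \<omega>) powr p) \<partial>\<pi>) (1 / p) < ?\<delta>}"
    using resampled_couplings t by simp
  then have "epowr (\<integral>\<^sup>+\<omega>. epowr (wasserstein dist p (cond_law \<gamma> t (restrict (fst \<omega>) {1..t}))
       (cond_law \<gamma> t (restrict (snd \<omega>) {1..t}))) p \<partial>resampled t) (1 / p) \<le> modulus p \<gamma> t ?\<delta>"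
    unfolding modulus_def by (rule SUP_upper)
  also have "modulus p \<gamma> t ?\<delta> = ennreal (h' t)" using h[OF t] Suc by (simp add: h'_def)
  finally have "(\<integral>\<^sup>+\<omega>. epowr (wasserstein dist p (cond_law \<gamma> t (restrict (fst \<omega>) {1..t}))
       (cond_law \<gamma> t (restrict (snd \<omega>) {1..t}))) p \<partial>resampled t) \<le> ennreal (h' t powr p)"
    using p h'_nonneg by (intro epowr_leD) auto
  then show ?thesis using p by (simp add: wasserstein_def epowr_epowr)
qed

text \<open>The next point is compared with the successor of the resampled path, at cost
  \<open>c + \<epsilon>\<close>, and that successor with the representative of its cell, at cost
  \<eta>. Minkowski's inequality is applied to the measurable \<open>c\<close>; passing on to
  \<open>transport\<close> rests on monotonicity of the integral.\<close>

lemma cost_Suc: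
  assumes t: "t < T" and IH: "\<And>s. s \<in> {1..t} \<Longrightarrow> cost s \<le> ennreal (err s powr p)"
  shows "cost (Suc t) \<le> ennreal (err (Suc t) powr p)"
proof -
  have tT: "t \<le> T" using t by simp
  note [measurable] = K[OF t] c_meas[OF t]
  have q[measurable]: "q \<in> borel \<rightarrow>\<^sub>M count_space UNIV" by (rule q_meas)
  have rq[measurable]: "(\<lambda>z. r (q z)) \<in> borel \<rightarrow>\<^sub>M borel" by (rule measurable_compose[OF q]) simp
  interpret R: prob_space "resampled t" by (rule prob_resampled[OF tT])
  note [measurable_cong] = sets_resampled[OF tT]
  have res[measurable]: "(\<lambda>x. restrict x {1..t}) \<in> path_space T \<rightarrow>\<^sub>M path_space t" using tT by (rule measurable_restrict_path)
  define G where "G w = (\<integral>\<^sup>+y. ennreal (dist (fst y) (r (q (snd y))) powr p) \<partial>K t w)" for w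
  have G[measurable]: "G \<in> borel_measurable (path_space t \<Otimes>\<^sub>M path_space t)" unfolding G_def by measurable
  have m2: "(\<lambda>y. ennreal (dist (fst y) (r (snd y)) powr p)) \<in> borel_measurable (borel \<Otimes>\<^sub>M count_space UNIV)"
  proof -
    have [measurable]: "(\<lambda>y. r (snd y)) \<in> borel \<Otimes>\<^sub>M count_space UNIV \<rightarrow>\<^sub>M borel"
      by (rule measurable_compose[OF measurable_snd]) simp
    show ?thesis by measurable
  qed
  have "(\<lambda>s. dist (fst s (Suc t)) (r (hd (snd s)))) \<in> borel_measurable (states (Suc t))"
    using dist_cell_meas[of "Suc t" "Suc t" 0] by simp
  then have m1: "(\<lambda>s. ennreal (dist (fst s (Suc t)) (r (hd (snd s))) powr p)) \<in> borel_measurable (states (Suc t))"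
    by measurable
  define Fc where "Fc s = (\<integral>\<^sup>+x'. G (fst s, restrict x' {1..t}) \<partial>cell_law t (snd s))" for s
  have Fc: "Fc \<in> borel_measurable (states t)"
  proof -
    have "(\<lambda>s. cell_law t (snd s)) \<in> states t \<rightarrow>\<^sub>M prob_algebra (path_space T)"
      by (rule measurable_compose[OF measurable_snd cell_law_kernel[OF tT]])
    then show ?thesis unfolding Fc_def by measurable
  qed
  have G_le: "(\<integral>\<^sup>+\<omega>. G (restrict (fst \<omega>) {1..t}, restrict (snd \<omega>) {1..t}) \<partial>resampled t)
      \<le> (\<integral>\<^sup>+\<omega>. ennreal ((c t (restrict (fst \<omega>) {1..t}, restrict (snd \<omega>) {1..t}) + (\<epsilon> + \<eta>)) powr p) \<partial>resampled t)"
    and c_transport: "(\<integral>\<^sup>+\<omega>. ennreal (c t (restrict (fst \<omega>) {1..t}, restrict (snd \<omega>) {1..t}) powr p) \<partial>resampled t)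
      \<le> (\<integral>\<^sup>+\<omega>. transport t \<omega> \<partial>resampled t)"
  proof -
    have *: "AE \<omega> in resampled t. \<omega> \<in> space (resampled t) \<and>
      (\<integral>\<^sup>+z. ennreal (norm z powr p) \<partial>cond_law \<gamma> t (restrict (fst \<omega>) {1..t})) < \<infinity> \<and>
      (\<integral>\<^sup>+z. ennreal (norm z powr p) \<partial>cond_law \<gamma> t (restrict (snd \<omega>) {1..t})) < \<infinity>"
    proof -
      note cp = couplings_D[OF resampled_couplings[OF tT]]
      have m: "fst \<in> resampled t \<rightarrow>\<^sub>M \<gamma>" "snd \<in> resampled t \<rightarrow>\<^sub>M \<gamma>"
        by (simp_all add: measurable_cong_sets[OF cp(2) refl])
      have "AE \<omega> in resampled t. (\<integral>\<^sup>+z. ennreal (norm z powr p) \<partial>cond_law \<gamma> t (restrict (fst \<omega>) {1..t})) < \<infinity>"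
        by (rule AE_distrD[OF m(1)]) (simp only: cp(4) AE_cond_law_moment[OF t])
      moreover have "AE \<omega> in resampled t. (\<integral>\<^sup>+z. ennreal (norm z powr p) \<partial>cond_law \<gamma> t (restrict (snd \<omega>) {1..t})) < \<infinity>"
        by (rule AE_distrD[OF m(2)]) (simp only: cp(5) AE_cond_law_moment[OF t])
      ultimately show ?thesis by (intro AE_conjI AE_space)
    qed
    have sp: "restrict (fst \<omega>) {1..t} \<in> space (path_space t)" "restrict (snd \<omega>) {1..t} \<in> space (path_space t)"
      if "\<omega> \<in> space (resampled t)" for \<omega>
    proof -
      have "\<omega> \<in> space (path_space T \<Otimes>\<^sub>M path_space T)"
        using that by (simp only: sets_eq_imp_space_eq[OF sets_resampled[OF tT]])
      then have "fst \<omega> \<in> space (path_space T)" "snd \<omega> \<in> space (path_space T)"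
        by (simp_all add: space_pair_measure mem_Times_iff)
      then show "restrict (fst \<omega>) {1..t} \<in> space (path_space t)" "restrict (snd \<omega>) {1..t} \<in> space (path_space t)"
        using measurable_space[OF res] by auto
    qed
    show "(\<integral>\<^sup>+\<omega>. G (restrict (fst \<omega>) {1..t}, restrict (snd \<omega>) {1..t}) \<partial>resampled t)
      \<le> (\<integral>\<^sup>+\<omega>. ennreal ((c t (restrict (fst \<omega>) {1..t}, restrict (snd \<omega>) {1..t}) + (\<epsilon> + \<eta>)) powr p) \<partial>resampled t)"
    proof (rule nn_integral_mono_AE, rule AE_mp[OF *], intro AE_I2 impI, elim conjE)
      fix \<omega> assume \<omega>: "\<omega> \<in> space (resampled t)"
        and fin: "(\<integral>\<^sup>+z. ennreal (norm z powr p) \<partial>cond_law \<gamma> t (restrict (fst \<omega>) {1..t})) < \<infinity>"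
          "(\<integral>\<^sup>+z. ennreal (norm z powr p) \<partial>cond_law \<gamma> t (restrict (snd \<omega>) {1..t})) < \<infinity>"
      let ?w = "(restrict (fst \<omega>) {1..t}, restrict (snd \<omega>) {1..t})"
      have w: "?w \<in> space (path_space t \<Otimes>\<^sub>M path_space t)" using sp[OF \<omega>] by (simp add: space_pair_measure)
      note [measurable_cong] = kernel_sets[OF K[OF t] w]
      interpret Kw: prob_space "K t ?w" by (rule kernel_prob[OF K[OF t] w])
      have "G ?w \<le> (\<integral>\<^sup>+y. ennreal ((dist (fst y) (snd y) + \<eta>) powr p) \<partial>K t ?w)"
        unfolding G_def
      proof (rule nn_integral_mono)
        fix y :: "(real^'d) \<times> (real^'d)"
        have "dist (fst y) (r (q (snd y))) \<le> dist (fst y) (snd y) + \<eta>"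
          using dist_triangle[of "fst y" "r (q (snd y))" "snd y"] r_q[of "snd y"] by simp
        then show "ennreal (dist (fst y) (r (q (snd y))) powr p) \<le> ennreal ((dist (fst y) (snd y) + \<eta>) powr p)"
          using p by (intro ennreal_leI powr_mono2) auto
      qed
      also have "\<dots> \<le> ennreal ((c t ?w + \<epsilon> + \<eta>) powr p)"
        using K_cost[OF t sp[OF \<omega>] fin] c_nonneg \<epsilon> \<eta>_nonneg
        by (intro minkowski_nn_integral p) (auto simp: Kw.emeasure_space_1)
      finally show "G ?w \<le> ennreal ((c t ?w + (\<epsilon> + \<eta>)) powr p)" by (simp add: add.assoc)
    qed
    show "(\<integral>\<^sup>+\<omega>. ennreal (c t (restrict (fst \<omega>) {1..t}, restrict (snd \<omega>) {1..t}) powr p) \<partial>resampled t)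
      \<le> (\<integral>\<^sup>+\<omega>. transport t \<omega> \<partial>resampled t)"
    proof (rule nn_integral_mono_AE, rule AE_mp[OF *], intro AE_I2 impI, elim conjE)
      fix \<omega> assume \<omega>: "\<omega> \<in> space (resampled t)"
        and fin: "(\<integral>\<^sup>+z. ennreal (norm z powr p) \<partial>cond_law \<gamma> t (restrict (fst \<omega>) {1..t})) < \<infinity>"
          "(\<integral>\<^sup>+z. ennreal (norm z powr p) \<partial>cond_law \<gamma> t (restrict (snd \<omega>) {1..t})) < \<infinity>"
      show "ennreal (c t (restrict (fst \<omega>) {1..t}, restrict (snd \<omega>) {1..t}) powr p) \<le> transport t \<omega>"
        using K_cost[OF t sp[OF \<omega>] fin] by blast
    qed
  qed
  have "cost (Suc t) = (\<integral>\<^sup>+s. (\<integral>\<^sup>+y. ennreal (dist (fst (extend t s y) (Suc t)) (r (hd (snd (extend t s y)))) powr p) \<partial>step t s) \<partial>chain t)"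
    unfolding cost_def by (rule nn_integral_chain_Suc[OF t m1])
  also have "\<dots> = (\<integral>\<^sup>+s. Fc s \<partial>chain t)"
  proof (rule nn_integral_cong)
    fix s assume "s \<in> space (chain t)"
    then obtain x g where s: "s = (x, g)" and x: "x \<in> space (path_space t)" using tT by (auto simp: space_chain)
    have "(\<integral>\<^sup>+y. ennreal (dist (fst (extend t s y) (Suc t)) (r (hd (snd (extend t s y)))) powr p) \<partial>step t s)
      = (\<integral>\<^sup>+y. ennreal (dist (fst y) (r (snd y)) powr p) \<partial>step t (x, g))"
      unfolding s by (intro nn_integral_cong) (simp add: extend_def)
    also have "\<dots> = Fc s" unfolding nn_integral_step[OF t x m2] Fc_def G_def s by simp
    finally show "(\<integral>\<^sup>+y. ennreal (dist (fst (extend t s y) (Suc t)) (r (hd (snd (extend t s y)))) powr p) \<partial>step t s) = Fc s" .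
  qed
  \<comment> \<open>Moving to \<open>chain T\<close> turns the expression into an integral over
    \<open>resampled t\<close>, whose components are full paths, as the modulus demands.\<close>
  also have "\<dots> = (\<integral>\<^sup>+s. Fc (restrict (fst s) {1..t}, drop (T - t) (snd s)) \<partial>chain T)"
    by (rule nn_integral_chain_prefix[symmetric, OF tT order_refl Fc])
  also have "\<dots> = (\<integral>\<^sup>+\<omega>. G (restrict (fst \<omega>) {1..t}, restrict (snd \<omega>) {1..t}) \<partial>resampled t)"
    unfolding Fc_def
    using nn_integral_resampled[OF tT, of "\<lambda>\<omega>. G (restrict (fst \<omega>) {1..t}, restrict (snd \<omega>) {1..t})"] by simp
  also note G_le
  also have "(\<integral>\<^sup>+\<omega>. ennreal ((c t (restrict (fst \<omega>) {1..t}, restrict (snd \<omega>) {1..t}) + (\<epsilon> + \<eta>)) powr p) \<partial>resampled t)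
      \<le> ennreal ((h' t + (\<epsilon> + \<eta>)) powr p)"
  proof (rule minkowski_nn_integral[OF p])
    show "(\<integral>\<^sup>+\<omega>. ennreal (c t (restrict (fst \<omega>) {1..t}, restrict (snd \<omega>) {1..t}) powr p) \<partial>resampled t) \<le> ennreal (h' t powr p)"
      by (rule order_trans[OF c_transport resampled_transport[OF t IH]])
  qed (use c_nonneg \<epsilon> \<eta>_nonneg h'_nonneg in \<open>auto simp: R.emeasure_space_1\<close>)
  also have "\<dots> = ennreal (err (Suc t) powr p)" by (simp add: err_def)
  finally show ?thesis .
qed

lemma cost_le: "t \<in> {1..T} \<Longrightarrow> cost t \<le> ennreal (err t powr p)"
proof (induction t rule: less_induct)
  case (less t)
  then obtain t' where t': "t = Suc t'" by (cases t) auto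
  show ?case unfolding t' by (rule cost_Suc) (use less t' in auto)
qed

text \<open>Superadditivity of the power merges the \<open>T\<close> errors into one. Their sum
  stays below the sum of the \<open>h t\<close> because \<sigma>, present in \<open>h\<close> but
  not in \<open>h'\<close>, exceeds the accumulated losses.\<close>

lemma chain_cost:
  "(\<integral>\<^sup>+s. (\<Sum>t=1..T. ennreal (dist (fst s t) (r (hd (drop (T - t) (snd s)))) powr p)) \<partial>chain T)
    \<le> ennreal ((\<Sum>t=0..T - 1. h t) powr p)"
proof -
  have "(\<integral>\<^sup>+s. (\<Sum>t=1..T. ennreal (dist (fst s t) (r (hd (drop (T - t) (snd s)))) powr p)) \<partial>chain T) = (\<Sum>t=1..T. cost t)"
    using dist_cell_meas
    by (subst nn_integral_sum) (auto simp: cost_prefix measurable_cong_sets[OF sets_chain[OF order_refl] refl])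
  also have "\<dots> \<le> (\<Sum>t=1..T. ennreal (err t powr p))" by (intro sum_mono cost_le)
  also have "\<dots> = ennreal (\<Sum>t=1..T. err t powr p)" by (intro sum_ennreal) simp
  also have "\<dots> \<le> ennreal ((\<Sum>t=0..T - 1. h t) powr p)"
  proof (rule ennreal_leI)
    have super: "(\<Sum>t\<in>I. err t powr p) \<le> (\<Sum>t\<in>I. err t) powr p" if "finite I" for I
      using that
    proof induction
      case (insert i I)
      then show ?case
        using powr_superadditive[of "err i" "\<Sum>t\<in>I. err t" p] err_nonneg p by (simp add: sum_nonneg)
    qed simp
    show "(\<Sum>t=1..T. err t powr p) \<le> (\<Sum>t=0..T - 1. h t) powr p"
    proof (cases T)
      case 0 then show ?thesis by simp
    next
      case (Suc T')
      have "(\<Sum>t=1..T. err t) = (\<Sum>t=1..T. h' (t - 1)) + real T * (\<epsilon> + \<eta>)"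
        unfolding err_def by (simp add: sum.distrib)
      also have "(\<Sum>t=1..T. h' (t - 1)) = (\<Sum>t=0..T'. h' t)"
        unfolding Suc One_nat_def by (subst sum.atLeast_Suc_atMost_Suc_shift) simp
      also have "(\<Sum>t=0..T'. h' t) = (\<Sum>t=0..T'. h t) - \<sigma>"
        by (simp add: sum.atLeast_Suc_atMost[of 0 T'] h'_def h0)
      also have "real T * (\<epsilon> + \<eta>) \<le> real T * (\<epsilon> + 2 * \<eta>)" using \<eta>_nonneg by (intro mult_left_mono) auto
      finally have "(\<Sum>t=1..T. err t) \<le> (\<Sum>t=0..T - 1. h t)" using small Suc by simp
      then have "(\<Sum>t=1..T. err t) powr p \<le> (\<Sum>t=0..T - 1. h t) powr p"
        using p err_nonneg by (intro powr_mono2) (auto intro: sum_nonneg)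
      then show ?thesis using super[of "{1..T}"] by simp
    qed
  qed
  finally show ?thesis .
qed

end

section \<open>Random shifts of the grid\<close>

text \<open>Integer form of Hermite's identity. Raising \<open>m\<close> by 1 shifts the sum by one
  place and replaces \<open>m div n\<close> by \<open>(m + n) div n\<close>, which is larger by
  1.\<close>

lemma sum_shifted_div:
  fixes m :: int
  assumes "0 < n"
  shows "(\<Sum>k<n. (m + int k) div int n) = m"
proof -
  let ?S = "\<lambda>m. \<Sum>k<n. (m + int k) div int n"
  have step: "?S (m + 1) = ?S m + 1" for m
  proof -
    obtain n' where n': "n = Suc n'" using assms by (cases n) auto
    have "?S (m + 1) = (\<Sum>k<n'. (m + int (Suc k)) div int n) + (m + int n) div int n"
      by (simp add: n' algebra_simps)
    moreover have "?S m = m div int n + (\<Sum>k<n'. (m + int (Suc k)) div int n)"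
      unfolding n' sum.lessThan_Suc_shift by simp
    moreover have "(m + int n) div int n = m div int n + 1" using assms by simp
    ultimately show ?thesis by simp
  qed
  have 0: "?S 0 = 0" using assms by (intro sum.neutral) auto
  show ?thesis
  proof (induction m rule: int_induct[of _ 0])
    case base show ?case using 0 .
  next
    case (step1 i) then show ?case using step[of i] by simp
  next
    case (step2 i) then show ?case using step[of "i - 1"] by simp
  qed
qed

text \<open>Hermite's identity, reduced to integers because the floor of a quotient by
  \<open>n\<close> depends on the floor of the numerator only.\<close>

lemma sum_shifted_floor:
  assumes "0 < n"
  shows "(\<Sum>k<n. \<lfloor>z + real k / real n\<rfloor>) = \<lfloor>real n * z\<rfloor>"
proof -
  have "\<lfloor>z + real k / real n\<rfloor> = (\<lfloor>real n * z\<rfloor> + int k) div int n" for k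
  proof -
    have "z + real k / real n = (real n * z + of_int (int k)) / real_of_int (int n)"
      using assms by (simp add: field_simps)
    then have "\<lfloor>z + real k / real n\<rfloor> = \<lfloor>real n * z + of_int (int k)\<rfloor> div int n"
      by (simp only: floor_divide_real_eq_div)
    then show ?thesis by (simp only: floor_add_int)
  qed
  then show ?thesis using sum_shifted_div[OF assms] by simp
qed

text \<open>For \<open>a \<le> b\<close> a separating shift makes the difference of the floors at
  least 1. By Hermite's identity these differences add up to the difference of the floors of
  \<open>n * b\<close> and \<open>n * a\<close>, which exceeds \<open>n * (b - a)\<close> by at most
  1.\<close>

lemma separating_shifts_le:
  fixes a b :: real
  assumes "0 < n"
  shows "(\<Sum>k<n. of_bool (\<lfloor>a + real k / real n\<rfloor> \<noteq> \<lfloor>b + real k / real n\<rfloor>)) \<le> real n * \<bar>a - b\<bar> + 1"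
proof (induction a b rule: linorder_wlog)
  case (le a b)
  have "of_bool (\<lfloor>a + real k / real n\<rfloor> \<noteq> \<lfloor>b + real k / real n\<rfloor>)
      \<le> real_of_int (\<lfloor>b + real k / real n\<rfloor> - \<lfloor>a + real k / real n\<rfloor>)" for k
    using floor_mono[of "a + real k / real n" "b + real k / real n"] le by (auto simp: of_bool_def)
  then have "(\<Sum>k<n. of_bool (\<lfloor>a + real k / real n\<rfloor> \<noteq> \<lfloor>b + real k / real n\<rfloor>))
      \<le> (\<Sum>k<n. real_of_int (\<lfloor>b + real k / real n\<rfloor> - \<lfloor>a + real k / real n\<rfloor>))" by (rule sum_mono)
  also have "\<dots> = real_of_int (\<lfloor>real n * b\<rfloor> - \<lfloor>real n * a\<rfloor>)"
    by (simp only: of_int_sum[symmetric] sum_subtractf sum_shifted_floor[OF assms])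
  also have "\<dots> \<le> real n * b - real n * a + 1" by linarith
  finally show ?case using le by (simp add: algebra_simps)
next
  case (sym a b)
  then show ?case by (simp add: abs_minus_commute eq_commute)
qed

lemma dist_le_path_dist: "t \<in> {1..T} \<Longrightarrow> dist (x t) (y t) \<le> path_dist T x y"
  unfolding path_dist_def by (rule member_le_L2_set) auto

lemma norm_le_path_norm: "t \<in> {1..T} \<Longrightarrow> norm (x t) \<le> path_norm T x"
  unfolding path_norm_def by (rule member_le_L2_set) auto

lemma qlist_neq: "qlist q T x \<noteq> qlist q T y \<Longrightarrow> \<exists>t\<in>{1..T}. q (x t) \<noteq> q (y t)"
proof (induction T)
  case (Suc T)
  then show ?case by (cases "q (x (Suc T)) = q (y (Suc T))") force+
qed simp

lemma grid_index_neq: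
  "grid_index l u z \<noteq> grid_index l u w \<Longrightarrow> \<exists>i. \<lfloor>(z $ i + u) / l\<rfloor> \<noteq> \<lfloor>(w $ i + u) / l\<rfloor>"
  unfolding grid_index_def grid_cell_def by (auto simp: vec_eq_iff)

text \<open>Union bound over the \<open>T\<close> times and \<open>d\<close> coordinates, each
  rescaled to mesh 1.\<close>

lemma separating_grids_le:
  fixes x y :: "nat \<Rightarrow> real^'d"
  assumes "0 < n" "0 < l"
  shows "(\<Sum>k<n. of_bool (qlist (grid_index l (l * real k / real n)) T x \<noteq> qlist (grid_index l (l * real k / real n)) T y))
    \<le> real T * real CARD('d) * (real n * path_dist T x y / l + 1)"
proof -
  let ?u = "\<lambda>k. l * real k / real n"
  have "(of_bool (qlist (grid_index l (?u k)) T x \<noteq> qlist (grid_index l (?u k)) T y) :: real)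
    \<le> (\<Sum>t=1..T. \<Sum>i\<in>UNIV. of_bool (\<lfloor>x t $ i / l + real k / real n\<rfloor> \<noteq> \<lfloor>y t $ i / l + real k / real n\<rfloor>))" for k
  proof (cases "qlist (grid_index l (?u k)) T x = qlist (grid_index l (?u k)) T y")
    case False
    then obtain t i where t: "t \<in> {1..T}" and "\<lfloor>(x t $ i + ?u k) / l\<rfloor> \<noteq> \<lfloor>(y t $ i + ?u k) / l\<rfloor>"
      using qlist_neq grid_index_neq by metis
    then have "\<lfloor>x t $ i / l + real k / real n\<rfloor> \<noteq> \<lfloor>y t $ i / l + real k / real n\<rfloor>"
      using assms by (simp add: add_divide_distrib)
    then have "1 \<le> (of_bool (\<lfloor>x t $ i / l + real k / real n\<rfloor> \<noteq> \<lfloor>y t $ i / l + real k / real n\<rfloor>) :: real)" by simp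
    also have "\<dots> \<le> (\<Sum>i\<in>UNIV. of_bool (\<lfloor>x t $ i / l + real k / real n\<rfloor> \<noteq> \<lfloor>y t $ i / l + real k / real n\<rfloor>))"
      by (rule member_le_sum) auto
    also have "\<dots> \<le> (\<Sum>t=1..T. \<Sum>i\<in>UNIV. of_bool (\<lfloor>x t $ i / l + real k / real n\<rfloor> \<noteq> \<lfloor>y t $ i / l + real k / real n\<rfloor>))"
      using t by (intro member_le_sum) (auto intro: sum_nonneg)
    finally show ?thesis by (rule order_trans[rotated]) simp
  qed (auto intro!: sum_nonneg)
  then have "(\<Sum>k<n. of_bool (qlist (grid_index l (?u k)) T x \<noteq> qlist (grid_index l (?u k)) T y) :: real)
    \<le> (\<Sum>k<n. \<Sum>t=1..T. \<Sum>i\<in>UNIV. of_bool (\<lfloor>x t $ i / l + real k / real n\<rfloor> \<noteq> \<lfloor>y t $ i / l + real k / real n\<rfloor>))"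
    by (intro sum_mono)
  also have "\<dots> = (\<Sum>t=1..T. \<Sum>i\<in>UNIV. \<Sum>k<n. of_bool (\<lfloor>x t $ i / l + real k / real n\<rfloor> \<noteq> \<lfloor>y t $ i / l + real k / real n\<rfloor>))"
    by (subst sum.swap, intro sum.cong refl, rule sum.swap)
  also have "\<dots> \<le> (\<Sum>t=1..T. \<Sum>i\<in>(UNIV::'d set). real n * path_dist T x y / l + 1)"
  proof (intro sum_mono)
    fix t i assume t: "t \<in> {1..T}"
    have "\<bar>x t $ i - y t $ i\<bar> \<le> dist (x t) (y t)"
      using component_le_norm_cart[of "x t - y t" i] by (simp add: dist_norm)
    also have "\<dots> \<le> path_dist T x y" by (rule dist_le_path_dist[OF t])
    finally have "real n * \<bar>x t $ i / l - y t $ i / l\<bar> \<le> real n * path_dist T x y / l"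
      using assms by (simp add: diff_divide_distrib[symmetric] divide_right_mono)
    with separating_shifts_le[OF assms(1), of "x t $ i / l" "y t $ i / l"]
    show "(\<Sum>k<n. of_bool (\<lfloor>x t $ i / l + real k / real n\<rfloor> \<noteq> \<lfloor>y t $ i / l + real k / real n\<rfloor>)) \<le> real n * path_dist T x y / l + 1"
      by simp
  qed
  also have "\<dots> = real T * real CARD('d) * (real n * path_dist T x y / l + 1)" by simp
  finally show ?thesis .
qed

lemma measurable_path_dist [measurable]:
  "(\<lambda>\<omega>. path_dist T (fst \<omega>) (snd \<omega>)) \<in> borel_measurable (path_space T \<Otimes>\<^sub>M path_space T)"
proof -
  have [measurable]: "(\<lambda>\<omega>. dist (fst \<omega> t) (snd \<omega> t)) \<in> borel_measurable (path_space T \<Otimes>\<^sub>M path_space T)" if "t \<in> {1..T}" for t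
    using measurable_path_component[OF that] by measurable
  show ?thesis unfolding path_dist_def L2_set_def by measurable
qed

lemma measurable_path_norm [measurable]: "path_norm T \<in> borel_measurable (path_space T)"
proof -
  have [measurable]: "(\<lambda>x. norm (x t)) \<in> borel_measurable (path_space T)" if "t \<in> {1..T}" for t
    using measurable_path_component[OF that] by measurable
  show ?thesis unfolding path_norm_def[abs_def] L2_set_def by measurable
qed

text \<open>Among \<open>n\<close> equally spaced shifts the best one does not exceed the average.
  The finite average replaces an integral over the shift; its rounding error
  \<open>T * d / n\<close> is removed at the end by letting \<open>n\<close> grow, which is possible
  because the other constants do not depend on \<open>n\<close>.\<close>

lemma ex_grid_shift:
  fixes \<mu> \<nu> :: "(nat \<Rightarrow> real^'d) measure"
  assumes \<mu>: "sets \<mu> = sets (path_space T)" and \<nu>: "sets \<nu> = sets (path_space T)"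
    and \<pi>: "\<pi> \<in> couplings \<mu> \<nu>" and "0 < n" "0 < l"
  shows "\<exists>u. (\<integral>\<^sup>+\<omega>. (if qlist (grid_index l u) T (fst \<omega>) = qlist (grid_index l u) T (snd \<omega>) then 0 else 1) \<partial>\<pi>)
    \<le> ennreal (real T * real CARD('d) / l) * (\<integral>\<^sup>+\<omega>. ennreal (path_dist T (fst \<omega>) (snd \<omega>)) \<partial>\<pi>)
      + ennreal (real T * real CARD('d) / real n)"
proof -
  interpret prob_space \<pi> by (rule couplings_D(1)[OF \<pi>])
  have sets_\<pi>[measurable_cong]: "sets \<pi> = sets (path_space T \<Otimes>\<^sub>M path_space T)"
    using couplings_D(2)[OF \<pi>] sets_pair_measure_cong[OF \<mu> \<nu>] by simp
  let ?u = "\<lambda>k. l * real k / real n"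
  let ?f = "\<lambda>k \<omega>. (if qlist (grid_index l (?u k)) T (fst \<omega>) = qlist (grid_index l (?u k)) T (snd \<omega>) then 0 else 1) :: ennreal"
  let ?I = "\<integral>\<^sup>+\<omega>. ennreal (path_dist T (fst \<omega>) (snd \<omega>)) \<partial>\<pi>"
  let ?D = "real T * real CARD('d)"
  have f[measurable]: "?f k \<in> borel_measurable \<pi>" for k
  proof -
    have Q: "(qlist (grid_index l (?u k)) T :: (nat \<Rightarrow> real^'d) \<Rightarrow> _) \<in> path_space T \<rightarrow>\<^sub>M count_space UNIV"
      using quantizer_grid[OF \<open>0 < l\<close>, of "?u k", where ?'d = 'd] by (intro measurable_qlist) (auto simp: quantizer_def)
    have "(\<lambda>\<omega>. (qlist (grid_index l (?u k)) T (fst \<omega>), qlist (grid_index l (?u k)) T (snd \<omega>))) \<in> \<pi> \<rightarrow>\<^sub>M count_space UNIV"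
      unfolding measurable_cong_sets[OF sets_\<pi> refl]
      by (intro measurable_count_Pair measurable_compose[OF measurable_fst Q] measurable_compose[OF measurable_snd Q])
    from measurable_compose[OF this, of "\<lambda>(a, b). if a = b then 0 else 1" borel] show ?thesis by simp
  qed
  define F where "F k = (\<integral>\<^sup>+\<omega>. ?f k \<omega> \<partial>\<pi>)" for k
  have "(\<Sum>k<n. F k) = (\<integral>\<^sup>+\<omega>. (\<Sum>k<n. ?f k \<omega>) \<partial>\<pi>)" unfolding F_def by (rule nn_integral_sum[symmetric]) (rule f)
  also have "\<dots> \<le> (\<integral>\<^sup>+\<omega>. ennreal (?D * real n / l) * ennreal (path_dist T (fst \<omega>) (snd \<omega>)) + ennreal ?D \<partial>\<pi>)"
  proof (rule nn_integral_mono)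
    fix \<omega> :: "(nat \<Rightarrow> real^'d) \<times> (nat \<Rightarrow> real^'d)"
    have "(\<Sum>k<n. ?f k \<omega>) = (\<Sum>k<n. ennreal (of_bool (qlist (grid_index l (?u k)) T (fst \<omega>) \<noteq> qlist (grid_index l (?u k)) T (snd \<omega>))))"
      by (intro sum.cong) auto
    also have "\<dots> = ennreal (\<Sum>k<n. of_bool (qlist (grid_index l (?u k)) T (fst \<omega>) \<noteq> qlist (grid_index l (?u k)) T (snd \<omega>)))"
      by (rule sum_ennreal) auto
    also have "\<dots> \<le> ennreal (?D * (real n * path_dist T (fst \<omega>) (snd \<omega>) / l + 1))"
      by (rule ennreal_leI[OF separating_grids_le[OF \<open>0 < n\<close> \<open>0 < l\<close>]])
    also have "\<dots> = ennreal (?D * real n / l) * ennreal (path_dist T (fst \<omega>) (snd \<omega>)) + ennreal ?D"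
      using \<open>0 < l\<close> by (simp add: path_dist_def L2_set_nonneg algebra_simps flip: ennreal_mult ennreal_plus)
    finally show "(\<Sum>k<n. ?f k \<omega>) \<le> ennreal (?D * real n / l) * ennreal (path_dist T (fst \<omega>) (snd \<omega>)) + ennreal ?D" .
  qed
  also have "\<dots> = ennreal (?D * real n / l) * ?I + ennreal ?D"
    by (simp add: nn_integral_add nn_integral_cmult emeasure_space_1)
  also have "\<dots> = of_nat n * (ennreal (?D / l) * ?I + ennreal (?D / real n))"
  proof -
    have "ennreal (?D * real n / l) = of_nat n * ennreal (?D / l)" "ennreal ?D = of_nat n * ennreal (?D / real n)"
      using \<open>0 < l\<close> \<open>0 < n\<close> by (simp_all add: ennreal_of_nat_eq_real_of_nat mult.commute flip: ennreal_mult)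
    then show ?thesis by (simp only: distrib_left mult.assoc)
  qed
  finally have sum_le: "(\<Sum>k<n. F k) \<le> of_nat n * (ennreal (?D / l) * ?I + ennreal (?D / real n))" .
  have "\<exists>k<n. F k \<le> ennreal (?D / l) * ?I + ennreal (?D / real n)"
  proof -
    have ne: "F ` {..<n} \<noteq> {}" "finite (F ` {..<n})" using \<open>0 < n\<close> by auto
    then obtain k where k: "k < n" "F k = Min (F ` {..<n})" using Min_in[OF ne(2,1)] by (metis imageE lessThan_iff)
    have "of_nat n * F k = (\<Sum>j<n. F k)" by simp
    also have "\<dots> \<le> (\<Sum>j<n. F j)" using ne by (intro sum_mono) (auto simp: k(2))
    also note sum_le
    finally have "F k \<le> ennreal (?D / l) * ?I + ennreal (?D / real n)"
      using \<open>0 < n\<close> by (subst (asm) ennreal_mult_le_mult_iff) auto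
    then show ?thesis using k by blast
  qed
  then show ?thesis unfolding F_def by blast
qed

section \<open>Choice of the couplings for all times\<close>

text \<open>The properties of a pair \<open>K\<close>, \<open>c\<close> at one time are gathered in
  a single predicate, so that such pairs can be chosen for every time.\<close>

definition near_optimal_kernel ::
  "(nat \<Rightarrow> real^'d) measure \<Rightarrow> real \<Rightarrow> real \<Rightarrow> nat \<Rightarrow>
   ((nat \<Rightarrow> real^'d) \<times> (nat \<Rightarrow> real^'d) \<Rightarrow> ((real^'d) \<times> (real^'d)) measure) \<Rightarrow>
   ((nat \<Rightarrow> real^'d) \<times> (nat \<Rightarrow> real^'d) \<Rightarrow> real) \<Rightarrow> bool" where
  "near_optimal_kernel \<gamma> p \<epsilon> t K c \<longleftrightarrow>
    K \<in> path_space t \<Otimes>\<^sub>M path_space t \<rightarrow>\<^sub>M prob_algebra (borel \<Otimes>\<^sub>M borel) \<and>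
    c \<in> borel_measurable (path_space t \<Otimes>\<^sub>M path_space t) \<and> (\<forall>w. 0 \<le> c w) \<and>
    (\<forall>w\<in>space (path_space t \<Otimes>\<^sub>M path_space t).
      K w \<in> couplings (cond_law \<gamma> t (fst w)) (cond_law \<gamma> t (snd w)) \<and>
      ((\<integral>\<^sup>+z. ennreal (norm z powr p) \<partial>cond_law \<gamma> t (fst w)) < \<infinity> \<longrightarrow>
       (\<integral>\<^sup>+z. ennreal (norm z powr p) \<partial>cond_law \<gamma> t (snd w)) < \<infinity> \<longrightarrow>
       (\<integral>\<^sup>+\<omega>. ennreal (dist (fst \<omega>) (snd \<omega>) powr p) \<partial>K w) \<le> ennreal ((c w + \<epsilon>) powr p) \<and>
       ennreal (c w powr p) \<le> (INF \<pi>\<in>couplings (cond_law \<gamma> t (fst w)) (cond_law \<gamma> t (snd w)).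
         \<integral>\<^sup>+\<omega>. ennreal (dist (fst \<omega>) (snd \<omega>) powr p) \<partial>\<pi>)))"

lemma ex_cond_law_couplings:
  fixes \<gamma> :: "(nat \<Rightarrow> real^'d) measure"
  assumes \<gamma>: "prob_space \<gamma>" "sets \<gamma> = sets (path_space T)" and p: "1 \<le> p" and \<epsilon>: "0 < \<epsilon>"
  obtains K c where
    "\<And>t. t < T \<Longrightarrow> K t \<in> path_space t \<Otimes>\<^sub>M path_space t \<rightarrow>\<^sub>M prob_algebra (borel \<Otimes>\<^sub>M borel)"
    "\<And>t x x'. t < T \<Longrightarrow> x \<in> space (path_space t) \<Longrightarrow> x' \<in> space (path_space t) \<Longrightarrow>
      K t (x, x') \<in> couplings (cond_law \<gamma> t x) (cond_law \<gamma> t x')"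
    "\<And>t. t < T \<Longrightarrow> c t \<in> borel_measurable (path_space t \<Otimes>\<^sub>M path_space t)"
    "\<And>t w. (0::real) \<le> c t w"
    "\<And>t x x'. t < T \<Longrightarrow> x \<in> space (path_space t) \<Longrightarrow> x' \<in> space (path_space t) \<Longrightarrow>
      (\<integral>\<^sup>+z. ennreal (norm z powr p) \<partial>cond_law \<gamma> t x) < \<infinity> \<Longrightarrow>
      (\<integral>\<^sup>+z. ennreal (norm z powr p) \<partial>cond_law \<gamma> t x') < \<infinity> \<Longrightarrow>
      (\<integral>\<^sup>+\<omega>. ennreal (dist (fst \<omega>) (snd \<omega>) powr p) \<partial>K t (x, x')) \<le> ennreal ((c t (x, x') + \<epsilon>) powr p) \<and>
      ennreal (c t (x, x') powr p) \<le>
        (INF \<pi>\<in>couplings (cond_law \<gamma> t x) (cond_law \<gamma> t x'). \<integral>\<^sup>+\<omega>. ennreal (dist (fst \<omega>) (snd \<omega>) powr p) \<partial>\<pi>)"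
proof -
  let ?fin = "\<lambda>t x. (\<integral>\<^sup>+z. ennreal (norm z powr p) \<partial>cond_law \<gamma> t x) < \<infinity>"
  obtain q and r :: "nat \<Rightarrow> real^'d" where quant: "quantizer q r (\<epsilon> / 8)" using ex_quantizer[of "\<epsilon> / 8"] \<epsilon> by auto
  have ex: "\<exists>K c. near_optimal_kernel \<gamma> p \<epsilon> t K c" if t: "t < T" for t
  proof -
    note \<kappa> = disintegrates_kernel[OF disintegrates_cond_law[OF \<gamma> t]]
    have a: "(\<lambda>w. cond_law \<gamma> t (fst w)) \<in> path_space t \<Otimes>\<^sub>M path_space t \<rightarrow>\<^sub>M prob_algebra borel"
      "(\<lambda>w. cond_law \<gamma> t (snd w)) \<in> path_space t \<Otimes>\<^sub>M path_space t \<rightarrow>\<^sub>M prob_algebra borel"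
      by (rule measurable_compose[OF _ \<kappa>], simp)+
    obtain K c where "K \<in> path_space t \<Otimes>\<^sub>M path_space t \<rightarrow>\<^sub>M prob_algebra (borel \<Otimes>\<^sub>M borel)"
      "c \<in> borel_measurable (path_space t \<Otimes>\<^sub>M path_space t)"
      "\<And>w. w \<in> space (path_space t \<Otimes>\<^sub>M path_space t) \<Longrightarrow> K w \<in> couplings (cond_law \<gamma> t (fst w)) (cond_law \<gamma> t (snd w))"
      "\<And>w. (0::real) \<le> c w"
      "\<And>w. w \<in> space (path_space t \<Otimes>\<^sub>M path_space t) \<Longrightarrow> ?fin t (fst w) \<Longrightarrow> ?fin t (snd w) \<Longrightarrow>
        (\<integral>\<^sup>+\<omega>. ennreal (dist (fst \<omega>) (snd \<omega>) powr p) \<partial>K w) \<le> ennreal ((c w + \<epsilon>) powr p) \<and>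
        ennreal (c w powr p) \<le> (INF \<pi>\<in>couplings (cond_law \<gamma> t (fst w)) (cond_law \<gamma> t (snd w)). \<integral>\<^sup>+\<omega>. ennreal (dist (fst \<omega>) (snd \<omega>) powr p) \<partial>\<pi>)"
      by (rule ex_near_optimal_kernel[OF p \<epsilon> quant a]) blast
    then have "near_optimal_kernel \<gamma> p \<epsilon> t K c" unfolding near_optimal_kernel_def by blast
    then show ?thesis by blast
  qed
  define K where "K t = (SOME K. \<exists>c. near_optimal_kernel \<gamma> p \<epsilon> t K c)" for t
  \<comment> \<open>The value 0 for times from \<open>T\<close> on keeps \<open>c\<close>
    nonnegative everywhere, as is demanded without restriction on \<open>t\<close>.\<close>
  define c where "c t = (if t < T then SOME c. near_optimal_kernel \<gamma> p \<epsilon> t (K t) c else (\<lambda>_. 0))" for t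
  have Pt: "near_optimal_kernel \<gamma> p \<epsilon> t (K t) (c t)" if t: "t < T" for t
  proof -
    have "\<exists>c. near_optimal_kernel \<gamma> p \<epsilon> t (K t) c" unfolding K_def by (rule someI_ex[OF ex[OF t]])
    moreover have "c t = (SOME c. near_optimal_kernel \<gamma> p \<epsilon> t (K t) c)" by (simp only: c_def t if_True)
    ultimately show ?thesis by (metis someI_ex)
  qed
  show ?thesis
  proof (rule that[of K c])
    show "0 \<le> c t w" for t w
    proof (cases "t < T")
      case True
      from Pt[OF this] show ?thesis unfolding near_optimal_kernel_def by blast
    next
      case False
      then show ?thesis by (simp add: c_def)
    qed
  next
    fix t x x' assume t: "t < T" and "x \<in> space (path_space t :: (nat \<Rightarrow> real^'d) measure)" "x' \<in> space (path_space t :: (nat \<Rightarrow> real^'d) measure)"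
    then have w: "(x, x') \<in> space (path_space t \<Otimes>\<^sub>M path_space t)" by (simp add: space_pair_measure)
    show "K t (x, x') \<in> couplings (cond_law \<gamma> t x) (cond_law \<gamma> t x')"
      using Pt[OF t] w unfolding near_optimal_kernel_def by fastforce
    show "?fin t x \<Longrightarrow> ?fin t x' \<Longrightarrow>
      (\<integral>\<^sup>+\<omega>. ennreal (dist (fst \<omega>) (snd \<omega>) powr p) \<partial>K t (x, x')) \<le> ennreal ((c t (x, x') + \<epsilon>) powr p) \<and>
      ennreal (c t (x, x') powr p) \<le>
        (INF \<pi>\<in>couplings (cond_law \<gamma> t x) (cond_law \<gamma> t x'). \<integral>\<^sup>+\<omega>. ennreal (dist (fst \<omega>) (snd \<omega>) powr p) \<partial>\<pi>)"
      using Pt[OF t] w unfolding near_optimal_kernel_def by fastforce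
  next
    fix t assume "t < T"
    from Pt[OF this]
    show "K t \<in> path_space t \<Otimes>\<^sub>M path_space t \<rightarrow>\<^sub>M prob_algebra (borel \<Otimes>\<^sub>M borel)"
      "c t \<in> borel_measurable (path_space t \<Otimes>\<^sub>M path_space t)"
      unfolding near_optimal_kernel_def by blast+
  qed
qed

lemma epowr_1: "epowr x 1 = x"
  by (cases x) (auto simp: epowr_def)

lemma epowr_ennreal: "0 \<le> a \<Longrightarrow> epowr (ennreal a) p = ennreal (a powr p)"
  by (simp add: epowr_def)

lemma moment_measures_D:
  assumes "\<gamma> \<in> moment_measures p T"
  shows "prob_space \<gamma>" "sets \<gamma> = sets (path_space T)" "(\<integral>\<^sup>+x. ennreal (path_norm T x powr p) \<partial>\<gamma>) < \<infinity>"
  using assms by (simp_all add: moment_measures_def)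

section \<open>The estimate\<close>

text \<open>The path coupling is cheap where the cells agree, because both paths are then close to the
  same cells; elsewhere the cost is split at level \<open>R\<close>.\<close>

lemma path_cost_le:
  fixes x y m :: "nat \<Rightarrow> real^'d"
  assumes p: "1 \<le> p" and "0 < R"
  shows "(\<Sum>t=1..T. dist (x t) (y t) powr p) \<le>
    2 powr p * ((\<Sum>t=1..T. dist (x t) (m t) powr p) + (\<Sum>t=1..T. dist (y t) (m' t) powr p))
    + real T * 2 powr p * (2 * R powr p * of_bool (\<not> (\<forall>t\<in>{1..T}. m t = m' t))
        + (path_norm T x powr p * of_bool (R \<le> path_norm T x) + path_norm T y powr p * of_bool (R \<le> path_norm T y)))"
proof (cases "\<forall>t\<in>{1..T}. m t = m' t")
  case True
  have "(\<Sum>t=1..T. dist (x t) (y t) powr p) \<le> (\<Sum>t=1..T. 2 powr p * (dist (x t) (m t) powr p + dist (y t) (m' t) powr p))"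
  proof (rule sum_mono)
    fix t assume "t \<in> {1..T}"
    then have "dist (x t) (y t) \<le> dist (x t) (m t) + dist (y t) (m' t)"
      using True dist_triangle2[of "x t" "y t" "m t"] by simp
    then have "dist (x t) (y t) powr p \<le> (dist (x t) (m t) + dist (y t) (m' t)) powr p"
      using p by (intro powr_mono2) auto
    also have "\<dots> \<le> 2 powr p * (dist (x t) (m t) powr p + dist (y t) (m' t) powr p)"
      using p by (intro powr_add_le_two_powr) auto
    finally show "dist (x t) (y t) powr p \<le> 2 powr p * (dist (x t) (m t) powr p + dist (y t) (m' t) powr p)" .
  qed
  also have "\<dots> = 2 powr p * ((\<Sum>t=1..T. dist (x t) (m t) powr p) + (\<Sum>t=1..T. dist (y t) (m' t) powr p))"
    by (simp add: sum_distrib_left sum.distrib distrib_left)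
  finally show ?thesis by (rule order_trans) simp
next
  case False
  have tail: "norm (z t) powr p \<le> R powr p + path_norm T z powr p * of_bool (R \<le> path_norm T z)"
    if "t \<in> {1..T}" for z :: "nat \<Rightarrow> real^'d" and t
  proof -
    have "norm (z t) powr p \<le> path_norm T z powr p"
      using norm_le_path_norm[OF that, of z] p by (intro powr_mono2) auto
    moreover have "path_norm T z powr p \<le> R powr p" if "\<not> R \<le> path_norm T z"
      using that p by (intro powr_mono2) (auto simp: path_norm_def L2_set_nonneg)
    moreover have "0 \<le> R powr p" by simp
    ultimately show ?thesis by (cases "R \<le> path_norm T z") (simp_all add: add_increasing)
  qed
  have "(\<Sum>t=1..T. dist (x t) (y t) powr p) \<le> (\<Sum>t=1..T. 2 powr p * (2 * R powr p
      + (path_norm T x powr p * of_bool (R \<le> path_norm T x) + path_norm T y powr p * of_bool (R \<le> path_norm T y))))"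
  proof (rule sum_mono)
    fix t assume t: "t \<in> {1..T}"
    have "dist (x t) (y t) powr p \<le> 2 powr p * (norm (x t) powr p + norm (y t) powr p)"
      using p by (intro dist_powr_le_norm) auto
    also have "\<dots> \<le> 2 powr p * (2 * R powr p
      + (path_norm T x powr p * of_bool (R \<le> path_norm T x) + path_norm T y powr p * of_bool (R \<le> path_norm T y)))"
      using tail[OF t, of x] tail[OF t, of y] by (intro mult_left_mono) auto
    finally show "dist (x t) (y t) powr p \<le> 2 powr p * (2 * R powr p
      + (path_norm T x powr p * of_bool (R \<le> path_norm T x) + path_norm T y powr p * of_bool (R \<le> path_norm T y)))" .
  qed
  also have "\<dots> = real T * 2 powr p * (2 * R powr p
      + (path_norm T x powr p * of_bool (R \<le> path_norm T x) + path_norm T y powr p * of_bool (R \<le> path_norm T y)))"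
    by (simp only: sum_constant card_atLeastAtMost mult.assoc diff_Suc_1 Suc_eq_plus1 add_diff_cancel_right')
  finally have "(\<Sum>t=1..T. dist (x t) (y t) powr p) \<le> real T * 2 powr p * (2 * R powr p * of_bool (\<not> (\<forall>t\<in>{1..T}. m t = m' t))
        + (path_norm T x powr p * of_bool (R \<le> path_norm T x) + path_norm T y powr p * of_bool (R \<le> path_norm T y)))"
    using False by (simp only: not_False_eq_True of_bool_eq mult_1_right)
  moreover have "0 \<le> 2 powr p * ((\<Sum>t=1..T. dist (x t) (m t) powr p) + (\<Sum>t=1..T. dist (y t) (m' t) powr p))"
    by (intro mult_nonneg_nonneg add_nonneg_nonneg sum_nonneg powr_ge_zero)
  ultimately show ?thesis by linarith
qed

text \<open>Finite iterated moduli are represented by reals without loss, and the couplings come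
  from \<open>ex_cond_law_couplings\<close>.\<close>

lemma ex_quantised_law_error:
  fixes \<gamma> :: "(nat \<Rightarrow> real^'d) measure"
  assumes p: "1 \<le> p" and \<gamma>: "\<gamma> \<in> moment_measures p T" and \<epsilon>: "0 < \<epsilon>" and quant: "quantizer q r \<eta>"
    and small: "real T * (\<epsilon> + 2 * \<eta>) < \<sigma>"
    and fin: "\<And>t. t < T \<Longrightarrow> iter_modulus p \<gamma> t (ennreal \<sigma>) < top" and \<sigma>: "0 \<le> \<sigma>"
  obtains K c where "quantised_law_error \<gamma> T q K p \<epsilon> \<eta> \<sigma> r c (\<lambda>t. enn2real (iter_modulus p \<gamma> t (ennreal \<sigma>)))"
proof -
  note D = moment_measures_D[OF \<gamma>]
  have q: "q \<in> borel \<rightarrow>\<^sub>M count_space UNIV" using quant by (simp add: quantizer_def)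
  have h: "iter_modulus p \<gamma> t (ennreal \<sigma>) = ennreal (enn2real (iter_modulus p \<gamma> t (ennreal \<sigma>)))" if "t < T" for t
    using fin[OF that] by simp
  have h0: "enn2real (iter_modulus p \<gamma> 0 (ennreal \<sigma>)) = \<sigma>" using \<sigma> by simp
  obtain K c where *: "\<And>t. t < T \<Longrightarrow> K t \<in> path_space t \<Otimes>\<^sub>M path_space t \<rightarrow>\<^sub>M prob_algebra (borel \<Otimes>\<^sub>M borel)"
      "\<And>t x x'. t < T \<Longrightarrow> x \<in> space (path_space t) \<Longrightarrow> x' \<in> space (path_space t) \<Longrightarrow>
        K t (x, x') \<in> couplings (cond_law \<gamma> t x) (cond_law \<gamma> t x')"
      "\<And>t. t < T \<Longrightarrow> c t \<in> borel_measurable (path_space t \<Otimes>\<^sub>M path_space t)"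
      "\<And>t w. (0::real) \<le> c t w"
      "\<And>t x x'. t < T \<Longrightarrow> x \<in> space (path_space t) \<Longrightarrow> x' \<in> space (path_space t) \<Longrightarrow>
        (\<integral>\<^sup>+z. ennreal (norm z powr p) \<partial>cond_law \<gamma> t x) < \<infinity> \<Longrightarrow>
        (\<integral>\<^sup>+z. ennreal (norm z powr p) \<partial>cond_law \<gamma> t x') < \<infinity> \<Longrightarrow>
        (\<integral>\<^sup>+\<omega>. ennreal (dist (fst \<omega>) (snd \<omega>) powr p) \<partial>K t (x, x')) \<le> ennreal ((c t (x, x') + \<epsilon>) powr p) \<and>
        ennreal (c t (x, x') powr p) \<le>
          (INF \<pi>\<in>couplings (cond_law \<gamma> t x) (cond_law \<gamma> t x'). \<integral>\<^sup>+\<omega>. ennreal (dist (fst \<omega>) (snd \<omega>) powr p) \<partial>\<pi>)"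
    by (rule ex_cond_law_couplings[OF D(1,2) p \<epsilon>]) blast
  have "quantised_law \<gamma> T (cond_law \<gamma>) q K"
    by (rule quantised_law.intro) (rule D(1,2) disintegrates_cond_law[OF D(1,2)] q *(1,2); assumption)+
  moreover have "quantised_law_error_axioms \<gamma> T q K p \<epsilon> \<eta> \<sigma> r c (\<lambda>t. enn2real (iter_modulus p \<gamma> t (ennreal \<sigma>)))"
    by (rule quantised_law_error_axioms.intro)
      (rule p less_imp_le[OF \<epsilon>] quant D(3) *(3,4) *(5) h enn2real_nonneg h0 small; assumption)+
  ultimately show ?thesis by (intro that quantised_law_error.intro)
qed

text \<open>The estimate for one coupling \<pi> and one number \<open>n\<close> of shifts:
  \<open>path_cost_le\<close> is integrated over the joint chain, where \<open>chain_cost\<close>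
  bounds the errors of both chains and \<open>joint_chain_decoupling\<close> the probability that
  the cells differ. Finiteness of the moduli is assumed here and recovered later from finiteness of
  the supremum on the right.\<close>

lemma bicausal_cost_le:
  fixes \<mu> \<nu> :: "(nat \<Rightarrow> real^'d) measure"
  assumes T: "1 \<le> T" and p: "1 \<le> p" and \<sigma>: "0 < \<sigma>" and R: "0 < R"
    and \<mu>: "\<mu> \<in> moment_measures p T" and \<nu>: "\<nu> \<in> moment_measures p T"
    and h\<mu>: "\<And>t. t < T \<Longrightarrow> iter_modulus p \<mu> t (ennreal \<sigma>) < top"
    and h\<nu>: "\<And>t. t < T \<Longrightarrow> iter_modulus p \<nu> t (ennreal \<sigma>) < top"
    and \<pi>: "\<pi> \<in> couplings \<mu> \<nu>" and n: "0 < n"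
  shows "(INF \<pi>\<in>bicausal_couplings T \<mu> \<nu>. \<integral>\<^sup>+\<omega>. ennreal (\<Sum>t=1..T. dist (fst \<omega> t) (snd \<omega> t) powr p) \<partial>\<pi>)
    \<le> ennreal (2 powr p) * (epowr (\<Sum>t=0..T-1. iter_modulus p \<mu> t (ennreal \<sigma>)) p + epowr (\<Sum>t=0..T-1. iter_modulus p \<nu> t (ennreal \<sigma>)) p)
      + ennreal (real T * 2 powr p) *
        (ennreal (4 * real T * R powr p) *
           (ennreal (4 * (real T * real CARD('d))\<^sup>2 / \<sigma>) * (\<integral>\<^sup>+\<omega>. ennreal (path_dist T (fst \<omega>) (snd \<omega>)) \<partial>\<pi>) + ennreal (real T * real CARD('d) / real n))
         + ((\<integral>\<^sup>+x\<in>{x\<in>space \<mu>. R \<le> path_norm T x}. ennreal (path_norm T x powr p) \<partial>\<mu>)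
          + (\<integral>\<^sup>+x\<in>{x\<in>space \<nu>. R \<le> path_norm T x}. ennreal (path_norm T x powr p) \<partial>\<nu>)))"
proof -
  note \<mu>D = moment_measures_D[OF \<mu>] and \<nu>D = moment_measures_D[OF \<nu>]
  let ?d = "real CARD('d)"
  \<comment> \<open>With \<eta> also in the role of \<epsilon>, the losses amount to
    \<open>3 * T * \<eta> = 3 * \<sigma> / 4 < \<sigma>\<close>. The mesh \<open>\<eta> / d\<close>
    gives cells of radius \<eta> and \<open>T * d / l = 4 * (T * d)^2 / \<sigma>\<close>.\<close>
  define \<eta> where "\<eta> = \<sigma> / (4 * real T)"
  define l where "l = \<eta> / ?d"
  have \<eta>: "0 < \<eta>" "real T * (\<eta> + 2 * \<eta>) < \<sigma>" and l: "0 < l" "?d * l = \<eta>"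
    using \<sigma> T by (simp_all add: \<eta>_def l_def)
  obtain u where u: "(\<integral>\<^sup>+\<omega>. (if qlist (grid_index l u) T (fst \<omega>) = qlist (grid_index l u) T (snd \<omega>) then 0 else 1) \<partial>\<pi>)
    \<le> ennreal (real T * ?d / l) * (\<integral>\<^sup>+\<omega>. ennreal (path_dist T (fst \<omega>) (snd \<omega>)) \<partial>\<pi>) + ennreal (real T * ?d / real n)"
    using ex_grid_shift[OF \<mu>D(2) \<nu>D(2) \<pi> n l(1)] by blast
  define q :: "real^'d \<Rightarrow> nat" where "q = grid_index l u"
  define r :: "nat \<Rightarrow> real^'d" where "r = grid_point l u"
  have quant: "quantizer q r \<eta>" using quantizer_grid[OF l(1), of u, where ?'d = 'd] l(2) by (simp add: q_def r_def)
  then have q_meas: "q \<in> borel \<rightarrow>\<^sub>M count_space UNIV" by (simp add: quantizer_def)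
  define h where "h \<gamma> t = enn2real (iter_modulus p \<gamma> t (ennreal \<sigma>))" for \<gamma> :: "(nat \<Rightarrow> real^'d) measure" and t
  obtain K c where Kc: "quantised_law_error \<mu> T q K p \<eta> \<eta> \<sigma> r c (h \<mu>)"
    unfolding h_def by (rule ex_quantised_law_error[OF p \<mu> \<eta>(1) quant \<eta>(2) h\<mu>]) (use \<sigma> in auto)
  obtain K' c' where Kc': "quantised_law_error \<nu> T q K' p \<eta> \<eta> \<sigma> r c' (h \<nu>)"
    unfolding h_def by (rule ex_quantised_law_error[OF p \<nu> \<eta>(1) quant \<eta>(2) h\<nu>]) (use \<sigma> in auto)
  interpret A: quantised_law_error \<mu> T q K p \<eta> \<eta> \<sigma> r c "h \<mu>" by (rule Kc)
  interpret B: quantised_law_error \<nu> T q K' p \<eta> \<eta> \<sigma> r c' "h \<nu>" by (rule Kc')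
  interpret coupled_laws \<mu> \<nu> T "cond_law \<mu>" "cond_law \<nu>" q K K' ..
  have epowr_h: "epowr (\<Sum>t=0..T-1. iter_modulus p \<gamma> t (ennreal \<sigma>)) p = ennreal ((\<Sum>t=0..T-1. h \<gamma> t) powr p)"
    if "\<And>t. t < T \<Longrightarrow> iter_modulus p \<gamma> t (ennreal \<sigma>) < top" for \<gamma> :: "(nat \<Rightarrow> real^'d) measure"
  proof -
    have "(\<Sum>t=0..T-1. iter_modulus p \<gamma> t (ennreal \<sigma>)) = (\<Sum>t=0..T-1. ennreal (h \<gamma> t))"
      using T that by (intro sum.cong) (auto simp: h_def)
    also have "\<dots> = ennreal (\<Sum>t=0..T-1. h \<gamma> t)" by (rule sum_ennreal) (simp add: h_def)
    finally show ?thesis by (simp add: epowr_ennreal sum_nonneg h_def)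
  qed
  let ?m = "\<lambda>s t. r (hd (drop (T - t) (snd s)))"
  let ?E = "\<lambda>s. (\<Sum>t=1..T. ennreal (dist (fst s t) (?m s t) powr p))"
  let ?ne = "\<lambda>s. (if snd (fst s) = snd (snd s) then 0 else 1) :: ennreal"
  let ?tail = "\<lambda>x. ennreal (path_norm T x powr p) * indicator {x. R \<le> path_norm T x} x"
  have Em: "?E \<in> borel_measurable (states T)"
    using A.dist_cell_meas by (intro borel_measurable_sum) auto
  have tailm: "?tail \<in> borel_measurable (path_space T)"
    by measurable
  have [measurable]: "(\<lambda>s. ?E (fst s)) \<in> borel_measurable (joint_chain T)" "(\<lambda>s. ?E (snd s)) \<in> borel_measurable (joint_chain T)"
    "(\<lambda>s. ?tail (fst (fst s))) \<in> borel_measurable (joint_chain T)" "(\<lambda>s. ?tail (fst (snd s))) \<in> borel_measurable (joint_chain T)"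
    unfolding measurable_cong_sets[OF sets_joint_chain[OF order_refl] refl]
    by (rule measurable_compose[OF measurable_fst Em] measurable_compose[OF measurable_snd Em]
        measurable_compose[OF measurable_compose[OF measurable_fst measurable_fst] tailm]
        measurable_compose[OF measurable_compose[OF measurable_snd measurable_fst] tailm])+
  have [measurable]: "?ne \<in> borel_measurable (joint_chain T)"
  proof -
    have "(\<lambda>s. (snd (fst s), snd (snd s))) \<in> states T \<Otimes>\<^sub>M states T \<rightarrow>\<^sub>M count_space UNIV"
      by (intro measurable_count_Pair) measurable
    from measurable_compose[OF this, of "\<lambda>(a, b). if a = b then 0 else 1" borel]
    show ?thesis by (simp add: measurable_cong_sets[OF sets_joint_chain[OF order_refl] refl])
  qed
  have sum_m: "(\<lambda>\<omega>. ennreal (\<Sum>t=1..T. dist (fst \<omega> t) (snd \<omega> t) powr p))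
      \<in> borel_measurable (path_space T \<Otimes>\<^sub>M path_space T :: ((nat \<Rightarrow> real^'d) \<times> (nat \<Rightarrow> real^'d)) measure)"
  proof -
    have "(\<lambda>\<omega>. dist (fst \<omega> t) (snd \<omega> t) powr p) \<in> borel_measurable (path_space T \<Otimes>\<^sub>M path_space T :: ((nat \<Rightarrow> real^'d) \<times> (nat \<Rightarrow> real^'d)) measure)"
      if "t \<in> {1..T}" for t
      by (intro powr_real_measurable borel_measurable_dist borel_measurable_const
          measurable_compose[OF measurable_fst measurable_path_component[OF that]]
          measurable_compose[OF measurable_snd measurable_path_component[OF that]])
    then show ?thesis by (intro measurable_compose[OF borel_measurable_sum measurable_ennreal])
  qed
  have "(INF \<pi>\<in>bicausal_couplings T \<mu> \<nu>. \<integral>\<^sup>+\<omega>. ennreal (\<Sum>t=1..T. dist (fst \<omega> t) (snd \<omega> t) powr p) \<partial>\<pi>)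
    \<le> (\<integral>\<^sup>+\<omega>. ennreal (\<Sum>t=1..T. dist (fst \<omega> t) (snd \<omega> t) powr p) \<partial>path_coupling)"
    by (rule INF_lower[OF path_coupling_bicausal])
  also have "\<dots> = (\<integral>\<^sup>+s. ennreal (\<Sum>t=1..T. dist (fst (fst s) t) (fst (snd s) t) powr p) \<partial>joint_chain T)"
    using nn_integral_path_coupling[OF sum_m] by simp
  also have "\<dots> \<le> (\<integral>\<^sup>+s. ennreal (2 powr p) * (?E (fst s) + ?E (snd s))
      + ennreal (real T * 2 powr p) * (ennreal (2 * R powr p) * ?ne s + (?tail (fst (fst s)) + ?tail (fst (snd s)))) \<partial>joint_chain T)"
  proof (rule nn_integral_mono)
    fix s :: "((nat \<Rightarrow> real^'d) \<times> nat list) \<times> ((nat \<Rightarrow> real^'d) \<times> nat list)"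
    let ?x = "fst (fst s)" and ?y = "fst (snd s)"
    let ?b = "of_bool (\<not> (\<forall>t\<in>{1..T}. ?m (fst s) t = ?m (snd s) t)) :: real"
    let ?tx = "path_norm T ?x powr p * of_bool (R \<le> path_norm T ?x)" and ?ty = "path_norm T ?y powr p * of_bool (R \<le> path_norm T ?y)"
    have "ennreal (\<Sum>t=1..T. dist (?x t) (?y t) powr p)
      \<le> ennreal (2 powr p * ((\<Sum>t=1..T. dist (?x t) (?m (fst s) t) powr p) + (\<Sum>t=1..T. dist (?y t) (?m (snd s) t) powr p))
        + real T * 2 powr p * (2 * R powr p * ?b + (?tx + ?ty)))"
      by (intro ennreal_leI path_cost_le p R)
    also have "\<dots> = ennreal (2 powr p) * (?E (fst s) + ?E (snd s))
        + ennreal (real T * 2 powr p) * (ennreal (2 * R powr p) * ennreal ?b + (ennreal ?tx + ennreal ?ty))"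
    proof -
      have E: "?E z = ennreal (\<Sum>t=1..T. dist (fst z t) (?m z t) powr p)" for z
        by (rule sum_ennreal) simp
      show ?thesis unfolding E
        by (simp add: sum_nonneg flip: ennreal_mult ennreal_plus)
    qed
    \<comment> \<open>Equal cell lists have equal representatives at all times, so the indicator in
      terms of representatives is at most the one in terms of lists.\<close>
    also have "\<dots> \<le> ennreal (2 powr p) * (?E (fst s) + ?E (snd s))
      + ennreal (real T * 2 powr p) * (ennreal (2 * R powr p) * ?ne s + (?tail ?x + ?tail ?y))"
      by (intro add_mono mult_left_mono order_refl) (auto simp: indicator_def)
    finally show "ennreal (\<Sum>t=1..T. dist (?x t) (?y t) powr p) \<le> ennreal (2 powr p) * (?E (fst s) + ?E (snd s))
      + ennreal (real T * 2 powr p) * (ennreal (2 * R powr p) * ?ne s + (?tail ?x + ?tail ?y))" .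
  qed
  also have "\<dots> = ennreal (2 powr p) * ((\<integral>\<^sup>+s. ?E (fst s) \<partial>joint_chain T) + (\<integral>\<^sup>+s. ?E (snd s) \<partial>joint_chain T))
      + ennreal (real T * 2 powr p) * (ennreal (2 * R powr p) * (\<integral>\<^sup>+s. ?ne s \<partial>joint_chain T)
        + ((\<integral>\<^sup>+s. ?tail (fst (fst s)) \<partial>joint_chain T) + (\<integral>\<^sup>+s. ?tail (fst (snd s)) \<partial>joint_chain T)))"
    by (simp add: nn_integral_add nn_integral_cmult del: sum_ennreal)
  also have "\<dots> \<le> ennreal (2 powr p) * (ennreal ((\<Sum>t=0..T-1. h \<mu> t) powr p) + ennreal ((\<Sum>t=0..T-1. h \<nu> t) powr p))
      + ennreal (real T * 2 powr p) * (ennreal (2 * R powr p) * (2 * of_nat T *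
          (ennreal (real T * ?d / l) * (\<integral>\<^sup>+\<omega>. ennreal (path_dist T (fst \<omega>) (snd \<omega>)) \<partial>\<pi>) + ennreal (real T * ?d / real n)))
        + ((\<integral>\<^sup>+x\<in>{x\<in>space \<mu>. R \<le> path_norm T x}. ennreal (path_norm T x powr p) \<partial>\<mu>)
          + (\<integral>\<^sup>+x\<in>{x\<in>space \<nu>. R \<le> path_norm T x}. ennreal (path_norm T x powr p) \<partial>\<nu>)))"
  proof (intro add_mono mult_left_mono)
    show "(\<integral>\<^sup>+s. ?E (fst s) \<partial>joint_chain T) \<le> ennreal ((\<Sum>t=0..T-1. h \<mu> t) powr p)"
      unfolding nn_integral_joint_chain_fst[OF order_refl Em] by (rule A.chain_cost)
    show "(\<integral>\<^sup>+s. ?E (snd s) \<partial>joint_chain T) \<le> ennreal ((\<Sum>t=0..T-1. h \<nu> t) powr p)"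
      unfolding nn_integral_joint_chain_snd[OF order_refl Em] by (rule B.chain_cost)
    show "(\<integral>\<^sup>+s. ?ne s \<partial>joint_chain T) \<le> 2 * of_nat T *
        (ennreal (real T * ?d / l) * (\<integral>\<^sup>+\<omega>. ennreal (path_dist T (fst \<omega>) (snd \<omega>)) \<partial>\<pi>) + ennreal (real T * ?d / real n))"
      using joint_chain_decoupling[OF \<pi> order_refl] u[folded q_def] by (meson mult_left_mono order_trans zero_le)
    have "(\<integral>\<^sup>+s. ?tail (fst (fst s)) \<partial>joint_chain T) = (\<integral>\<^sup>+s. ?tail (fst s) \<partial>A.chain T)"
      by (rule nn_integral_joint_chain_fst[OF order_refl measurable_compose[OF measurable_fst tailm]])
    also have "\<dots> = (\<integral>\<^sup>+x. ?tail (restrict x {1..T}) \<partial>\<mu>)" by (rule A.nn_integral_chain_fst[OF order_refl tailm])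
    also have "\<dots> = (\<integral>\<^sup>+x\<in>{x\<in>space \<mu>. R \<le> path_norm T x}. ennreal (path_norm T x powr p) \<partial>\<mu>)"
      by (intro nn_integral_cong) (auto simp: restrict_path_id A.space_\<gamma> indicator_def)
    finally show "(\<integral>\<^sup>+s. ?tail (fst (fst s)) \<partial>joint_chain T) \<le> (\<integral>\<^sup>+x\<in>{x\<in>space \<mu>. R \<le> path_norm T x}. ennreal (path_norm T x powr p) \<partial>\<mu>)"
      by simp
    have "(\<integral>\<^sup>+s. ?tail (fst (snd s)) \<partial>joint_chain T) = (\<integral>\<^sup>+s. ?tail (fst s) \<partial>B.chain T)"
      by (rule nn_integral_joint_chain_snd[OF order_refl measurable_compose[OF measurable_fst tailm]])
    also have "\<dots> = (\<integral>\<^sup>+x. ?tail (restrict x {1..T}) \<partial>\<nu>)" by (rule B.nn_integral_chain_fst[OF order_refl tailm])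
    also have "\<dots> = (\<integral>\<^sup>+x\<in>{x\<in>space \<nu>. R \<le> path_norm T x}. ennreal (path_norm T x powr p) \<partial>\<nu>)"
      by (intro nn_integral_cong) (auto simp: restrict_path_id B.space_\<gamma> indicator_def)
    finally show "(\<integral>\<^sup>+s. ?tail (fst (snd s)) \<partial>joint_chain T) \<le> (\<integral>\<^sup>+x\<in>{x\<in>space \<nu>. R \<le> path_norm T x}. ennreal (path_norm T x powr p) \<partial>\<nu>)"
      by simp
  qed auto
  \<comment> \<open>The factor \<open>2 * R powr p\<close> from the split at level \<open>R\<close>
    meets \<open>2 * T\<close> from the decoupling, which gives
    \<open>4 * T * R powr p\<close>.\<close>
  also have "ennreal (2 * R powr p) * (2 * of_nat T *
          (ennreal (real T * ?d / l) * (\<integral>\<^sup>+\<omega>. ennreal (path_dist T (fst \<omega>) (snd \<omega>)) \<partial>\<pi>) + ennreal (real T * ?d / real n)))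
      = ennreal (4 * real T * R powr p) *
           (ennreal (4 * (real T * ?d)\<^sup>2 / \<sigma>) * (\<integral>\<^sup>+\<omega>. ennreal (path_dist T (fst \<omega>) (snd \<omega>)) \<partial>\<pi>) + ennreal (real T * ?d / real n))"
  proof -
    have "real T * ?d / l = 4 * (real T * ?d)\<^sup>2 / \<sigma>"
      using \<sigma> T by (simp add: l_def \<eta>_def power2_eq_square)
    moreover have "ennreal (2 * R powr p) * (2 * of_nat T) = ennreal (4 * real T * R powr p)"
    proof -
      have "2 * of_nat T = ennreal (2 * real T)" by (simp add: ennreal_of_nat_eq_real_of_nat ennreal_mult)
      then show ?thesis by (simp add: mult_ac flip: ennreal_mult)
    qed
    ultimately show ?thesis by (simp only: mult.assoc[symmetric])
  qed
  finally show ?thesis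
    by (subst (1 2) epowr_h) (use h\<mu> h\<nu> in auto)
qed

theorem corollary30:
  fixes T :: nat and p :: real
  assumes "1 \<le> T" and "1 \<le> p"
  shows "\<exists>C::real. 0 < C \<and>
    (\<forall>(K :: (nat \<Rightarrow> real^'d) measure set) (\<sigma>::real) (R::real).
       adapted_relatively_compact p T K \<longrightarrow> 0 < \<sigma> \<longrightarrow> \<sigma> < R \<longrightarrow>
       (\<forall>\<mu>\<in>K. \<forall>\<nu>\<in>K.
          epowr (adapted_wasserstein p T \<mu> \<nu>) p \<le>
            ennreal C *
            (ennreal (R powr p) * wasserstein (path_dist T) 1 \<mu> \<nu> / ennreal \<sigma>
             + (SUP \<gamma>\<in>K. epowr (\<Sum>t=0..T-1. iter_modulus p \<gamma> t (ennreal \<sigma>)) p)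
             + (SUP \<gamma>\<in>K. \<integral>\<^sup>+x\<in>{x\<in>space \<gamma>. R \<le> path_norm T x}.
                            ennreal (path_norm T x powr p) \<partial>\<gamma>))))"
proof -
  let ?d = "real CARD('d)"
  \<comment> \<open>The coefficient of \<open>R powr p * W / \<sigma>\<close>: the factor
    \<open>T * 2 powr p\<close> comes from \<open>path_cost_le\<close>, \<open>4 * T\<close> from
    the split at \<open>R\<close> together with the decoupling, and \<open>4 * (T * d)^2\<close>
    from the grid.\<close>
  define c1 where "c1 = real T * 2 powr p * (4 * real T) * (4 * (real T * ?d)\<^sup>2)"
  \<comment> \<open>The sum dominates each coefficient. Those of the two suprema are doubled because
    \<mu> and \<nu> are both estimated by the same supremum.\<close>
  define C where "C = c1 + 2 * 2 powr p + 2 * (real T * 2 powr p)"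
  have "0 \<le> c1" by (simp add: c1_def)
  then have C: "0 < C" "c1 \<le> C" "2 * 2 powr p \<le> C" "2 * (real T * 2 powr p) \<le> C"
    using assms by (simp_all add: C_def add_nonneg_pos add_pos_nonneg)
  show ?thesis
  proof (intro exI[of _ C] conjI C(1) allI impI ballI)
    fix K :: "(nat \<Rightarrow> real^'d) measure set" and \<sigma> R :: real and \<mu> \<nu>
    assume K: "adapted_relatively_compact p T K" and \<sigma>: "0 < \<sigma>" and R: "\<sigma> < R" and \<mu>: "\<mu> \<in> K" and \<nu>: "\<nu> \<in> K"
    have mom: "\<mu> \<in> moment_measures p T" "\<nu> \<in> moment_measures p T"
      using K \<mu> \<nu> by (auto simp: adapted_relatively_compact_def)
    let ?H = "\<lambda>\<gamma>. epowr (\<Sum>t=0..T-1. iter_modulus p \<gamma> t (ennreal \<sigma>)) p"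
    let ?tail = "\<lambda>\<gamma>. \<integral>\<^sup>+x\<in>{x\<in>space \<gamma>. R \<le> path_norm T x}. ennreal (path_norm T x powr p) \<partial>\<gamma>"
    define A where "A = (INF \<pi>\<in>bicausal_couplings T \<mu> \<nu>. \<integral>\<^sup>+\<omega>. ennreal (\<Sum>t=1..T. dist (fst \<omega> t) (snd \<omega> t) powr p) \<partial>\<pi>)"
    define I where "I \<pi> = (\<integral>\<^sup>+\<omega>. ennreal (path_dist T (fst \<omega>) (snd \<omega>)) \<partial>\<pi>)" for \<pi> :: "((nat \<Rightarrow> real^'d) \<times> (nat \<Rightarrow> real^'d)) measure"
    define W where "W = (INF \<pi>\<in>couplings \<mu> \<nu>. I \<pi>)"
    define SH where "SH = (SUP \<gamma>\<in>K. ?H \<gamma>)"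
    define ST where "ST = (SUP \<gamma>\<in>K. ?tail \<gamma>)"
    have A: "epowr (adapted_wasserstein p T \<mu> \<nu>) p = A"
      using assms(2) by (simp add: adapted_wasserstein_def A_def epowr_epowr)
    have W: "wasserstein (path_dist T) 1 \<mu> \<nu> = W"
      by (simp add: wasserstein_def epowr_1 W_def I_def path_dist_def L2_set_nonneg)
    have SH: "?H \<mu> \<le> SH" "?H \<nu> \<le> SH" and ST: "?tail \<mu> \<le> ST" "?tail \<nu> \<le> ST"
      using \<mu> \<nu> by (auto simp: SH_def ST_def intro: SUP_upper)
    let ?a = "ennreal (c1 * R powr p / \<sigma>)" and ?b = "ennreal C * (SH + ST)"
    \<comment> \<open>If one of the two quantities is infinite, so is the right-hand side, the
      coefficients being positive. Otherwise the finite supremum makes all iterated moduli of \<mu>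
      and \<nu> finite, and \<open>W\<close> is approached by couplings of finite cost.\<close>
    have main: "A \<le> ?a * W + ?b"
    proof (cases "SH = top \<or> W = top")
      case True
      have "0 < c1" using assms by (simp add: c1_def)
      then have "?a \<noteq> 0" using \<sigma> R by simp
      then show ?thesis using True C(1) by (auto simp: ennreal_mult_top ennreal_top_mult top_unique)
    next
      case False
      have fin: "iter_modulus p \<gamma> t (ennreal \<sigma>) < top" if "?H \<gamma> \<le> SH" "t < T" for \<gamma> :: "(nat \<Rightarrow> real^'d) measure" and t
      proof -
        have "?H \<gamma> \<noteq> top" using that(1) False by (auto simp: top_unique)
        then have "(\<Sum>t=0..T-1. iter_modulus p \<gamma> t (ennreal \<sigma>)) \<noteq> top"
          by (metis epowr_def infinity_ennreal_def)
        then show ?thesis using that(2) by (auto simp: less_top)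
      qed
      have le: "A \<le> ?a * I \<pi> + ?b + ennreal (real T * 2 powr p * (4 * real T * R powr p) * (real T * ?d)) / of_nat n"
        if \<pi>: "\<pi> \<in> couplings \<mu> \<nu>" and n: "0 < n" for \<pi> n
      proof -
        have "A \<le> ennreal (2 powr p) * (?H \<mu> + ?H \<nu>) + ennreal (real T * 2 powr p) *
          (ennreal (4 * real T * R powr p) * (ennreal (4 * (real T * ?d)\<^sup>2 / \<sigma>) * I \<pi> + ennreal (real T * ?d / real n))
           + (?tail \<mu> + ?tail \<nu>))"
          unfolding A_def I_def
          using \<sigma> R fin[OF SH(1)] fin[OF SH(2)] by (intro bicausal_cost_le assms mom \<pi> n) auto
        also have "\<dots> \<le> ennreal (2 powr p) * (SH + SH) + ennreal (real T * 2 powr p) *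
          (ennreal (4 * real T * R powr p) * (ennreal (4 * (real T * ?d)\<^sup>2 / \<sigma>) * I \<pi> + ennreal (real T * ?d / real n))
           + (ST + ST))"
          by (intro add_mono mult_left_mono SH ST order_refl) auto
        also have "\<dots> = ?a * I \<pi> + (ennreal (2 * 2 powr p) * SH + ennreal (2 * (real T * 2 powr p)) * ST)
          + ennreal (real T * 2 powr p * (4 * real T * R powr p) * (real T * ?d)) / of_nat n"
        proof -
          have 1: "ennreal (real T * 2 powr p) * (ennreal (4 * real T * R powr p) * ennreal (4 * (real T * ?d)\<^sup>2 / \<sigma>)) = ?a"
            using \<sigma> by (simp add: c1_def mult_ac flip: ennreal_mult)
          have 2: "ennreal (real T * 2 powr p) * (ennreal (4 * real T * R powr p) * ennreal (real T * ?d / real n))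
            = ennreal (real T * 2 powr p * (4 * real T * R powr p) * (real T * ?d)) / of_nat n"
            using n by (simp add: ennreal_of_nat_eq_real_of_nat divide_ennreal mult_ac flip: ennreal_mult)
          have 3: "ennreal (2 * 2 powr p) = ennreal (2 powr p) + ennreal (2 powr p)"
            "ennreal (2 * (real T * 2 powr p)) = ennreal (real T * 2 powr p) + ennreal (real T * 2 powr p)"
            by (simp_all flip: ennreal_plus)
          show ?thesis
            unfolding 1[symmetric] 2[symmetric] 3 by (simp only: distrib_left distrib_right mult.assoc ac_simps)
        qed
        also have "\<dots> \<le> ?a * I \<pi> + ?b + ennreal (real T * 2 powr p * (4 * real T * R powr p) * (real T * ?d)) / of_nat n"
          unfolding distrib_left by (intro add_mono mult_right_mono ennreal_leI C order_refl) auto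
        finally show ?thesis .
      qed
      have le': "A \<le> ?a * I \<pi> + ?b" if \<pi>: "\<pi> \<in> couplings \<mu> \<nu>" for \<pi>
      proof (rule ennreal_le_epsilon)
        fix e :: real assume e: "0 < e"
        let ?c = "real T * 2 powr p * (4 * real T * R powr p) * (real T * ?d)"
        \<comment> \<open>Enough shifts to bring the rounding error of the averaging below
          \<open>e\<close>.\<close>
        obtain n where n: "?c / e < real n" using reals_Archimedean2 by blast
        moreover have "0 \<le> ?c / e" using e by simp
        ultimately have "0 < n" by (cases n) auto
        then have "ennreal ?c / of_nat n \<le> ennreal e"
          using n e by (simp add: ennreal_of_nat_eq_real_of_nat divide_ennreal field_simps)
        then show "A \<le> ?a * I \<pi> + ?b + ennreal e"
          using le[OF \<pi> \<open>0 < n\<close>] by (meson add_left_mono order_trans)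
      qed
      show ?thesis
      proof (rule ennreal_le_epsilon)
        fix e :: real assume e: "0 < e"
        have "0 < c1" using assms by (simp add: c1_def)
        then have a: "0 < c1 * R powr p / \<sigma>" using \<sigma> R by simp
        \<comment> \<open>A coupling within \<delta> of the infimum \<open>W\<close> loses at most
          \<open>e\<close> after multiplication by the coefficient of \<open>W\<close>.\<close>
        define \<delta> where "\<delta> = e / (c1 * R powr p / \<sigma>)"
        have \<delta>: "0 < \<delta>" unfolding \<delta>_def by (rule divide_pos_pos[OF e a])
        have a\<delta>: "(c1 * R powr p / \<sigma>) * \<delta> = e" using a unfolding \<delta>_def by (metis less_irrefl nonzero_mult_div_cancel_left times_divide_eq_right)
        have "W < W + ennreal \<delta>"
          using False \<delta> by (cases W) (auto simp: ennreal_less_iff simp flip: ennreal_plus)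
        then obtain \<pi> where \<pi>: "\<pi> \<in> couplings \<mu> \<nu>" "I \<pi> < W + ennreal \<delta>"
          unfolding W_def INF_less_iff by blast
        have "A \<le> ?a * (W + ennreal \<delta>) + ?b"
          using le'[OF \<pi>(1)] \<pi>(2) by (meson add_right_mono less_imp_le mult_left_mono order_trans zero_le)
        also have "\<dots> = ?a * W + ?b + ?a * ennreal \<delta>"
          unfolding distrib_left[of ?a W "ennreal \<delta>"] by (simp only: ac_simps)
        also have "?a * ennreal \<delta> = ennreal e"
          using less_imp_le[OF a] \<delta> by (subst ennreal_mult[symmetric]) (auto simp: a\<delta> simp del: times_divide_eq_left)
        finally show "A \<le> ?a * W + ?b + ennreal e" .
      qed
    qed
    have "?a * W = ennreal c1 * (ennreal (R powr p) * W / ennreal \<sigma>)"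
    proof -
      have "?a = ennreal c1 * (ennreal (R powr p) / ennreal \<sigma>)"
        using \<sigma> \<open>0 \<le> c1\<close> by (simp add: divide_ennreal flip: ennreal_mult)
      then show ?thesis by (simp add: ennreal_divide_times ennreal_times_divide mult_ac)
    qed
    also have "\<dots> \<le> ennreal C * (ennreal (R powr p) * W / ennreal \<sigma>)"
      by (intro mult_right_mono ennreal_leI C) auto
    finally have "?a * W + ?b \<le> ennreal C * (ennreal (R powr p) * W / ennreal \<sigma> + SH + ST)"
      by (simp only: distrib_left add.assoc add_right_mono)
    with main show "epowr (adapted_wasserstein p T \<mu> \<nu>) p \<le>
            ennreal C *
            (ennreal (R powr p) * wasserstein (path_dist T) 1 \<mu> \<nu> / ennreal \<sigma> + (SUP \<gamma>\<in>K. ?H \<gamma>) + (SUP \<gamma>\<in>K. ?tail \<gamma>))"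
      unfolding A W SH_def[symmetric] ST_def[symmetric] by (rule order_trans)
  qed
qed

end
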